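(* Let $\Bbbk$ be a commutative unital ring and $q\in\Bbbk$ an invertible element such that $1-q^d$ is invertible for all integers $d\neq0$. Then for any composition $\underline k$ and any singular Soergel bimodule $B\in\mathbf{sSBim}(R^{\underline k},R^{\underline k})$ one has $$\mathit{qHH}_i(R^{\underline k},B)=0\qquad\text{for } i>0.$$
   Context: **Polynomial rings.** Let $R=\Bbbk[x_1,\dots,x_N]$ with $\deg x_i=2$. A composition $\underline k=(k_1,\dots,k_r)$ of $N$ (positive integers summing to $N$) determines the parabolic subgroup $\mathfrak S_{\underline k}=\mathfrak S_{k_1}\times\dots\times\mathfrak S_{k_r}\subset\mathfrak S_N$ and $R^{\underline k}=R^{\mathfrak S_{\underline k}}$. A composition $\underline\ell$ is a refinement of $\underline k$ if it is obtained by replacing each $k_i$ by a composition of $k_i$; then $R^{\underline k}\subset R^{\underline\ell}$ is a graded Frobenius extension (of some degree $d$, meaning that there is a nondegenerate $R^{\underline k}$-linear trace $R^{\underline\ell}\to R^{\underline k}$ homogeneous of degree $-2d$). **Singular Soergel bimodules.** Singular Bott–Samelson bimodules are finite tensor products (over the rings $R^{\underline k}$) of the bimodules ${}_{R^{\underline\ell}}(R^{\underline\ell})_{R^{\underline k}}$ (induction) and ${}_{R^{\underline k}}(\mathbf q^dR^{\underline\ell})_{R^{\underline\ell}}$ (restriction, shifted up by $d$) for refinements $\underline\ell$ of $\underline k$. $\mathbf{sSBim}(R^{\underline k},R^{\underline\ell})$ consists of the graded $(R^{\underline k},R^{\underline\ell})$-bimodules that are direct summands of finite direct sums of degree shifts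 of singular Bott–Samelson $(R^{\underline k},R^{\underline\ell})$-bimodules. **Quantum Hochschild homology.** For a graded $\Bbbk$-algebra $A$ and graded $(A,A)$-bimodule $M$, $\mathit{qHH}_\bullet(A,M)$ is the homology of the complex with chain groups $M\otimes_{\Bbbk}A^{\otimes n}$ and differential $$\partial(m\otimes a_1\otimes\dots\otimes a_n)=ma_1\otimes a_2\otimes\dots\otimes a_n+\sum_{i=1}^{n-1}(-1)^im\otimes a_1\otimes\dots\otimes a_ia_{i+1}\otimes\dots\otimes a_n+(-1)^nq^{-|a_n|}a_nm\otimes a_1\otimes\dots\otimes a_{n-1},$$ for homogeneous $a_i$, $|a|$ denoting the degree. *)

theory Defs
  imports "HOL-Algebra.Algebra" "HOL-Combinatorics.Permutations" "HOL-Library.Poly_Mapping"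
begin

section \<open>Graded algebras and graded bimodules\<close>

definition unit_powi :: "'k::comm_ring_1 \<Rightarrow> int \<Rightarrow> 'k" where
  "unit_powi q d = (if 0 \<le> d then q ^ nat d else (THE r. q * r = 1) ^ nat (- d))"

text \<open>A grading of an abelian group, written multiplicatively as in \<^theory>\<open>HOL-Algebra.Group\<close>, is an
  internal direct sum decomposition indexed by the integers.\<close>

definition graded_decomp ::
    "('m, 'z) monoid_scheme \<Rightarrow> (int \<Rightarrow> 'm set) \<Rightarrow> 'm \<Rightarrow> (int \<Rightarrow> 'm) \<Rightarrow> bool" where
  "graded_decomp G gr m c \<longleftrightarrow>
     (\<forall>d. c d \<in> gr d) \<and> finite {d. c d \<noteq> \<one>\<^bsub>G\<^esub>} \<and> m = finprod G c {d. c d \<noteq> \<one>\<^bsub>G\<^esub>}"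

definition grading :: "('m, 'z) monoid_scheme \<Rightarrow> (int \<Rightarrow> 'm set) \<Rightarrow> bool" where
  "grading G gr \<longleftrightarrow>
     (\<forall>d. subgroup (gr d) G) \<and> (\<forall>m \<in> carrier G. \<exists>!c. graded_decomp G gr m c)"

definition hom_component ::
    "('m, 'z) monoid_scheme \<Rightarrow> (int \<Rightarrow> 'm set) \<Rightarrow> 'm \<Rightarrow> int \<Rightarrow> 'm" where
  "hom_component G gr m = (THE c. graded_decomp G gr m c)"

record ('k, 'a) graded_alg = "'a ring" +
  kscale :: "'k \<Rightarrow> 'a \<Rightarrow> 'a"
  alg_deg :: "int \<Rightarrow> 'a set"

locale graded_algebra = ring A
  for A :: "('k::comm_ring_1, 'a) graded_alg" (structure) +
  assumes kscale_closed: "a \<in> carrier A \<Longrightarrow> kscale A c a \<in> carrier A"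
    and kscale_add: "a \<in> carrier A \<Longrightarrow> b \<in> carrier A \<Longrightarrow>
          kscale A c (a \<oplus> b) = kscale A c a \<oplus> kscale A c b"
    and add_kscale: "a \<in> carrier A \<Longrightarrow> kscale A (c + c') a = kscale A c a \<oplus> kscale A c' a"
    and mult_kscale: "a \<in> carrier A \<Longrightarrow> kscale A (c * c') a = kscale A c (kscale A c' a)"
    and one_kscale: "a \<in> carrier A \<Longrightarrow> kscale A 1 a = a"
    and kscale_mult_left: "a \<in> carrier A \<Longrightarrow> b \<in> carrier A \<Longrightarrow>
          kscale A c (a \<otimes> b) = kscale A c a \<otimes> b"
    and kscale_mult_right: "a \<in> carrier A \<Longrightarrow> b \<in> carrier A \<Longrightarrow>
          kscale A c (a \<otimes> b) = a \<otimes> kscale A c b"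
    and alg_grading: "grading (add_monoid A) (alg_deg A)"
    and one_deg: "\<one> \<in> alg_deg A 0"
    and mult_deg: "a \<in> alg_deg A d \<Longrightarrow> b \<in> alg_deg A e \<Longrightarrow> a \<otimes> b \<in> alg_deg A (d + e)"
    and kscale_deg: "a \<in> alg_deg A d \<Longrightarrow> kscale A c a \<in> alg_deg A d"

text \<open>In a bimodule the monoid operation is the \<^emph>\<open>addition\<close> of the underlying abelian group.  As
  usual for bimodules over \<open>k\<close>-algebras, \<open>k\<close> acts in the same way from both sides.\<close>

record ('a, 'b, 'm) graded_bimod = "'m monoid" +
  lact :: "'a \<Rightarrow> 'm \<Rightarrow> 'm"
  ract :: "'m \<Rightarrow> 'b \<Rightarrow> 'm"
  mod_deg :: "int \<Rightarrow> 'm set"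

locale graded_bimodule =
  A: graded_algebra A + B: graded_algebra B + comm_group M
  for A :: "('k::comm_ring_1, 'a) graded_alg"
    and B :: "('k, 'b) graded_alg"
    and M :: "('a, 'b, 'm) graded_bimod" (structure) +
  assumes lact_closed: "a \<in> carrier A \<Longrightarrow> m \<in> carrier M \<Longrightarrow> lact M a m \<in> carrier M"
    and ract_closed: "b \<in> carrier B \<Longrightarrow> m \<in> carrier M \<Longrightarrow> ract M m b \<in> carrier M"
    and lact_add: "a \<in> carrier A \<Longrightarrow> m \<in> carrier M \<Longrightarrow> m' \<in> carrier M \<Longrightarrow>
          lact M a (m \<otimes> m') = lact M a m \<otimes> lact M a m'"
    and add_ract: "b \<in> carrier B \<Longrightarrow> m \<in> carrier M \<Longrightarrow> m' \<in> carrier M \<Longrightarrow>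
          ract M (m \<otimes> m') b = ract M m b \<otimes> ract M m' b"
    and add_lact: "a \<in> carrier A \<Longrightarrow> a' \<in> carrier A \<Longrightarrow> m \<in> carrier M \<Longrightarrow>
          lact M (a \<oplus>\<^bsub>A\<^esub> a') m = lact M a m \<otimes> lact M a' m"
    and ract_add: "b \<in> carrier B \<Longrightarrow> b' \<in> carrier B \<Longrightarrow> m \<in> carrier M \<Longrightarrow>
          ract M m (b \<oplus>\<^bsub>B\<^esub> b') = ract M m b \<otimes> ract M m b'"
    and mult_lact: "a \<in> carrier A \<Longrightarrow> a' \<in> carrier A \<Longrightarrow> m \<in> carrier M \<Longrightarrow>
          lact M (a \<otimes>\<^bsub>A\<^esub> a') m = lact M a (lact M a' m)"
    and ract_mult: "b \<in> carrier B \<Longrightarrow> b' \<in> carrier B \<Longrightarrow> m \<in> carrier M \<Longrightarrow>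
          ract M m (b \<otimes>\<^bsub>B\<^esub> b') = ract M (ract M m b) b'"
    and one_lact: "m \<in> carrier M \<Longrightarrow> lact M \<one>\<^bsub>A\<^esub> m = m"
    and ract_one: "m \<in> carrier M \<Longrightarrow> ract M m \<one>\<^bsub>B\<^esub> = m"
    and lact_ract: "a \<in> carrier A \<Longrightarrow> b \<in> carrier B \<Longrightarrow> m \<in> carrier M \<Longrightarrow>
          ract M (lact M a m) b = lact M a (ract M m b)"
    and central: "m \<in> carrier M \<Longrightarrow>
          lact M (kscale A c \<one>\<^bsub>A\<^esub>) m = ract M m (kscale B c \<one>\<^bsub>B\<^esub>)"
    and mod_grading: "grading M (mod_deg M)"
    and lact_deg: "a \<in> alg_deg A d \<Longrightarrow> m \<in> mod_deg M e \<Longrightarrow> lact M a m \<in> mod_deg M (d + e)"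
    and ract_deg: "b \<in> alg_deg B d \<Longrightarrow> m \<in> mod_deg M e \<Longrightarrow> ract M m b \<in> mod_deg M (e + d)"

definition graded_bimod_iso ::
    "('k, 'a) graded_alg \<Rightarrow> ('k, 'b) graded_alg \<Rightarrow> ('a, 'b, 'm) graded_bimod \<Rightarrow>
     ('a, 'b, 'n) graded_bimod \<Rightarrow> bool" where
  "graded_bimod_iso A B M N \<longleftrightarrow>
     (\<exists>h \<in> Group.iso M N.
        (\<forall>a \<in> carrier A. \<forall>m \<in> carrier M. h (lact M a m) = lact N a (h m)) \<and>
        (\<forall>b \<in> carrier B. \<forall>m \<in> carrier M. h (ract M m b) = ract N (h m) b) \<and>
        (\<forall>d. h ` mod_deg M d = mod_deg N d))"

text \<open>The shift \<open>\<^bold>q\<^sup>s M\<close> moves the degree \<open>e\<close> part of \<open>M\<close> to degree \<open>e + s\<close>.\<close>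

definition shift :: "int \<Rightarrow> ('a, 'b, 'm) graded_bimod \<Rightarrow> ('a, 'b, 'm) graded_bimod" where
  "shift s M = M\<lparr>mod_deg := \<lambda>e. mod_deg M (e - s)\<rparr>"

definition bimod_sum ::
    "('a, 'b, 'm) graded_bimod \<Rightarrow> ('a, 'b, 'n) graded_bimod \<Rightarrow> ('a, 'b, 'm \<times> 'n) graded_bimod" where
  "bimod_sum M N =
    \<lparr>carrier = carrier (M \<times>\<times> N), monoid.mult = monoid.mult (M \<times>\<times> N), one = one (M \<times>\<times> N),
     lact = (\<lambda>a (m, n). (lact M a m, lact N a n)),
     ract = (\<lambda>(m, n) b. (ract M m b, ract N n b)),
     mod_deg = (\<lambda>d. mod_deg M d \<times> mod_deg N d)\<rparr>"

definition bimod_finite_sum ::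
    "nat \<Rightarrow> (nat \<Rightarrow> ('a, 'b, 'm) graded_bimod) \<Rightarrow> ('a, 'b, nat \<Rightarrow> 'm) graded_bimod" where
  "bimod_finite_sum n M =
    \<lparr>carrier = carrier (product_group {..<n} M),
     monoid.mult = monoid.mult (product_group {..<n} M),
     one = one (product_group {..<n} M),
     lact = (\<lambda>a f. \<lambda>i\<in>{..<n}. lact (M i) a (f i)),
     ract = (\<lambda>f b. \<lambda>i\<in>{..<n}. ract (M i) (f i) b),
     mod_deg = (\<lambda>d. \<Pi>\<^sub>E i\<in>{..<n}. mod_deg (M i) d)\<rparr>"


section \<open>Tensor products\<close>

text \<open>The abelian group generated by \<open>S\<close> subject to the relations \<open>R\<close>, and the homomorphism between
  two such groups induced by a homomorphism \<open>f\<close> of free groups (meaningful only when \<open>f\<close> maps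
  relations to relations: then \<open>pres_map S' R' f\<close> sends the class of \<open>c\<close> to the class of \<open>f c\<close>).\<close>

definition pres_rels :: "'g set \<Rightarrow> ('g \<Rightarrow>\<^sub>0 int) set \<Rightarrow> ('g \<Rightarrow>\<^sub>0 int) set" where
  "pres_rels S R = generate (free_Abelian_group S) R"

definition pres_group :: "'g set \<Rightarrow> ('g \<Rightarrow>\<^sub>0 int) set \<Rightarrow> ('g \<Rightarrow>\<^sub>0 int) set monoid" where
  "pres_group S R = free_Abelian_group S Mod pres_rels S R"

definition pres_map ::
    "'h set \<Rightarrow> ('h \<Rightarrow>\<^sub>0 int) set \<Rightarrow> (('g \<Rightarrow>\<^sub>0 int) \<Rightarrow> ('h \<Rightarrow>\<^sub>0 int)) \<Rightarrow>
     ('g \<Rightarrow>\<^sub>0 int) set \<Rightarrow> ('h \<Rightarrow>\<^sub>0 int) set" where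
  "pres_map S' R' f K = pres_rels S' R' <#>\<^bsub>free_Abelian_group S'\<^esub> (f ` K)"

text \<open>Given rings \<open>As = [A\<^sub>0, \<dots>, A\<^sub>n]\<close> and \<open>(A\<^sub>i, A\<^sub>i\<^sub>+\<^sub>1)\<close>-bimodules \<open>Ms = [M\<^sub>0, \<dots>, M\<^sub>n\<^sub>-\<^sub>1]\<close> with \<open>n > 0\<close>,
  \<open>tensor As Ms\<close> is the \<open>(A\<^sub>0, A\<^sub>n)\<close>-bimodule \<open>M\<^sub>0 \<otimes>\<^bsub>A\<^sub>1\<^esub> M\<^sub>1 \<otimes>\<^bsub>A\<^sub>2\<^esub> \<dots> \<otimes>\<^bsub>A\<^sub>n\<^sub>-\<^sub>1\<^esub> M\<^sub>n\<^sub>-\<^sub>1\<close>.  The word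
  \<open>[m\<^sub>0, \<dots>, m\<^sub>n\<^sub>-\<^sub>1]\<close> stands for the pure tensor \<open>m\<^sub>0 \<otimes> \<dots> \<otimes> m\<^sub>n\<^sub>-\<^sub>1\<close>.\<close>

definition tensor_words :: "('a, 'a, 'm) graded_bimod list \<Rightarrow> 'm list set" where
  "tensor_words Ms = {w. length w = length Ms \<and> (\<forall>i < length Ms. w ! i \<in> carrier (Ms ! i))}"

definition tensor_rels ::
    "('k, 'a) graded_alg list \<Rightarrow> ('a, 'a, 'm) graded_bimod list \<Rightarrow> ('m list \<Rightarrow>\<^sub>0 int) set" where
  "tensor_rels As Ms =
     {frag_of (w[i := x \<otimes>\<^bsub>Ms ! i\<^esub> y]) - frag_of (w[i := x]) - frag_of (w[i := y]) | w i x y.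
        w \<in> tensor_words Ms \<and> i < length Ms \<and> x \<in> carrier (Ms ! i) \<and> y \<in> carrier (Ms ! i)} \<union>
     {frag_of (w[i := ract (Ms ! i) (w ! i) a]) -
      frag_of (w[Suc i := lact (Ms ! Suc i) a (w ! Suc i)]) | w i a.
        w \<in> tensor_words Ms \<and> Suc i < length Ms \<and> a \<in> carrier (As ! Suc i)}"

definition tensor_hom_words :: "('a, 'a, 'm) graded_bimod list \<Rightarrow> int \<Rightarrow> 'm list set" where
  "tensor_hom_words Ms d =
     {w. length w = length Ms \<and>
         (\<exists>ds. length ds = length Ms \<and> sum_list ds = d \<and>
               (\<forall>i < length Ms. w ! i \<in> mod_deg (Ms ! i) (ds ! i)))}"

definition tensor ::
    "('k, 'a) graded_alg list \<Rightarrow> ('a, 'a, 'm) graded_bimod list \<Rightarrow>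
     ('a, 'a, ('m list \<Rightarrow>\<^sub>0 int) set) graded_bimod" where
  "tensor As Ms =
    (let S = tensor_words Ms; R = tensor_rels As Ms; l = length Ms - 1 in
    \<lparr>carrier = carrier (pres_group S R),
     monoid.mult = monoid.mult (pres_group S R),
     one = one (pres_group S R),
     lact = (\<lambda>a. pres_map S R (frag_extend (\<lambda>w. frag_of (w[0 := lact (Ms ! 0) a (w ! 0)])))),
     ract = (\<lambda>K b. pres_map S R (frag_extend (\<lambda>w. frag_of (w[l := ract (Ms ! l) (w ! l) b]))) K),
     mod_deg = (\<lambda>d. {pres_rels S R #>\<^bsub>free_Abelian_group S\<^esub> c | c.
                        Poly_Mapping.keys c \<subseteq> tensor_hom_words Ms d})\<rparr>)"


section \<open>Quantum Hochschild homology\<close>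

text \<open>The \<open>k\<close>-linear map \<open>a \<mapsto> q\<^bsup>-|a|\<^esup> a\<close>, extended from homogeneous elements to all of \<open>A\<close>.\<close>

definition qtwist :: "'k::comm_ring_1 \<Rightarrow> ('k, 'a) graded_alg \<Rightarrow> 'a \<Rightarrow> 'a" where
  "qtwist q A a =
     (let c = hom_component (add_monoid A) (alg_deg A) a
      in finsum A (\<lambda>d. kscale A (unit_powi q (- d)) (c d)) {d. c d \<noteq> \<zero>\<^bsub>A\<^esub>})"

text \<open>The pair \<open>(m, [a\<^sub>1, \<dots>, a\<^sub>n])\<close> stands for \<open>m \<otimes> a\<^sub>1 \<otimes> \<dots> \<otimes> a\<^sub>n\<close> in the tensor product over \<open>k\<close>.\<close>

definition hoch_words ::
    "('k, 'a) graded_alg \<Rightarrow> ('a, 'a, 'm) graded_bimod \<Rightarrow> nat \<Rightarrow> ('m \<times> 'a list) set" where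
  "hoch_words A M n = {(m, as). m \<in> carrier M \<and> length as = n \<and> set as \<subseteq> carrier A}"

definition hoch_rels ::
    "('k, 'a) graded_alg \<Rightarrow> ('a, 'a, 'm) graded_bimod \<Rightarrow> nat \<Rightarrow> (('m \<times> 'a list) \<Rightarrow>\<^sub>0 int) set" where
  "hoch_rels A M n =
     {frag_of (m \<otimes>\<^bsub>M\<^esub> m', as) - frag_of (m, as) - frag_of (m', as) | m m' as.
        (m, as) \<in> hoch_words A M n \<and> m' \<in> carrier M} \<union>
     {frag_of (m, as[i := x \<oplus>\<^bsub>A\<^esub> y]) - frag_of (m, as[i := x]) - frag_of (m, as[i := y]) | m as i x y.
        (m, as) \<in> hoch_words A M n \<and> i < n \<and> x \<in> carrier A \<and> y \<in> carrier A} \<union>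
     {frag_of (lact M (kscale A c \<one>\<^bsub>A\<^esub>) m, as) - frag_of (m, as[i := kscale A c (as ! i)]) | m as i c.
        (m, as) \<in> hoch_words A M n \<and> i < n}"

definition hoch_chains ::
    "('k, 'a) graded_alg \<Rightarrow> ('a, 'a, 'm) graded_bimod \<Rightarrow> nat \<Rightarrow> (('m \<times> 'a list) \<Rightarrow>\<^sub>0 int) set monoid" where
  "hoch_chains A M n = pres_group (hoch_words A M n) (hoch_rels A M n)"

text \<open>The differential on pure tensors; \<open>a\<^sub>i\<close> is \<open>as ! (i - 1)\<close>.\<close>

definition qhoch_face ::
    "'k::comm_ring_1 \<Rightarrow> ('k, 'a) graded_alg \<Rightarrow> ('a, 'a, 'm) graded_bimod \<Rightarrow>
     'm \<times> 'a list \<Rightarrow> ('m \<times> 'a list) \<Rightarrow>\<^sub>0 int" where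
  "qhoch_face q A M w =
     (case w of (m, as) \<Rightarrow> let n = length as in
        if n = 0 then 0 else
          frag_of (ract M m (hd as), tl as) +
          (\<Sum>i = 1..n - 1. frag_cmul ((-1) ^ i)
             (frag_of (m, take (i - 1) as @ [as ! (i - 1) \<otimes>\<^bsub>A\<^esub> as ! i] @ drop (i + 1) as))) +
          frag_cmul ((-1) ^ n) (frag_of (lact M (qtwist q A (last as)) m, butlast as)))"

text \<open>The differential from degree \<open>n\<close> to degree \<open>n - 1\<close>; it is zero for \<open>n = 0\<close>.\<close>

definition qhoch_boundary ::
    "'k::comm_ring_1 \<Rightarrow> ('k, 'a) graded_alg \<Rightarrow> ('a, 'a, 'm) graded_bimod \<Rightarrow> nat \<Rightarrow>
     (('m \<times> 'a list) \<Rightarrow>\<^sub>0 int) set \<Rightarrow> (('m \<times> 'a list) \<Rightarrow>\<^sub>0 int) set" where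
  "qhoch_boundary q A M n =
     pres_map (hoch_words A M (n - 1)) (hoch_rels A M (n - 1)) (frag_extend (qhoch_face q A M))"

definition qHH ::
    "'k::comm_ring_1 \<Rightarrow> ('k, 'a) graded_alg \<Rightarrow> ('a, 'a, 'm) graded_bimod \<Rightarrow> nat \<Rightarrow>
     (('m \<times> 'a list) \<Rightarrow>\<^sub>0 int) set set monoid" where
  "qHH q A M n =
     (hoch_chains A M n)
       \<lparr>carrier := kernel (hoch_chains A M n) (hoch_chains A M (n - 1)) (qhoch_boundary q A M n)\<rparr>
     Mod (qhoch_boundary q A M (Suc n) ` carrier (hoch_chains A M (Suc n)))"


section \<open>Partially symmetric polynomials\<close>

text \<open>Polynomials in variables indexed by the natural numbers: finitely supported coefficient
  functions on exponent vectors.\<close>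

type_synonym 'k mpoly = "(nat \<Rightarrow>\<^sub>0 nat) \<Rightarrow>\<^sub>0 'k"

definition composition :: "nat \<Rightarrow> nat list \<Rightarrow> bool" where
  "composition N ks \<longleftrightarrow> (\<forall>k \<in> set ks. 0 < k) \<and> sum_list ks = N"

definition refines :: "nat list \<Rightarrow> nat list \<Rightarrow> bool" where
  "refines ls ks \<longleftrightarrow>
     (\<exists>lss. length lss = length ks \<and> (\<forall>i < length ks. composition (ks ! i) (lss ! i)) \<and>
            ls = concat lss)"

definition block :: "nat list \<Rightarrow> nat \<Rightarrow> nat set" where
  "block ks i = {sum_list (take i ks) ..< sum_list (take (Suc i) ks)}"

definition parabolic :: "nat list \<Rightarrow> (nat \<Rightarrow> nat) set" where
  "parabolic ks =
     {p. p permutes {..< sum_list ks} \<and> (\<forall>i < length ks. p ` block ks i = block ks i)}"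

text \<open>The action of a permutation \<open>p\<close> by algebra automorphisms with \<open>x\<^sub>i \<mapsto> x\<^bsub>p i\<^esub>\<close>: the coefficient of
  \<open>m\<close> in the result is the coefficient of \<open>m \<circ> p\<close> in \<open>f\<close>.\<close>

definition permute_vars :: "(nat \<Rightarrow> nat) \<Rightarrow> 'k::comm_ring_1 mpoly \<Rightarrow> 'k mpoly" where
  "permute_vars p f = Poly_Mapping.map_key (Poly_Mapping.map_key p) f"

text \<open>For a composition \<open>ks\<close> of \<open>N\<close>, the ring \<open>R\<^sup>k\<close> of invariants of the parabolic subgroup in the
  polynomial ring \<open>R\<close> on \<open>x\<^sub>0, \<dots>, x\<^bsub>N-1\<^esub>\<close>, all of degree 2.\<close>

definition invariants :: "nat list \<Rightarrow> 'k::comm_ring_1 mpoly set" where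
  "invariants ks =
     {f. (\<forall>m \<in> Poly_Mapping.keys f. Poly_Mapping.keys m \<subseteq> {..< sum_list ks}) \<and>
         (\<forall>p \<in> parabolic ks. permute_vars p f = f)}"

definition poly_hom :: "int \<Rightarrow> 'k::comm_ring_1 mpoly set" where
  "poly_hom d =
     {f. \<forall>m \<in> Poly_Mapping.keys f. 2 * int (\<Sum>i \<in> Poly_Mapping.keys m. Poly_Mapping.lookup m i) = d}"

definition inv_ring :: "nat list \<Rightarrow> ('k::comm_ring_1, 'k mpoly) graded_alg" where
  "inv_ring ks =
    \<lparr>carrier = invariants ks, monoid.mult = (*), one = 1, ring.zero = 0, ring.add = (+),
     kscale = (\<lambda>c f. Poly_Mapping.single 0 c * f),
     alg_deg = (\<lambda>d. invariants ks \<inter> poly_hom d)\<rparr>"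


section \<open>Singular Soergel bimodules\<close>

text \<open>\<open>T\<close> is a graded Frobenius extension of its subring \<open>S\<close>, of degree \<open>d\<close>: nondegeneracy of the
  trace means the existence of dual bases of \<open>T\<close> over \<open>S\<close>.\<close>

definition frobenius_trace ::
    "('k, 'a) graded_alg \<Rightarrow> ('k, 'a) graded_alg \<Rightarrow> int \<Rightarrow> ('a \<Rightarrow> 'a) \<Rightarrow> bool" where
  "frobenius_trace S T d tr \<longleftrightarrow>
     tr \<in> carrier T \<rightarrow> carrier S \<and>
     (\<forall>x \<in> carrier T. \<forall>y \<in> carrier T. tr (x \<oplus>\<^bsub>T\<^esub> y) = tr x \<oplus>\<^bsub>S\<^esub> tr y) \<and>
     (\<forall>s \<in> carrier S. \<forall>x \<in> carrier T. tr (s \<otimes>\<^bsub>T\<^esub> x) = s \<otimes>\<^bsub>S\<^esub> tr x) \<and>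
     (\<forall>e. tr ` alg_deg T e \<subseteq> alg_deg S (e - 2 * d)) \<and>
     (\<exists>(n::nat) x y. x \<in> {..<n} \<rightarrow> carrier T \<and> y \<in> {..<n} \<rightarrow> carrier T \<and>
        (\<forall>i<n. \<forall>j<n. tr (x i \<otimes>\<^bsub>T\<^esub> y j) = (if i = j then \<one>\<^bsub>S\<^esub> else \<zero>\<^bsub>S\<^esub>)) \<and>
        (\<forall>t \<in> carrier T. t = finsum T (\<lambda>i. tr (t \<otimes>\<^bsub>T\<^esub> y i) \<otimes>\<^bsub>T\<^esub> x i) {..<n}))"

definition frobenius_degree :: "('k, 'a) graded_alg \<Rightarrow> ('k, 'a) graded_alg \<Rightarrow> int \<Rightarrow> bool" where
  "frobenius_degree S T d \<longleftrightarrow> (\<exists>tr. frobenius_trace S T d tr)"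

text \<open>\<open>R\<^sup>l\<close> as a graded bimodule over any of its subrings, in particular over the rings \<open>R\<^sup>k\<close> for
  which \<open>l\<close> refines \<open>k\<close>.\<close>

definition inv_bimod :: "nat list \<Rightarrow> ('k::comm_ring_1 mpoly, 'k mpoly, 'k mpoly) graded_bimod" where
  "inv_bimod ls =
    \<lparr>carrier = invariants ls, monoid.mult = (+), one = 0, lact = (*), ract = (*),
     mod_deg = (\<lambda>d. invariants ls \<inter> poly_hom d)\<rparr>"

inductive bs_factor ::
    "nat list \<Rightarrow> nat list \<Rightarrow> ('k::comm_ring_1 mpoly, 'k mpoly, 'k mpoly) graded_bimod \<Rightarrow> bool" where
  induction_bimod: "refines ls ks \<Longrightarrow> bs_factor ls ks (inv_bimod ls)"
| restriction_bimod:
    "refines ls ks \<Longrightarrow>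
     frobenius_degree (inv_ring ks :: ('k, 'k mpoly) graded_alg) (inv_ring ls) d \<Longrightarrow>
     bs_factor ks ls (shift d (inv_bimod ls))"

text \<open>The tensor product of no factors is \<open>R\<^sup>k\<close>, which is also the induction bimodule for the trivial
  refinement; hence it is enough to consider nonempty tensor products.\<close>

definition singular_bott_samelson ::
    "nat list \<Rightarrow> nat list \<Rightarrow>
     ('k::comm_ring_1 mpoly, 'k mpoly, ('k mpoly list \<Rightarrow>\<^sub>0 int) set) graded_bimod \<Rightarrow> bool" where
  "singular_bott_samelson ks ls Y \<longleftrightarrow>
     (\<exists>cs Ms. Ms \<noteq> [] \<and> length cs = Suc (length Ms) \<and>
        hd cs = ks \<and> last cs = ls \<and>
        (\<forall>c \<in> set cs. composition (sum_list ks) c) \<and>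
        (\<forall>i < length Ms. bs_factor (cs ! i) (cs ! Suc i) (Ms ! i)) \<and>
        Y = tensor (map inv_ring cs) Ms)"

text \<open>In the definition of a direct summand \<open>B\<close> of \<open>Y\<close> the complement \<open>C\<close> can be taken to be a
  sub-bimodule of \<open>Y\<close>, so that prescribing its type is no restriction.  The type of the elements
  of \<open>B\<close> itself is arbitrary.\<close>

definition singular_soergel ::
    "nat list \<Rightarrow> nat list \<Rightarrow> ('k::comm_ring_1 mpoly, 'k mpoly, 'b) graded_bimod \<Rightarrow> bool" where
  "singular_soergel ks ls B \<longleftrightarrow>
     graded_bimodule (inv_ring ks :: ('k, 'k mpoly) graded_alg) (inv_ring ls) B \<and>
     (\<exists>n Y s (C :: ('k mpoly, 'k mpoly, nat \<Rightarrow> ('k mpoly list \<Rightarrow>\<^sub>0 int) set) graded_bimod).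
        (\<forall>i<n. singular_bott_samelson ks ls (Y i)) \<and>
        graded_bimodule (inv_ring ks :: ('k, 'k mpoly) graded_alg) (inv_ring ls) C \<and>
        graded_bimod_iso (inv_ring ks :: ('k, 'k mpoly) graded_alg) (inv_ring ls)
          (bimod_sum B C) (bimod_finite_sum n (\<lambda>i. shift (s i) (Y i))))"

end

theory Submission
  imports Defs
begin

text \<open>Put l = q^(-2). Since every variable has degree 2, the twist a |-> q^(-|a|) a is the
  algebra map x_i |-> l x_i (\<open>scale_vars l\<close>, see \<open>qtwist_inv_ring\<close>). After
  this the grading no longer enters the complex, and the claim is that the Hochschild complex of R^k
  with coefficients in B, with its last face twisted by this algebra map, is acyclic in positive
  degrees. That property passes to retracts (\<open>acyclic_retract\<close>), to finite sums
  (\<open>acyclic_finite_sum\<close>) and to extensions of bimodules that split linearly over the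
  ground ring (\<open>acyclic_extension\<close>). The proof reduces B to one explicit bimodule by
  these operations.

  The explicit case is the full polynomial ring R with coefficients in R, the right action being
  twisted by a permutation p of the variables. Geometrically one intersects the graph of p with the
  graph of multiplication by l. For P the permutation matrix, det(l - P) is a product of factors l^r
  - 1 over the cycle lengths r, and these are units by hypothesis, so the graphs meet transversally
  at the origin and higher Tor vanishes. The formal argument is a contraction. Chains of degree n
  are polynomials in n+1 blocks of variables (\<open>ev_can\<close>, \<open>can_ev\<close>), the
  faces are substitutions (\<open>ev_dface\<close>), and solving a linear system with matrix l - P
  (\<open>zeta_eq\<close>, \<open>zeta_fixed\<close>) gives a substitution that commutes with all
  faces but the last and is undone by the last one. This extra degeneracy proves
  \<open>acyclic_base\<close>.

  Next come the Bott-Samelson bimodules R \<otimes> R \<otimes> ... \<otimes> R, tensored over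
  invariants of adjacent transpositions. With divided differences such a bimodule is written as a
  free left module with an explicit right action (\<open>vr\<close>). Each letter s of the word
  yields an extension of a bimodule by the same bimodule twisted by s, so induction on the word
  reduces to permutation twists (\<open>acyclic_vmod\<close>).

  To pass from R to R^k, use that R has a trace to R^k, a composite of divided differences, with
  dual families of elements (\<open>trace_data_exists\<close>). Sending each algebra entry of a
  chain to its matrix with respect to these families, as in the Dennis trace of Morita theory, makes
  the complex of R^k with coefficients in M a retract of the complex of R with coefficients in M
  enlarged by tensor factors for the letters of the trace (\<open>acyclic_multitrace\<close>).

  Finally a singular Bott-Samelson bimodule is a retract of such a bimodule for a suitable word
  (\<open>G_F\<close>): every factor R^l is a retract of R by the trace, and every tensor sign over
  R^c is a retract of a chain of tensor signs over invariants of adjacent transpositions. Shifts,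
  finite sums and direct summands then give all singular Soergel bimodules. As the ground ring may
  have zero divisors, division by x_a - x_b is always replaced by cancellation
  (\<open>pvar_diff_cancel\<close>).\<close>

abbreviation keys where "keys \<equiv> Poly_Mapping.keys"
abbreviation lookup where "lookup \<equiv> Poly_Mapping.lookup"
abbreviation single where "single \<equiv> Poly_Mapping.single"

section \<open>Polynomials, substitutions and algebra homomorphisms\<close>

definition pconst :: "'k::comm_ring_1 \<Rightarrow> 'k mpoly" where "pconst c = single 0 c"
definition pvar :: "nat \<Rightarrow> 'k::comm_ring_1 mpoly" where "pvar i = single (single i 1) 1"
definition pmon :: "(nat \<Rightarrow>\<^sub>0 nat) \<Rightarrow> 'k::comm_ring_1 mpoly" where "pmon m = single m 1"

lemma const_simps [simp]:
  "pconst 0 = 0" "pconst 1 = 1" "pconst (a + b) = pconst a + pconst b" "pconst (a * b) = pconst a * pconst b"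
  "pconst (a - b) = pconst a - pconst b" "pconst (- a) = - pconst a"
  by (simp_all add: pconst_def single_add single_diff single_uminus mult_single)

lemma const_power: "pconst (a ^ n) = pconst a ^ n"
  by (induction n) simp_all

lemma mon_0 [simp]: "pmon 0 = 1"
  by (simp add: pmon_def)

lemma mon_add: "pmon (m + n) = pmon m * pmon n"
  by (simp add: pmon_def mult_single)

lemma single_eq_const_mon: "single m c = pconst c * pmon m"
  by (simp add: pconst_def pmon_def mult_single)

lemma mon_sum: "finite I \<Longrightarrow> pmon (sum f I) = (\<Prod>i\<in>I. pmon (f i))"
  by (induction I rule: finite_induct) (simp_all add: mon_add)

lemma mon_single: "pmon (single i n) = pvar i ^ n"
proof (induction n)
  case (Suc n)
  have "single i (Suc n) = single i 1 + single i n"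
    by (metis plus_1_eq_Suc single_add)
  then show ?case using Suc by (simp add: mon_add) (simp add: pmon_def pvar_def)
qed simp

lemma pm_sum_single: "(\<Sum>m\<in>keys p. single m (lookup p m)) = p"
  for p :: "'a \<Rightarrow>\<^sub>0 'b::comm_monoid_add"
  by (rule poly_mapping_eqI) (simp add: lookup_sum lookup_single when_def sum.delta in_keys_iff)

lemma mpoly_expand: "p = (\<Sum>m\<in>keys p. pconst (lookup p m) * pmon m)"
  using pm_sum_single[of p] by (simp add: single_eq_const_mon)

lemma mon_expand: "pmon m = (\<Prod>i\<in>keys m. pvar i ^ lookup m i)"
  using mon_sum[of "keys m" "\<lambda>i. single i (lookup m i)"]
  by (simp add: pm_sum_single mon_single)

definition vars_in :: "nat set \<Rightarrow> 'k::comm_ring_1 mpoly set" where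
  "vars_in I = {f. \<forall>m\<in>keys f. keys m \<subseteq> I}"

lemma vars_in_const [simp]: "pconst c \<in> vars_in I"
  by (simp add: vars_in_def pconst_def)

lemma vars_in_0 [simp]: "0 \<in> vars_in I" and vars_in_1 [simp]: "1 \<in> vars_in I"
  by (simp_all add: vars_in_def)

lemma vars_in_var [simp]: "i \<in> I \<Longrightarrow> pvar i \<in> vars_in I"
  by (simp add: vars_in_def pvar_def)

lemma vars_in_mon: "keys m \<subseteq> I \<Longrightarrow> pmon m \<in> vars_in I"
  by (simp add: vars_in_def pmon_def)

lemma vars_in_add: "f \<in> vars_in I \<Longrightarrow> g \<in> vars_in I \<Longrightarrow> f + g \<in> vars_in I"
  unfolding vars_in_def using keys_add[of f g] by blast

lemma vars_in_uminus: "f \<in> vars_in I \<Longrightarrow> - f \<in> vars_in I"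
  unfolding vars_in_def by (simp add: in_keys_iff)

lemma vars_in_diff: "f \<in> vars_in I \<Longrightarrow> g \<in> vars_in I \<Longrightarrow> f - g \<in> vars_in I"
  using vars_in_add[of f I "- g"] vars_in_uminus[of g I] by simp

lemma vars_in_mult:
  assumes f: "f \<in> vars_in I" and g: "g \<in> vars_in I" shows "f * g \<in> vars_in I"
  unfolding vars_in_def
proof (clarify)
  fix m i assume "m \<in> keys (f * g)" "i \<in> keys m"
  then obtain a b where ab: "m = a + b" "a \<in> keys f" "b \<in> keys g"
    using keys_mult[of f g] by blast
  then have "keys m \<subseteq> keys a \<union> keys b" using keys_add[of a b] by simp
  then show "i \<in> I" using ab f g \<open>i \<in> keys m\<close> unfolding vars_in_def by blast
qed

lemma vars_in_sum: "(\<And>a. a \<in> A \<Longrightarrow> f a \<in> vars_in I) \<Longrightarrow> sum f A \<in> vars_in I"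
  by (induction A rule: infinite_finite_induct) (auto intro: vars_in_add)

lemma vars_in_prod: "(\<And>a. a \<in> A \<Longrightarrow> f a \<in> vars_in I) \<Longrightarrow> prod f A \<in> vars_in I"
  by (induction A rule: infinite_finite_induct) (auto intro: vars_in_mult)

lemma vars_in_power: "f \<in> vars_in I \<Longrightarrow> f ^ n \<in> vars_in I"
  by (induction n) (auto intro: vars_in_mult)

lemma vars_in_mono: "I \<subseteq> J \<Longrightarrow> f \<in> vars_in I \<Longrightarrow> f \<in> vars_in J"
  unfolding vars_in_def by blast

lemma vars_in_UNIV [simp]: "f \<in> vars_in UNIV"
  by (simp add: vars_in_def)

lemmas vars_in_intros = vars_in_add vars_in_diff vars_in_uminus vars_in_mult vars_in_sum
  vars_in_prod vars_in_power vars_in_const vars_in_var vars_in_0 vars_in_1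

lemma vars_in_induct [consumes 1, case_names const var add mult]:
  assumes f: "f \<in> vars_in I" and c: "\<And>c. P (pconst c)" and v: "\<And>i. i \<in> I \<Longrightarrow> P (pvar i)"
    and a: "\<And>f g. f \<in> vars_in I \<Longrightarrow> g \<in> vars_in I \<Longrightarrow> P f \<Longrightarrow> P g \<Longrightarrow> P (f + g)"
    and m: "\<And>f g. f \<in> vars_in I \<Longrightarrow> g \<in> vars_in I \<Longrightarrow> P f \<Longrightarrow> P g \<Longrightarrow> P (f * g)"
  shows "P f"
proof -
  have P0: "P 0" and P1: "P 1" using c[of 0] c[of 1] by simp_all
  have pow: "P (pvar i ^ n)" if "i \<in> I" for i n
    using that by (induction n) (auto simp: P1 intro!: m v vars_in_intros)
  have prd: "finite J \<Longrightarrow> J \<subseteq> I \<Longrightarrow> P (\<Prod>i\<in>J. pvar i ^ e i)" for J and e :: "nat \<Rightarrow> nat"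
    by (induction J rule: finite_induct) (auto simp: P1 intro!: m pow vars_in_intros)
  have mn: "P (pmon m)" if "keys m \<subseteq> I" for m
    unfolding mon_expand by (intro prd that) simp
  have sm: "finite S \<Longrightarrow> (\<And>s. s \<in> S \<Longrightarrow> keys s \<subseteq> I) \<Longrightarrow> P (\<Sum>s\<in>S. pconst (e s) * pmon s)" for S e
    by (induction S rule: finite_induct)
       (auto simp: P0 intro!: a m c mn vars_in_intros vars_in_mon)
  show ?thesis
    by (subst mpoly_expand) (use f in \<open>intro sm; auto simp: vars_in_def\<close>)
qed

definition alg_hom :: "('k::comm_ring_1 mpoly \<Rightarrow> 'k mpoly) \<Rightarrow> bool" where
  "alg_hom h \<longleftrightarrow> (\<forall>f g. h (f + g) = h f + h g) \<and> (\<forall>f g. h (f * g) = h f * h g) \<and> (\<forall>c. h (pconst c) = pconst c)"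

lemma alg_homD:
  assumes "alg_hom h"
  shows "h (f + g) = h f + h g" "h (f * g) = h f * h g" "h (pconst c) = pconst c" "h 0 = 0" "h 1 = 1"
    "h (- f) = - h f" "h (f - g) = h f - h g"
proof -
  show A: "h (f + g) = h f + h g" "h (f * g) = h f * h g" "h (pconst c) = pconst c" for f g c
    using assms by (auto simp: alg_hom_def)
  show Z: "h 0 = 0" "h 1 = 1" using A(3)[of 0] A(3)[of 1] by simp_all
  have M: "h (- f) = - h f" for f using A(1)[of f "- f"] Z by (simp add: eq_neg_iff_add_eq_0 add.commute)
  show "h (- f) = - h f" by (rule M)
  show "h (f - g) = h f - h g" using A(1)[of f "- g"] M by simp
qed

lemma alg_hom_sum: "alg_hom h \<Longrightarrow> h (sum f A) = (\<Sum>a\<in>A. h (f a))"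
  by (induction A rule: infinite_finite_induct) (simp_all add: alg_homD)

lemma alg_hom_prod: "alg_hom h \<Longrightarrow> h (prod f A) = (\<Prod>a\<in>A. h (f a))"
  by (induction A rule: infinite_finite_induct) (simp_all add: alg_homD)

lemma alg_hom_power: "alg_hom h \<Longrightarrow> h (f ^ n) = h f ^ n"
  by (induction n) (simp_all add: alg_homD)

lemma alg_hom_id [simp]: "alg_hom (\<lambda>f. f)"
  by (simp add: alg_hom_def)

lemma alg_hom_comp: "alg_hom g \<Longrightarrow> alg_hom h \<Longrightarrow> alg_hom (\<lambda>f. g (h f))"
  by (simp add: alg_hom_def)

lemma alg_hom_eqI:
  assumes "alg_hom g" "alg_hom h" "f \<in> vars_in I" "\<And>i. i \<in> I \<Longrightarrow> g (pvar i) = h (pvar i)"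
  shows "g f = h f"
  using assms(3) by (induction rule: vars_in_induct) (simp_all add: assms alg_homD)

lemma alg_hom_vars_in:
  assumes "alg_hom h" "f \<in> vars_in I" "\<And>i. i \<in> I \<Longrightarrow> h (pvar i) \<in> vars_in J"
  shows "h f \<in> vars_in J"
  using assms(2) by (induction rule: vars_in_induct) (auto simp: assms alg_homD intro: vars_in_intros)

definition subst :: "(nat \<Rightarrow> 'k::comm_ring_1 mpoly) \<Rightarrow> 'k mpoly \<Rightarrow> 'k mpoly" where
  "subst v f = (\<Sum>m\<in>keys f. pconst (lookup f m) * (\<Prod>i\<in>keys m. v i ^ lookup m i))"

lemma subst_mon_superset:
  fixes v :: "nat \<Rightarrow> 'k::comm_ring_1 mpoly"
  assumes "finite I" "keys m \<subseteq> I"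
  shows "(\<Prod>i\<in>keys m. v i ^ lookup m i) = (\<Prod>i\<in>I. v i ^ lookup m i)"
  by (rule prod.mono_neutral_left) (use assms in \<open>auto simp: in_keys_iff\<close>)

lemma subst_superset:
  assumes "finite S" "keys f \<subseteq> S"
  shows "subst v f = (\<Sum>m\<in>S. pconst (lookup f m) * (\<Prod>i\<in>keys m. v i ^ lookup m i))"
  unfolding subst_def by (rule sum.mono_neutral_left) (use assms in \<open>auto simp: in_keys_iff\<close>)

lemma subst_add: "subst v (f + g) = subst v f + subst v g"
proof -
  let ?S = "keys f \<union> keys g"
  have "subst v (f + g) = (\<Sum>m\<in>?S. pconst (lookup (f + g) m) * (\<Prod>i\<in>keys m. v i ^ lookup m i))"
    by (rule subst_superset) (auto simp: keys_add)
  also have "\<dots> = subst v f + subst v g"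
    by (simp add: subst_superset[of ?S f] subst_superset[of ?S g] lookup_add algebra_simps sum.distrib)
  finally show ?thesis .
qed

lemma subst_single: "subst v (single m c) = pconst c * (\<Prod>i\<in>keys m. v i ^ lookup m i)"
  by (cases "c = 0") (simp_all add: subst_def)

lemma subst_sum: "subst v (sum f A) = (\<Sum>a\<in>A. subst v (f a))"
  by (induction A rule: infinite_finite_induct) (simp_all add: subst_add subst_def[of _ 0])

lemma subst_mult_single: "subst v (single m c * single n d) = subst v (single m c) * subst v (single n d)"
proof -
  let ?I = "keys m \<union> keys n"
  have "(\<Prod>i\<in>keys (m + n). v i ^ lookup (m + n) i) = (\<Prod>i\<in>?I. v i ^ lookup (m + n) i)"
    by (rule subst_mon_superset) (auto simp: keys_add)
  also have "\<dots> = (\<Prod>i\<in>keys m. v i ^ lookup m i) * (\<Prod>i\<in>keys n. v i ^ lookup n i)"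
    by (simp add: subst_mon_superset[of ?I m] subst_mon_superset[of ?I n] lookup_add power_add prod.distrib)
  finally show ?thesis by (simp add: mult_single subst_single algebra_simps)
qed

lemma subst_mult: "subst v (f * g) = subst v f * subst v g"
proof -
  have "f * g = (\<Sum>m\<in>keys f. \<Sum>n\<in>keys g. single m (lookup f m) * single n (lookup g n))"
    by (simp only: sum_product[symmetric] pm_sum_single)
  then have "subst v (f * g) = (\<Sum>m\<in>keys f. \<Sum>n\<in>keys g. subst v (single m (lookup f m)) * subst v (single n (lookup g n)))"
    by (simp only: subst_sum subst_mult_single)
  also have "\<dots> = (\<Sum>m\<in>keys f. subst v (single m (lookup f m))) * (\<Sum>n\<in>keys g. subst v (single n (lookup g n)))"
    by (simp only: sum_product)
  also have "\<dots> = subst v f * subst v g"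
    by (simp only: subst_sum[symmetric] pm_sum_single)
  finally show ?thesis .
qed

lemma alg_hom_subst [simp]: "alg_hom (subst v)"
  unfolding alg_hom_def by (simp add: subst_add subst_mult pconst_def subst_single)

lemma subst_var [simp]: "subst v (pvar i) = v i"
  by (simp add: pvar_def subst_single)

lemmas subst_simps [simp] = alg_homD[OF alg_hom_subst]

text \<open>Reindexing of exponent vectors agrees with a substitution on monomials, and both sides
  are additive. From here on permutations of variables are handled only as algebra homomorphisms,
  determined by their values on variables.\<close>

lemma permute_vars_subst:
  fixes f :: "'k::comm_ring_1 mpoly"
  assumes "bij p" shows "permute_vars p f = subst (\<lambda>i. pvar (p i)) f"
proof -
  have inj: "inj p" using assms by (simp add: bij_def)
  let ?K = "Poly_Mapping.map_key p :: (nat \<Rightarrow>\<^sub>0 nat) \<Rightarrow> (nat \<Rightarrow>\<^sub>0 nat)"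
  have injK: "inj ?K"
  proof (rule injI)
    fix a b assume e: "?K a = ?K b"
    show "a = b"
    proof (rule poly_mapping_eqI)
      fix k
      obtain j where "k = p j" using assms by (metis bij_pointE)
      then show "lookup a k = lookup b k"
        using e inj by (metis (no_types, lifting) comp_apply map_key.rep_eq)
    qed
  qed
  have K: "?K (single (p i) n) = single i n" for i n
    by (rule map_key_single[OF inj])
  have one: "permute_vars p (single (m :: nat \<Rightarrow>\<^sub>0 nat) c) = subst (\<lambda>i. pvar (p i)) (single m c)" for m and c :: 'k
  proof -
    \<comment> \<open>The exponent vector pushed forward along \<open>p\<close>; its pullback is
      \<open>m\<close>.\<close>
    define m' where "m' = (\<Sum>i\<in>keys m. single (p i) (lookup m i))"
    have sum: "?K (sum g A) = (\<Sum>a\<in>A. ?K (g a))" for g :: "nat \<Rightarrow> (nat \<Rightarrow>\<^sub>0 nat)" and A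
      by (induction A rule: infinite_finite_induct)
        (simp_all add: map_key_plus[OF inj] map_key_zero[OF inj])
    have Km': "?K m' = m"
      by (simp add: m'_def sum K pm_sum_single)
    have pm': "pmon m' = (\<Prod>i\<in>keys m. pvar (p i) ^ lookup m i :: 'k mpoly)"
      by (simp add: m'_def mon_sum mon_single)
    have "permute_vars p (single m c) = single m' c"
      unfolding permute_vars_def by (subst (1) Km'[symmetric]) (rule map_key_single[OF injK])
    also have "\<dots> = subst (\<lambda>i. pvar (p i)) (single m c)"
      by (simp only: subst_single single_eq_const_mon[of m'] pm')
    finally show ?thesis .
  qed
  have add: "permute_vars p (f + g) = permute_vars p f + permute_vars p g" for f g :: "'k mpoly"
    unfolding permute_vars_def by (rule map_key_plus[OF injK])
  have zero: "permute_vars p (0 :: 'k mpoly) = 0"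
    unfolding permute_vars_def by (rule map_key_zero[OF injK])
  have sum: "permute_vars p (sum g A) = (\<Sum>a\<in>A. permute_vars p (g a))" for g :: "(nat \<Rightarrow>\<^sub>0 nat) \<Rightarrow> 'k mpoly" and A
    by (induction A rule: infinite_finite_induct) (simp_all add: add zero)
  show ?thesis
    by (subst (1 2) pm_sum_single[of f, symmetric]) (simp only: sum subst_sum one)
qed

lemma alg_hom_permute_vars: "bij p \<Longrightarrow> alg_hom (permute_vars p)"
  using permute_vars_subst[of p] by (metis (no_types, lifting) alg_hom_subst ext)

section \<open>Adjacent transpositions and divided differences\<close>

lemma lookup_single_mult: "lookup (single k c * g) (k + m) = c * lookup g m"
  for g :: "'a::cancel_comm_monoid_add \<Rightarrow>\<^sub>0 'b::comm_semiring_1"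
proof -
  have "lookup (single k c * g) (k + m)
      = (\<Sum>l. lookup (single k c) l * (\<Sum>q. lookup g q when k + m = l + q))"
    by (rule lookup_mult)
  also have "\<dots> = (\<Sum>l. c * (\<Sum>q. lookup g q when k + m = k + q) when l = k)"
    by (rule Sum_any.cong) (auto simp: lookup_single when_def)
  also have "\<dots> = c * lookup g m" by simp
  finally show ?thesis .
qed

text \<open>The automorphism \<open>u\<close>, with x_a |-> x_a + x_b and inverse \<open>v\<close>,
  turns x_a - x_b into the variable x_a. A variable is never a zero divisor, whatever the ground
  ring, because multiplication by it only shifts exponents.\<close>

lemma pvar_diff_cancel:
  fixes h :: "'k::comm_ring_1 mpoly"
  assumes ab: "a \<noteq> b" and 0: "(pvar a - pvar b) * h = 0"
  shows "h = 0"
proof -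
  define u where "u = subst ((\<lambda>i. pvar i)(a := pvar a + pvar b :: 'k mpoly))"
  define v where "v = subst ((\<lambda>i. pvar i)(a := pvar a - pvar b :: 'k mpoly))"
  have "u ((pvar a - pvar b) * h) = 0" by (simp add: 0 u_def)
  then have e: "pvar a * u h = 0" using ab by (simp add: u_def)
  have "u h = 0"
  proof (rule poly_mapping_eqI)
    fix m
    have "lookup (pvar a * u h) (single a 1 + m) = 1 * lookup (u h) m"
      unfolding pvar_def by (rule lookup_single_mult)
    then show "lookup (u h) m = lookup 0 m" by (simp add: e)
  qed
  moreover have "v (u h) = h"
    by (rule alg_hom_eqI[where I=UNIV and g="\<lambda>f. v (u f)" and h="\<lambda>f. f"])
      (use ab in \<open>auto simp: u_def v_def alg_hom_comp[OF alg_hom_subst alg_hom_subst]\<close>)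
  ultimately show ?thesis by (simp add: v_def)
qed

lemma pvar_diff_cancel':
  fixes h h' :: "'k::comm_ring_1 mpoly"
  assumes "a \<noteq> b" "(pvar a - pvar b) * h = (pvar a - pvar b) * h'"
  shows "h = h'"
  using pvar_diff_cancel[of a b "h - h'"] assms by (simp add: algebra_simps)

definition sw :: "nat \<Rightarrow> 'k::comm_ring_1 mpoly \<Rightarrow> 'k mpoly" where
  "sw i = permute_vars (Transposition.transpose i (Suc i))"

lemma alg_hom_sw [simp]: "alg_hom (sw i)"
  by (simp add: sw_def alg_hom_permute_vars)

lemmas sw_simps [simp] = alg_homD[OF alg_hom_sw] alg_hom_power[OF alg_hom_sw]

lemma permute_vars_pvar: "bij p \<Longrightarrow> permute_vars p (pvar i) = pvar (p i)"
  by (simp add: permute_vars_subst)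

lemma sw_pvar: "sw i (pvar j) = pvar (Transposition.transpose i (Suc i) j)"
  by (simp add: sw_def permute_vars_pvar)

lemma sw_pvar_simps [simp]:
  "sw i (pvar i) = pvar (Suc i)" "sw i (pvar (Suc i)) = pvar i"
  "j \<noteq> i \<Longrightarrow> j \<noteq> Suc i \<Longrightarrow> sw i (pvar j) = pvar j"
  by (simp_all add: sw_pvar)

lemma alg_hom_eq: "alg_hom g \<Longrightarrow> alg_hom h \<Longrightarrow> (\<And>i. g (pvar i) = h (pvar i)) \<Longrightarrow> g f = h f"
  by (rule alg_hom_eqI[where I=UNIV]) simp_all

lemmas alg_hom_sw2 = alg_hom_comp[OF alg_hom_sw alg_hom_sw]
lemmas alg_hom_sw3 = alg_hom_comp[OF alg_hom_sw alg_hom_sw2]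

lemma sw_sw [simp]: "sw i (sw i f) = f"
  by (rule alg_hom_eq[where g="\<lambda>f. sw i (sw i f)" and h="\<lambda>f. f"]) (auto simp: alg_hom_sw2 alg_hom_sw3 sw_pvar)

lemma sw_commute: "Suc i < j \<or> Suc j < i \<Longrightarrow> sw i (sw j f) = sw j (sw i f)"
  by (rule alg_hom_eq[where g="\<lambda>f. sw i (sw j f)" and h="\<lambda>f. sw j (sw i f)"])
    (auto simp: alg_hom_sw2 alg_hom_sw3 sw_pvar Transposition.transpose_def)

lemma sw_braid: "sw i (sw (Suc i) (sw i f)) = sw (Suc i) (sw i (sw (Suc i) f))"
  by (rule alg_hom_eq[where g="\<lambda>f. sw i (sw (Suc i) (sw i f))" and h="\<lambda>f. sw (Suc i) (sw i (sw (Suc i) f))"])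
    (auto simp: alg_hom_sw2 alg_hom_sw3 sw_pvar Transposition.transpose_def)

text \<open>The quotient is unique by \<open>pvar_diff_cancel'\<close> and exists by
  \<open>dd_exists\<close>. The sign is chosen so that x_(i+1), the variable in which
  \<open>psi\<close> will interpolate, has divided difference 1.\<close>

definition dd :: "nat \<Rightarrow> 'k::comm_ring_1 mpoly \<Rightarrow> 'k mpoly" where
  "dd i f = (THE h. (pvar (Suc i) - pvar i) * h = f - sw i f)"

lemma dd_unique: "(pvar (Suc i) - pvar i) * h = f - sw i f \<Longrightarrow> dd i f = h"
  unfolding dd_def by (rule the_equality) (auto intro: pvar_diff_cancel'[of "Suc i" i])

text \<open>On generators the quotient is 0, 1 or -1, and for products the twisted Leibniz rule
  writes it through the quotients of the factors. Building it this way also shows that no new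
  variables appear.\<close>

lemma dd_exists:
  fixes f :: "'k::comm_ring_1 mpoly"
  assumes "f \<in> vars_in I" "Suc i \<in> I" "i \<in> I"
  shows "\<exists>h\<in>vars_in I. (pvar (Suc i) - pvar i) * h = f - sw i f"
  using assms(1)
proof (induction rule: vars_in_induct)
  case (const c)
  then show ?case by (intro bexI[of _ 0]) auto
next
  case (var j)
  consider "j = i" | "j = Suc i" | "j \<noteq> i" "j \<noteq> Suc i" by blast
  then show ?case
  proof cases
    case 1 then show ?thesis by (intro bexI[of _ "-1"]) (auto intro: vars_in_intros)
  next
    case 2 then show ?thesis by (intro bexI[of _ 1]) auto
  next
    case 3 then show ?thesis by (intro bexI[of _ 0]) auto
  qed
next
  case (add f g)
  then obtain h k where "h \<in> vars_in I" "k \<in> vars_in I"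
    "(pvar (Suc i) - pvar i) * h = f - sw i f" "(pvar (Suc i) - pvar i) * k = g - sw i g" by blast
  then show ?case by (intro bexI[of _ "h + k"]) (auto intro: vars_in_intros simp: distrib_left)
next
  case (mult f g)
  then obtain h k where hk: "h \<in> vars_in I" "k \<in> vars_in I"
    "(pvar (Suc i) - pvar i) * h = f - sw i f" "(pvar (Suc i) - pvar i) * k = g - sw i g" by blast
  have swg: "sw i g \<in> vars_in I"
    using \<open>g \<in> vars_in I\<close> by (rule alg_hom_vars_in[OF alg_hom_sw])
      (use assms in \<open>auto simp: sw_pvar Transposition.transpose_def intro!: vars_in_var\<close>)
  have "(pvar (Suc i) - pvar i) * (f * k + h * sw i g) = f * (g - sw i g) + (f - sw i f) * sw i g"
    unfolding hk(3,4)[symmetric] by (simp add: algebra_simps)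
  also have "\<dots> = f * g - sw i (f * g)" by (simp add: algebra_simps)
  finally show ?case using mult hk swg by (intro bexI[of _ "f * k + h * sw i g"]) (auto intro: vars_in_intros)
qed

lemma dd_eq: "(pvar (Suc i) - pvar i) * dd i f = f - sw i f"
  using dd_exists[of f UNIV i] dd_unique[of i _ f] by auto

lemma dd_vars_in: "f \<in> vars_in I \<Longrightarrow> Suc i \<in> I \<Longrightarrow> i \<in> I \<Longrightarrow> dd i f \<in> vars_in I"
  using dd_exists[of f I i] dd_unique[of i _ f] by auto

lemma sw_vars_in: "f \<in> vars_in I \<Longrightarrow> Suc i \<in> I \<Longrightarrow> i \<in> I \<Longrightarrow> sw i f \<in> vars_in I"
  by (rule alg_hom_vars_in[OF alg_hom_sw, of _ I])
     (auto simp: sw_pvar Transposition.transpose_def intro!: vars_in_var)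

lemma dd_add: "dd i (f + g) = dd i f + dd i g"
  by (rule dd_unique) (simp add: distrib_left dd_eq)

lemma dd_diff: "dd i (f - g) = dd i f - dd i g"
  by (rule dd_unique) (simp add: right_diff_distrib dd_eq)

lemma dd_fixed: "sw i f = f \<Longrightarrow> dd i f = 0"
  by (rule dd_unique) simp

lemma dd_0 [simp]: "dd i 0 = 0" and dd_1 [simp]: "dd i 1 = 0"
  by (simp_all add: dd_fixed)

lemma dd_mult: "dd i (f * g) = f * dd i g + dd i f * sw i g"
proof (rule dd_unique)
  have "(pvar (Suc i) - pvar i) * (f * dd i g + dd i f * sw i g)
      = f * ((pvar (Suc i) - pvar i) * dd i g) + ((pvar (Suc i) - pvar i) * dd i f) * sw i g"
    by (simp add: algebra_simps)
  also have "\<dots> = f * g - sw i (f * g)"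
    unfolding dd_eq by (simp add: algebra_simps)
  finally show "(pvar (Suc i) - pvar i) * (f * dd i g + dd i f * sw i g) = f * g - sw i (f * g)" .
qed

lemma dd_mult_fixed: "sw i g = g \<Longrightarrow> dd i (f * g) = dd i f * g"
  by (simp add: dd_mult dd_fixed)

lemma dd_mult_fixed_left: "sw i g = g \<Longrightarrow> dd i (g * f) = g * dd i f"
  using dd_mult_fixed[of i g f] by (simp add: mult.commute)

lemma dd_sum: "dd i (sum f A) = (\<Sum>a\<in>A. dd i (f a))"
  by (induction A rule: infinite_finite_induct) (simp_all add: dd_add)

lemma dd_pvar_Suc [simp]: "dd i (pvar (Suc i)) = 1" and dd_pvar [simp]: "dd i (pvar i) = - 1"
  by (rule dd_unique, simp)+

lemma sw_dd [simp]: "sw i (dd i f) = dd i f"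
proof (rule pvar_diff_cancel'[of "Suc i" i])
  have "sw i ((pvar (Suc i) - pvar i) * dd i f) = sw i (f - sw i f)" by (simp only: dd_eq)
  then have e: "(pvar i - pvar (Suc i)) * sw i (dd i f) = sw i f - f" by simp
  have "(pvar (Suc i) - pvar i) * sw i (dd i f) = - ((pvar i - pvar (Suc i)) * sw i (dd i f))"
    by (simp add: algebra_simps)
  also have "\<dots> = (pvar (Suc i) - pvar i) * dd i f" by (simp only: e dd_eq) simp
  finally show "(pvar (Suc i) - pvar i) * sw i (dd i f) = (pvar (Suc i) - pvar i) * dd i f" .
qed simp

lemma sw_dd_commute:
  assumes "Suc i < j \<or> Suc j < i" shows "sw j (dd i f) = dd i (sw j f)"
proof (rule dd_unique[symmetric])
  have "sw j ((pvar (Suc i) - pvar i) * dd i f) = sw j (f - sw i f)" by (simp only: dd_eq)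
  then show "(pvar (Suc i) - pvar i) * sw j (dd i f) = sw j f - sw i (sw j f)"
    using assms by (auto simp: sw_commute)
qed

text \<open>This is the braid relation for divided differences, applied to an element killed by the
  one at \<open>i\<close>. After multiplication by the Vandermonde product of the three variables,
  the claim concerns a combination of the conjugates a, a2, a3 of \<open>a\<close>. The
  transposition at i+1 exchanges a and a2, fixes a3 by \<open>sw_braid\<close>, and negates both the
  combination and the Vandermonde product, which can then be cancelled.\<close>

lemma sw_dd_braid:
  fixes a :: "'k::comm_ring_1 mpoly"
  assumes a: "sw i a = a"
  shows "sw (Suc i) (dd i (dd (Suc i) a)) = dd i (dd (Suc i) a)"
proof -
  let ?x = "pvar i :: 'k mpoly" and ?y = "pvar (Suc i) :: 'k mpoly" and ?z = "pvar (Suc (Suc i)) :: 'k mpoly"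
  define b where "b = dd i (dd (Suc i) a)"
  define c where "c = dd (Suc i) a"
  define a2 where "a2 = sw (Suc i) a"
  define a3 where "a3 = sw i a2"
  have c: "(?z - ?y) * c = a - a2" unfolding c_def a2_def by (rule dd_eq)
  have "sw i ((?z - ?y) * c) = sw i (a - a2)" by (simp only: c)
  then have sc: "(?z - ?x) * sw i c = a - a3" by (simp add: a a3_def)
  have b: "(?y - ?x) * b = c - sw i c" unfolding b_def c_def[symmetric] by (rule dd_eq)
  have "((?y - ?x) * (?z - ?x) * (?z - ?y)) * b
      = (?z - ?x) * (?z - ?y) * ((?y - ?x) * b)" by (simp add: algebra_simps)
  also have "\<dots> = (?z - ?x) * ((?z - ?y) * c) - (?z - ?y) * ((?z - ?x) * sw i c)"
    unfolding b by (simp add: algebra_simps)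
  also have "\<dots> = (?z - ?x) * (a - a2) - (?z - ?y) * (a - a3)" by (simp only: c sc)
  finally have eq: "((?y - ?x) * (?z - ?x) * (?z - ?y)) * b = (?z - ?x) * (a - a2) - (?z - ?y) * (a - a3)" .
  have s1: "sw (Suc i) a2 = a" by (simp add: a2_def)
  have s2: "sw (Suc i) a3 = a3"
  proof -
    have "sw (Suc i) a3 = sw i (sw (Suc i) (sw i a))"
      unfolding a3_def a2_def by (rule sw_braid[symmetric])
    then show ?thesis by (simp add: a a3_def a2_def)
  qed
  have s3: "sw (Suc i) a = a2" by (simp add: a2_def)
  have "sw (Suc i) (((?y - ?x) * (?z - ?x) * (?z - ?y)) * b)
      = sw (Suc i) ((?z - ?x) * (a - a2) - (?z - ?y) * (a - a3))" by (simp only: eq)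
  then have "((?z - ?x) * (?y - ?x) * (?y - ?z)) * sw (Suc i) b
      = (?y - ?x) * (a2 - a) - (?y - ?z) * (a2 - a3)"
    by (simp add: s1 s2 s3)
  then have "((?y - ?x) * (?z - ?x) * (?z - ?y)) * sw (Suc i) b
      = - ((?y - ?x) * (a2 - a) - (?y - ?z) * (a2 - a3))"
    by (simp add: algebra_simps)
  also have "\<dots> = (?z - ?x) * (a - a2) - (?z - ?y) * (a - a3)" by (simp add: algebra_simps)
  finally have "((?y - ?x) * (?z - ?x) * (?z - ?y)) * (sw (Suc i) b - b) = 0"
    using eq by (simp add: right_diff_distrib)
  then have "(?y - ?x) * ((?z - ?x) * ((?z - ?y) * (sw (Suc i) b - b))) = 0"
    by (simp only: mult.assoc)
  then have "(?z - ?x) * ((?z - ?y) * (sw (Suc i) b - b)) = 0"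
    by (rule pvar_diff_cancel[rotated]) simp
  then have "(?z - ?y) * (sw (Suc i) b - b) = 0"
    by (rule pvar_diff_cancel[rotated]) simp
  then have "sw (Suc i) b - b = 0"
    by (rule pvar_diff_cancel[rotated]) simp
  then show ?thesis by (simp add: b_def)
qed

section \<open>Traces by iterated divided differences, with dual families\<close>

definition fixed_by :: "nat set \<Rightarrow> 'k::comm_ring_1 mpoly set" where
  "fixed_by I = {f. \<forall>i\<in>I. sw i f = f}"

lemma fixed_byD: "f \<in> fixed_by I \<Longrightarrow> i \<in> I \<Longrightarrow> sw i f = f"
  by (simp add: fixed_by_def)

lemma fixed_by_intros:
  "f \<in> fixed_by I \<Longrightarrow> g \<in> fixed_by I \<Longrightarrow> f + g \<in> fixed_by I"
  "f \<in> fixed_by I \<Longrightarrow> g \<in> fixed_by I \<Longrightarrow> f - g \<in> fixed_by I"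
  "f \<in> fixed_by I \<Longrightarrow> g \<in> fixed_by I \<Longrightarrow> f * g \<in> fixed_by I"
  "pconst c \<in> fixed_by I" "0 \<in> fixed_by I" "1 \<in> fixed_by I"
  by (auto simp: fixed_by_def)

text \<open>A Demazure operator. The head of the list acts first, so appending a word composes a
  further trace on the outside (\<open>eps_append\<close>).\<close>

definition eps :: "nat list \<Rightarrow> 'k::comm_ring_1 mpoly \<Rightarrow> 'k mpoly" where
  "eps W f = fold dd W f"

lemma eps_simps [simp]: "eps [] f = f" "eps (s # W) f = eps W (dd s f)"
  by (simp_all add: eps_def)

lemma eps_append: "eps (U @ W) f = eps W (eps U f)"
  by (simp add: eps_def)

lemma eps_add: "eps W (f + g) = eps W f + eps W g"
  by (induction W arbitrary: f g) (simp_all add: dd_add)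

lemma eps_diff: "eps W (f - g) = eps W f - eps W g"
  by (induction W arbitrary: f g) (simp_all add: dd_diff)

lemma eps_0 [simp]: "eps W 0 = 0"
  by (induction W) simp_all

lemma eps_sum: "eps W (sum f A) = (\<Sum>a\<in>A. eps W (f a))"
  by (induction A rule: infinite_finite_induct) (simp_all add: eps_add)

lemma eps_mult_right: "(\<And>s. s \<in> set W \<Longrightarrow> sw s t = t) \<Longrightarrow> eps W (f * t) = eps W f * t"
  by (induction W arbitrary: f) (simp_all add: dd_mult_fixed)

lemma eps_mult_fixed_by: "t \<in> fixed_by I \<Longrightarrow> set W \<subseteq> I \<Longrightarrow> eps W (f * t) = eps W f * t"
  by (rule eps_mult_right) (auto simp: fixed_by_def)

lemma eps_vars_in: "f \<in> vars_in I \<Longrightarrow> (\<And>s. s \<in> set W \<Longrightarrow> s \<in> I \<and> Suc s \<in> I) \<Longrightarrow> eps W f \<in> vars_in I"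
  by (induction W arbitrary: f) (simp_all add: dd_vars_in)

text \<open>For \<open>f\<close> a function of the last variable \<open>y = x\<^bsub>n+1\<^esub>\<close>, symmetric in the other variables
  \<open>x\<^sub>r, \<dots>, x\<^sub>n\<close>, \<open>psi n j f\<close> is the divided difference of \<open>f\<close> at the nodes \<open>x\<^bsub>n+1\<^esub>, x\<^sub>n, \<dots>, x\<^bsub>n+1-j\<^esub>\<close>.\<close>

definition psi :: "nat \<Rightarrow> nat \<Rightarrow> 'k::comm_ring_1 mpoly \<Rightarrow> 'k mpoly" where
  "psi n j = eps (map (\<lambda>t. n - t) [0..<j])"

lemma psi_0 [simp]: "psi n 0 f = f" and psi_Suc: "psi n (Suc j) f = dd (n - j) (psi n j f)"
  by (simp_all add: psi_def eps_append)

lemma psi_add: "psi n j (f + g) = psi n j f + psi n j g"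
  and psi_diff: "psi n j (f - g) = psi n j f - psi n j g"
  and psi_zero [simp]: "psi n j 0 = 0"
  by (simp_all add: psi_def eps_add eps_diff)

lemma psi_mult_right:
  assumes "\<And>i. n < i + j \<Longrightarrow> i \<le> n \<Longrightarrow> sw i t = t" "j \<le> Suc n"
  shows "psi n j (f * t) = psi n j f * t"
  unfolding psi_def by (rule eps_mult_right) (use assms in auto)

text \<open>The excluded index n - j is that of the next operator to be applied. The last operator
  applied makes its own transposition act trivially, the neighbour above it is handled by
  \<open>sw_dd_braid\<close>, and all remaining transpositions commute with the last
  operator.\<close>

lemma psi_fixed:
  assumes f: "\<And>i. r \<le> i \<Longrightarrow> i < n \<Longrightarrow> sw i f = f" and "j \<le> Suc (n - r)" "r \<le> n"
    and i: "r \<le> i" "i \<le> n" "i + j \<noteq> n"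
  shows "sw i (psi n j f) = psi n j f"
  using assms(2) i
proof (induction j arbitrary: i rule: less_induct)
  case (less k)
  show ?case
  proof (cases k)
    case 0 then show ?thesis using less.prems by (simp add: f)
  next
    case (Suc j)
    define m where "m = n - j"
    have m: "m + j = n" "r \<le> m" using less.prems \<open>r \<le> n\<close> Suc by (auto simp: m_def)
    have psik: "psi n k f = dd m (psi n j f)" by (simp add: Suc psi_Suc m_def)
    consider "i = m" | "i = Suc m" | "Suc m < i \<or> Suc i < m"
      using less.prems m Suc by linarith
    then show ?thesis
    proof cases
      case 1 then show ?thesis by (simp add: psik)
    next
      case 2
      then obtain j' where j': "j = Suc j'" using less.prems m by (cases j) auto
      have "psi n j f = dd (Suc m) (psi n j' f)"
        using m j' by (simp add: psi_Suc) (metis Suc_diff_Suc add_Suc_right diff_add_inverse2 le_add2 less_eq_Suc_le)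
      moreover have "sw m (psi n j' f) = psi n j' f"
        by (rule less.IH) (use less.prems m j' Suc in auto)
      ultimately show ?thesis by (simp add: psik 2 sw_dd_braid)
    next
      case 3
      then have "sw i (psi n j f) = psi n j f" using less.IH[of j i] less.prems m Suc by auto
      with 3 show ?thesis by (auto simp: psik sw_dd_commute)
    qed
  qed
qed

lemma psi_fixed_low:
  assumes "sw i f = f" "Suc i < r" "j \<le> Suc (n - r)" "r \<le> n"
  shows "sw i (psi n j f) = psi n j f"
  using assms(3)
proof (induction j)
  case (Suc j)
  have "Suc i < n - j" using Suc.prems assms by linarith
  then show ?case using Suc by (simp add: psi_Suc sw_dd_commute)
qed (simp add: assms)

text \<open>The Leibniz rule for divided differences when one factor is the identity function of the
  node. In the induction step the next operator kills \<open>psi n j f\<close>, which its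
  transposition fixes.\<close>

lemma psi_mult_pvar:
  assumes f: "\<And>i. r \<le> i \<Longrightarrow> i < n \<Longrightarrow> sw i f = f" and "j \<le> n - r" "r \<le> n"
  shows "psi n (Suc j) (f * pvar (Suc n)) = psi n (Suc j) f * pvar (n - j) + psi n j f"
  using assms(2)
proof (induction j)
  case 0
  then show ?case by (simp add: psi_Suc dd_mult)
next
  case (Suc j)
  define m where "m = n - Suc j"
  have m: "m + Suc j = n" "r \<le> m" "n - j = Suc m" using Suc.prems \<open>r \<le> n\<close> by (auto simp: m_def)
  have "sw m (psi n j f) = psi n j f"
    by (rule psi_fixed[where r=r]) (use f m \<open>r \<le> n\<close> in auto)
  then have "dd m (psi n j f) = 0" by (rule dd_fixed)
  then have "dd m (psi n (Suc j) f * pvar (Suc m) + psi n j f) = psi n (Suc j) f + dd m (psi n (Suc j) f) * pvar m"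
    by (simp add: dd_add dd_mult)
  then show ?case using Suc m by (simp add: psi_Suc[of n "Suc j"] m_def[symmetric] algebra_simps)
qed

text \<open>By induction on the exponent with \<open>psi_mult_pvar\<close>. The case b = j supplies
  an element of trace 1 for \<open>dual_families_exist\<close>.\<close>

lemma psi_power:
  assumes "b \<le> j" "j \<le> Suc (n - r)" "r \<le> n"
  shows "psi n j (pvar (Suc n) ^ b) = (if b = j then 1 else 0)"
  using assms(1,2)
proof (induction b arbitrary: j)
  case 0
  have "psi n (Suc j) 1 = (0 :: 'a mpoly)" for j
    by (induction j) (simp_all add: psi_Suc)
  then show ?case by (cases j) auto
next
  case (Suc b)
  then obtain k where k: "j = Suc k" "b \<le> k" by (cases j) auto
  have "psi n (Suc k) (pvar (Suc n) ^ b * pvar (Suc n))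
      = psi n (Suc k) (pvar (Suc n) ^ b) * pvar (n - k) + psi n k (pvar (Suc n) ^ b :: 'a mpoly)"
    by (rule psi_mult_pvar[where r=r]) (use Suc.prems k \<open>r \<le> n\<close> in auto)
  then show ?case using Suc k by (simp add: mult.commute)
qed

text \<open>The coefficients of \<open>(Y - x\<^sub>n) (Y - x\<^bsub>n-1\<^esub>) \<dots> (Y - x\<^bsub>n+1-j\<^esub>)\<close> as a polynomial in \<open>Y\<close>.\<close>

fun pc :: "nat \<Rightarrow> nat \<Rightarrow> nat \<Rightarrow> 'k::comm_ring_1 mpoly" where
  "pc n 0 a = (if a = 0 then 1 else 0)"
| "pc n (Suc j) a = (if a = 0 then 0 else pc n j (a - 1)) - pvar (n - j) * pc n j a"

lemma pc_zero: "j < a \<Longrightarrow> pc n j a = 0"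
  by (induction j arbitrary: a) auto

text \<open>Up to sign these are elementary symmetric polynomials in the j variables with indices
  n+1-j, ..., n. A transposition at i < n preserves this set of variables unless it moves its lowest
  member out, which happens exactly for i = n - j.\<close>

lemma pc_fixed:
  assumes "i < n" "i + j \<noteq> n" "j \<le> Suc n"
  shows "sw i (pc n j a) = (pc n j a :: 'k::comm_ring_1 mpoly)"
  using assms(2,3)
proof (induction j arbitrary: a rule: less_induct)
  case (less k)
  show ?case
  proof (cases k)
    case 0 then show ?thesis by simp
  next
    case (Suc j)
    show ?thesis
    proof (cases "i + j = n")
      case False
      then have "sw i (pc n j a) = (pc n j a :: 'k mpoly)" for a using less.IH[of j] less.prems Suc by auto
      moreover have "sw i (pvar (n - j)) = (pvar (n - j) :: 'k mpoly)"
        by (rule sw_pvar_simps) (use False less.prems Suc in auto)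
      ultimately show ?thesis by (simp add: Suc)
    next
      case True
      then obtain j' where j': "j = Suc j'" using \<open>i < n\<close> by (cases j) auto
      have p: "sw i (pc n j' a) = (pc n j' a :: 'k mpoly)" for a using less.IH[of j'] less.prems Suc j' True by auto
      have e: "n - j' = Suc i" "n - Suc j' = i" using True j' by auto
      show ?thesis
        unfolding Suc j' by (simp add: p e) (simp add: algebra_simps)
    qed
  qed
qed

lemma pc_vars_in: "(\<And>i. i \<le> n \<Longrightarrow> i \<in> I) \<Longrightarrow> pc n j a \<in> vars_in I"
  by (induction j arbitrary: a) (auto intro!: vars_in_intros)

text \<open>The sum is the Lagrange interpolation polynomial of \<open>f\<close> at the j+1 nodes,
  with coefficients obtained by symmetrising \<open>f\<close> times the product over the other
  nodes, evaluated at the node x_(n+1) itself. It therefore returns \<open>f\<close>. The formal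
  proof adds one node at a time.\<close>

lemma psi_interpolation:
  assumes f: "\<And>i. r \<le> i \<Longrightarrow> i < n \<Longrightarrow> sw i f = f" and "j \<le> Suc (n - r)" "r \<le> n"
  shows "(\<Sum>a\<le>j. psi n j (f * pc n j a) * pvar (Suc n) ^ a) = f"
  using assms(2)
proof (induction j)
  case 0 then show ?case by simp
next
  case (Suc j)
  define m where "m = n - j"
  have m: "m + j = n" "r \<le> m" using Suc.prems \<open>r \<le> n\<close> by (auto simp: m_def)
  define y where "y = (pvar (Suc n) :: 'a mpoly)"
  define v where "v a = psi n j (f * pc n j a)" for a
  have v0: "v a = 0" if "j < a" for a using that by (simp add: v_def pc_zero)
  have IH: "(\<Sum>a\<le>j. v a * y ^ a) = f" using Suc by (simp add: v_def y_def)
  have step: "psi n (Suc j) (f * pc n (Suc j) a)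
      = (if a = 0 then 0 else dd m (v (a - 1))) + (v a - dd m (v a) * pvar (Suc m))" for a
  proof -
    have "psi n j (f * pc n j a * pvar m) = v a * pvar m"
      unfolding v_def by (rule psi_mult_right) (use m Suc.prems in \<open>auto intro!: sw_pvar_simps\<close>)
    then have "psi n j (f * pc n (Suc j) a) = (if a = 0 then 0 else v (a - 1)) - v a * pvar m"
      by (simp add: v_def m_def right_diff_distrib psi_diff mult.commute mult.left_commute)
    then show ?thesis
      by (simp add: psi_Suc m_def[symmetric] dd_diff dd_mult)
  qed
  have "(\<Sum>a\<le>Suc j. psi n (Suc j) (f * pc n (Suc j) a) * y ^ a)
      = (\<Sum>a\<le>Suc j. (if a = 0 then 0 else dd m (v (a - 1))) * y ^ a)
        + (\<Sum>a\<le>Suc j. (v a - dd m (v a) * pvar (Suc m)) * y ^ a)"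
    by (simp only: step distrib_right sum.distrib)
  also have "(\<Sum>a\<le>Suc j. (if a = 0 then 0 else dd m (v (a - 1))) * y ^ a)
      = (\<Sum>a\<le>j. dd m (v a) * y ^ a * y)"
    by (subst sum.atMost_Suc_shift) (simp add: mult.commute mult.left_commute)
  also have "(\<Sum>a\<le>Suc j. (v a - dd m (v a) * pvar (Suc m)) * y ^ a)
      = (\<Sum>a\<le>j. (v a - dd m (v a) * pvar (Suc m)) * y ^ a)"
    by (simp add: v0)
  also have "(\<Sum>a\<le>j. dd m (v a) * y ^ a * y) + \<dots>
      = (\<Sum>a\<le>j. v a * y ^ a) + (\<Sum>a\<le>j. dd m (v a) * y ^ a) * (y - pvar (Suc m))"
    by (simp add: sum_distrib_right sum_distrib_left algebra_simps flip: sum.distrib)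
  \<comment> \<open>The error of the larger interpolation is a multiple of the divided difference at
    \<open>m\<close> of the smaller interpolation, hence of \<open>f\<close>, and \<open>f\<close>
    is symmetric there. For j = 0 the other factor vanishes, as x_(m+1) is then
    \<open>y\<close>.\<close>
  also have "(\<Sum>a\<le>j. dd m (v a) * y ^ a) * (y - pvar (Suc m)) = 0"
  proof (cases "j = 0")
    case True then show ?thesis using m by (simp add: y_def)
  next
    case False
    then have y: "sw m y = y" using m by (simp add: y_def)
    have "(\<Sum>a\<le>j. dd m (v a) * y ^ a) = dd m (\<Sum>a\<le>j. v a * y ^ a)"
      by (simp add: dd_sum dd_mult_fixed y)
    also have "\<dots> = 0" unfolding IH by (rule dd_fixed) (use f m False in auto)
    finally show ?thesis by simp
  qed
  finally have "(\<Sum>a\<le>Suc j. psi n (Suc j) (f * pc n (Suc j) a) * y ^ a) = f"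
    by (simp only: IH add_0_right)
  then show ?case by (simp only: y_def)
qed

text \<open>The families are the graphs \<open>L\<close> of dual bases for the trace \<open>eps W\<close>; the first basis element
  is \<open>1\<close> and only the first dual basis element has nonzero trace.\<close>

definition dual_families :: "nat \<Rightarrow> nat set \<Rightarrow> nat list \<Rightarrow> ('k::comm_ring_1 mpoly \<times> 'k mpoly) list \<Rightarrow> bool" where
  "dual_families N I W L \<longleftrightarrow>
     set W \<subseteq> I \<and> (\<forall>r\<in>(vars_in {..<N} :: 'k mpoly set). eps W r \<in> fixed_by I) \<and>
     (\<forall>(x, p)\<in>set L. x \<in> vars_in {..<N} \<and> p \<in> vars_in {..<N}) \<and>
     (\<forall>r\<in>vars_in {..<N}. (\<Sum>(x, p)\<leftarrow>L. eps W (r * p) * x) = r)"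

text \<open>Transitivity of traces. Adding the largest index n to I' extends a run of consecutive
  indices r, ..., n, and the step from I'-invariants to I-invariants has trace
  \<open>psi n J\<close>, generators the powers of y = x_(n+1), and dual elements
  \<open>pc n J a\<close>, by \<open>psi_interpolation\<close>. Products of these with the families
  for I' form the families for I.\<close>

lemma dual_families_exist:
  assumes "I \<subseteq> {..<n}" "\<And>i. i \<in> I \<Longrightarrow> Suc i < N"
  shows "\<exists>W L. dual_families N I W (L :: ('k::comm_ring_1 mpoly \<times> 'k mpoly) list) \<and>
           (\<exists>g\<in>vars_in {..<N}. eps W g = (1 :: 'k mpoly))"
  using assms
proof (induction n arbitrary: I)
  case 0
  then show ?case
    by (intro exI[of _ "[]"] exI[of _ "[(1, 1)]"]) (auto simp: dual_families_def fixed_by_def intro: bexI[of _ 1])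
next
  case (Suc n)
  show ?case
  proof (cases "n \<in> I")
    case False
    then have "I \<subseteq> {..<n}" using Suc.prems by (auto simp: less_Suc_eq)
    then show ?thesis using Suc.IH Suc.prems by blast
  next
    case True
    define I' where "I' = I - {n}"
    have "I' \<subseteq> {..<n}" using Suc.prems by (auto simp: I'_def less_Suc_eq)
    then have "\<exists>W L. dual_families N I' W (L :: ('k mpoly \<times> 'k mpoly) list) \<and>
        (\<exists>g\<in>vars_in {..<N}. eps W g = (1 :: 'k mpoly))"
      by (rule Suc.IH) (use Suc.prems in \<open>auto simp: I'_def\<close>)
    then obtain W and L :: "('k mpoly \<times> 'k mpoly) list" and g :: "'k mpoly"
      where d: "dual_families N I' W L" and g: "g \<in> vars_in {..<N}" "eps W g = 1"
      by blast
    \<comment> \<open>The start of the maximal run of consecutive indices of \<open>I\<close> ending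
      in \<open>n\<close>. By maximality r - 1 is not in \<open>I\<close>, so the other indices are
      far enough from the run for their transpositions to commute with
      \<open>psi n J\<close>.\<close>
    define r where "r = (LEAST r. {r..n} \<subseteq> I)"
    have r: "{r..n} \<subseteq> I" unfolding r_def by (rule LeastI[of _ n]) (use True in auto)
    have rn: "r \<le> n" unfolding r_def by (rule Least_le) (use True in auto)
    have r1: "Suc i \<noteq> r" if "i \<in> I" for i
    proof
      assume e: "Suc i = r"
      have "{i..n} \<subseteq> I"
      proof
        fix k assume "k \<in> {i..n}"
        then show "k \<in> I" using that r e by (cases "k = i") auto
      qed
      then have "r \<le> i" unfolding r_def by (rule Least_le)
      then show False using e by simp
    qed
    have N: "Suc n < N" using Suc.prems True by auto
    define J where "J = Suc (n - r)"
    define V where "V = map (\<lambda>t. n - t) [0..<J]"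
    define y where "y = (pvar (Suc n) :: 'k mpoly)"
    have V: "set V \<subseteq> I" using r rn by (auto simp: V_def J_def)
    have epsV: "eps V f = psi n J f" for f :: "'k mpoly" by (simp add: V_def psi_def)
    have W: "set W \<subseteq> I'" using d by (simp add: dual_families_def)
    \<comment> \<open>Products of the given families with the powers of \<open>y\<close> and the
      interpolation coefficients.\<close>
    define M where "M = concat (map (\<lambda>(x, p). map (\<lambda>a. (y ^ a * x, p * pc n J a)) [0..<Suc J]) L)"
    have yv: "y \<in> vars_in {..<N}" using N by (simp add: y_def)
    have pcv: "(pc n J a :: 'k mpoly) \<in> vars_in {..<N}" for a using N by (auto intro!: pc_vars_in)
    have pcf: "(pc n J a :: 'k mpoly) \<in> fixed_by I'" for a
    proof -
      have "sw i (pc n J a) = (pc n J a :: 'k mpoly)" if "i \<in> I'" for i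
      proof (rule pc_fixed)
        show "i < n" using that \<open>I' \<subseteq> {..<n}\<close> by auto
        show "i + J \<noteq> n" using that r1[of i] rn by (auto simp: I'_def J_def)
      qed (simp add: J_def)
      then show ?thesis by (simp add: fixed_by_def)
    qed
    have yf: "y ^ a \<in> fixed_by I'" for a
      using \<open>I' \<subseteq> {..<n}\<close> by (auto simp: fixed_by_def y_def)
    have epsW: "eps W f \<in> fixed_by I'" if "f \<in> vars_in {..<N}" for f :: "'k mpoly"
      using d that by (simp add: dual_families_def)
    have psif: "psi n J f \<in> fixed_by I" if f: "f \<in> fixed_by I'" for f :: "'k mpoly"
    proof -
      have fr: "sw i f = f" if "r \<le> i" "i < n" for i
        by (rule fixed_byD[OF f]) (use that r in \<open>auto simp: I'_def\<close>)
      have "sw i (psi n J f) = psi n J f" if "i \<in> I" for i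
      proof (cases "r \<le> i")
        case True
        show ?thesis
          by (rule psi_fixed[where r=r]) (use fr True rn that Suc.prems in \<open>auto simp: J_def\<close>)
      next
        case False
        then have "Suc i < r" using r1[OF that] by linarith
        then show ?thesis
          by (rule psi_fixed_low[rotated]) (use f False rn that in \<open>auto simp: J_def fixed_by_def I'_def\<close>)
      qed
      then show ?thesis by (simp add: fixed_by_def)
    qed
    have interp: "(\<Sum>a\<le>J. psi n J (f * pc n J a) * y ^ a) = f" if f: "f \<in> fixed_by I'" for f :: "'k mpoly"
      unfolding y_def
    proof (rule psi_interpolation[where r=r])
      show "sw i f = f" if "r \<le> i" "i < n" for i
        by (rule fixed_byD[OF f]) (use that r in \<open>auto simp: I'_def\<close>)
    qed (use rn in \<open>auto simp: J_def\<close>)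
    have Wn: "eps W (f * t) = eps W f * t" if "t \<in> fixed_by I'" for f t :: "'k mpoly"
      using that W by (rule eps_mult_fixed_by)
    have cmpl: "(\<Sum>(x, p)\<leftarrow>M. eps (W @ V) (f * p) * x) = f" if f: "f \<in> vars_in {..<N}" for f :: "'k mpoly"
    proof -
      have "(\<Sum>(x, p)\<leftarrow>M. eps (W @ V) (f * p) * x)
          = (\<Sum>(x, p)\<leftarrow>L. \<Sum>a\<le>J. psi n J (eps W (f * (p * pc n J a))) * (y ^ a * x))"
        unfolding M_def
        by (induction L) (auto simp: case_prod_unfold o_def eps_append epsV
            interv_sum_list_conv_sum_set_nat atLeast0LessThan lessThan_Suc_atMost simp del: upt_Suc)
      also have "\<dots> = (\<Sum>(x, p)\<leftarrow>L. eps W (f * p) * x)"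
      proof (rule arg_cong[of _ _ sum_list], rule map_cong[OF refl], clarify)
        fix x p assume "(x, p) \<in> set L"
        then have p: "p \<in> vars_in {..<N}" using d by (auto simp: dual_families_def)
        have "(\<Sum>a\<le>J. psi n J (eps W (f * (p * pc n J a))) * (y ^ a * x))
            = (\<Sum>a\<le>J. psi n J (eps W (f * p) * pc n J a) * y ^ a) * x"
          by (simp add: Wn pcf sum_distrib_right flip: mult.assoc)
        also have "\<dots> = eps W (f * p) * x"
          by (subst interp) (auto intro!: epsW vars_in_mult f p)
        finally show "(\<Sum>a\<le>J. psi n J (eps W (f * (p * pc n J a))) * (y ^ a * x)) = eps W (f * p) * x" .
      qed
      also have "\<dots> = f" using d f by (simp add: dual_families_def)
      finally show ?thesis .
    qed
    have "dual_families N I (W @ V) M"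
      unfolding dual_families_def
    proof (intro conjI ballI)
      show "set (W @ V) \<subseteq> I" using W V by (auto simp: I'_def)
      show "eps (W @ V) f \<in> fixed_by I" if "f \<in> vars_in {..<N}" for f :: "'k mpoly"
        using that by (simp add: eps_append epsV epsW psif)
      show "case xp of (x, p) \<Rightarrow> x \<in> vars_in {..<N} \<and> p \<in> vars_in {..<N}" if "xp \<in> set M" for xp
        using that d by (auto simp: M_def dual_families_def intro!: vars_in_mult vars_in_power yv pcv)
    qed (rule cmpl)
    \<comment> \<open>The old element of trace 1 times the top power of \<open>y\<close>, on which
      \<open>psi n J\<close> takes the value 1.\<close>
    moreover have "eps (W @ V) (g * y ^ J) = 1"
    proof -
      have "eps W (g * y ^ J) = y ^ J" by (simp add: Wn yf g)
      then show ?thesis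
        using psi_power[of J J n r] rn by (simp add: eps_append epsV y_def J_def)
    qed
    ultimately show ?thesis using g yv by (blast intro: vars_in_mult vars_in_power)
  qed
qed

section \<open>Parabolic invariants and normalised traces\<close>

text \<open>An index \<open>i\<close> stands for the exchange of x_i and x_(i+1). It belongs to the
  parabolic subgroup exactly when no block ends between the two, that is, when no partial sum equals
  i+1.\<close>

definition adj :: "nat list \<Rightarrow> nat set" where
  "adj ks = {i. Suc i < sum_list ks \<and> (\<forall>j. sum_list (take j ks) \<noteq> Suc i)}"

lemma permute_vars_comp:
  assumes "bij p" "bij q"
  shows "permute_vars p (permute_vars q f) = permute_vars (p \<circ> q) f"
proof -
  have "bij (p \<circ> q)" using assms by (simp add: bij_comp)
  show ?thesis
  proof (rule alg_hom_eq[where g="\<lambda>f. permute_vars p (permute_vars q f)"])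
    show "alg_hom (\<lambda>f. permute_vars p (permute_vars q f))"
      by (rule alg_hom_comp; rule alg_hom_permute_vars) (fact assms)+
    show "alg_hom (permute_vars (p \<circ> q))" by (rule alg_hom_permute_vars) fact
    show "permute_vars p (permute_vars q (pvar i)) = permute_vars (p \<circ> q) (pvar i)" for i
      by (simp only: permute_vars_pvar assms \<open>bij (p \<circ> q)\<close> comp_apply)
  qed
qed

lemma permute_vars_id [simp]: "permute_vars (\<lambda>x. x) f = f"
  by (rule alg_hom_eq[where h="\<lambda>f. f"]) (auto simp: permute_vars_pvar alg_hom_permute_vars bij_id[unfolded id_def])

text \<open>The exchange of a and b+1 is the conjugate of the exchange of a and b by the adjacent
  transposition at b.\<close>

lemma permute_vars_transpose:
  assumes "{a..<b} \<subseteq> I" "f \<in> fixed_by I" "a < b"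
  shows "permute_vars (Transposition.transpose a b) f = f"
  using assms(1,3)
proof (induction b)
  case (Suc b)
  show ?case
  proof (cases "a = b")
    case True
    then show ?thesis using fixed_byD[OF assms(2), of a] Suc by (simp add: sw_def)
  next
    case False
    let ?s = "Transposition.transpose b (Suc b)" and ?t = "Transposition.transpose a b"
    have e: "Transposition.transpose a (Suc b) = ?s \<circ> (?t \<circ> ?s)"
      using False Suc.prems by (auto simp: fun_eq_iff Transposition.transpose_def)
    have s: "permute_vars ?s f = f"
      using fixed_byD[OF assms(2), of b] Suc.prems by (auto simp: sw_def subset_iff)
    have "{a..<b} \<subseteq> {a..<Suc b}" by auto
    then have t: "permute_vars ?t f = f" using Suc False by (metis less_antisym subset_trans)
    show ?thesis
      by (simp only: e s t bij_transpose bij_comp permute_vars_comp[symmetric])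
  qed
qed simp

text \<open>Equivalently, \<open>a\<close> and \<open>b\<close> lie in one orbit of the group
  generated by the adjacent transpositions in \<open>I\<close>.\<close>

definition linked :: "nat set \<Rightarrow> nat \<Rightarrow> nat \<Rightarrow> bool" where
  "linked I a b \<longleftrightarrow> {min a b..<max a b} \<subseteq> I"

lemma linked_trans: "linked I a b \<Longrightarrow> linked I b c \<Longrightarrow> linked I a c"
  unfolding linked_def subset_iff atLeastLessThan_iff min_def max_def
  by (smt (verit) linorder_not_less nle_le order_trans)

text \<open>Composing with the exchange of x and p x makes x a fixed point, so induction on the
  number of moved points writes \<open>p\<close> as a product of transpositions of linked
  points.\<close>

lemma permute_vars_linked:
  assumes "finite {x. p x \<noteq> x}" "bij p" "\<And>x. linked I x (p x)" "f \<in> fixed_by I"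
  shows "permute_vars p f = f"
  using assms(1-3)
proof (induction "card {x. p x \<noteq> x}" arbitrary: p rule: less_induct)
  case less
  show ?case
  proof (cases "\<exists>x. p x \<noteq> x")
    case False
    then have "p = (\<lambda>x. x)" by auto
    then show ?thesis by simp
  next
    case True
    then obtain x where x: "p x \<noteq> x" by blast
    define t where "t = Transposition.transpose x (p x)"
    define p' where "p' = t \<circ> p"
    have inj: "p y = p z \<longleftrightarrow> y = z" for y z
      using less.prems by (simp add: bij_def inj_eq)
    have bij': "bij p'" by (simp add: p'_def t_def bij_comp less.prems)
    have p: "p = t \<circ> p'" by (auto simp: p'_def t_def)
    have sub: "{y. p' y \<noteq> y} \<subset> {y. p y \<noteq> y}"
    proof
      show "{y. p' y \<noteq> y} \<subseteq> {y. p y \<noteq> y}"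
        using x inj by (auto simp: p'_def t_def Transposition.transpose_def)
      have "p' x = x" by (simp add: p'_def t_def)
      then show "{y. p' y \<noteq> y} \<noteq> {y. p y \<noteq> y}"
        using x by blast
    qed
    have lk: "linked I y (p' y)" for y
    proof -
      \<comment> \<open>The point formerly sent to x now goes to p x; it is linked to p x through
        x.\<close>
      have "p' y = (if p y = x then p x else if y = x then x else p y)"
        using inj by (auto simp: p'_def t_def Transposition.transpose_def)
      then show ?thesis
        using less.prems(3)[of y] less.prems(3)[of x] linked_trans[of I y "p y" "p x"]
        by (auto simp: linked_def)
    qed
    have "permute_vars p' f = f"
    proof (rule less.hyps)
      show "card {y. p' y \<noteq> y} < card {y. p y \<noteq> y}"
        by (rule psubset_card_mono) (use less.prems sub in auto)
      show "finite {y. p' y \<noteq> y}" using sub less.prems finite_subset by blast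
    qed (use bij' lk in auto)
    moreover have "permute_vars t f = f"
    proof (cases "x < p x")
      case True
      then show ?thesis
        unfolding t_def
        by (intro permute_vars_transpose[OF _ assms(4)]) (use less.prems(3)[of x] in \<open>auto simp: linked_def\<close>)
    next
      case False
      then have "permute_vars (Transposition.transpose (p x) x) f = f"
        by (intro permute_vars_transpose[OF _ assms(4)]) (use x less.prems(3)[of x] in \<open>auto simp: linked_def\<close>)
      then show ?thesis by (simp add: t_def transpose_commute)
    qed
    ultimately show ?thesis
      by (metis p permute_vars_comp bij' bij_transpose t_def)
  qed
qed

lemma sum_list_take_mono: "i \<le> j \<Longrightarrow> sum_list (take i ks) \<le> sum_list (take j ks)" for ks :: "nat list"
  by (metis le_add1 min.absorb1 sum_list_append take_add le_Suc_ex)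

text \<open>The parabolic subgroup is generated by the adjacent transpositions it contains, because
  a permutation preserving the blocks moves every point to a linked one. Invariance thus becomes a
  condition on the operators \<open>sw i\<close>, which interact with divided differences.\<close>

lemma invariants_eq: "invariants ks = vars_in {..<sum_list ks} \<inter> fixed_by (adj ks)"
proof (intro equalityI subsetI)
  fix f assume f: "f \<in> invariants ks"
  have "sw i f = f" if i: "i \<in> adj ks" for i
  proof -
    let ?t = "Transposition.transpose i (Suc i)"
    have "i \<in> block ks j \<longleftrightarrow> Suc i \<in> block ks j" for j
    proof -
      have "sum_list (take j ks) \<noteq> Suc i" "sum_list (take (Suc j) ks) \<noteq> Suc i"
        using i by (simp_all add: adj_def)
      then show ?thesis unfolding block_def atLeastLessThan_iff by linarith
    qed
    then have "?t ` block ks j = block ks j" for j by (rule transpose_image_eq)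
    moreover have "?t permutes {..<sum_list ks}"
      using i by (intro permutes_swap_id) (auto simp: adj_def)
    ultimately show ?thesis using f by (simp add: invariants_def parabolic_def sw_def)
  qed
  then show "f \<in> vars_in {..<sum_list ks} \<inter> fixed_by (adj ks)"
    using f by (simp add: fixed_by_def invariants_def vars_in_def)
next
  fix f assume f: "f \<in> vars_in {..<sum_list ks} \<inter> fixed_by (adj ks)"
  have "permute_vars p f = f" if p: "p \<in> parabolic ks" for p
  proof (rule permute_vars_linked)
    have perm: "p permutes {..<sum_list ks}" using p by (simp add: parabolic_def)
    show "bij p" using perm by (rule permutes_bij)
    show "finite {x. p x \<noteq> x}"
      by (rule finite_subset[of _ "{..<sum_list ks}"]) (use perm in \<open>auto simp: permutes_def\<close>)
    show "f \<in> fixed_by (adj ks)" using f by simp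
    show "linked (adj ks) x (p x)" for x
    proof (cases "x < sum_list ks")
      case False
      then have "p x = x" using perm by (simp add: permutes_def)
      then show ?thesis by (simp add: linked_def)
    next
      case True
      \<comment> \<open>The first partial sum exceeding \<open>x\<close>; the block containing
        \<open>x\<close> is the one before it, with index j - 1.\<close>
      define j where "j = (LEAST j. x < sum_list (take j ks))"
      have j: "x < sum_list (take j ks)"
        unfolding j_def by (rule LeastI[of _ "length ks"]) (use True in simp)
      then obtain i where i: "j = Suc i" by (cases j) auto
      have ge: "\<not> x < sum_list (take i ks)"
        using not_less_Least[of i "\<lambda>j. x < sum_list (take j ks)"] i by (simp add: j_def)
      have x: "x \<in> block ks i" using j ge by (simp add: block_def i)
      have "i < length ks" using j ge i by (cases "i < length ks") auto
      then have "p ` block ks i = block ks i" using p by (simp add: parabolic_def)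
      then have px: "p x \<in> block ks i" using x by blast
      show ?thesis
        unfolding linked_def
      proof
        fix k assume k: "k \<in> {min x (p x)..<max x (p x)}"
        have k': "sum_list (take i ks) \<le> k" "Suc k < sum_list (take (Suc i) ks)"
          using k x px by (auto simp: block_def min_def max_def split: if_splits)
        have "sum_list (take m ks) \<noteq> Suc k" for m
          using sum_list_take_mono[of m i ks] sum_list_take_mono[of "Suc i" m ks] k' by (cases "m \<le> i") auto
        moreover have "Suc k < sum_list ks"
          using k' sum_list_take_mono[of "Suc i" "Suc i + length ks" ks] by simp
        ultimately show "k \<in> adj ks" by (simp add: adj_def)
      qed
    qed
  qed
  then show "f \<in> invariants ks" using f by (simp add: invariants_def vars_in_def)
qed

lemma refines_sum_list_take: "refines ls ks \<Longrightarrow> \<exists>m. sum_list (take j ks) = sum_list (take m ls)"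
proof -
  assume "refines ls ks"
  then obtain lss where l: "length lss = length ks" "\<forall>i<length ks. composition (ks ! i) (lss ! i)" "ls = concat lss"
    by (auto simp: refines_def)
  have "sum_list (concat (take j lss)) = sum_list (map sum_list (take j lss))" for j
    by (induction lss arbitrary: j) (auto simp: take_Cons split: nat.splits)
  also have "map sum_list (take j lss) = take j ks"
    by (rule nth_equalityI) (use l in \<open>auto simp: composition_def\<close>)
  moreover have "concat lss = concat (take j lss) @ concat (drop j lss)"
    by (metis append_take_drop_id concat_append)
  ultimately have "sum_list (take j ks) = sum_list (take (length (concat (take j lss))) ls)"
    by (simp add: l(3))
  then show ?thesis by blast
qed

lemma refines_adj: "refines ls ks \<Longrightarrow> sum_list ls = sum_list ks \<Longrightarrow> adj ls \<subseteq> adj ks"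
  unfolding adj_def using refines_sum_list_take by (clarsimp) metis

lemma invariants_mono: "refines ls ks \<Longrightarrow> sum_list ls = sum_list ks \<Longrightarrow> invariants ks \<subseteq> invariants ls"
  unfolding invariants_eq using refines_adj[of ls ks] by (auto simp: fixed_by_def)

lemma invariants_ones: "invariants (replicate N 1) = vars_in {..<N}"
proof -
  have "adj (replicate N 1) = {}"
  proof -
    have "sum_list (take (Suc i) (replicate N 1)) = Suc i" if "Suc i < N" for i
      using that by (simp add: sum_list_replicate)
    moreover have "sum_list (replicate N 1) = N" by (simp add: sum_list_replicate)
    ultimately show ?thesis unfolding adj_def by (intro equals0I) (metis (mono_tags, lifting) mem_Collect_eq)
  qed
  then show ?thesis by (simp add: invariants_eq fixed_by_def sum_list_replicate)
qed

lemma invariants_intros: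
  "f \<in> invariants ks \<Longrightarrow> g \<in> invariants ks \<Longrightarrow> f + g \<in> invariants ks"
  "f \<in> invariants ks \<Longrightarrow> g \<in> invariants ks \<Longrightarrow> f - g \<in> invariants ks"
  "f \<in> invariants ks \<Longrightarrow> g \<in> invariants ks \<Longrightarrow> f * g \<in> invariants ks"
  "pconst c \<in> invariants ks" "0 \<in> invariants ks" "1 \<in> invariants ks"
  by (auto simp: invariants_eq intro: vars_in_intros fixed_by_intros)

text \<open>The elements \<open>x j\<close> generate the polynomial ring over the invariants, with
  coordinate functions r |-> \<open>eps W (r * p j)\<close>; linear independence is not demanded.
  The normalisation in the last line makes r |-> \<open>eps W (r * p 0)\<close> a projection onto
  the invariants, and makes the coordinates of an invariant vanish except the one at 0.\<close>

definition trace_data ::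
    "nat \<Rightarrow> nat list \<Rightarrow> nat list \<Rightarrow> nat \<Rightarrow> (nat \<Rightarrow> 'k::comm_ring_1 mpoly) \<Rightarrow> (nat \<Rightarrow> 'k mpoly) \<Rightarrow> bool" where
  "trace_data N ks W d x p \<longleftrightarrow>
     set W \<subseteq> adj ks \<and> 0 < d \<and> (\<forall>r\<in>(vars_in {..<N} :: 'k mpoly set). eps W r \<in> invariants ks) \<and>
     (\<forall>j<d. x j \<in> vars_in {..<N} \<and> p j \<in> vars_in {..<N}) \<and>
     (\<forall>r\<in>vars_in {..<N}. (\<Sum>j<d. eps W (r * p j) * x j) = r) \<and>
     (\<forall>r\<in>vars_in {..<N}. (\<Sum>j<d. eps W (r * x j) * p j) = r) \<and>
     x 0 = 1 \<and> eps W (p 0) = 1 \<and> (\<forall>j. 0 < j \<longrightarrow> j < d \<longrightarrow> eps W (p j) = 0)"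

text \<open>The families of \<open>dual_families_exist\<close> are normalised by means of an element
  \<open>g\<close> of trace 1. Symmetry in x and p follows from nondegeneracy of the trace
  form.\<close>

lemma trace_data_exists:
  assumes N: "sum_list ks = N"
  shows "\<exists>W d x p. trace_data N ks W d (x :: nat \<Rightarrow> 'k::comm_ring_1 mpoly) p"
proof -
  have "\<exists>W L. dual_families N (adj ks) W (L :: ('k mpoly \<times> 'k mpoly) list) \<and>
           (\<exists>g\<in>vars_in {..<N}. eps W g = (1 :: 'k mpoly))"
    by (rule dual_families_exist[of _ N]) (auto simp: adj_def N)
  then obtain W and L :: "('k mpoly \<times> 'k mpoly) list" and g :: "'k mpoly"
    where d: "dual_families N (adj ks) W L" and g: "g \<in> vars_in {..<N}" "eps W g = 1"
    by blast
  have W: "set W \<subseteq> adj ks" using d by (simp add: dual_families_def)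
  have ev: "eps W r \<in> vars_in {..<N}" if "r \<in> vars_in {..<N}" for r :: "'k mpoly"
    using that by (rule eps_vars_in) (use W in \<open>auto simp: adj_def N\<close>)
  have ef: "eps W r \<in> fixed_by (adj ks)" if "r \<in> vars_in {..<N}" for r :: "'k mpoly"
    using d that by (simp add: dual_families_def)
  have lin: "eps W (f * eps W r) = eps W f * eps W r" if "r \<in> vars_in {..<N}" for f r :: "'k mpoly"
    using ef[OF that] W by (rule eps_mult_fixed_by)
  \<comment> \<open>Adding the pair (1, g) contributes \<open>eps W (r * g)\<close> to the expansion
    of r. Subtracting from each p its multiple of g removes the same amount, as the expansion of 1
    shows, and leaves elements of trace 0.\<close>
  define L' where "L' = (1, g) # map (\<lambda>(x, p). (x, p - g * eps W p)) L"
  define n where "n = length L'"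
  define x where "x j = fst (L' ! j)" for j
  define p where "p j = snd (L' ! j)" for j
  have Lv: "fst xp \<in> vars_in {..<N}" "snd xp \<in> vars_in {..<N}" if "xp \<in> set L" for xp
    using d that by (cases xp; force simp: dual_families_def)+
  have L'v: "fst xp \<in> vars_in {..<N}" "snd xp \<in> vars_in {..<N}" if "xp \<in> set L'" for xp
    using that Lv g by (auto simp: L'_def split: prod.splits intro!: vars_in_diff vars_in_mult ev)
  have xv: "x j \<in> vars_in {..<N}" and pv: "p j \<in> vars_in {..<N}" if "j < n" for j
    using that L'v[of "L' ! j"] by (auto simp: x_def p_def n_def)
  have sumL: "(\<Sum>(x, p)\<leftarrow>L. eps W (r * p) * x) = r" if "r \<in> vars_in {..<N}" for r
    using d that by (simp add: dual_families_def)
  have cmpl: "(\<Sum>j<n. eps W (r * p j) * x j) = r" if r: "r \<in> vars_in {..<N}" for r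
  proof -
    have "(\<Sum>j<n. eps W (r * p j) * x j) = (\<Sum>(x, p)\<leftarrow>L'. eps W (r * p) * x)"
      by (simp add: sum_list_sum_nth n_def x_def p_def atLeast0LessThan case_prod_unfold)
    also have "\<dots> = eps W (r * g) + (\<Sum>(x, p)\<leftarrow>L. eps W (r * (p - g * eps W p)) * x)"
      by (simp add: L'_def case_prod_unfold o_def)
    also have "(\<Sum>(x, p)\<leftarrow>L. eps W (r * (p - g * eps W p)) * x)
        = (\<Sum>(x, p)\<leftarrow>L. eps W (r * p) * x - eps W (r * g) * (eps W p * x))"
    proof (rule arg_cong[of _ _ sum_list], rule map_cong[OF refl], clarify)
      fix a b assume "(a, b) \<in> set L"
      then have "eps W (r * g * eps W b) = eps W (r * g) * eps W b" using Lv by (intro lin) force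
      then show "eps W (r * (b - g * eps W b)) * a = eps W (r * b) * a - eps W (r * g) * (eps W b * a)"
        by (simp add: right_diff_distrib eps_diff algebra_simps)
    qed
    also have "\<dots> = (\<Sum>(x, p)\<leftarrow>L. eps W (r * p) * x) - eps W (r * g) * (\<Sum>(x, p)\<leftarrow>L. eps W (1 * p) * x)"
      by (simp add: case_prod_unfold sum_list_subtractf sum_list_const_mult)
    also have "\<dots> = r - eps W (r * g)" by (subst (1 2) sumL) (simp_all add: r)
    finally show ?thesis by simp
  qed
  have dual: "(\<Sum>j<n. eps W (r * x j) * p j) = r" if r: "r \<in> vars_in {..<N}" for r
  proof -
    \<comment> \<open>The defect of the dual expansion pairs to zero with every element, so its own
      expansion in the x j is zero.\<close>
    define h where "h = r - (\<Sum>j<n. eps W (r * x j) * p j)"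
    have hv: "h \<in> vars_in {..<N}"
      unfolding h_def using r xv pv by (intro vars_in_intros ev) auto
    have "eps W (s * h) = 0" if s: "s \<in> vars_in {..<N}" for s
    proof -
      have "eps W (s * (\<Sum>j<n. eps W (r * x j) * p j)) = (\<Sum>j<n. eps W ((s * p j) * eps W (r * x j)))"
        by (simp add: sum_distrib_left eps_sum algebra_simps)
      also have "\<dots> = (\<Sum>j<n. eps W (s * p j) * eps W (r * x j))"
        by (rule sum.cong) (use r xv in \<open>auto intro!: lin vars_in_mult\<close>)
      also have "\<dots> = (\<Sum>j<n. eps W ((r * x j) * eps W (s * p j)))"
        by (rule sum.cong) (use s pv in \<open>auto simp: mult.commute lin vars_in_mult\<close>)
      also have "\<dots> = eps W (r * (\<Sum>j<n. eps W (s * p j) * x j))"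
        by (simp add: sum_distrib_left eps_sum algebra_simps)
      also have "\<dots> = eps W (s * r)" by (simp only: cmpl[OF s] mult.commute[of r s])
      finally show ?thesis by (simp add: h_def right_diff_distrib eps_diff)
    qed
    then have "(\<Sum>j<n. eps W (h * p j) * x j) = 0"
      using pv by (intro sum.neutral) (auto simp: mult.commute[of h])
    then show ?thesis using cmpl[OF hv] by (simp add: h_def)
  qed
  have "trace_data N ks W n x p"
    unfolding trace_data_def
  proof (intro conjI allI impI ballI)
    show "set W \<subseteq> adj ks" "0 < n" by (simp_all add: W n_def L'_def)
    show "eps W r \<in> invariants ks" if "r \<in> vars_in {..<N}" for r :: "'k mpoly"
      using that by (simp add: invariants_eq ev ef N)
    show "x 0 = 1" "eps W (p 0) = 1" by (simp_all add: x_def p_def L'_def g)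
    show "eps W (p j) = 0" if "0 < j" "j < n" for j
    proof -
      have "L ! (j - 1) \<in> set L" using that by (auto simp: n_def L'_def)
      then have "eps W (g * eps W (snd (L ! (j - 1)))) = eps W g * eps W (snd (L ! (j - 1)))"
        by (intro lin Lv)
      then show ?thesis using that
        by (auto simp: p_def n_def L'_def eps_diff g case_prod_unfold)
    qed
  qed (use cmpl dual xv pv in auto)
  then show ?thesis by blast
qed

section \<open>Integer combinations of relations\<close>

text \<open>The subgroup generated by \<open>S\<close>, without the set of generators that
  \<open>pres_rels\<close> carries along; \<open>pres_rels_eq\<close> identifies the two. Congruence
  of chains means that their difference lies in such a span.\<close>

inductive_set zspan :: "('g \<Rightarrow>\<^sub>0 int) set \<Rightarrow> ('g \<Rightarrow>\<^sub>0 int) set" for S where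
  zspan_0 [simp]: "0 \<in> zspan S"
| zspan_step_add: "a \<in> S \<Longrightarrow> b \<in> zspan S \<Longrightarrow> a + b \<in> zspan S"
| zspan_step_diff: "a \<in> S \<Longrightarrow> b \<in> zspan S \<Longrightarrow> b - a \<in> zspan S"

lemma zspan_base: "a \<in> S \<Longrightarrow> a \<in> zspan S"
  using zspan_step_add[of a S 0] by simp

lemma zspan_add: "a \<in> zspan S \<Longrightarrow> b \<in> zspan S \<Longrightarrow> a + b \<in> zspan S"
proof (induction a rule: zspan.induct)
  case (zspan_step_add a c)
  then show ?case using zspan.zspan_step_add[of a S "c + b"] by (simp add: add.assoc)
next
  case (zspan_step_diff a c)
  then show ?case using zspan.zspan_step_diff[of a S "c + b"] by (simp add: algebra_simps)
qed simp

lemma zspan_uminus: "a \<in> zspan S \<Longrightarrow> - a \<in> zspan S"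
proof (induction a rule: zspan.induct)
  case (zspan_step_add a c)
  have "- (a + c) = - c - a" by simp
  then show ?case using zspan_step_add zspan.zspan_step_diff[of a S "- c"] by metis
next
  case (zspan_step_diff a c)
  then show ?case using zspan.zspan_step_add[of a S "- c"] by simp
qed simp

lemma zspan_diff: "a \<in> zspan S \<Longrightarrow> b \<in> zspan S \<Longrightarrow> a - b \<in> zspan S"
  using zspan_add[of a S "- b"] zspan_uminus[of b S] by simp

lemma zspan_sum: "(\<And>i. i \<in> I \<Longrightarrow> f i \<in> zspan S) \<Longrightarrow> sum f I \<in> zspan S"
  by (induction I rule: infinite_finite_induct) (auto intro: zspan_add)

lemma zspan_cmul: "a \<in> zspan S \<Longrightarrow> frag_cmul k a \<in> zspan S"
  by (rule frag_closure_minus_cmul[where P="\<lambda>c. c \<in> zspan S"]) (auto intro: zspan_diff)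

lemma zspan_commute: "a - b \<in> zspan S \<Longrightarrow> b - a \<in> zspan S"
  using zspan_uminus[of "a - b" S] by simp

lemma zspan_trans: "a - b \<in> zspan S \<Longrightarrow> b - c \<in> zspan S \<Longrightarrow> a - c \<in> zspan S"
  using zspan_add[of "a - b" S "b - c"] by simp

lemma zspan_map:
  assumes "c \<in> zspan S" "\<And>a. a \<in> S \<Longrightarrow> frag_extend f a \<in> zspan T"
  shows "frag_extend f c \<in> zspan T"
  using assms(1)
  by (induction c rule: zspan.induct)
     (auto simp: frag_extend_add frag_extend_diff assms(2) intro: zspan_add zspan_diff)

lemma zspan_keys:
  assumes "c \<in> zspan R" "\<And>r. r \<in> R \<Longrightarrow> keys r \<subseteq> S" shows "keys c \<subseteq> S"
  using assms(1)
proof (induction c rule: zspan.induct)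
  case (zspan_step_add a b) then show ?case using keys_add[of a b] assms(2) by blast
next
  case (zspan_step_diff a b) then show ?case using keys_diff[of b a] assms(2) by blast
qed simp

lemma pres_rels_eq:
  assumes R: "\<And>r. r \<in> R \<Longrightarrow> keys r \<subseteq> S"
  shows "pres_rels S R = zspan R"
proof (intro equalityI subsetI)
  fix c assume "c \<in> pres_rels S R"
  then have "c \<in> generate (free_Abelian_group S) R" by (simp add: pres_rels_def)
  then show "c \<in> zspan R"
  proof (induction rule: generate.induct)
    case (inv h) then show ?case by (simp add: R zspan_base zspan_uminus)
  qed (auto intro: zspan_base zspan_add)
next
  fix c assume "c \<in> zspan R"
  then show "c \<in> pres_rels S R"
  proof (induction c rule: zspan.induct)
    case zspan_0
    then show ?case
      using generate.one[of "free_Abelian_group S" R] by (simp add: pres_rels_def)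
  next
    case (zspan_step_add a b)
    then show ?case
      using generate.eng[OF generate.incl[of a R "free_Abelian_group S"], of b] by (simp add: pres_rels_def)
  next
    case (zspan_step_diff a b)
    then show ?case
      using generate.eng[of b "free_Abelian_group S" R, OF _ generate.inv[of a R "free_Abelian_group S"]]
      by (simp add: pres_rels_def R)
  qed
qed

lemma frag_extend_cong_zspan:
  assumes "keys c \<subseteq> W" "\<And>w. w \<in> W \<Longrightarrow> f w - g w \<in> zspan T"
  shows "frag_extend f c - frag_extend g c \<in> zspan T"
  using assms(1)
proof (induction c rule: frag_induction)
  case (one x) then show ?case by (simp add: assms(2))
next
  case (diff a b)
  have "frag_extend f (a - b) - frag_extend g (a - b)
      = (frag_extend f a - frag_extend g a) - (frag_extend f b - frag_extend g b)"
    by (simp add: frag_extend_diff)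
  then show ?case using diff by (simp add: zspan_diff)
qed simp

lemma frag_extend_comp: "frag_extend f (frag_extend g c) = frag_extend (\<lambda>w. frag_extend f (g w)) c"
  using subset_UNIV
  by (induction c rule: frag_induction[where S=UNIV]) (auto simp: frag_extend_diff)

lemma frag_extend_frag_of [simp]: "frag_extend frag_of c = c"
  by (rule frag_expansion[symmetric])

lemma keys_frag_extend_subset:
  assumes "keys c \<subseteq> W" "\<And>w. w \<in> W \<Longrightarrow> keys (f w) \<subseteq> W'"
  shows "keys (frag_extend f c) \<subseteq> W'"
  using keys_frag_extend[of f c] assms by blast

lemma keys_sum_subset: "(\<And>i. i \<in> I \<Longrightarrow> keys (f i) \<subseteq> W) \<Longrightarrow> keys (sum f I) \<subseteq> W"
  using keys_sum[of f I] by blast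

section \<open>Twisted Hochschild chains and transfer of acyclicity\<close>

abbreviation hw where "hw ks M n \<equiv> hoch_words (inv_ring ks) M n"
abbreviation hrel where "hrel ks M n \<equiv> hoch_rels (inv_ring ks) M n"

lemma inv_ring_simps [simp]:
  "carrier (inv_ring ks) = invariants ks" "\<one>\<^bsub>inv_ring ks\<^esub> = 1" "\<zero>\<^bsub>inv_ring ks\<^esub> = 0"
  "a \<otimes>\<^bsub>inv_ring ks\<^esub> b = a * b" "a \<oplus>\<^bsub>inv_ring ks\<^esub> b = a + b"
  "kscale (inv_ring ks) c f = pconst c * f" "alg_deg (inv_ring ks) d = invariants ks \<inter> poly_hom d"
  by (simp_all add: inv_ring_def pconst_def)

definition merge :: "nat \<Rightarrow> 'k::comm_ring_1 mpoly list \<Rightarrow> 'k mpoly list" where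
  "merge i as = take (i - 1) as @ [as ! (i - 1) * as ! i] @ drop (i + 1) as"

text \<open>The individual terms of the differential, as faces of a presimplicial object. The twist
  of the last face is left as a map \<open>\<tau>\<close>, which stands for \<open>qtwist\<close>
  and will be \<open>scale_vars l\<close>.\<close>

definition dface ::
    "('k::comm_ring_1 mpoly \<Rightarrow> 'k mpoly) \<Rightarrow> ('k mpoly, 'k mpoly, 'm) graded_bimod \<Rightarrow> nat \<Rightarrow>
     'm \<times> 'k mpoly list \<Rightarrow> 'm \<times> 'k mpoly list" where
  "dface \<tau> M i w = (case w of (m, as) \<Rightarrow>
     if i = 0 then (ract M m (hd as), tl as)
     else if i < length as then (m, merge i as)
     else (lact M (\<tau> (last as)) m, butlast as))"

definition bd ::
    "('k::comm_ring_1 mpoly \<Rightarrow> 'k mpoly) \<Rightarrow> ('k mpoly, 'k mpoly, 'm) graded_bimod \<Rightarrow>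
     'm \<times> 'k mpoly list \<Rightarrow> ('m \<times> 'k mpoly list) \<Rightarrow>\<^sub>0 int" where
  "bd \<tau> M w = (if snd w = [] then 0
     else \<Sum>i\<le>length (snd w). frag_cmul ((-1) ^ i) (frag_of (dface \<tau> M i w)))"

text \<open>Exactness is expressed on representatives in the free abelian group: a cycle modulo
  relations is a boundary modulo relations. Chain maps can then be given on words, and cosets enter
  only in \<open>trivial_qHH\<close>.\<close>

definition acyclic_in_pos_deg ::
    "('k::comm_ring_1 mpoly \<Rightarrow> 'k mpoly) \<Rightarrow> nat list \<Rightarrow> ('k mpoly, 'k mpoly, 'm) graded_bimod \<Rightarrow> bool" where
  "acyclic_in_pos_deg \<tau> ks M \<longleftrightarrow>
     (\<forall>n z. keys z \<subseteq> hw ks M (Suc n) \<longrightarrow> frag_extend (bd \<tau> M) z \<in> zspan (hrel ks M n) \<longrightarrow>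
        (\<exists>e. keys e \<subseteq> hw ks M (Suc (Suc n)) \<and> z - frag_extend (bd \<tau> M) e \<in> zspan (hrel ks M (Suc n))))"

text \<open>A complex that is a retract of an acyclic one is acyclic: if \<open>\<alpha>\<close> z
  bounds e, then z = \<open>\<beta>\<close> (\<open>\<alpha>\<close> z) bounds
  \<open>\<beta>\<close> e. All identities are required only modulo relations, and the two complexes
  may belong to different rings of invariants.\<close>

lemma acyclic_transfer:
  fixes M :: "('k::comm_ring_1 mpoly, 'k mpoly, 'm) graded_bimod"
    and M' :: "('k mpoly, 'k mpoly, 'n) graded_bimod"
    and \<alpha> :: "'m \<times> 'k mpoly list \<Rightarrow> 'n \<times> 'k mpoly list \<Rightarrow>\<^sub>0 int"
    and \<beta> :: "'n \<times> 'k mpoly list \<Rightarrow> 'm \<times> 'k mpoly list \<Rightarrow>\<^sub>0 int"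
  assumes ac: "acyclic_in_pos_deg \<tau> ks' M'"
    and \<alpha>w: "\<And>n w. w \<in> hw ks M n \<Longrightarrow> keys (\<alpha> w) \<subseteq> hw ks' M' n"
    and \<alpha>r: "\<And>n r. r \<in> hrel ks M n \<Longrightarrow> frag_extend \<alpha> r \<in> zspan (hrel ks' M' n)"
    and \<alpha>d: "\<And>n w. w \<in> hw ks M (Suc n) \<Longrightarrow>
          frag_extend \<alpha> (bd \<tau> M w) - frag_extend (bd \<tau> M') (\<alpha> w) \<in> zspan (hrel ks' M' n)"
    and \<beta>w: "\<And>n w. w \<in> hw ks' M' n \<Longrightarrow> keys (\<beta> w) \<subseteq> hw ks M n"
    and \<beta>r: "\<And>n r. r \<in> hrel ks' M' n \<Longrightarrow> frag_extend \<beta> r \<in> zspan (hrel ks M n)"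
    and \<beta>d: "\<And>n w. w \<in> hw ks' M' (Suc n) \<Longrightarrow>
          frag_extend \<beta> (bd \<tau> M' w) - frag_extend (bd \<tau> M) (\<beta> w) \<in> zspan (hrel ks M n)"
    and \<beta>\<alpha>: "\<And>n w. w \<in> hw ks M n \<Longrightarrow> frag_extend \<beta> (\<alpha> w) - frag_of w \<in> zspan (hrel ks M n)"
  shows "acyclic_in_pos_deg \<tau> ks M"
  unfolding acyclic_in_pos_deg_def
proof (intro allI impI)
  fix n z assume z: "keys z \<subseteq> hw ks M (Suc n)" and dz: "frag_extend (bd \<tau> M) z \<in> zspan (hrel ks M n)"
  define y where "y = frag_extend \<alpha> z"
  have y: "keys y \<subseteq> hw ks' M' (Suc n)" unfolding y_def using z \<alpha>w by (rule keys_frag_extend_subset)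
  have "frag_extend \<alpha> (frag_extend (bd \<tau> M) z) \<in> zspan (hrel ks' M' n)" by (rule zspan_map[OF dz \<alpha>r])
  moreover have "frag_extend (bd \<tau> M') y - frag_extend \<alpha> (frag_extend (bd \<tau> M) z) \<in> zspan (hrel ks' M' n)"
    unfolding y_def frag_extend_comp
    by (rule frag_extend_cong_zspan[OF z]) (rule zspan_commute[OF \<alpha>d])
  ultimately have "frag_extend (bd \<tau> M') y \<in> zspan (hrel ks' M' n)"
    using zspan_add by fastforce
  then obtain e where e: "keys e \<subseteq> hw ks' M' (Suc (Suc n))"
    and ye: "y - frag_extend (bd \<tau> M') e \<in> zspan (hrel ks' M' (Suc n))"
    using ac y unfolding acyclic_in_pos_deg_def by blast
  define f where "f = frag_extend \<beta> e"
  have f: "keys f \<subseteq> hw ks M (Suc (Suc n))" unfolding f_def using e \<beta>w by (rule keys_frag_extend_subset)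
  have 1: "frag_extend \<beta> y - z \<in> zspan (hrel ks M (Suc n))"
    using frag_extend_cong_zspan[OF z, of "\<lambda>w. frag_extend \<beta> (\<alpha> w)" frag_of, OF \<beta>\<alpha>]
    by (simp add: y_def frag_extend_comp)
  have 2: "frag_extend \<beta> y - frag_extend \<beta> (frag_extend (bd \<tau> M') e) \<in> zspan (hrel ks M (Suc n))"
    using zspan_map[OF ye \<beta>r] by (simp add: frag_extend_diff)
  have 3: "frag_extend \<beta> (frag_extend (bd \<tau> M') e) - frag_extend (bd \<tau> M) f \<in> zspan (hrel ks M (Suc n))"
    unfolding f_def frag_extend_comp by (rule frag_extend_cong_zspan[OF e \<beta>d])
  have "z - frag_extend (bd \<tau> M) f \<in> zspan (hrel ks M (Suc n))"
    using zspan_trans[OF zspan_commute[OF 1] zspan_trans[OF 2 3]] .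
  with f show "\<exists>e. keys e \<subseteq> hw ks M (Suc (Suc n)) \<and>
      z - frag_extend (bd \<tau> M) e \<in> zspan (hrel ks M (Suc n))" by blast
qed

definition bimod_map ::
    "nat list \<Rightarrow> ('k::comm_ring_1 mpoly, 'k mpoly, 'm) graded_bimod \<Rightarrow>
     ('k mpoly, 'k mpoly, 'n) graded_bimod \<Rightarrow> ('m \<Rightarrow> 'n) \<Rightarrow> bool" where
  "bimod_map ks M M' f \<longleftrightarrow>
     (\<forall>m\<in>carrier M. f m \<in> carrier M') \<and>
     (\<forall>m\<in>carrier M. \<forall>m'\<in>carrier M. f (m \<otimes>\<^bsub>M\<^esub> m') = f m \<otimes>\<^bsub>M'\<^esub> f m') \<and>
     (\<forall>a\<in>invariants ks. \<forall>m\<in>carrier M. f (lact M a m) = lact M' a (f m)) \<and>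
     (\<forall>a\<in>invariants ks. \<forall>m\<in>carrier M. f (ract M m a) = ract M' (f m) a)"

definition push :: "('m \<Rightarrow> 'n) \<Rightarrow> 'm \<times> 'a list \<Rightarrow> ('n \<times> 'a list) \<Rightarrow>\<^sub>0 int" where
  "push f w = frag_of (f (fst w), snd w)"

lemma frag_extend_push_push: "frag_extend (push g) (push f w) = push (\<lambda>m. g (f m)) w"
  by (simp add: push_def)

lemma hoch_words_iff: "(m, as) \<in> hw ks M n \<longleftrightarrow> m \<in> carrier M \<and> length as = n \<and> set as \<subseteq> invariants ks"
  by (simp add: hoch_words_def)

lemma hrel_cases [consumes 1, case_names add_mod add_alg scale]:
  assumes "r \<in> hrel ks M n"
  obtains m m' as where "(m, as) \<in> hw ks M n" "m' \<in> carrier M"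
      "r = frag_of (m \<otimes>\<^bsub>M\<^esub> m', as) - frag_of (m, as) - frag_of (m', as)"
  | m as i x y where "(m, as) \<in> hw ks M n" "i < n" "x \<in> invariants ks" "y \<in> invariants ks"
      "r = frag_of (m, as[i := x + y]) - frag_of (m, as[i := x]) - frag_of (m, as[i := y])"
  | m as i c where "(m, as) \<in> hw ks M n" "i < n"
      "r = frag_of (lact M (pconst c) m, as) - frag_of (m, as[i := pconst c * as ! i])"
  using assms unfolding hoch_rels_def inv_ring_simps mult_1_right by blast

lemma hrel_intros:
  "m \<in> carrier M \<Longrightarrow> m' \<in> carrier M \<Longrightarrow> length as = n \<Longrightarrow> set as \<subseteq> invariants ks \<Longrightarrow>
     frag_of (m \<otimes>\<^bsub>M\<^esub> m', as) - frag_of (m, as) - frag_of (m', as) \<in> hrel ks M n"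
  "m \<in> carrier M \<Longrightarrow> length as = n \<Longrightarrow> set as \<subseteq> invariants ks \<Longrightarrow> i < n \<Longrightarrow> x \<in> invariants ks \<Longrightarrow> y \<in> invariants ks \<Longrightarrow>
     frag_of (m, as[i := x + y]) - frag_of (m, as[i := x]) - frag_of (m, as[i := y]) \<in> hrel ks M n"
  "m \<in> carrier M \<Longrightarrow> length as = n \<Longrightarrow> set as \<subseteq> invariants ks \<Longrightarrow> i < n \<Longrightarrow>
     frag_of (lact M (pconst c) m, as) - frag_of (m, as[i := pconst c * as ! i]) \<in> hrel ks M n"
  unfolding hoch_rels_def inv_ring_simps mult_1_right hoch_words_def by blast+

text \<open>The compatibility with \<open>\<tau>\<close> and the left action is not needed for the relations.\<close>

lemma push_hrel:
  assumes f: "\<And>m. m \<in> carrier M \<Longrightarrow> f m \<in> carrier M'"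
    "\<And>m m'. m \<in> carrier M \<Longrightarrow> m' \<in> carrier M \<Longrightarrow> f (m \<otimes>\<^bsub>M\<^esub> m') = f m \<otimes>\<^bsub>M'\<^esub> f m'"
    "\<And>c m. m \<in> carrier M \<Longrightarrow> f (lact M (pconst c) m) = lact M' (pconst c) (f m)"
    and r: "r \<in> hrel ks M n"
  shows "frag_extend (push f) r \<in> zspan (hrel ks M' n)"
  using r
proof (cases rule: hrel_cases)
  case (add_mod m m' as)
  then show ?thesis using f
    by (auto simp: frag_extend_diff push_def hoch_words_iff intro!: zspan_base hrel_intros)
next
  case (add_alg m as i x y)
  then show ?thesis using f
    by (auto simp: frag_extend_diff push_def hoch_words_iff intro!: zspan_base hrel_intros)
next
  case (scale m as i c)
  then show ?thesis using f
    by (auto simp: frag_extend_diff push_def hoch_words_iff intro!: zspan_base hrel_intros)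
qed

lemma push_bd:
  assumes f: "bimod_map ks M M' f" and \<tau>: "\<And>a. a \<in> invariants ks \<Longrightarrow> \<tau> a \<in> invariants ks"
    and w: "w \<in> hw ks M n"
  shows "frag_extend (push f) (bd \<tau> M w) = frag_extend (bd \<tau> M') (push f w)"
proof (cases "snd w = []")
  case True then show ?thesis by (simp add: bd_def push_def)
next
  case False
  obtain m as where wm: "w = (m, as)" by (cases w)
  have *: "m \<in> carrier M" "hd as \<in> invariants ks" "last as \<in> invariants ks"
    using w False by (auto simp: wm hoch_words_iff subset_iff)
  have "push f (dface \<tau> M i w) = frag_of (dface \<tau> M' i (f m, as))" for i
    using f * \<tau>[of "last as"] by (auto simp: dface_def wm push_def bimod_map_def)
  then show ?thesis using False by (simp add: bd_def wm push_def frag_extend_sum frag_extend_cmul)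
qed

lemma acyclic_retract:
  fixes M :: "('k::comm_ring_1 mpoly, 'k mpoly, 'm) graded_bimod"
  assumes "acyclic_in_pos_deg \<tau> ks M'" and f: "bimod_map ks M M' f" and g: "bimod_map ks M' M g"
    and gf: "\<And>m. m \<in> carrier M \<Longrightarrow> g (f m) = m"
    and \<tau>: "\<And>a. a \<in> invariants ks \<Longrightarrow> \<tau> a \<in> invariants ks"
  shows "acyclic_in_pos_deg \<tau> ks M"
proof (rule acyclic_transfer[where \<alpha>="push f" and \<beta>="push g", OF assms(1)])
  have c: "pconst c \<in> invariants ks" for c :: 'k by (rule invariants_intros)
  show "frag_extend (push f) r \<in> zspan (hrel ks M' n)" if "r \<in> hrel ks M n" for n r
    by (rule push_hrel[OF _ _ _ that]) (use f c in \<open>auto simp: bimod_map_def\<close>)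
  show "frag_extend (push g) r \<in> zspan (hrel ks M n)" if "r \<in> hrel ks M' n" for n r
    by (rule push_hrel[OF _ _ _ that]) (use g c in \<open>auto simp: bimod_map_def\<close>)
  show "keys (push f w) \<subseteq> hw ks M' n" if "w \<in> hw ks M n" for w n
    using that f by (cases w) (auto simp: push_def hoch_words_iff bimod_map_def)
  show "keys (push g w) \<subseteq> hw ks M n" if "w \<in> hw ks M' n" for w n
    using that g by (cases w) (auto simp: push_def hoch_words_iff bimod_map_def)
  show "frag_extend (push g) (push f w) - frag_of w \<in> zspan (hrel ks M n)" if "w \<in> hw ks M n" for w n
    using that by (cases w) (auto simp: push_def hoch_words_iff gf)
qed (simp_all add: push_bd[OF f \<tau>] push_bd[OF g \<tau>])

lemma frag_cmul_diff2: "frag_cmul k (a - b) = frag_cmul k a - frag_cmul k b"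
  by (rule poly_mapping_eqI) (simp add: lookup_minus algebra_simps)

section \<open>Cosets in groups given by generators and relations\<close>

definition cls :: "('g \<Rightarrow>\<^sub>0 int) set \<Rightarrow> ('g \<Rightarrow>\<^sub>0 int) \<Rightarrow> ('g \<Rightarrow>\<^sub>0 int) set" where
  "cls R c = (\<lambda>r. r + c) ` zspan R"

lemma cls_self: "c \<in> cls R c"
  unfolding cls_def by (rule image_eqI[of _ _ 0]) simp_all

lemma mem_cls: "d \<in> cls R c \<longleftrightarrow> d - c \<in> zspan R"
  unfolding cls_def by (auto simp: image_iff intro!: bexI[of _ "d - c"])

lemma cls_eq_iff: "cls R c = cls R d \<longleftrightarrow> c - d \<in> zspan R"
proof
  assume "cls R c = cls R d" then show "c - d \<in> zspan R" using cls_self[of c R] by (simp add: mem_cls)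
next
  assume cd: "c - d \<in> zspan R"
  show "cls R c = cls R d"
    using zspan_trans[OF _ cd] zspan_trans[OF _ zspan_commute[OF cd]] by (auto simp: mem_cls)
qed

context
  fixes S :: "'g set" and R :: "('g \<Rightarrow>\<^sub>0 int) set"
  assumes RS: "\<And>r. r \<in> R \<Longrightarrow> keys r \<subseteq> S"
begin

lemma r_coset_cls: "pres_rels S R #>\<^bsub>free_Abelian_group S\<^esub> c = cls R c"
  by (auto simp: r_coset_def pres_rels_eq[OF RS] cls_def image_iff)

lemma pres_rels_normal: "pres_rels S R \<lhd> free_Abelian_group S"
proof -
  interpret comm_group "free_Abelian_group S" by (rule abelian_free_Abelian_group)
  have "subgroup (pres_rels S R) (free_Abelian_group S)"
    unfolding pres_rels_def by (rule generate_is_subgroup) (use RS in auto)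
  then show ?thesis by (rule subgroup_imp_normal)
qed

lemma carrier_pres_group: "carrier (pres_group S R) = {cls R c |c. keys c \<subseteq> S}"
  unfolding pres_group_def FactGroup_def RCOSETS_def by (auto simp: r_coset_cls)

lemma cls_in_pres_group: "keys c \<subseteq> S \<Longrightarrow> cls R c \<in> carrier (pres_group S R)"
  by (auto simp: carrier_pres_group)

lemma cls_mult: "keys c \<subseteq> S \<Longrightarrow> keys d \<subseteq> S \<Longrightarrow> cls R c \<otimes>\<^bsub>pres_group S R\<^esub> cls R d = cls R (c + d)"
  using normal.rcos_sum[OF pres_rels_normal, of c d]
  by (simp add: pres_group_def FactGroup_def r_coset_cls)

lemma one_pres_group: "\<one>\<^bsub>pres_group S R\<^esub> = cls R 0"
  by (simp add: pres_group_def FactGroup_def pres_rels_eq[OF RS] cls_def)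

lemma comm_group_pres_group: "comm_group (pres_group S R)"
proof -
  interpret normal "pres_rels S R" "free_Abelian_group S" by (rule pres_rels_normal)
  have "group (pres_group S R)" unfolding pres_group_def by (rule factorgroup_is_group)
  then show ?thesis
    by (rule group.group_comm_groupI) (auto simp: carrier_pres_group cls_mult add.commute)
qed

lemma pres_map_cls:
  fixes S' :: "'h set"
  assumes RS': "\<And>r. r \<in> R' \<Longrightarrow> keys r \<subseteq> S'" and f: "\<And>r. r \<in> R \<Longrightarrow> frag_extend f r \<in> zspan R'"
  shows "pres_map S' R' (frag_extend f) (cls R c) = cls R' (frag_extend f c)"
proof -
  have "pres_map S' R' (frag_extend f) (cls R c) = {a + frag_extend f (b + c) |a b. a \<in> zspan R' \<and> b \<in> zspan R}"
    by (auto simp: pres_map_def set_mult_def pres_rels_eq[OF RS'] cls_def)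
  also have "\<dots> = cls R' (frag_extend f c)"
  proof (intro equalityI subsetI)
    fix x assume "x \<in> {a + frag_extend f (b + c) |a b. a \<in> zspan R' \<and> b \<in> zspan R}"
    then obtain a b where ab: "x = a + frag_extend f (b + c)" "a \<in> zspan R'" "b \<in> zspan R" by blast
    then show "x \<in> cls R' (frag_extend f c)"
      using zspan_add[OF ab(2) zspan_map[OF ab(3) f]]
      by (simp add: mem_cls frag_extend_add algebra_simps)
  next
    fix x assume "x \<in> cls R' (frag_extend f c)"
    then have "x - frag_extend f c \<in> zspan R'" by (simp add: mem_cls)
    then show "x \<in> {a + frag_extend f (b + c) |a b. a \<in> zspan R' \<and> b \<in> zspan R}"
      by (intro CollectI exI[of _ "x - frag_extend f c"] exI[of _ 0]) auto
  qed
  finally show ?thesis .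
qed

end

section \<open>The twisted Hochschild complex of a bimodule\<close>

text \<open>The axioms of a bimodule over the invariants, stripped of gradings: once the twist is an
  algebra endomorphism \<open>\<tau>\<close>, degrees no longer enter the complex.\<close>

locale hoch_bimod =
  fixes \<tau> :: "'k::comm_ring_1 mpoly \<Rightarrow> 'k mpoly" and ks :: "nat list"
    and M :: "('k mpoly, 'k mpoly, 'm) graded_bimod"
  assumes grp: "comm_group M"
    and lact_closed: "a \<in> invariants ks \<Longrightarrow> m \<in> carrier M \<Longrightarrow> lact M a m \<in> carrier M"
    and ract_closed: "a \<in> invariants ks \<Longrightarrow> m \<in> carrier M \<Longrightarrow> ract M m a \<in> carrier M"
    and lact_add: "a \<in> invariants ks \<Longrightarrow> m \<in> carrier M \<Longrightarrow> m' \<in> carrier M \<Longrightarrow>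
          lact M a (m \<otimes>\<^bsub>M\<^esub> m') = lact M a m \<otimes>\<^bsub>M\<^esub> lact M a m'"
    and add_ract: "a \<in> invariants ks \<Longrightarrow> m \<in> carrier M \<Longrightarrow> m' \<in> carrier M \<Longrightarrow>
          ract M (m \<otimes>\<^bsub>M\<^esub> m') a = ract M m a \<otimes>\<^bsub>M\<^esub> ract M m' a"
    and add_lact: "a \<in> invariants ks \<Longrightarrow> b \<in> invariants ks \<Longrightarrow> m \<in> carrier M \<Longrightarrow>
          lact M (a + b) m = lact M a m \<otimes>\<^bsub>M\<^esub> lact M b m"
    and ract_add: "a \<in> invariants ks \<Longrightarrow> b \<in> invariants ks \<Longrightarrow> m \<in> carrier M \<Longrightarrow>
          ract M m (a + b) = ract M m a \<otimes>\<^bsub>M\<^esub> ract M m b"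
    and mult_lact: "a \<in> invariants ks \<Longrightarrow> b \<in> invariants ks \<Longrightarrow> m \<in> carrier M \<Longrightarrow>
          lact M (a * b) m = lact M a (lact M b m)"
    and ract_mult: "a \<in> invariants ks \<Longrightarrow> b \<in> invariants ks \<Longrightarrow> m \<in> carrier M \<Longrightarrow>
          ract M m (a * b) = ract M (ract M m a) b"
    and lact_ract: "a \<in> invariants ks \<Longrightarrow> b \<in> invariants ks \<Longrightarrow> m \<in> carrier M \<Longrightarrow>
          ract M (lact M a m) b = lact M a (ract M m b)"
    and central: "m \<in> carrier M \<Longrightarrow> lact M (pconst c) m = ract M m (pconst c)"
    and twist_closed: "a \<in> invariants ks \<Longrightarrow> \<tau> a \<in> invariants ks"
    and twist_hom: "alg_hom \<tau>"
begin

lemma dface_closed: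
  assumes "w \<in> hw ks M (Suc n)" "i \<le> Suc n" shows "dface \<tau> M i w \<in> hw ks M n"
proof -
  obtain m as where w: "w = (m, as)" "m \<in> carrier M" "length as = Suc n" "set as \<subseteq> invariants ks"
    using assms by (cases w) (auto simp: hoch_words_iff)
  have nth: "as ! j \<in> invariants ks" if "j \<le> n" for j using w that by (auto simp: subset_iff)
  have "as \<noteq> []" using w by auto
  then have "hd as \<in> invariants ks" "last as \<in> invariants ks" "set (tl as) \<subseteq> invariants ks"
    "set (butlast as) \<subseteq> invariants ks"
    using w(4) by (auto simp: list.set_sel(2) dest: in_set_butlastD)
  moreover have "set (merge i as) \<subseteq> invariants ks" "length (merge i as) = n" if "0 < i" "i < Suc n"
    using that w(3,4) nth
    by (auto simp: merge_def intro!: invariants_intros dest: in_set_takeD in_set_dropD)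
  ultimately show ?thesis
    using assms w by (auto simp: dface_def hoch_words_iff lact_closed ract_closed twist_closed)
qed

lemma bd_closed: "w \<in> hw ks M (Suc n) \<Longrightarrow> keys (bd \<tau> M w) \<subseteq> hw ks M n"
proof -
  assume w: "w \<in> hw ks M (Suc n)"
  then have "length (snd w) = Suc n" by (cases w) (simp add: hoch_words_iff)
  moreover have "keys (\<Sum>i\<le>Suc n. frag_cmul ((-1) ^ i) (frag_of (dface \<tau> M i w))) \<subseteq> hw ks M n"
    by (rule keys_sum_subset, rule order_trans[OF keys_cmul]) (simp add: dface_closed[OF w])
  ultimately show ?thesis by (auto simp: bd_def simp del: sum.atMost_Suc)
qed

lemma nth_merge:
  assumes "0 < i" "i < length as" "j < length as - 1"
  shows "merge i as ! j = (if j < i - 1 then as ! j else if j = i - 1 then as ! (i - 1) * as ! i else as ! Suc j)"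
  using assms by (auto simp: merge_def nth_append nth_Cons min_def split: nat.splits
      intro!: arg_cong[of _ _ "(!) as"])

lemma length_merge: "0 < i \<Longrightarrow> i < length as \<Longrightarrow> length (merge i as) = length as - 1"
  by (simp add: merge_def)

lemma merge_update:
  assumes i: "0 < i" "i < length as" and k: "k < length as"
  shows "merge i (as[k := z]) =
    (if k < i - 1 then (merge i as)[k := z] else if k = i - 1 then (merge i as)[i - 1 := z * as ! i]
     else if k = i then (merge i as)[i - 1 := as ! (i - 1) * z] else (merge i as)[k - 1 := z])"
proof (rule nth_equalityI)
  fix t assume "t < length (merge i (as[k := z]))"
  then have t: "t < length as - 1" using i by (simp add: length_merge)
  have 1: "merge i (as[k := z]) ! t = (if t < i - 1 then as[k := z] ! t
      else if t = i - 1 then as[k := z] ! (i - 1) * as[k := z] ! i else as[k := z] ! Suc t)"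
    by (rule nth_merge) (use i t in auto)
  have 2: "(merge i as)[l := y] ! t = (if t = l then y else if t < i - 1 then as ! t
      else if t = i - 1 then as ! (i - 1) * as ! i else as ! Suc t)" for l y
    using i t by (simp add: nth_list_update length_merge nth_merge)
  show "merge i (as[k := z]) ! t = (if k < i - 1 then (merge i as)[k := z] else if k = i - 1 then (merge i as)[i - 1 := z * as ! i]
     else if k = i then (merge i as)[i - 1 := as ! (i - 1) * z] else (merge i as)[k - 1 := z]) ! t"
    unfolding 1 if_distrib[where f="\<lambda>l. l ! t"] 2
    using i k t by (cases i; cases rule: linorder_cases[of t "i - 1"]; cases rule: linorder_cases[of k "i - 1"])
      (auto simp: nth_list_update)
qed (use i in \<open>simp add: length_merge\<close>)

text \<open>Seen as a function of one algebra entry, a face either writes a linear function of that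
  entry into an algebra slot, or absorbs it linearly into the module entry. With this alternative
  both slot relations are checked for all faces at once in \<open>dface_hrel\<close>.\<close>

lemma dface_slot:
  assumes w: "(m, as) \<in> hw ks M (Suc n)" and k: "k < Suc n" and i: "i \<le> Suc n"
  shows "(\<exists>m' as' k' g. m' \<in> carrier M \<and> length as' = n \<and> set as' \<subseteq> invariants ks \<and> k' < n \<and>
            (\<forall>z. z \<in> invariants ks \<longrightarrow> g z \<in> invariants ks) \<and> (\<forall>z z'. g (z + z') = g z + g z') \<and>
            (\<forall>c z. g (pconst c * z) = pconst c * g z) \<and>
            (\<forall>z. dface \<tau> M i (m, as[k := z]) = (m', as'[k' := g z])))
       \<or> (\<exists>h as'. length as' = n \<and> set as' \<subseteq> invariants ks \<and>
            (\<forall>z\<in>invariants ks. h z \<in> carrier M) \<and>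
            (\<forall>z\<in>invariants ks. \<forall>z'\<in>invariants ks. h (z + z') = h z \<otimes>\<^bsub>M\<^esub> h z') \<and>
            (\<forall>c. \<forall>z\<in>invariants ks. h (pconst c * z) = lact M (pconst c) (h z)) \<and>
            (\<forall>z. dface \<tau> M i (m, as[k := z]) = (h z, as')))" (is "?A \<or> ?B")
proof -
  have m: "m \<in> carrier M" and len: "length as = Suc n" and as: "set as \<subseteq> invariants ks"
    using w by (auto simp: hoch_words_iff)
  have D: "dface \<tau> M i (m, as) \<in> hw ks M n" by (rule dface_closed[OF w i])
  have nth: "as ! j \<in> invariants ks" if "j \<le> n" for j using as len that by (auto simp: subset_iff)
  have ne: "as \<noteq> []" using len by auto
  consider (first0) "i = 0" "k = 0" | (first) "i = 0" "0 < k"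
    | (mid) "0 < i" "i < Suc n" | (last0) "i = Suc n" "k = n" | (last) "i = Suc n" "k < n"
    using i k by linarith
  then show ?thesis
  proof cases
    case first0
    have "?B"
    proof (intro exI[of _ "\<lambda>z. ract M m z"] exI[of _ "tl as"] conjI allI ballI)
      show "ract M m (pconst c * z) = lact M (pconst c) (ract M m z)" if "z \<in> invariants ks" for c z
        using that m by (simp add: mult.commute[of "pconst c"] ract_mult central ract_closed invariants_intros)
      show "dface \<tau> M i (m, as[k := z]) = (ract M m z, tl as)" for z
        using first0 ne by (cases as) (auto simp: dface_def)
      show "set (tl as) \<subseteq> invariants ks" using as ne by (auto simp: list.set_sel(2))
    qed (use m len in \<open>auto simp: ract_closed ract_add\<close>)
    then show ?thesis ..
  next
    case first
    have "?A"
    proof (intro exI[of _ "ract M m (hd as)"] exI[of _ "tl as"] exI[of _ "k - 1"] exI[of _ "\<lambda>z. z"] conjI allI impI)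
      show "dface \<tau> M i (m, as[k := z]) = (ract M m (hd as), (tl as)[k - 1 := z])" for z
        using first ne by (cases as) (auto simp: dface_def split: nat.splits)
      show "set (tl as) \<subseteq> invariants ks" using as ne by (auto simp: list.set_sel(2))
      show "ract M m (hd as) \<in> carrier M" using as ne m hd_in_set[of as] by (auto intro!: ract_closed)
    qed (use len first k in auto)
    then show ?thesis ..
  next
    case mid
    have mg: "length (merge i as) = n" "set (merge i as) \<subseteq> invariants ks"
      using D mid len by (auto simp: dface_def hoch_words_iff)
    \<comment> \<open>Slots i - 1 and i both end up in position i - 1 of the merged list; later
      slots move down by one.\<close>
    define k' where "k' = (if k < i - 1 then k else if k \<le> i then i - 1 else k - 1)"
    define g where "g z = (if k = i - 1 then z * as ! i else if k = i then as ! (i - 1) * z else z)" for z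
    have "?A"
    proof (intro exI[of _ m] exI[of _ "merge i as"] exI[of _ k'] exI[of _ g] conjI allI impI)
      show "dface \<tau> M i (m, as[k := z]) = (m, (merge i as)[k' := g z])" for z
        using mid len k by (auto simp: dface_def merge_update k'_def g_def)
      show "g z \<in> invariants ks" if "z \<in> invariants ks" for z
        using that nth[of i] nth[of "i - 1"] mid by (auto simp: g_def intro: invariants_intros)
      show "k' < n" using mid k by (auto simp: k'_def)
    qed (use m mg in \<open>auto simp: g_def algebra_simps\<close>)
    then show ?thesis ..
  next
    case last0
    have "?B"
    proof (intro exI[of _ "\<lambda>z. lact M (\<tau> z) m"] exI[of _ "butlast as"] conjI allI ballI)
      show "lact M (\<tau> (pconst c * z)) m = lact M (pconst c) (lact M (\<tau> z) m)" if "z \<in> invariants ks" for c z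
        using that m twist_hom by (simp add: alg_homD mult_lact twist_closed invariants_intros)
      show "dface \<tau> M i (m, as[k := z]) = (lact M (\<tau> z) m, butlast as)" for z
        using last0 ne len by (cases as rule: rev_cases) (auto simp: dface_def list_update_append)
      show "set (butlast as) \<subseteq> invariants ks" using as by (auto dest: in_set_butlastD)
    qed (use m len twist_hom in \<open>auto simp: lact_closed add_lact twist_closed alg_homD\<close>)
    then show ?thesis ..
  next
    case last
    have "?A"
    proof (intro exI[of _ "lact M (\<tau> (List.last as)) m"] exI[of _ "butlast as"] exI[of _ k] exI[of _ "\<lambda>z. z"] conjI allI impI)
      show "dface \<tau> M i (m, as[k := z]) = (lact M (\<tau> (List.last as)) m, (butlast as)[k := z])" for z
        using last ne len by (cases as rule: rev_cases) (auto simp: dface_def list_update_append)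
      show "set (butlast as) \<subseteq> invariants ks" using as by (auto dest: in_set_butlastD)
      show "lact M (\<tau> (List.last as)) m \<in> carrier M" using as ne m last_in_set[of as] by (auto intro!: lact_closed twist_closed)
    qed (use len last k in auto)
    then show ?thesis ..
  qed
qed

lemma dface_scale:
  assumes w: "(m, as) \<in> hw ks M (Suc n)" and i: "i \<le> Suc n"
  shows "dface \<tau> M i (lact M (pconst c) m, as) =
    (lact M (pconst c) (fst (dface \<tau> M i (m, as))), snd (dface \<tau> M i (m, as)))"
proof -
  have m: "m \<in> carrier M" and "as \<noteq> []" and as: "set as \<subseteq> invariants ks"
    using w by (auto simp: hoch_words_iff)
  then have "hd as \<in> invariants ks" "\<tau> (last as) \<in> invariants ks"
    using hd_in_set[of as] last_in_set[of as] by (auto intro!: twist_closed)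
  moreover have "lact M a (lact M (pconst c) m) = lact M (pconst c) (lact M a m)" if "a \<in> invariants ks" for a
    using that m by (simp add: mult_lact[symmetric] invariants_intros mult.commute)
  ultimately show ?thesis using m by (auto simp: dface_def lact_ract invariants_intros)
qed

lemma hrel_keys: "r \<in> hrel ks M n \<Longrightarrow> keys r \<subseteq> hw ks M n"
proof -
  interpret comm_group M by (rule grp)
  have upd: "set (as[i := x]) \<subseteq> invariants ks" if "set as \<subseteq> invariants ks" "x \<in> invariants ks" for as i and x :: "'k mpoly"
    using that set_update_subset_insert[of as i x] by auto
  have sub: "keys (frag_of a - frag_of b) \<subseteq> hw ks M n" if "a \<in> hw ks M n" "b \<in> hw ks M n" for a b
    using that by (intro order_trans[OF keys_diff]) auto
  have sub3: "keys (frag_of a - frag_of b - frag_of c) \<subseteq> hw ks M n"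
    if "a \<in> hw ks M n" "b \<in> hw ks M n" "c \<in> hw ks M n" for a b c
    using sub[of a b] that by (intro order_trans[OF keys_diff]) auto
  assume "r \<in> hrel ks M n"
  then show ?thesis
  proof (cases rule: hrel_cases)
    case (add_mod m m' as)
    then show ?thesis unfolding add_mod(3) by (intro sub3) (auto simp: hoch_words_iff)
  next
    case (add_alg m as i x y)
    then show ?thesis unfolding add_alg(5)
      by (intro sub3) (use upd in \<open>auto simp: hoch_words_iff invariants_intros\<close>)
  next
    case (scale m as i c)
    then have "as ! i \<in> invariants ks" by (auto simp: hoch_words_iff)
    then show ?thesis using scale(1) unfolding scale(3)
      by (intro sub) (use upd in \<open>auto simp: hoch_words_iff invariants_intros lact_closed\<close>)
  qed
qed

lemma dface_hrel:
  assumes r: "r \<in> hrel ks M (Suc n)" and i: "i \<le> Suc n"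
  shows "frag_extend (\<lambda>w. frag_of (dface \<tau> M i w)) r \<in> zspan (hrel ks M n)"
  using r
proof (cases rule: hrel_cases)
  case (add_mod m m' as)
  interpret comm_group M by (rule grp)
  have m: "m \<in> carrier M" "m' \<in> carrier M" and "as \<noteq> []" and as: "set as \<subseteq> invariants ks"
    using add_mod by (auto simp: hoch_words_iff)
  then have in': "hd as \<in> invariants ks" "\<tau> (last as) \<in> invariants ks"
    using hd_in_set[of as] last_in_set[of as] by (auto intro!: twist_closed)
  have D: "dface \<tau> M i (a, as) \<in> hw ks M n" if "a \<in> carrier M" for a
    using add_mod that by (intro dface_closed[OF _ i]) (auto simp: hoch_words_iff)
  have 1: "fst (dface \<tau> M i (m \<otimes>\<^bsub>M\<^esub> m', as)) = fst (dface \<tau> M i (m, as)) \<otimes>\<^bsub>M\<^esub> fst (dface \<tau> M i (m', as))"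
    using m in' by (auto simp: dface_def add_ract lact_add)
  have 2: "snd (dface \<tau> M i (a, as)) = snd (dface \<tau> M i (m, as))" for a
    by (auto simp: dface_def)
  have 3: "dface \<tau> M i (a, as) = (fst (dface \<tau> M i (a, as)), snd (dface \<tau> M i (m, as)))" for a
    by (metis 2 prod.collapse)
  have "frag_of (dface \<tau> M i (m \<otimes>\<^bsub>M\<^esub> m', as)) - frag_of (dface \<tau> M i (m, as)) - frag_of (dface \<tau> M i (m', as))
      \<in> hrel ks M n"
    by (subst (1 2 3) 3, subst 1, rule hrel_intros)
       (use D m in \<open>auto simp: hoch_words_def case_prod_unfold\<close>)
  then show ?thesis by (simp add: add_mod(3) frag_extend_diff zspan_base)
next
  case (add_alg m as k x y)
  from dface_slot[OF add_alg(1,2) i] show ?thesis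
  proof (elim disjE exE conjE)
    fix m' as' k' g
    assume *: "m' \<in> carrier M" "length as' = n" "set as' \<subseteq> invariants ks" "k' < n"
      "\<forall>z. z \<in> invariants ks \<longrightarrow> g z \<in> invariants ks" "\<forall>z z'. g (z + z') = g z + g z'"
      "\<forall>z. dface \<tau> M i (m, as[k := z]) = (m', as'[k' := g z])"
    then show ?thesis using add_alg
      by (simp add: frag_extend_diff) (rule zspan_base, rule hrel_intros, auto)
  next
    fix h as'
    assume *: "length as' = n" "set as' \<subseteq> invariants ks" "\<forall>z\<in>invariants ks. h z \<in> carrier M"
      "\<forall>z\<in>invariants ks. \<forall>z'\<in>invariants ks. h (z + z') = h z \<otimes>\<^bsub>M\<^esub> h z'"
      "\<forall>z. dface \<tau> M i (m, as[k := z]) = (h z, as')"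
    then show ?thesis using add_alg
      by (simp add: frag_extend_diff) (rule zspan_base, rule hrel_intros, auto)
  qed
next
  case (scale m as k c)
  have kin: "as ! k \<in> invariants ks" using scale by (auto simp: hoch_words_iff)
  have upd: "as[k := as ! k] = as" by simp
  from dface_slot[OF scale(1,2) i] show ?thesis
  proof (elim disjE exE conjE)
    fix m' as' k' g
    assume *: "m' \<in> carrier M" "length as' = n" "set as' \<subseteq> invariants ks" "k' < n"
      "\<forall>z. z \<in> invariants ks \<longrightarrow> g z \<in> invariants ks"
      "\<forall>c z. g (pconst c * z) = pconst c * g z"
      and e: "\<forall>z. dface \<tau> M i (m, as[k := z]) = (m', as'[k' := g z])"
    define bs where "bs = as'[k' := g (as ! k)]"
    have d: "dface \<tau> M i (m, as) = (m', bs)" using e[rule_format, of "as ! k"] by (simp add: bs_def)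
    have bs: "set bs \<subseteq> invariants ks"
      unfolding bs_def using * kin set_update_subset_insert[of as' k' "g (as ! k)"] by auto
    have "dface \<tau> M i (m, as[k := pconst c * as ! k]) = (m', bs[k' := pconst c * bs ! k'])"
      using * e by (simp add: bs_def)
    moreover have "dface \<tau> M i (lact M (pconst c) m, as) = (lact M (pconst c) m', bs)"
      using dface_scale[OF scale(1) i] by (simp add: d)
    moreover have "frag_of (lact M (pconst c) m', bs) - frag_of (m', bs[k' := pconst c * bs ! k']) \<in> hrel ks M n"
      by (rule hrel_intros(3)) (use * bs in \<open>auto simp: bs_def\<close>)
    ultimately show ?thesis
      unfolding scale(3) frag_extend_diff frag_extend_of by (simp add: zspan_base)
  next
    fix h as'
    assume *: "\<forall>c. \<forall>z\<in>invariants ks. h (pconst c * z) = lact M (pconst c) (h z)"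
      and e: "\<forall>z. dface \<tau> M i (m, as[k := z]) = (h z, as')"
    have d: "dface \<tau> M i (m, as) = (h (as ! k), as')" using e[rule_format, of "as ! k"] by simp
    have "dface \<tau> M i (lact M (pconst c) m, as) = (lact M (pconst c) (h (as ! k)), as')"
      using dface_scale[OF scale(1) i] by (simp add: d)
    then show ?thesis
      unfolding scale(3) frag_extend_diff frag_extend_of using * e kin by simp
  qed
qed

lemma frag_extend_bd:
  assumes "keys c \<subseteq> hw ks M (Suc n)"
  shows "frag_extend (bd \<tau> M) c
    = (\<Sum>i\<le>Suc n. frag_cmul ((-1) ^ i) (frag_extend (\<lambda>w. frag_of (dface \<tau> M i w)) c))"
  using assms
proof (induction c rule: frag_induction)
  case (one w)
  then have "length (snd w) = Suc n" by (cases w) (simp add: hoch_words_iff)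
  then show ?case by (auto simp: bd_def)
next
  case (diff a b)
  then show ?case by (simp add: frag_extend_diff frag_cmul_diff2 sum_subtractf)
qed simp

lemma bd_hrel: "r \<in> hrel ks M (Suc n) \<Longrightarrow> frag_extend (bd \<tau> M) r \<in> zspan (hrel ks M n)"
  unfolding frag_extend_bd[OF hrel_keys] by (intro zspan_sum zspan_cmul dface_hrel) auto

lemma bd_zspan: "c \<in> zspan (hrel ks M (Suc n)) \<Longrightarrow> frag_extend (bd \<tau> M) c \<in> zspan (hrel ks M n)"
  by (erule zspan_map) (rule bd_hrel)

end

text \<open>The presimplicial identity pairs the term (i, j), i < j, with the term (j - 1, i), whose
  sign is opposite.\<close>

lemma alternating_double_sum:
  fixes g :: "nat \<Rightarrow> nat \<Rightarrow> 'g \<Rightarrow>\<^sub>0 int"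
  assumes g: "\<And>i j. i < j \<Longrightarrow> j \<le> Suc N \<Longrightarrow> g i j = g (j - 1) i"
  shows "(\<Sum>j\<le>Suc N. \<Sum>i\<le>N. frag_cmul ((-1) ^ (i + j)) (g i j)) = 0"
proof -
  define F where "F i j = frag_cmul ((-1) ^ (i + j)) (g i j)" for i j
  define G where "G t i = (if i \<le> t then F t i else 0)" for t i
  have Fs: "F i (Suc t) = - F t i" if "i \<le> t" "t \<le> N" for i t
    using g[of i "Suc t"] that by (simp add: F_def add.commute)
  have "(\<Sum>j\<le>Suc N. \<Sum>i\<le>N. F i j)
      = (\<Sum>j\<le>Suc N. \<Sum>i\<le>N. (if i < j then F i j else 0) + (if j \<le> i then F i j else 0))"
    by (intro sum.cong refl) (simp only: not_less[symmetric] if_not_P split: if_split, simp)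
  also have "\<dots> = (\<Sum>j\<le>Suc N. \<Sum>i\<le>N. if i < j then F i j else 0) + (\<Sum>j\<le>Suc N. \<Sum>i\<le>N. if j \<le> i then F i j else 0)"
    by (simp only: sum.distrib)
  also have "(\<Sum>j\<le>Suc N. \<Sum>i\<le>N. if i < j then F i j else 0) = (\<Sum>t\<le>N. \<Sum>i\<le>N. if i < Suc t then F i (Suc t) else 0)"
    by (subst sum.atMost_Suc_shift) simp
  also have "\<dots> = (\<Sum>t\<le>N. \<Sum>i\<le>N. - G t i)"
    by (intro sum.cong refl) (simp add: G_def Fs less_Suc_eq_le)
  also have "(\<Sum>j\<le>Suc N. \<Sum>i\<le>N. if j \<le> i then F i j else 0) = (\<Sum>j\<le>N. \<Sum>i\<le>N. G i j)"
    by (subst sum.atMost_Suc) (simp add: G_def)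
  also have "\<dots> = (\<Sum>i\<le>N. \<Sum>j\<le>N. G i j)" by (rule sum.swap)
  finally show ?thesis by (simp add: F_def sum_negf)
qed

context hoch_bimod begin

lemma merge_merge:
  assumes "0 < i" "i < j" "j < length as"
  shows "merge i (merge j as) = merge (j - 1) (merge i as)"
proof (rule nth_equalityI)
  have l: "length (merge i as) = length as - 1" "length (merge j as) = length as - 1"
    using assms by (simp_all add: length_merge)
  then show "length (merge i (merge j as)) = length (merge (j - 1) (merge i as))"
    using assms by (simp add: length_merge)
  fix t assume "t < length (merge i (merge j as))"
  then have t: "t < length as - 2" using assms l by (simp add: length_merge)
  show "merge i (merge j as) ! t = merge (j - 1) (merge i as) ! t"
  proof -
    have v: "merge j as ! t = (if t < j - 1 then as ! t else if t = j - 1 then as ! (j - 1) * as ! j else as ! Suc t)"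
      if "t < length as - 1" for t by (rule nth_merge) (use assms that in auto)
    have u: "merge i as ! t = (if t < i - 1 then as ! t else if t = i - 1 then as ! (i - 1) * as ! i else as ! Suc t)"
      if "t < length as - 1" for t by (rule nth_merge) (use assms that in auto)
    have iv: "merge i (merge j as) ! t = (if t < i - 1 then merge j as ! t
        else if t = i - 1 then merge j as ! (i - 1) * merge j as ! i else merge j as ! Suc t)"
      by (rule nth_merge) (use assms t l in auto)
    have ju: "merge (j - 1) (merge i as) ! t = (if t < j - 1 - 1 then merge i as ! t
        else if t = j - 1 - 1 then merge i as ! (j - 1 - 1) * merge i as ! (j - 1) else merge i as ! Suc t)"
      by (rule nth_merge) (use assms t l in auto)
    have b: "t < length as - 1" "i - 1 < length as - 1" "i < length as - 1" "Suc t < length as - 1"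
      "j - 1 - 1 < length as - 1" "j - 1 < length as - 1" using assms t by auto
    obtain i' where i': "i = Suc i'" using assms by (cases i) auto
    obtain j' where j': "j = Suc (Suc j')" using assms i' by (cases j; cases "j - 1") auto
    show ?thesis
      unfolding iv ju v[OF b(1)] v[OF b(2)] v[OF b(3)] v[OF b(4)] u[OF b(1)] u[OF b(4)] u[OF b(5)] u[OF b(6)]
      using assms(2) unfolding i' j'
      by (cases "j' = i'") (simp_all add: mult.assoc)
  qed
qed

text \<open>Associativity of the actions and of the product settles adjacent faces. The outermost
  pair needs that left and right actions commute, and the last two faces need that
  \<open>\<tau>\<close> is multiplicative.\<close>

lemma dface_dface:
  assumes w: "w \<in> hw ks M (Suc (Suc n))" and ij: "i < j" "j \<le> Suc (Suc n)"
  shows "dface \<tau> M i (dface \<tau> M j w) = dface \<tau> M (j - 1) (dface \<tau> M i w)"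
proof -
  obtain m as where wm: "w = (m, as)" "m \<in> carrier M" "length as = Suc (Suc n)" and as: "set as \<subseteq> invariants ks"
    using w by (cases w) (auto simp: hoch_words_iff)
  have nth: "as ! t \<in> invariants ks" if "t < Suc (Suc n)" for t
    using as wm(3) that by (auto simp: subset_iff)
  have hd0: "hd as = as ! 0" and last: "last as = as ! Suc n"
    using wm by (simp_all add: hd_conv_nth last_conv_nth flip: length_greater_0_conv)
  have tw: "\<tau> (a * b) = \<tau> a * \<tau> b" for a b using twist_hom by (simp add: alg_homD)
  consider (a) "i = 0" "j = 1" | (b) "i = 0" "1 < j" "j < Suc (Suc n)" | (c) "i = 0" "j = Suc (Suc n)"
    | (d) "0 < i" "j < Suc (Suc n)" | (e) "0 < i" "i < Suc n" "j = Suc (Suc n)" | (f) "0 < i" "i = Suc n" "j = Suc (Suc n)"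
    using ij by linarith
  then show ?thesis
  proof cases
    case a
    obtain x y zs where "as = x # y # zs" using wm(3) by (auto simp: length_Suc_conv)
    then show ?thesis using a wm nth[of 0] nth[of 1]
      by (auto simp: dface_def merge_def ract_mult)
  next
    case b
    obtain x zs where x: "as = x # zs" using wm(3) by (auto simp: length_Suc_conv)
    obtain t where t: "j = Suc (Suc t)" using b by (cases j; cases "j - 1") auto
    have "merge j as = x # merge (Suc t) zs" by (simp add: x t merge_def)
    then show ?thesis using b wm by (auto simp: dface_def x t)
  next
    case c
    obtain x us where "as = x # us" "us \<noteq> []" using wm(3) by (auto simp: length_Suc_conv)
    then obtain zs y where x: "as = x # zs @ [y]" by (cases us rule: rev_cases) auto
    then have "x \<in> invariants ks" "\<tau> y \<in> invariants ks" using as by (auto intro: twist_closed)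
    then show ?thesis using c wm by (auto simp: dface_def x lact_ract butlast_append)
  next
    case d
    then show ?thesis using ij wm merge_merge[of i j as] by (auto simp: dface_def length_merge)
  next
    case e
    then have l: "length (merge i as) = Suc n" using wm by (simp add: length_merge)
    then have ne: "merge i as \<noteq> []" by auto
    have "last (merge i as) = last as" using e wm l ne by (cases i) (auto simp: last last_conv_nth nth_merge)
    moreover have "butlast (merge i as) = merge i (butlast as)"
      by (rule nth_equalityI) (use e wm l in \<open>auto simp: length_merge nth_butlast nth_merge\<close>)
    ultimately show ?thesis using e wm l by (auto simp: dface_def)
  next
    case f
    then have l: "length (merge i as) = Suc n" using wm by (simp add: length_merge)
    then have ne: "merge i as \<noteq> []" by auto
    have "last (merge i as) = last (butlast as) * last as"
      using f wm l ne by (simp add: last last_conv_nth nth_merge nth_butlast flip: length_greater_0_conv)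
    moreover have "butlast (merge i as) = butlast (butlast as)"
      by (rule nth_equalityI) (use f wm l in \<open>auto simp: length_merge nth_butlast nth_merge\<close>)
    moreover have "last as \<in> invariants ks" "last (butlast as) \<in> invariants ks"
      using nth[of n] nth[of "Suc n"] wm last by (simp_all add: last_conv_nth nth_butlast flip: length_greater_0_conv)
    ultimately show ?thesis using f wm l by (auto simp: dface_def tw mult_lact twist_closed)
  qed
qed

lemma bd_bd:
  assumes "w \<in> hw ks M (Suc (Suc n))"
  shows "frag_extend (bd \<tau> M) (bd \<tau> M w) = 0"
proof -
  have l: "length (snd w) = Suc (Suc n)" using assms by (cases w) (simp add: hoch_words_iff)
  then have bw: "bd \<tau> M w = (\<Sum>j\<le>Suc (Suc n). frag_cmul ((-1) ^ j) (frag_of (dface \<tau> M j w)))"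
    by (auto simp: bd_def simp del: sum.atMost_Suc)
  have bdj: "bd \<tau> M (dface \<tau> M j w) = (\<Sum>i\<le>Suc n. frag_cmul ((-1) ^ i) (frag_of (dface \<tau> M i (dface \<tau> M j w))))"
    if "j \<le> Suc (Suc n)" for j
  proof -
    have "length (snd (dface \<tau> M j w)) = Suc n"
      using dface_closed[OF assms that] by (cases "dface \<tau> M j w") (simp add: hoch_words_iff)
    then show ?thesis by (auto simp: bd_def simp del: sum.atMost_Suc)
  qed
  have "frag_extend (bd \<tau> M) (bd \<tau> M w)
      = (\<Sum>j\<le>Suc (Suc n). frag_cmul ((-1) ^ j) (bd \<tau> M (dface \<tau> M j w)))"
    unfolding bw by (simp add: frag_extend_sum frag_extend_cmul del: sum.atMost_Suc)
  also have "\<dots> = (\<Sum>j\<le>Suc (Suc n). \<Sum>i\<le>Suc n. frag_cmul ((-1) ^ (i + j)) (frag_of (dface \<tau> M i (dface \<tau> M j w))))"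
    by (rule sum.cong) (auto simp: bdj frag_cmul_sum power_add mult.commute simp del: sum.atMost_Suc)
  also have "\<dots> = 0"
    by (rule alternating_double_sum) (simp add: dface_dface[OF assms])
  finally show ?thesis .
qed

lemma bd_bd_frag: "keys c \<subseteq> hw ks M (Suc (Suc n)) \<Longrightarrow> frag_extend (bd \<tau> M) (frag_extend (bd \<tau> M) c) = 0"
  unfolding frag_extend_comp by (rule frag_extend_eq_0) (use bd_bd in blast)

lemma qhoch_face_eq:
  assumes tw: "\<And>a. a \<in> invariants ks \<Longrightarrow> qtwist q (inv_ring ks) a = \<tau> a" and w: "w \<in> hw ks M n"
  shows "qhoch_face q (inv_ring ks) M w = bd \<tau> M w"
proof -
  obtain m as where wm: "w = (m, as)" "length as = n" "set as \<subseteq> invariants ks"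
    using w by (cases w) (auto simp: hoch_words_iff)
  show ?thesis
  proof (cases n)
    case 0 then show ?thesis using wm by (simp add: qhoch_face_def bd_def)
  next
    case (Suc k)
    then have ne: "as \<noteq> []" using wm by auto
    then have last: "last as \<in> invariants ks" using wm last_in_set[of as] by blast
    have d0: "dface \<tau> M 0 (m, as) = (ract M m (hd as), tl as)" by (simp add: dface_def)
    have dk: "dface \<tau> M (Suc k) (m, as) = (lact M (\<tau> (List.last as)) m, butlast as)"
      using wm Suc by (simp add: dface_def)
    have di: "(\<Sum>i = 1..k. frag_cmul ((-1) ^ i) (frag_of (dface \<tau> M i (m, as))))
        = (\<Sum>i = 1..k. frag_cmul ((-1) ^ i) (frag_of (m, take (i - 1) as @ [as ! (i - 1) * as ! i] @ drop (i + 1) as)))"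
      by (rule sum.cong) (use wm Suc in \<open>auto simp: dface_def merge_def\<close>)
    have "bd \<tau> M (m, as) = (\<Sum>i\<le>k. frag_cmul ((-1) ^ i) (frag_of (dface \<tau> M i (m, as))))
        + frag_cmul ((-1) ^ Suc k) (frag_of (dface \<tau> M (Suc k) (m, as)))"
      using ne wm Suc by (simp add: bd_def)
    also have "(\<Sum>i\<le>k. frag_cmul ((-1) ^ i) (frag_of (dface \<tau> M i (m, as))))
        = frag_of (dface \<tau> M 0 (m, as)) + (\<Sum>i = 1..k. frag_cmul ((-1) ^ i) (frag_of (dface \<tau> M i (m, as))))"
      unfolding atMost_atLeast0 by (subst sum.atLeast_Suc_atMost) auto
    finally show ?thesis
      using wm Suc ne by (simp only: d0 dk di qhoch_face_def) (simp add: Let_def tw last)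
  qed
qed

text \<open>Once the faces are matched with those twisted by \<open>\<tau>\<close>, acyclicity says
  that the image of one boundary map is the kernel of the next, so the homology group is the
  quotient of the kernel by itself.\<close>

lemma trivial_qHH:
  assumes tw: "\<And>a. a \<in> invariants ks \<Longrightarrow> qtwist q (inv_ring ks) a = \<tau> a"
    and ac: "acyclic_in_pos_deg \<tau> ks M" and i: "0 < i"
  shows "trivial_group (qHH q (inv_ring ks) M i)"
proof -
  obtain n where n: "i = Suc n" using i by (cases i) auto
  define H where "H k = hoch_chains (inv_ring ks) M k" for k
  have Hk: "H k = pres_group (hw ks M k) (hrel ks M k)" for k by (simp add: H_def hoch_chains_def)
  define D where "D k = qhoch_boundary q (inv_ring ks) M k" for k
  have face: "frag_extend (qhoch_face q (inv_ring ks) M) c = frag_extend (bd \<tau> M) c"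
    if "keys c \<subseteq> hw ks M k" for c k
    by (rule frag_extend_eq) (use that qhoch_face_eq[OF tw] in blast)
  have D: "D (Suc k) (cls (hrel ks M (Suc k)) c) = cls (hrel ks M k) (frag_extend (bd \<tau> M) c)"
    if c: "keys c \<subseteq> hw ks M (Suc k)" for c k
  proof -
    have "D (Suc k) (cls (hrel ks M (Suc k)) c)
        = cls (hrel ks M k) (frag_extend (qhoch_face q (inv_ring ks) M) c)"
      unfolding D_def qhoch_boundary_def diff_Suc_1
    proof (rule pres_map_cls)
      show "frag_extend (qhoch_face q (inv_ring ks) M) r \<in> zspan (hrel ks M k)" if "r \<in> hrel ks M (Suc k)" for r
        using that by (simp add: face[OF hrel_keys] bd_hrel)
    qed (fact hrel_keys)+
    then show ?thesis by (simp add: face[OF c])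
  qed
  have carH: "carrier (H k) = {cls (hrel ks M k) c |c. keys c \<subseteq> hw ks M k}" for k
    unfolding Hk by (rule carrier_pres_group) (rule hrel_keys)
  have bdk: "keys (frag_extend (bd \<tau> M) c) \<subseteq> hw ks M k" if "keys c \<subseteq> hw ks M (Suc k)" for c k
    using that bd_closed by (rule keys_frag_extend_subset)
  have cg: "comm_group (H k)" for k
    unfolding Hk by (rule comm_group_pres_group) (rule hrel_keys)
  have one: "\<one>\<^bsub>H k\<^esub> = cls (hrel ks M k) 0" for k
    unfolding Hk by (rule one_pres_group) (rule hrel_keys)
  have mult: "cls (hrel ks M k) c \<otimes>\<^bsub>H k\<^esub> cls (hrel ks M k) d = cls (hrel ks M k) (c + d)"
    if "keys c \<subseteq> hw ks M k" "keys d \<subseteq> hw ks M k" for c d k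
    unfolding Hk by (rule cls_mult[OF hrel_keys that])
  have hom: "group_hom (H (Suc n)) (H n) (D (Suc n))"
    unfolding group_hom_def group_hom_axioms_def
  proof (intro conjI comm_group.axioms(2)[OF cg] homI)
    fix x assume "x \<in> carrier (H (Suc n))"
    then obtain c where "x = cls (hrel ks M (Suc n)) c" "keys c \<subseteq> hw ks M (Suc n)" by (auto simp: carH)
    then show "D (Suc n) x \<in> carrier (H n)" using bdk[of c n] by (auto simp: carH D)
  next
    fix x y assume "x \<in> carrier (H (Suc n))" "y \<in> carrier (H (Suc n))"
    then obtain c d where cd: "x = cls (hrel ks M (Suc n)) c" "y = cls (hrel ks M (Suc n)) d"
      "keys c \<subseteq> hw ks M (Suc n)" "keys d \<subseteq> hw ks M (Suc n)" by (auto simp: carH)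
    then have "keys (c + d) \<subseteq> hw ks M (Suc n)" using keys_add[of c d] by blast
    then show "D (Suc n) (x \<otimes>\<^bsub>H (Suc n)\<^esub> y) = D (Suc n) x \<otimes>\<^bsub>H n\<^esub> D (Suc n) y"
      using cd by (simp add: mult D bdk frag_extend_add)
  qed
  define K where "K = kernel (H (Suc n)) (H n) (D (Suc n))"
  have sub: "subgroup K (H (Suc n))" unfolding K_def by (rule group_hom.subgroup_kernel[OF hom])
  have Kmem: "cls (hrel ks M (Suc n)) c \<in> K \<longleftrightarrow> frag_extend (bd \<tau> M) c \<in> zspan (hrel ks M n)"
    if "keys c \<subseteq> hw ks M (Suc n)" for c
  proof -
    have "cls (hrel ks M (Suc n)) c \<in> carrier (H (Suc n))" using that by (auto simp: carH)
    then show ?thesis using that by (simp add: K_def kernel_def D one cls_eq_iff)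
  qed
  have img: "D (Suc (Suc n)) ` carrier (H (Suc (Suc n))) = K"
  proof (intro equalityI subsetI)
    fix x assume "x \<in> D (Suc (Suc n)) ` carrier (H (Suc (Suc n)))"
    then obtain e where e: "keys e \<subseteq> hw ks M (Suc (Suc n))" "x = cls (hrel ks M (Suc n)) (frag_extend (bd \<tau> M) e)"
      by (auto simp: carH D)
    then show "x \<in> K" by (simp add: Kmem bdk bd_bd_frag)
  next
    fix x assume x: "x \<in> K"
    then obtain c where c: "x = cls (hrel ks M (Suc n)) c" "keys c \<subseteq> hw ks M (Suc n)"
      by (auto simp: K_def kernel_def carH)
    then have "frag_extend (bd \<tau> M) c \<in> zspan (hrel ks M n)" using x Kmem by simp
    then obtain e where e: "keys e \<subseteq> hw ks M (Suc (Suc n))"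
      "c - frag_extend (bd \<tau> M) e \<in> zspan (hrel ks M (Suc n))"
      using ac c unfolding acyclic_in_pos_deg_def by blast
    then have "x = D (Suc (Suc n)) (cls (hrel ks M (Suc (Suc n))) e)"
      by (simp add: D c cls_eq_iff)
    then show "x \<in> D (Suc (Suc n)) ` carrier (H (Suc (Suc n)))" using e by (auto simp: carH)
  qed
  define Z where "Z = H (Suc n)\<lparr>carrier := K\<rparr>"
  have Z: "group Z" unfolding Z_def
    by (rule subgroup.subgroup_is_group[OF sub comm_group.axioms(2)[OF cg]])
  interpret Z: group Z by (rule Z)
  have K: "K = carrier Z" by (simp add: Z_def)
  have Ks: "subgroup K Z" unfolding K by (rule Z.subgroup_self)
  have "K \<lhd> Z" unfolding K Z.normal_inv_iff using Z.subgroup_self by auto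
  then have "group (Z Mod K)" by (rule normal.factorgroup_is_group)
  moreover have "carrier (Z Mod K) = {K}"
    unfolding FactGroup_def RCOSETS_def
    using Z.coset_join2[OF _ Ks] Z.one_closed by (auto simp: K)
  then have "carrier (Z Mod K) = {\<one>\<^bsub>Z Mod K\<^esub>}" by simp
  ultimately have "trivial_group (Z Mod K)" by (simp add: trivial_group_def)
  moreover have "qHH q (inv_ring ks) M i = Z Mod K"
    using img by (simp add: qHH_def n Z_def K_def H_def D_def)
  ultimately show ?thesis by simp
qed

end

section \<open>Finite direct sums and extensions\<close>

lemma acyclic_in_pos_degD:
  assumes "acyclic_in_pos_deg \<tau> ks M" "keys z \<subseteq> hw ks M (Suc n)" "frag_extend (bd \<tau> M) z \<in> zspan (hrel ks M n)"
  shows "\<exists>e. keys e \<subseteq> hw ks M (Suc (Suc n)) \<and> z - frag_extend (bd \<tau> M) e \<in> zspan (hrel ks M (Suc n))"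
  using assms by (simp add: acyclic_in_pos_deg_def)

lemma push_closed: "(\<And>m. m \<in> carrier M \<Longrightarrow> f m \<in> carrier M') \<Longrightarrow> w \<in> hw ks M n \<Longrightarrow> keys (push f w) \<subseteq> hw ks M' n"
  by (cases w) (auto simp: push_def hoch_words_iff)

lemma push_frag_bd:
  assumes f: "bimod_map ks M M' f" and \<tau>: "\<And>a. a \<in> invariants ks \<Longrightarrow> \<tau> a \<in> invariants ks"
    and c: "keys c \<subseteq> hw ks M n"
  shows "frag_extend (push f) (frag_extend (bd \<tau> M) c) = frag_extend (bd \<tau> M') (frag_extend (push f) c)"
  unfolding frag_extend_comp
  by (rule frag_extend_eq) (rule push_bd[OF f \<tau> subsetD[OF c]])

text \<open>The unit of the monoid \<open>M\<close> is the zero of the module. The additivity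
  relation for 0 + 0 = 0 is minus the word in question.\<close>

lemma frag_of_one_zspan:
  assumes "\<one>\<^bsub>M\<^esub> \<in> carrier M" "\<one>\<^bsub>M\<^esub> \<otimes>\<^bsub>M\<^esub> \<one>\<^bsub>M\<^esub> = \<one>\<^bsub>M\<^esub>" "length as = n" "set as \<subseteq> invariants ks"
  shows "frag_of (\<one>\<^bsub>M\<^esub>, as) \<in> zspan (hrel ks M n)"
proof -
  have "frag_of (\<one>\<^bsub>M\<^esub> \<otimes>\<^bsub>M\<^esub> \<one>\<^bsub>M\<^esub>, as) - frag_of (\<one>\<^bsub>M\<^esub>, as) - frag_of (\<one>\<^bsub>M\<^esub>, as) \<in> zspan (hrel ks M n)"
    by (intro zspan_base hrel_intros) (use assms in auto)
  then show ?thesis using zspan_uminus[of "- frag_of (\<one>\<^bsub>M\<^esub>, as)" "hrel ks M n"] by (simp add: assms(2))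
qed

text \<open>Project a cycle to each summand, bound it there and include the results. The sum of the
  composites of projection and inclusion is the identity only modulo the additivity relations, which
  is \<open>split\<close>.\<close>

lemma acyclic_finite_sum:
  fixes Ms :: "nat \<Rightarrow> ('k::comm_ring_1 mpoly, 'k mpoly, 'm) graded_bimod"
  assumes ac: "\<And>i. i < n \<Longrightarrow> acyclic_in_pos_deg \<tau> ks (Ms i)"
    and grp: "\<And>i. i < n \<Longrightarrow> comm_group (Ms i)"
    and lact_one: "\<And>i a. i < n \<Longrightarrow> a \<in> invariants ks \<Longrightarrow> lact (Ms i) a \<one>\<^bsub>Ms i\<^esub> = \<one>\<^bsub>Ms i\<^esub>"
    and ract_one: "\<And>i a. i < n \<Longrightarrow> a \<in> invariants ks \<Longrightarrow> ract (Ms i) \<one>\<^bsub>Ms i\<^esub> a = \<one>\<^bsub>Ms i\<^esub>"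
    and \<tau>: "\<And>a. a \<in> invariants ks \<Longrightarrow> \<tau> a \<in> invariants ks"
  shows "acyclic_in_pos_deg \<tau> ks (bimod_finite_sum n Ms)"
proof -
  let ?S = "bimod_finite_sum n Ms"
  have car: "carrier ?S = (\<Pi>\<^sub>E i\<in>{..<n}. carrier (Ms i))"
    by (simp add: bimod_finite_sum_def product_group_def)
  have mul: "f \<otimes>\<^bsub>?S\<^esub> g = (\<lambda>i\<in>{..<n}. f i \<otimes>\<^bsub>Ms i\<^esub> g i)" for f g
    by (simp add: bimod_finite_sum_def product_group_def)
  have la: "lact ?S a f = (\<lambda>i\<in>{..<n}. lact (Ms i) a (f i))" for a f by (simp add: bimod_finite_sum_def)
  have ra: "ract ?S f a = (\<lambda>i\<in>{..<n}. ract (Ms i) (f i) a)" for a f by (simp add: bimod_finite_sum_def)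
  have monoid: "monoid (Ms i)" if "i < n" for i
    using grp[OF that] by (simp add: comm_group_def comm_monoid_def)
  note mon [simp] = monoid.one_closed[OF monoid] monoid.l_one[OF monoid] monoid.r_one[OF monoid]
  have one: "\<one>\<^bsub>?S\<^esub> = (\<lambda>i\<in>{..<n}. \<one>\<^bsub>Ms i\<^esub>)" by (simp add: bimod_finite_sum_def product_group_def)
  have pe: "\<one>\<^bsub>?S\<^esub> \<in> carrier ?S" "\<one>\<^bsub>?S\<^esub> \<otimes>\<^bsub>?S\<^esub> \<one>\<^bsub>?S\<^esub> = \<one>\<^bsub>?S\<^esub>"
    by (auto simp: one car mul fun_eq_iff)
  define p where "p i f = f i" for i :: nat and f :: "nat \<Rightarrow> 'm"
  define \<iota> where "\<iota> i m = (\<lambda>j\<in>{..<n}. if j = i then m else \<one>\<^bsub>Ms j\<^esub>)" for i m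
  have p: "bimod_map ks ?S (Ms i) (p i)" if "i < n" for i
    using that by (auto simp: bimod_map_def car mul la ra p_def PiE_mem)
  have \<iota>: "bimod_map ks (Ms i) ?S (\<iota> i)" if "i < n" for i
    using that by (auto simp: bimod_map_def car mul la ra \<iota>_def lact_one ract_one fun_eq_iff)
  have push0: "frag_extend (push f) r \<in> zspan (hrel ks M' k)"
    if "bimod_map ks M M' f" "r \<in> zspan (hrel ks M k)"
    for f :: "'u \<Rightarrow> 'v" and r k and M :: "('k mpoly, 'k mpoly, 'u) graded_bimod"
      and M' :: "('k mpoly, 'k mpoly, 'v) graded_bimod"
    by (rule zspan_map[OF that(2)], rule push_hrel)
       (use that(1) in \<open>auto simp: bimod_map_def invariants_intros\<close>)
  have split: "frag_of w - (\<Sum>i<n. push (\<lambda>f. \<iota> i (p i f)) w) \<in> zspan (hrel ks ?S k)"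
    if w: "w \<in> hw ks ?S k" for w k
  proof -
    obtain f as where fas: "w = (f, as)" "f \<in> carrier ?S" "length as = k" "set as \<subseteq> invariants ks"
      using w by (cases w) (auto simp: hoch_words_iff)
    \<comment> \<open>Truncation of \<open>f\<close> to its first \<open>t\<close> coordinates.
      Adding one coordinate at a time uses one additivity relation each.\<close>
    define T where "T t = (\<lambda>j\<in>{..<n}. if j < t then f j else \<one>\<^bsub>Ms j\<^esub>)" for t
    have Tc: "T t \<in> carrier ?S" for t using fas by (auto simp: T_def car PiE_mem)
    have \<iota>c: "\<iota> i (f i) \<in> carrier ?S" if "i < n" for i
      using \<iota>[OF that] fas that by (auto simp: bimod_map_def car PiE_mem)
    have "frag_of (T t, as) - (\<Sum>i<t. frag_of (\<iota> i (f i), as)) \<in> zspan (hrel ks ?S k)" if "t \<le> n" for t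
      using that
    proof (induction t)
      case 0
      have "T 0 = \<one>\<^bsub>?S\<^esub>" by (simp add: T_def bimod_finite_sum_def product_group_def)
      then show ?case using frag_of_one_zspan[OF pe fas(3,4)] by simp
    next
      case (Suc t)
      have fc: "f j \<in> carrier (Ms j)" if "j < n" for j using fas that by (auto simp: car PiE_mem)
      have "T (Suc t) = T t \<otimes>\<^bsub>?S\<^esub> \<iota> t (f t)"
        using Suc.prems by (auto simp: T_def mul \<iota>_def fun_eq_iff fc)
      then have "frag_of (T (Suc t), as) - frag_of (T t, as) - frag_of (\<iota> t (f t), as) \<in> zspan (hrel ks ?S k)"
        using Tc \<iota>c Suc.prems fas by (auto intro!: zspan_base hrel_intros)
      then have "(frag_of (T (Suc t), as) - frag_of (T t, as) - frag_of (\<iota> t (f t), as))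
        + (frag_of (T t, as) - (\<Sum>i<t. frag_of (\<iota> i (f i), as))) \<in> zspan (hrel ks ?S k)"
        by (rule zspan_add) (use Suc in simp)
      then show ?case by (simp add: algebra_simps)
    qed
    from this[of n] have "frag_of (T n, as) - (\<Sum>i<n. frag_of (\<iota> i (f i), as)) \<in> zspan (hrel ks ?S k)" by simp
    moreover have "T n = f" using fas by (auto simp: T_def car fun_eq_iff PiE_def extensional_def)
    ultimately show ?thesis by (simp add: fas push_def p_def)
  qed
  show ?thesis
    unfolding acyclic_in_pos_deg_def
  proof (intro allI impI)
    fix k z assume z: "keys z \<subseteq> hw ks ?S (Suc k)" and dz: "frag_extend (bd \<tau> ?S) z \<in> zspan (hrel ks ?S k)"
    have pc: "keys (frag_extend (push (p i)) z) \<subseteq> hw ks (Ms i) (Suc k)" if "i < n" for i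
      by (rule keys_frag_extend_subset[OF z], rule push_closed) (use p[OF that] in \<open>auto simp: bimod_map_def\<close>)
    define Q where "Q i e \<longleftrightarrow> keys e \<subseteq> hw ks (Ms i) (Suc (Suc k)) \<and>
        frag_extend (push (p i)) z - frag_extend (bd \<tau> (Ms i)) e \<in> zspan (hrel ks (Ms i) (Suc k))" for i e
    have ex: "\<exists>e. Q i e" if i: "i < n" for i
    proof -
      have "frag_extend (bd \<tau> (Ms i)) (frag_extend (push (p i)) z) \<in> zspan (hrel ks (Ms i) k)"
        using push0[OF p[OF i] dz] push_frag_bd[OF p[OF i] \<tau> z] by simp
      then show ?thesis unfolding Q_def by (rule acyclic_in_pos_degD[OF ac[OF i] pc[OF i]])
    qed
    define e where "e i = (SOME e. Q i e)" for i
    have Qe: "Q i (e i)" if "i < n" for i unfolding e_def using ex[OF that] by (rule someI_ex)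
    have e: "\<And>i. i < n \<Longrightarrow> keys (e i) \<subseteq> hw ks (Ms i) (Suc (Suc k))"
      "\<And>i. i < n \<Longrightarrow> frag_extend (push (p i)) z - frag_extend (bd \<tau> (Ms i)) (e i) \<in> zspan (hrel ks (Ms i) (Suc k))"
      using Qe by (simp_all add: Q_def)
    define E where "E = (\<Sum>i<n. frag_extend (push (\<iota> i)) (e i))"
    have Ek: "keys E \<subseteq> hw ks ?S (Suc (Suc k))"
      unfolding E_def
    proof (rule keys_sum_subset)
      fix i assume "i \<in> {..<n}"
      then have i: "i < n" by simp
      show "keys (frag_extend (push (\<iota> i)) (e i)) \<subseteq> hw ks ?S (Suc (Suc k))"
        by (rule keys_frag_extend_subset[OF e(1)[OF i]], rule push_closed) (use \<iota>[OF i] in \<open>simp_all add: bimod_map_def\<close>)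
    qed
    have "z - (\<Sum>i<n. frag_extend (push (\<iota> i)) (frag_extend (push (p i)) z)) \<in> zspan (hrel ks ?S (Suc k))"
    proof -
      have "frag_extend frag_of z - frag_extend (\<lambda>w. \<Sum>i<n. push (\<lambda>f. \<iota> i (p i f)) w) z \<in> zspan (hrel ks ?S (Suc k))"
        by (rule frag_extend_cong_zspan[OF z split])
      moreover have "frag_extend (\<lambda>w. \<Sum>i<m. push (\<lambda>f. \<iota> i (p i f)) w) z
          = (\<Sum>i<m. frag_extend (push (\<iota> i)) (frag_extend (push (p i)) z))" for m
      proof -
        have "frag_extend (\<lambda>w. g w + h w) c = frag_extend g c + frag_extend h c"
          for g h :: "(nat \<Rightarrow> 'm) \<times> 'k mpoly list \<Rightarrow> (nat \<Rightarrow> 'm) \<times> 'k mpoly list \<Rightarrow>\<^sub>0 int" and c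
          by (simp add: frag_extend_def frag_cmul_distrib2 sum.distrib)
        then show ?thesis
          by (induction m) (simp_all add: frag_extend_comp frag_extend_push_push frag_extend_eq_0)
      qed
      ultimately show ?thesis by simp
    qed
    moreover have "(\<Sum>i<n. frag_extend (push (\<iota> i)) (frag_extend (push (p i)) z)) - frag_extend (bd \<tau> ?S) E
      \<in> zspan (hrel ks ?S (Suc k))"
    proof -
      have "frag_extend (bd \<tau> ?S) E = (\<Sum>i<n. frag_extend (push (\<iota> i)) (frag_extend (bd \<tau> (Ms i)) (e i)))"
        unfolding E_def frag_extend_sum[OF finite_lessThan] o_def
        by (rule sum.cong) (use push_frag_bd[OF \<iota> \<tau> e(1)] in auto)
      then have "(\<Sum>i<n. frag_extend (push (\<iota> i)) (frag_extend (push (p i)) z)) - frag_extend (bd \<tau> ?S) E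
        = (\<Sum>i<n. frag_extend (push (\<iota> i)) (frag_extend (push (p i)) z - frag_extend (bd \<tau> (Ms i)) (e i)))"
        by (simp add: sum_subtractf frag_extend_diff)
      also have "\<dots> \<in> zspan (hrel ks ?S (Suc k))"
        by (rule zspan_sum) (use push0[OF \<iota> e(2)] in auto)
      finally show ?thesis .
    qed
    ultimately have "z - frag_extend (bd \<tau> ?S) E \<in> zspan (hrel ks ?S (Suc k))" by (rule zspan_trans)
    with Ek show "\<exists>e. keys e \<subseteq> hw ks ?S (Suc (Suc k)) \<and> z - frag_extend (bd \<tau> ?S) e \<in> zspan (hrel ks ?S (Suc k))"
      by blast
  qed
qed

text \<open>The diagram chase behind the long exact sequence of 0 -> M' -> E -> Q -> 0. Chains are
  tensor products over the ground ring, so the section \<open>s\<close> and the retraction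
  \<open>r\<close> need only be linear over it, not bimodule maps; they give exactness of the chain
  groups but do not commute with the boundary.\<close>

lemma acyclic_extension:
  fixes E :: "('k::comm_ring_1 mpoly, 'k mpoly, 'x) graded_bimod"
    and M' :: "('k mpoly, 'k mpoly, 'm) graded_bimod" and Q :: "('k mpoly, 'k mpoly, 'n) graded_bimod"
    and i :: "'m \<Rightarrow> 'x" and p :: "'x \<Rightarrow> 'n" and s :: "'n \<Rightarrow> 'x" and r :: "'x \<Rightarrow> 'm"
  assumes E: "hoch_bimod \<tau> ks E" and M': "hoch_bimod \<tau> ks M'"
    and ac: "acyclic_in_pos_deg \<tau> ks M'" "acyclic_in_pos_deg \<tau> ks Q"
    and i: "bimod_map ks M' E i" and p: "bimod_map ks E Q p"
    and s: "\<And>m. m \<in> carrier Q \<Longrightarrow> s m \<in> carrier E"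
      "\<And>m m'. m \<in> carrier Q \<Longrightarrow> m' \<in> carrier Q \<Longrightarrow> s (m \<otimes>\<^bsub>Q\<^esub> m') = s m \<otimes>\<^bsub>E\<^esub> s m'"
      "\<And>c m. m \<in> carrier Q \<Longrightarrow> s (lact Q (pconst c) m) = lact E (pconst c) (s m)"
    and r: "\<And>m. m \<in> carrier E \<Longrightarrow> r m \<in> carrier M'"
      "\<And>m m'. m \<in> carrier E \<Longrightarrow> m' \<in> carrier E \<Longrightarrow> r (m \<otimes>\<^bsub>E\<^esub> m') = r m \<otimes>\<^bsub>M'\<^esub> r m'"
      "\<And>c m. m \<in> carrier E \<Longrightarrow> r (lact E (pconst c) m) = lact M' (pconst c) (r m)"
    and ps: "\<And>m. m \<in> carrier Q \<Longrightarrow> p (s m) = m"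
    and ri: "\<And>m. m \<in> carrier M' \<Longrightarrow> r (i m) = m"
    and dec: "\<And>x. x \<in> carrier E \<Longrightarrow> i (r x) \<otimes>\<^bsub>E\<^esub> s (p x) = x"
  shows "acyclic_in_pos_deg \<tau> ks E"
  unfolding acyclic_in_pos_deg_def
proof (intro allI impI)
  fix n z assume z: "keys z \<subseteq> hw ks E (Suc n)" and dz: "frag_extend (bd \<tau> E) z \<in> zspan (hrel ks E n)"
  interpret E: hoch_bimod \<tau> ks E by (rule E)
  note \<tau> = E.twist_closed
  note M'bd = hoch_bimod.bd_closed[OF M']
  have bc: "\<And>m. m \<in> carrier M' \<Longrightarrow> i m \<in> carrier E" "\<And>m. m \<in> carrier E \<Longrightarrow> p m \<in> carrier Q"
    using i p by (auto simp: bimod_map_def)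
  have pushi: "frag_extend (push i) c \<in> zspan (hrel ks E k)" if "c \<in> zspan (hrel ks M' k)" for c k
    by (rule zspan_map[OF that], rule push_hrel) (use i in \<open>auto simp: bimod_map_def invariants_intros\<close>)
  have pushp: "frag_extend (push p) c \<in> zspan (hrel ks Q k)" if "c \<in> zspan (hrel ks E k)" for c k
    by (rule zspan_map[OF that], rule push_hrel) (use p in \<open>auto simp: bimod_map_def invariants_intros\<close>)
  have pushs: "frag_extend (push s) c \<in> zspan (hrel ks E k)" if "c \<in> zspan (hrel ks Q k)" for c k
    by (rule zspan_map[OF that], rule push_hrel[OF s])
  have pushr: "frag_extend (push r) c \<in> zspan (hrel ks M' k)" if "c \<in> zspan (hrel ks E k)" for c k
    by (rule zspan_map[OF that], rule push_hrel[OF r])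
  have kp: "keys (frag_extend (push f) c) \<subseteq> hw ks M2 k"
    if "keys c \<subseteq> hw ks M1 k" "\<And>m. m \<in> carrier M1 \<Longrightarrow> f m \<in> carrier M2"
    for c k and f :: "'u \<Rightarrow> 'v" and M1 :: "('k mpoly, 'k mpoly, 'u) graded_bimod"
      and M2 :: "('k mpoly, 'k mpoly, 'v) graded_bimod"
    by (rule keys_frag_extend_subset[OF that(1)], rule push_closed[OF that(2)])
  have pushid: "frag_extend (push g) (frag_extend (push f) c) = c"
    if "keys c \<subseteq> hw ks M1 k" "\<And>m. m \<in> carrier M1 \<Longrightarrow> g (f m) = m"
    for c k and f :: "'u \<Rightarrow> 'v" and g and M1 :: "('k mpoly, 'k mpoly, 'u) graded_bimod"
  proof -
    have "frag_extend (push g) (frag_extend (push f) c) = frag_extend frag_of c"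
      unfolding frag_extend_comp frag_extend_push_push
      by (rule frag_extend_eq) (use that in \<open>force simp: push_def hoch_words_def\<close>)
    then show ?thesis by simp
  qed
  have pz: "keys (frag_extend (push p) z) \<subseteq> hw ks Q (Suc n)" by (rule kp[OF z bc(2)])
  have dpz: "frag_extend (bd \<tau> Q) (frag_extend (push p) z) \<in> zspan (hrel ks Q n)"
    using pushp[OF dz] by (simp only: push_frag_bd[OF p \<tau> z])
  from acyclic_in_pos_degD[OF ac(2) pz dpz] obtain e where e: "keys e \<subseteq> hw ks Q (Suc (Suc n))"
    and ze: "frag_extend (push p) z - frag_extend (bd \<tau> Q) e \<in> zspan (hrel ks Q (Suc n))"
    by (elim exE conjE)
  \<comment> \<open>Lift of the bounding chain from Q; subtracting its boundary gives a cycle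
    \<open>c\<close> whose image in Q vanishes modulo relations.\<close>
  define u where "u = frag_extend (push s) e"
  have u: "keys u \<subseteq> hw ks E (Suc (Suc n))" unfolding u_def by (rule kp[OF e s(1)])
  have pu: "frag_extend (push p) u = e" unfolding u_def by (rule pushid[OF e]) (rule ps)
  define c where "c = z - frag_extend (bd \<tau> E) u"
  have bu: "keys (frag_extend (bd \<tau> E) u) \<subseteq> hw ks E (Suc n)"
    using u E.bd_closed by (rule keys_frag_extend_subset)
  have c: "keys c \<subseteq> hw ks E (Suc n)" unfolding c_def using order_trans[OF keys_diff Un_least[OF z bu]] .
  have dc: "frag_extend (bd \<tau> E) c \<in> zspan (hrel ks E n)"
    unfolding c_def frag_extend_diff E.bd_bd_frag[OF u] using dz by simp
  have "frag_extend (push p) c \<in> zspan (hrel ks Q (Suc n))"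
    using ze by (simp only: c_def frag_extend_diff push_frag_bd[OF p \<tau> u] pu)
  then have spc: "frag_extend (push s) (frag_extend (push p) c) \<in> zspan (hrel ks E (Suc n))" by (rule pushs)
  \<comment> \<open>The chain of M' that represents \<open>c\<close>, because the part of
    \<open>c\<close> coming from Q is zero.\<close>
  define v where "v = frag_extend (push r) c"
  have v: "keys v \<subseteq> hw ks M' (Suc n)" unfolding v_def by (rule kp[OF c r(1)])
  have "frag_extend frag_of c - frag_extend (\<lambda>w. push (\<lambda>x. i (r x)) w + push (\<lambda>x. s (p x)) w) c
      \<in> zspan (hrel ks E (Suc n))"
  proof (rule frag_extend_cong_zspan[OF c])
    fix w assume "w \<in> hw ks E (Suc n)"
    then obtain x as where w: "w = (x, as)" "x \<in> carrier E" "length as = Suc n" "set as \<subseteq> invariants ks"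
      by (cases w) (auto simp: hoch_words_iff)
    have "frag_of (i (r x) \<otimes>\<^bsub>E\<^esub> s (p x), as) - frag_of (i (r x), as) - frag_of (s (p x), as) \<in> hrel ks E (Suc n)"
      by (rule hrel_intros) (use w r s bc in auto)
    then show "frag_of w - (push (\<lambda>x. i (r x)) w + push (\<lambda>x. s (p x)) w) \<in> zspan (hrel ks E (Suc n))"
      using w by (intro zspan_base) (simp add: dec push_def diff_diff_eq)
  qed
  moreover have "frag_extend (\<lambda>w. push (\<lambda>x. i (r x)) w + push (\<lambda>x. s (p x)) w) c
      = frag_extend (push i) v + frag_extend (push s) (frag_extend (push p) c)"
    unfolding v_def frag_extend_comp frag_extend_push_push
    by (simp add: frag_extend_def frag_cmul_distrib2 sum.distrib)
  ultimately have "(c - frag_extend (push i) v - frag_extend (push s) (frag_extend (push p) c))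
      + frag_extend (push s) (frag_extend (push p) c) \<in> zspan (hrel ks E (Suc n))"
    by (intro zspan_add spc) (simp add: diff_diff_eq)
  then have civ: "c - frag_extend (push i) v \<in> zspan (hrel ks E (Suc n))" by simp
  have "frag_extend (bd \<tau> E) (frag_extend (push i) v) \<in> zspan (hrel ks E n)"
    using zspan_diff[OF dc E.bd_zspan[OF civ]] by (simp add: frag_extend_diff)
  then have "frag_extend (push i) (frag_extend (bd \<tau> M') v) \<in> zspan (hrel ks E n)"
    by (simp only: push_frag_bd[OF i \<tau> v])
  \<comment> \<open>The retraction shows that \<open>i\<close> is injective on chains modulo
    relations, hence that \<open>v\<close> is a cycle in M'.\<close>
  then have "frag_extend (push r) (frag_extend (push i) (frag_extend (bd \<tau> M') v)) \<in> zspan (hrel ks M' n)"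
    by (rule pushr)
  moreover have "frag_extend (push r) (frag_extend (push i) (frag_extend (bd \<tau> M') v)) = frag_extend (bd \<tau> M') v"
    by (rule pushid[OF keys_frag_extend_subset[OF v M'bd]]) (assumption, rule ri)
  ultimately have dv: "frag_extend (bd \<tau> M') v \<in> zspan (hrel ks M' n)" by simp
  from acyclic_in_pos_degD[OF ac(1) v dv] obtain f where f: "keys f \<subseteq> hw ks M' (Suc (Suc n))"
    and vf: "v - frag_extend (bd \<tau> M') f \<in> zspan (hrel ks M' (Suc n))"
    by (elim exE conjE)
  define g where "g = frag_extend (push i) f + u"
  have g: "keys g \<subseteq> hw ks E (Suc (Suc n))"
    unfolding g_def by (rule order_trans[OF keys_add Un_least[OF kp[OF f bc(1)] u]])
  have "frag_extend (push i) v - frag_extend (bd \<tau> E) (frag_extend (push i) f) \<in> zspan (hrel ks E (Suc n))"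
    using pushi[OF vf] by (simp add: frag_extend_diff push_frag_bd[OF i \<tau> f])
  then have "c - frag_extend (bd \<tau> E) (frag_extend (push i) f) \<in> zspan (hrel ks E (Suc n))"
    by (rule zspan_trans[OF civ])
  then have "z - frag_extend (bd \<tau> E) g \<in> zspan (hrel ks E (Suc n))"
    by (simp add: c_def g_def frag_extend_add algebra_simps)
  with g show "\<exists>e. keys e \<subseteq> hw ks E (Suc (Suc n)) \<and> z - frag_extend (bd \<tau> E) e \<in> zspan (hrel ks E (Suc n))"
    by blast
qed

section \<open>Iterated tensor products of the polynomial ring, filtered by words\<close>

text \<open>\<open>vmod N \<sigma> [s\<^sub>l, \<dots>, s\<^sub>1]\<close> models the bimodule \<open>R \<otimes>\<^bsub>R\<^sup>s\<^sup>1\<^esub> R \<otimes> \<dots> \<otimes>\<^bsub>R\<^sup>s\<^sup>l\<^esub> R\<close> over the polynomial ring \<open>R\<close>,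
  with the right action twisted by \<open>\<sigma>\<close>, through the isomorphism \<open>M \<otimes>\<^bsub>R\<^sup>s\<^esub> R \<cong> M \<times> M\<close> of left modules
  that sends \<open>m \<otimes> f\<close> to \<open>(m f, m \<partial>\<^sub>s f)\<close>.  The entry \<open>False\<close> of a list selects the first component.\<close>

fun vr :: "nat list \<Rightarrow> (bool list \<Rightarrow> 'k::comm_ring_1 mpoly) \<Rightarrow> 'k mpoly \<Rightarrow> bool list \<Rightarrow> 'k mpoly" where
  "vr [] v g b = v b * g"
| "vr (s # ws) v g [] = 0"
| "vr (s # ws) v g (False # b) = vr ws (\<lambda>b. v (False # b)) g b"
| "vr (s # ws) v g (True # b) = vr ws (\<lambda>b. v (False # b)) (dd s g) b + vr ws (\<lambda>b. v (True # b)) (sw s g) b"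

definition vcar :: "nat \<Rightarrow> nat list \<Rightarrow> (bool list \<Rightarrow> 'k::comm_ring_1 mpoly) set" where
  "vcar N ws = {v. (\<forall>b. v b \<in> vars_in {..<N}) \<and> (\<forall>b. length b \<noteq> length ws \<longrightarrow> v b = 0)}"

definition vmod ::
    "nat \<Rightarrow> ('k::comm_ring_1 mpoly \<Rightarrow> 'k mpoly) \<Rightarrow> nat list \<Rightarrow>
     ('k mpoly, 'k mpoly, bool list \<Rightarrow> 'k mpoly) graded_bimod" where
  "vmod N \<sigma> ws =
    \<lparr>carrier = vcar N ws, monoid.mult = (\<lambda>u v b. u b + v b), one = (\<lambda>b. 0),
     lact = (\<lambda>a v b. a * v b), ract = (\<lambda>v g. vr ws v (\<sigma> g)), mod_deg = (\<lambda>d. {})\<rparr>"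

lemma vmod_simps [simp]:
  "carrier (vmod N \<sigma> ws) = vcar N ws" "u \<otimes>\<^bsub>vmod N \<sigma> ws\<^esub> v = (\<lambda>b. u b + v b)" "\<one>\<^bsub>vmod N \<sigma> ws\<^esub> = (\<lambda>b. 0)"
  "lact (vmod N \<sigma> ws) a v = (\<lambda>b. a * v b)" "ract (vmod N \<sigma> ws) v g = vr ws v (\<sigma> g)"
  by (simp_all add: vmod_def)

lemma vr_add_left: "vr ws (\<lambda>b. u b + v b) g b = vr ws u g b + vr ws v g b"
  by (induction ws u g b arbitrary: v rule: vr.induct) (simp_all add: distrib_right)

lemma vr_0_left [simp]: "vr ws (\<lambda>b. 0) g b = 0"
  using vr_add_left[of ws "\<lambda>b. 0" "\<lambda>b. 0" g b] by simp

lemma vr_mult_left: "vr ws (\<lambda>b. a * v b) g b = a * vr ws v g b"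
  by (induction ws v g b rule: vr.induct) (simp_all add: algebra_simps)

lemma vr_add_right: "vr ws v (g + h) b = vr ws v g b + vr ws v h b"
  by (induction ws v g b arbitrary: h rule: vr.induct) (simp_all add: distrib_left dd_add)

lemma vr_0_right [simp]: "vr ws v 0 b = 0"
  using vr_add_right[of ws v 0 0 b] by simp

lemma vr_const_right:
  assumes "\<And>b. length b \<noteq> length ws \<Longrightarrow> v b = 0" shows "vr ws v (pconst c) b = pconst c * v b"
  using assms
proof (induction ws arbitrary: v b)
  case (Cons s ws)
  have "vr ws (\<lambda>b. v (x # b)) (pconst c) b = pconst c * v (x # b)" for x b
    by (rule Cons.IH) (simp add: Cons.prems)
  moreover have "v [] = 0" by (rule Cons.prems) simp
  ultimately show ?case by (cases "(s # ws, v, pconst c, b)" rule: vr.cases) (simp_all add: dd_fixed)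
qed (simp add: mult.commute)

text \<open>Associativity of this action is the twisted Leibniz rule \<open>dd_mult\<close> at every
  letter.\<close>

lemma vr_mult_right: "vr ws v (g * h) b = vr ws (vr ws v g) h b"
proof (induction ws arbitrary: v g h b)
  case (Cons s ws)
  have eta: "(\<lambda>b. vr (s # ws) v g (False # b)) = vr ws (\<lambda>b. v (False # b)) g"
    "(\<lambda>b. vr (s # ws) v g (True # b))
      = (\<lambda>b. vr ws (\<lambda>b. v (False # b)) (dd s g) b + vr ws (\<lambda>b. v (True # b)) (sw s g) b)"
    by (simp_all add: fun_eq_iff)
  show ?case
  proof (cases b)
    case (Cons x c)
    then show ?thesis
      by (cases x) (simp_all add: eta Cons.IH dd_mult vr_add_right vr_add_left)
  qed simp
qed (simp add: mult.assoc)

lemma vr_closed: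
  assumes "\<And>s. s \<in> set ws \<Longrightarrow> Suc s < N" "v \<in> vcar N ws" "g \<in> vars_in {..<N}"
  shows "vr ws v g \<in> vcar N ws"
  using assms
proof (induction ws arbitrary: v g)
  case (Cons s ws)
  have v: "(\<lambda>b. v (x # b)) \<in> vcar N ws" for x using Cons.prems by (simp add: vcar_def)
  have 1: "vr ws (\<lambda>b. v (x # b)) h \<in> vcar N ws" if "h \<in> vars_in {..<N}" for x h
    by (rule Cons.IH) (use Cons.prems v that in auto)
  have h: "g \<in> vars_in {..<N}" "dd s g \<in> vars_in {..<N}" "sw s g \<in> vars_in {..<N}"
    using Cons.prems(1)[of s] Cons.prems(3) by (auto intro!: dd_vars_in sw_vars_in)
  note 2 = 1[OF h(1)] 1[OF h(2)] 1[OF h(3)]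
  have "vr (s # ws) v g b \<in> vars_in {..<N} \<and> (length b \<noteq> length (s # ws) \<longrightarrow> vr (s # ws) v g b = 0)" for b
    using 2 by (cases "(s # ws, v, g, b)" rule: vr.cases) (auto simp: vcar_def intro!: vars_in_add)
  then show ?case by (simp add: vcar_def)
qed (auto simp: vcar_def intro: vars_in_mult)

lemma hoch_bimod_vmod:
  assumes ws: "\<And>s. s \<in> set ws \<Longrightarrow> Suc s < N"
    and \<sigma>: "alg_hom \<sigma>" "\<And>f. f \<in> vars_in {..<N} \<Longrightarrow> \<sigma> f \<in> vars_in {..<N}"
    and \<tau>: "alg_hom \<tau>" "\<And>f. f \<in> vars_in {..<N} \<Longrightarrow> \<tau> f \<in> vars_in {..<N}"
  shows "hoch_bimod \<tau> (replicate N 1) (vmod N \<sigma> ws)"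
proof -
  have cl: "(\<lambda>b. u b + v b) \<in> vcar N ws" "(\<lambda>b. a * u b) \<in> vcar N ws"
    if "u \<in> vcar N ws" "v \<in> vcar N ws" "a \<in> vars_in {..<N}" for u v :: "bool list \<Rightarrow> 'a mpoly" and a
    using that by (auto simp: vcar_def intro: vars_in_intros)
  have z: "(\<lambda>b. 0) \<in> vcar N ws" by (simp add: vcar_def)
  have grp: "comm_group (vmod N \<sigma> ws)"
  proof (rule comm_groupI)
    show "\<exists>y\<in>carrier (vmod N \<sigma> ws). y \<otimes>\<^bsub>vmod N \<sigma> ws\<^esub> x = \<one>\<^bsub>vmod N \<sigma> ws\<^esub>" if "x \<in> carrier (vmod N \<sigma> ws)" for x
      using that by (intro bexI[of _ "\<lambda>b. - x b"]) (auto simp: vcar_def intro: vars_in_uminus)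
  qed (auto simp: cl[of _ _ 0] z algebra_simps fun_eq_iff)
  have vrc: "vr ws v (\<sigma> a) \<in> vcar N ws" if "v \<in> vcar N ws" "a \<in> vars_in {..<N}" for v a
    using ws that \<sigma>(2) by (intro vr_closed) auto
  have vcc: "vr ws v (pconst c) = (\<lambda>b. pconst c * v b)" if "v \<in> vcar N ws" for v :: "bool list \<Rightarrow> 'a mpoly" and c
    by (rule ext, rule vr_const_right) (use that in \<open>simp add: vcar_def\<close>)
  show ?thesis
    unfolding hoch_bimod_def invariants_ones
    using grp \<sigma> \<tau>
    by (simp add: cl vrc vcc alg_homD vr_add_left vr_add_right vr_mult_left vr_mult_right
        distrib_left distrib_right mult.assoc fun_eq_iff)
qed

text \<open>The vectors with vanishing first component form a subbimodule, on which g acts from the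
  right through s g, while the first component is the quotient with its twist unchanged. The
  splitting by coordinates is linear over the ground ring, so \<open>acyclic_extension\<close>
  applies.\<close>

lemma acyclic_vmod_Cons:
  assumes ws: "\<And>t. t \<in> set (s # ws) \<Longrightarrow> Suc t < N"
    and \<sigma>: "alg_hom \<sigma>" "\<And>f. f \<in> vars_in {..<N} \<Longrightarrow> \<sigma> f \<in> vars_in {..<N}"
    and \<tau>: "alg_hom \<tau>" "\<And>f. f \<in> vars_in {..<N} \<Longrightarrow> \<tau> f \<in> vars_in {..<N}"
    and ac: "acyclic_in_pos_deg \<tau> (replicate N 1) (vmod N (\<lambda>g. sw s (\<sigma> g)) ws)"
      "acyclic_in_pos_deg \<tau> (replicate N 1) (vmod N \<sigma> ws)"
  shows "acyclic_in_pos_deg \<tau> (replicate N 1) (vmod N \<sigma> (s # ws))"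
proof -
  define pad where "pad x v b = (case b of [] \<Rightarrow> 0 | y # b' \<Rightarrow> if y = x then v b' else (0::'a mpoly))"
    for x :: bool and v :: "bool list \<Rightarrow> 'a mpoly" and b
  have pad: "pad x v \<in> vcar N (s # ws)" if "v \<in> vcar N ws" for x v
    using that by (auto simp: pad_def vcar_def split: list.splits)
  have prj: "(\<lambda>b. v (x # b)) \<in> vcar N ws" if "v \<in> vcar N (s # ws)" for x v
    using that by (auto simp: vcar_def)
  have pad_add: "pad x (\<lambda>b. u b + v b) = (\<lambda>b. pad x u b + pad x v b)" for x u v
    by (auto simp: pad_def fun_eq_iff split: list.splits)
  have pad_mult: "pad x (\<lambda>b. a * v b) = (\<lambda>b. a * pad x v b)" for x a v
    by (auto simp: pad_def fun_eq_iff split: list.splits)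
  have pt: "(\<lambda>b. pad True v (True # b)) = v" "(\<lambda>b. pad True v (False # b)) = (\<lambda>b. 0)"
    "(\<lambda>b. pad False v (False # b)) = v" for v by (simp_all add: pad_def)
  \<comment> \<open>With vanishing first component the divided difference term of \<open>vr\<close>
    drops out and only the twisted term is left.\<close>
  have pr: "vr (s # ws) (pad True v) g = pad True (vr ws v (sw s g))" for v g
  proof
    fix b show "vr (s # ws) (pad True v) g b = pad True (vr ws v (sw s g)) b"
    proof (cases b)
      case (Cons x c) then show ?thesis by (cases x) (simp_all add: pt, simp_all add: pad_def)
    qed (simp add: pad_def)
  qed
  have sws: "alg_hom (\<lambda>g. sw s (\<sigma> g))" by (rule alg_hom_comp[OF alg_hom_sw \<sigma>(1)])
  have sv: "sw s (\<sigma> f) \<in> vars_in {..<N}" if "f \<in> vars_in {..<N}" for f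
    using \<sigma>(2)[OF that] by (rule sw_vars_in) (use ws[of s] in auto)
  show ?thesis
  proof (rule acyclic_extension[OF _ _ ac, where i="pad True" and p="\<lambda>v b. v (False # b)"
        and s="pad False" and r="\<lambda>v b. v (True # b)"])
    show "hoch_bimod \<tau> (replicate N 1) (vmod N \<sigma> (s # ws))"
      by (rule hoch_bimod_vmod) (use ws \<sigma> \<tau> in auto)
    show "hoch_bimod \<tau> (replicate N 1) (vmod N (\<lambda>g. sw s (\<sigma> g)) ws)"
      by (rule hoch_bimod_vmod) (use ws sws sv \<tau> in auto)
    show "bimod_map (replicate N 1) (vmod N (\<lambda>g. sw s (\<sigma> g)) ws) (vmod N \<sigma> (s # ws)) (pad True)"
      unfolding bimod_map_def by (simp add: pad pad_add pad_mult pr)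
    show "bimod_map (replicate N 1) (vmod N \<sigma> (s # ws)) (vmod N \<sigma> ws) (\<lambda>v b. v (False # b))"
      unfolding bimod_map_def by (auto simp: prj fun_eq_iff)
    show "pad True (\<lambda>b. x (True # b)) \<otimes>\<^bsub>vmod N \<sigma> (s # ws)\<^esub> pad False (\<lambda>b. x (False # b)) = x"
      if "x \<in> carrier (vmod N \<sigma> (s # ws))" for x
      using that by (auto simp: pad_def fun_eq_iff vcar_def split: list.splits)
  qed (auto simp: pad prj pad_add pad_mult pt)
qed

section \<open>Chains over the polynomial ring as polynomials in blocks of variables\<close>

definition fsum :: "('w \<Rightarrow> 'k::comm_ring_1 mpoly) \<Rightarrow> ('w \<Rightarrow>\<^sub>0 int) \<Rightarrow> 'k mpoly" where
  "fsum f c = (\<Sum>w\<in>keys c. of_int (lookup c w) * f w)"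

lemma fsum_superset: "finite S \<Longrightarrow> keys c \<subseteq> S \<Longrightarrow> fsum f c = (\<Sum>w\<in>S. of_int (lookup c w) * f w)"
  unfolding fsum_def by (rule sum.mono_neutral_left) (auto simp: in_keys_iff)

lemma fsum_0 [simp]: "fsum f 0 = 0" and fsum_frag_of [simp]: "fsum f (frag_of w) = f w"
  by (simp_all add: fsum_def)

lemma fsum_add: "fsum f (a + b) = fsum f a + fsum f b"
  by (simp add: fsum_superset[of "keys a \<union> keys b"] keys_add lookup_add distrib_right sum.distrib)

lemma fsum_diff: "fsum f (a - b) = fsum f a - fsum f b"
  by (simp add: fsum_superset[of "keys a \<union> keys b"] keys_diff lookup_minus left_diff_distrib sum_subtractf)

lemma fsum_cmul: "fsum f (frag_cmul k c) = of_int k * fsum f c"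
  by (subst fsum_superset[of "keys c"]) (simp_all add: keys_cmul fsum_def sum_distrib_left mult.assoc)

lemma fsum_sum: "fsum f (sum g A) = (\<Sum>a\<in>A. fsum f (g a))"
  by (induction A rule: infinite_finite_induct) (simp_all add: fsum_add)

lemma fsum_frag_extend: "fsum f (frag_extend g c) = fsum (\<lambda>w. fsum f (g w)) c"
  using subset_UNIV
  by (induction c rule: frag_induction[where S=UNIV]) (auto simp: frag_extend_diff fsum_diff)

lemma fsum_cong: "(\<And>w. w \<in> keys c \<Longrightarrow> f w = g w) \<Longrightarrow> fsum f c = fsum g c"
  by (simp add: fsum_def)

lemma fsum_zspan: "c \<in> zspan S \<Longrightarrow> (\<And>r. r \<in> S \<Longrightarrow> fsum f r = 0) \<Longrightarrow> fsum f c = 0"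
  by (induction c rule: zspan.induct) (auto simp: fsum_add fsum_diff)

lemma alg_hom_fsum: "alg_hom h \<Longrightarrow> h (fsum f c) = fsum (\<lambda>w. h (f w)) c"
proof -
  assume h: "alg_hom h"
  have of_int: "h (of_int k) = of_int k" for k
    using alg_homD(3)[OF h, of "of_int k"] by (simp add: pconst_def)
  show ?thesis by (simp add: fsum_def alg_hom_sum h alg_homD of_int)
qed

text \<open>The chain group \<open>R\<^bsup>\<otimes>(n+1)\<^esup>\<close> is the polynomial ring in the variables \<open>XX j i\<close>, \<open>j \<le> n\<close>.\<close>

definition XX :: "nat \<Rightarrow> nat \<Rightarrow> 'k::comm_ring_1 mpoly" where "XX j i = pvar (prod_encode (j, i))"
definition block_vars :: "nat \<Rightarrow> nat \<Rightarrow> nat set" where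
  "block_vars N n = {prod_encode (j, i) |j i. j \<le> n \<and> i < N}"
definition psub :: "(nat \<Rightarrow> nat \<Rightarrow> 'k::comm_ring_1 mpoly) \<Rightarrow> 'k mpoly \<Rightarrow> 'k mpoly" where
  "psub f = subst (\<lambda>m. f (fst (prod_decode m)) (snd (prod_decode m)))"
definition \<iota> :: "nat \<Rightarrow> 'k::comm_ring_1 mpoly \<Rightarrow> 'k mpoly" where "\<iota> j = subst (XX j)"

lemma alg_hom_psub [simp]: "alg_hom (psub f)" and alg_hom_\<iota> [simp]: "alg_hom (\<iota> j)"
  by (simp_all add: psub_def \<iota>_def)

lemmas psub_simps [simp] = alg_homD[OF alg_hom_psub] and \<iota>_simps [simp] = alg_homD[OF alg_hom_\<iota>]

lemma psub_XX [simp]: "psub f (XX j i) = f j i" by (simp add: psub_def XX_def)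
lemma \<iota>_pvar [simp]: "\<iota> j (pvar i) = XX j i" by (simp add: \<iota>_def)

lemma XX_block_vars: "j \<le> n \<Longrightarrow> i < N \<Longrightarrow> XX j i \<in> vars_in (block_vars N n)"
  unfolding XX_def by (rule vars_in_var) (auto simp: block_vars_def)

lemma block_vars_eqI:
  assumes "alg_hom g" "alg_hom h" "f \<in> vars_in (block_vars N n)"
    "\<And>j i. j \<le> n \<Longrightarrow> i < N \<Longrightarrow> g (XX j i) = h (XX j i)"
  shows "g f = h f"
  by (rule alg_hom_eqI[OF assms(1-3)]) (use assms(4) in \<open>auto simp: block_vars_def XX_def\<close>)

fun evl :: "nat \<Rightarrow> 'k::comm_ring_1 mpoly list \<Rightarrow> 'k mpoly" where
  "evl j [] = 1"
| "evl j (a # l) = \<iota> j a * evl (Suc j) l"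

lemma evl_append: "evl j (u @ v) = evl j u * evl (j + length u) v"
  by (induction u arbitrary: j) (simp_all add: mult.assoc)

lemma alg_hom_evl:
  assumes "alg_hom h" "\<And>t f. t < length l \<Longrightarrow> f \<in> set l \<Longrightarrow> h (\<iota> (j + t) f) = \<iota> (j' + t) f"
  shows "h (evl j l) = evl j' l"
  using assms(2)
proof (induction l arbitrary: j j')
  case (Cons a l)
  have "h (evl (Suc j) l) = evl (Suc j') l"
    by (rule Cons.IH) (use Cons.prems[of "Suc _"] in auto)
  then show ?case using Cons.prems[of 0 a] by (simp add: alg_homD[OF assms(1)])
qed (simp add: alg_homD[OF assms(1)])

lemma evl_block_vars:
  assumes "set l \<subseteq> vars_in {..<N}" "j + length l \<le> Suc n"
  shows "evl j l \<in> vars_in (block_vars N n)"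
  using assms
proof (induction l arbitrary: j)
  case (Cons a l)
  have "\<iota> j a \<in> vars_in (block_vars N n)"
    by (rule alg_hom_vars_in[OF alg_hom_\<iota>, where I="{..<N}"]) (use Cons.prems in \<open>auto intro: XX_block_vars\<close>)
  then show ?case using Cons by (auto intro!: vars_in_mult)
qed simp

text \<open>The word m \<otimes> a_1 \<otimes> ... \<otimes> a_n becomes the product of its entries,
  each written in its own block of variables, with m in block 0. Modulo relations this is an
  isomorphism with inverse \<open>can\<close>.\<close>

definition ev :: "(bool list \<Rightarrow> 'k::comm_ring_1 mpoly) \<times> 'k mpoly list \<Rightarrow> 'k mpoly" where
  "ev w = evl 0 (fst w [] # snd w)"

lemma ev_slot: "ev (v, u @ x # s) = ev (v, u) * \<iota> (Suc (length u)) x * evl (Suc (Suc (length u))) s"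
  by (simp add: ev_def evl_append algebra_simps)

lemma list_update_split: "i < length as \<Longrightarrow> as[i := x] = take i as @ x # drop (Suc i) as"
  by (simp add: upd_conv_take_nth_drop)

lemma ev_hrel:
  assumes "r \<in> hoch_rels (inv_ring ks) (vmod N \<sigma> []) n" shows "fsum ev r = 0"
  using assms
proof (cases rule: hrel_cases)
  case (add_mod m m' as)
  then show ?thesis by (simp add: fsum_diff ev_def distrib_right)
next
  case (add_alg m as i x y)
  then have "i < length as" by (simp add: hoch_words_iff)
  then show ?thesis unfolding add_alg(5)
    by (simp add: fsum_diff list_update_split ev_slot distrib_left distrib_right)
next
  case (scale m as i c)
  then have i: "i < length as" by (simp add: hoch_words_iff)
  have as: "as = take i as @ as ! i # drop (Suc i) as" using i by (rule id_take_nth_drop)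
  have c: "ev (\<lambda>b. pconst c * m b, bs) = pconst c * ev (m, bs)" for bs
    by (simp add: ev_def mult.assoc)
  have "ev (m, as[i := pconst c * as ! i]) = pconst c * ev (m, as)"
    by (subst (2) as) (simp only: list_update_split[OF i] ev_slot \<iota>_simps, simp add: algebra_simps)
  then show ?thesis unfolding scale(3) by (simp add: fsum_diff c)
qed

text \<open>Elements of the module for the empty word are functions supported on the empty list,
  that is, single polynomials.\<close>

definition emb :: "'k::comm_ring_1 mpoly \<Rightarrow> bool list \<Rightarrow> 'k mpoly" where
  "emb f b = (if b = [] then f else 0)"

lemma emb_nil [simp]: "emb f [] = f" by (simp add: emb_def)
lemma vcar_Nil: "v \<in> vcar N [] \<longleftrightarrow> (\<exists>f\<in>vars_in {..<N}. v = emb f)"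
proof
  assume "v \<in> vcar N []"
  then show "\<exists>f\<in>vars_in {..<N}. v = emb f"
    by (intro bexI[of _ "v []"]) (auto simp: vcar_def emb_def fun_eq_iff)
qed (auto simp: vcar_def emb_def)
lemma emb_0 [simp]: "emb 0 = (\<lambda>b. 0)" by (simp add: emb_def fun_eq_iff)
lemma emb_add: "emb (f + g) = (\<lambda>b. emb f b + emb g b)" and emb_mult: "emb (a * f) = (\<lambda>b. a * emb f b)"
  by (auto simp: emb_def fun_eq_iff)

definition mono_block :: "nat \<Rightarrow> (nat \<Rightarrow>\<^sub>0 nat) \<Rightarrow> (nat \<Rightarrow>\<^sub>0 nat)" where
  "mono_block j m = Poly_Mapping.map_key (\<lambda>i. prod_encode (j, i)) m"

lemma inj_pe: "inj (\<lambda>i. prod_encode (j, i))"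
  by (rule injI) simp

lemma lookup_mono_block: "lookup (mono_block j m) i = lookup m (prod_encode (j, i))"
  by (simp add: mono_block_def map_key.rep_eq[OF inj_pe])

text \<open>A monomial factors uniquely over the blocks. Its coefficient is kept in the module
  entry, so that all algebra entries are monomials.\<close>

definition canw :: "nat \<Rightarrow> (nat \<Rightarrow>\<^sub>0 nat) \<Rightarrow> 'k::comm_ring_1 \<Rightarrow> (bool list \<Rightarrow> 'k mpoly) \<times> 'k mpoly list" where
  "canw n m c = (emb (single (mono_block 0 m) c), map (\<lambda>j. pmon (mono_block (Suc j) m)) [0..<n])"

definition can :: "nat \<Rightarrow> 'k::comm_ring_1 mpoly \<Rightarrow> ((bool list \<Rightarrow> 'k mpoly) \<times> 'k mpoly list) \<Rightarrow>\<^sub>0 int" where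
  "can n F = (\<Sum>m\<in>keys F. frag_of (canw n m (lookup F m)))"

lemma mono_block_vars: "keys m \<subseteq> block_vars N n \<Longrightarrow> keys (mono_block j m) \<subseteq> {..<N}"
  by (auto simp: in_keys_iff lookup_mono_block block_vars_def subset_iff) (metis (no_types, lifting) old.prod.inject prod_encode_eq)

lemma single_vars_in: "keys m \<subseteq> I \<Longrightarrow> single m c \<in> vars_in I"
  by (simp add: vars_in_def)

definition pshift :: "nat \<Rightarrow> (nat \<Rightarrow>\<^sub>0 nat) \<Rightarrow> (nat \<Rightarrow>\<^sub>0 nat)" where
  "pshift j a = (\<Sum>i\<in>keys a. single (prod_encode (j, i)) (lookup a i))"

lemma lookup_pshift: "lookup (pshift j a) (prod_encode (j', i)) = (if j = j' then lookup a i else 0)"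
  by (auto simp: pshift_def lookup_sum lookup_single when_def in_keys_iff)

lemma \<iota>_pmon: "\<iota> j (pmon a) = pmon (pshift j a)"
  by (simp add: pshift_def mon_sum mon_single \<iota>_def pmon_def[of a] subst_single XX_def)

definition glue :: "nat \<Rightarrow> (nat \<Rightarrow> (nat \<Rightarrow>\<^sub>0 nat)) \<Rightarrow> (nat \<Rightarrow>\<^sub>0 nat)" where
  "glue n f = (\<Sum>j\<le>n. pshift j (f j))"

lemma lookup_glue: "lookup (glue n f) (prod_encode (j, i)) = (if j \<le> n then lookup (f j) i else 0)"
  by (simp add: glue_def lookup_sum lookup_pshift)

lemma mono_block_glue: "j \<le> n \<Longrightarrow> mono_block j (glue n f) = f j"
  by (rule poly_mapping_eqI) (simp add: lookup_mono_block lookup_glue)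

lemma glue_mono_block: "keys m \<subseteq> block_vars N n \<Longrightarrow> glue n (\<lambda>j. mono_block j m) = m"
proof (rule poly_mapping_eqI)
  fix k assume m: "keys m \<subseteq> block_vars N n"
  obtain j i where k: "k = prod_encode (j, i)" by (metis prod_decode_inverse surj_pair)
  have "lookup m k = 0" if "\<not> j \<le> n"
  proof -
    have "k \<notin> block_vars N n" using that by (auto simp: k block_vars_def)
    then show ?thesis using m by (auto simp: in_keys_iff)
  qed
  then show "lookup (glue n (\<lambda>j. mono_block j m)) k = lookup m k"
    by (simp add: k lookup_glue lookup_mono_block)
qed

lemma keys_glue: "(\<And>j. j \<le> n \<Longrightarrow> keys (f j) \<subseteq> {..<N}) \<Longrightarrow> keys (glue n f) \<subseteq> block_vars N n"
proof
  fix k assume f: "\<And>j. j \<le> n \<Longrightarrow> keys (f j) \<subseteq> {..<N}" and k: "k \<in> keys (glue n f)"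
  obtain j i where ji: "k = prod_encode (j, i)" by (metis prod_decode_inverse surj_pair)
  then have "j \<le> n" "i \<in> keys (f j)" using k by (auto simp: in_keys_iff lookup_glue split: if_splits)
  then show "k \<in> block_vars N n" using f[of j] by (auto simp: ji block_vars_def)
qed

lemma evl_pmons: "evl n (map (\<lambda>j. pmon (f j)) [n..<n + k]) = pmon (\<Sum>j\<in>{n..<n + k}. pshift j (f j))"
proof (induction k)
  case (Suc k)
  have "[n..<n + Suc k] = [n..<n + k] @ [n + k]" by simp
  then show ?case by (simp only: map_append evl_append Suc) (simp add: \<iota>_pmon mon_add)
qed simp

lemma ev_canw: "ev (canw n m c) = (single (glue n (\<lambda>j. mono_block j m)) c :: 'k::comm_ring_1 mpoly)"
proof -
  have "ev (canw n m c) = pconst c * evl 0 (map (\<lambda>j. pmon (mono_block j m)) [0..<Suc n])"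
    unfolding upt_conv_Cons[OF zero_less_Suc] map_Suc_upt[symmetric]
    by (simp add: ev_def canw_def single_eq_const_mon o_def mult.assoc)
  also have "evl 0 (map (\<lambda>j. pmon (mono_block j m)) [0..<Suc n]) = (pmon (\<Sum>j\<in>{0..<Suc n}. pshift j (mono_block j m)) :: 'k mpoly)"
    using evl_pmons[of 0 "\<lambda>j. mono_block j m" "Suc n"] by simp
  also have "pconst c * \<dots> = single (glue n (\<lambda>j. mono_block j m)) c"
    by (simp add: single_eq_const_mon[of _ c] glue_def atLeast0LessThan lessThan_Suc_atMost)
  finally show ?thesis .
qed

context
  fixes N :: nat and ones :: "nat list" and \<sigma> :: "'k::comm_ring_1 mpoly \<Rightarrow> 'k mpoly"
  assumes inv: "(invariants ones :: 'k mpoly set) = vars_in {..<N}"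
begin

abbreviation (input) "V0 \<equiv> vmod N \<sigma> []"

lemma canw_closed: "keys m \<subseteq> block_vars N n \<Longrightarrow> canw n m c \<in> hw ones V0 n"
  by (auto simp: canw_def hoch_words_iff vcar_Nil inv intro!: single_vars_in vars_in_mon mono_block_vars)

lemma keys_can: "F \<in> vars_in (block_vars N n) \<Longrightarrow> keys (can n F) \<subseteq> hw ones V0 n"
  unfolding can_def by (rule keys_sum_subset) (simp add: vars_in_def canw_closed)

lemma canw_add:
  assumes "keys m \<subseteq> block_vars N n"
  shows "frag_of (canw n m (c + d)) - frag_of (canw n m c) - frag_of (canw n m d) \<in> zspan (hrel ones V0 n)"
proof -
  have "frag_of (emb (single (mono_block 0 m) c) \<otimes>\<^bsub>V0\<^esub> emb (single (mono_block 0 m) d), snd (canw n m c))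
    - frag_of (emb (single (mono_block 0 m) c), snd (canw n m c))
    - frag_of (emb (single (mono_block 0 m) d), snd (canw n m c)) \<in> zspan (hrel ones V0 n)"
    using canw_closed[OF assms, of c] canw_closed[OF assms, of d]
    by (intro zspan_base hrel_intros) (auto simp: hoch_words_iff canw_def)
  then show ?thesis by (simp add: canw_def single_add emb_add)
qed

lemma canw_0: "keys m \<subseteq> block_vars N n \<Longrightarrow> frag_of (canw n m 0) \<in> zspan (hrel ones V0 n)"
  using canw_add[of m n 0 0] zspan_uminus by fastforce

text \<open>A monomial with coefficient 0 contributes a word that vanishes only modulo relations, so
  enlarging the index set beyond the support changes the sum, but not its class.\<close>

lemma can_superset:
  assumes "finite S" "keys F \<subseteq> S" "\<And>m. m \<in> S \<Longrightarrow> keys m \<subseteq> block_vars N n"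
  shows "(\<Sum>m\<in>S. frag_of (canw n m (lookup F m))) - can n F \<in> zspan (hrel ones V0 n)"
proof -
  have "(\<Sum>m\<in>S. frag_of (canw n m (lookup F m))) - can n F = (\<Sum>m\<in>S - keys F. frag_of (canw n m (lookup F m)))"
    unfolding can_def by (subst sum.subset_diff[OF assms(2,1)]) simp
  also have "\<dots> \<in> zspan (hrel ones V0 n)"
    by (rule zspan_sum) (use assms canw_0 in \<open>auto simp: in_keys_iff\<close>)
  finally show ?thesis .
qed

lemma can_add:
  assumes F: "F \<in> vars_in (block_vars N n)" and G: "G \<in> vars_in (block_vars N n)"
  shows "can n (F + G) - can n F - can n G \<in> zspan (hrel ones V0 n)"
proof -
  define S where "S = keys F \<union> keys G"
  define T where "T F = (\<Sum>m\<in>S. frag_of (canw n m (lookup F m)))" for F :: "'k mpoly"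
  have S: "finite S" "\<And>m. m \<in> S \<Longrightarrow> keys m \<subseteq> block_vars N n"
    using F G by (auto simp: S_def vars_in_def)
  have T: "T H - can n H \<in> zspan (hrel ones V0 n)" if "keys H \<subseteq> S" for H
    unfolding T_def by (rule can_superset[OF S(1) that S(2)])
  have "T (F + G) - T F - T G \<in> zspan (hrel ones V0 n)"
  proof -
    have "T (F + G) - T F - T G = (\<Sum>m\<in>S. frag_of (canw n m (lookup F m + lookup G m))
      - frag_of (canw n m (lookup F m)) - frag_of (canw n m (lookup G m)))"
      by (simp add: T_def lookup_add sum_subtractf)
    also have "\<dots> \<in> zspan (hrel ones V0 n)" by (rule zspan_sum) (rule canw_add[OF S(2)])
    finally show ?thesis .
  qed
  moreover have "T (F + G) - can n (F + G) \<in> zspan (hrel ones V0 n)" "T F - can n F \<in> zspan (hrel ones V0 n)"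
    "T G - can n G \<in> zspan (hrel ones V0 n)"
    using keys_add[of F G] by (simp_all add: T S_def)
  ultimately have "(T (F + G) - T F - T G) - (T (F + G) - can n (F + G)) + (T F - can n F) + (T G - can n G)
     \<in> zspan (hrel ones V0 n)" using zspan_add[OF zspan_add[OF zspan_diff]] by blast
  then show ?thesis by (simp add: algebra_simps)
qed

lemma ev_can: "F \<in> vars_in (block_vars N n) \<Longrightarrow> fsum ev (can n F) = F"
proof -
  assume F: "F \<in> vars_in (block_vars N n)"
  have "fsum ev (can n F) = (\<Sum>m\<in>keys F. single m (lookup F m))"
    unfolding can_def fsum_sum
    by (rule sum.cong) (use F in \<open>auto simp: ev_canw vars_in_def glue_mono_block\<close>)
  then show ?thesis by (simp add: pm_sum_single)
qed

lemma ev_block_vars: "w \<in> hw ones V0 n \<Longrightarrow> ev w \<in> vars_in (block_vars N n)"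
  unfolding ev_def by (rule evl_block_vars) (cases w, auto simp: hoch_words_iff inv vcar_Nil)+

definition normal where "normal n w \<longleftrightarrow> frag_of w - can n (ev w) \<in> zspan (hrel ones V0 n)"

lemma can_0 [simp]: "can n 0 = 0" by (simp add: can_def)

lemma normal_add:
  assumes "w \<in> hw ones V0 n" "w' \<in> hw ones V0 n" "ev w'' = ev w + ev w'"
    "frag_of w'' - frag_of w - frag_of w' \<in> zspan (hrel ones V0 n)" "normal n w" "normal n w'"
  shows "normal n w''"
proof -
  have "(frag_of w'' - frag_of w - frag_of w') + (frag_of w - can n (ev w)) + (frag_of w' - can n (ev w'))
     - (can n (ev w + ev w') - can n (ev w) - can n (ev w')) \<in> zspan (hrel ones V0 n)"
    by (rule zspan_diff[OF zspan_add[OF zspan_add]])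
      (use assms in \<open>auto simp: normal_def intro!: can_add ev_block_vars\<close>)
  then show ?thesis by (simp add: normal_def assms(3) algebra_simps)
qed

lemma vars_in_sum_induct [consumes 1, case_names zero single add]:
  assumes "f \<in> vars_in I" "P (0 :: 'k mpoly)" "\<And>m c. keys m \<subseteq> I \<Longrightarrow> P (single m c)"
    "\<And>f g. f \<in> vars_in I \<Longrightarrow> g \<in> vars_in I \<Longrightarrow> P f \<Longrightarrow> P g \<Longrightarrow> P (f + g)"
  shows "P f"
proof -
  have "P (\<Sum>m\<in>S. single m (c m))" if "finite S" "\<And>m. m \<in> S \<Longrightarrow> keys m \<subseteq> I" for S and c :: "_ \<Rightarrow> 'k"
    using that by (induction S rule: finite_induct) (auto intro!: assms vars_in_sum single_vars_in)
  from this[of "keys f" "lookup f"] show ?thesis using assms(1) by (simp add: pm_sum_single vars_in_def)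
qed

text \<open>Induction on the number of leading algebra slots that may still be arbitrary. Slot k is
  expanded into monomials by additivity, each coefficient being moved into the module entry. When
  all slots are monomials, the module entry is expanded and the words are those of
  \<open>can\<close>.\<close>

lemma normal_word:
  assumes "k \<le> n" "m \<in> vars_in {..<N}" "length as = n" "set as \<subseteq> vars_in {..<N}"
    "\<And>j. k \<le> j \<Longrightarrow> j < n \<Longrightarrow> \<exists>\<mu>. as ! j = pmon \<mu>"
  shows "normal n (emb m, as)"
  using assms
proof (induction k arbitrary: m as)
  case 0
  then have "\<forall>j. \<exists>\<mu>. j < n \<longrightarrow> as ! j = pmon \<mu>" by blast
  then obtain f where f: "\<And>j. j < n \<Longrightarrow> as ! j = pmon (f j)" by metis
  have fk: "keys (f j) \<subseteq> {..<N}" if "j < n" for j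
  proof -
    have "as ! j \<in> vars_in {..<N}" using 0 that by auto
    then show ?thesis using f[OF that] by (simp add: vars_in_def pmon_def)
  qed
  have w: "(emb g, as) \<in> hw ones V0 n" if "g \<in> vars_in {..<N}" for g :: "'k mpoly"
    using that 0 by (auto simp: hoch_words_iff vcar_Nil inv)
  show ?case using 0(2)
  proof (induction rule: vars_in_sum_induct)
    case zero
    have "frag_of (emb 0 \<otimes>\<^bsub>V0\<^esub> emb 0, as) - frag_of (emb 0, as) - frag_of (emb 0, as) \<in> zspan (hrel ones V0 n)"
      by (intro zspan_base hrel_intros) (use w[of 0] in \<open>auto simp: hoch_words_iff\<close>)
    then have "- frag_of (emb 0, as) \<in> zspan (hrel ones V0 n)" by simp
    from zspan_uminus[OF this] show ?case by (simp add: normal_def ev_def)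
  next
    case (single \<mu> c)
    define F where "F j = (if j = 0 then \<mu> else f (j - 1))" for j
    have Fk: "keys (glue n F) \<subseteq> block_vars N n"
      by (rule keys_glue) (use fk single in \<open>auto simp: F_def\<close>)
    have e: "(emb (single \<mu> c), as) = canw n (glue n F) c"
      unfolding canw_def by (auto simp: mono_block_glue F_def f 0 intro!: nth_equalityI)
    have g: "glue n (\<lambda>j. mono_block j (glue n F)) = glue n F" by (rule glue_mono_block[OF Fk])
    show ?case
    proof (cases "c = 0")
      case True
      then show ?thesis unfolding normal_def e ev_canw g using canw_0[OF Fk] by simp
    next
      case False
      then show ?thesis unfolding normal_def e ev_canw g by (simp add: can_def)
    qed
  next
    case (add g h)
    have "frag_of (emb g \<otimes>\<^bsub>V0\<^esub> emb h, as) - frag_of (emb g, as) - frag_of (emb h, as) \<in> zspan (hrel ones V0 n)"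
      by (intro zspan_base hrel_intros) (use w[of g] w[of h] add in \<open>auto simp: hoch_words_iff\<close>)
    then show ?case
      by (intro normal_add[OF w[OF add(1)] w[OF add(2)] _ _ add(3,4)]) (simp_all add: emb_add ev_def distrib_right)
  qed
next
  case (Suc k)
  have k: "k < length as" using Suc.prems by simp
  have w: "(emb g, as[k := x]) \<in> hw ones V0 n" if "x \<in> vars_in {..<N}" "g \<in> vars_in {..<N}" for x g :: "'k mpoly"
    using Suc.prems that set_update_subset_insert[of as k x] by (auto simp: hoch_words_iff vcar_Nil inv)
  have evs: "ev (emb g, as[k := x + y]) = ev (emb g, as[k := x]) + ev (emb g, as[k := y])"
    "ev (emb g, as[k := pconst c * x]) = ev (emb (pconst c * g), as[k := x])" for x y g :: "'k mpoly" and c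
    by (simp_all add: list_update_split[OF k] ev_slot algebra_simps) (simp_all add: ev_def algebra_simps)
  have rel: "frag_of (emb m, as[k := x + y]) - frag_of (emb m, as[k := x]) - frag_of (emb m, as[k := y])
      \<in> zspan (hrel ones V0 n)" if "x \<in> vars_in {..<N}" "y \<in> vars_in {..<N}" for x y
    by (intro zspan_base hrel_intros) (use Suc.prems that in \<open>auto simp: vcar_Nil inv\<close>)
  have "normal n (emb m, as[k := x])" if "x \<in> vars_in {..<N}" for x
    using that
  proof (induction rule: vars_in_sum_induct)
    case zero
    have "frag_of (emb m, as[k := 0]) \<in> zspan (hrel ones V0 n)"
      using zspan_uminus[OF rel[of 0 0]] by simp
    moreover have "ev (emb m, as[k := 0]) = 0" by (simp add: list_update_split[OF k] ev_slot)
    ultimately show ?case by (simp add: normal_def)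
  next
    case (single \<mu> c)
    have pm: "pmon \<mu> \<in> vars_in {..<N}" using single by (rule vars_in_mon)
    have "normal n (emb (pconst c * m), as[k := pmon \<mu>])"
    proof (rule Suc.IH)
      show "\<exists>\<nu>. as[k := pmon \<mu>] ! j = pmon \<nu>" if "k \<le> j" "j < n" for j
        using Suc.prems(5)[of j] that k by (cases "j = k") auto
    qed (use Suc.prems w[OF pm Suc.prems(2)] in \<open>auto simp: hoch_words_iff inv intro: vars_in_mult\<close>)
    \<comment> \<open>The scaling relation, which carries the coefficient \<open>c\<close> from slot
      \<open>k\<close> to the module entry.\<close>
    moreover have "frag_of (lact V0 (pconst c) (emb m), as[k := pmon \<mu>])
        - frag_of (emb m, (as[k := pmon \<mu>])[k := pconst c * as[k := pmon \<mu>] ! k]) \<in> zspan (hrel ones V0 n)"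
      by (intro zspan_base hrel_intros) (use k w[OF pm Suc.prems(2)] in \<open>auto simp: hoch_words_iff\<close>)
    ultimately have "(frag_of (emb (pconst c * m), as[k := pmon \<mu>]) - can n (ev (emb (pconst c * m), as[k := pmon \<mu>])))
       - (frag_of (emb (pconst c * m), as[k := pmon \<mu>]) - frag_of (emb m, as[k := single \<mu> c])) \<in> zspan (hrel ones V0 n)"
      using k by (rule_tac zspan_diff) (simp_all add: normal_def emb_mult single_eq_const_mon)
    then show ?case by (simp add: normal_def single_eq_const_mon[of \<mu> c] evs(2))
  next
    case (add x y)
    show ?case
      by (rule normal_add[OF w[OF add(1) Suc.prems(2)] w[OF add(2) Suc.prems(2)] evs(1) rel add(3,4)]) (use add in auto)
  qed
  moreover have "as ! k \<in> vars_in {..<N}" using Suc.prems(4) k by (auto simp: subset_iff)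
  ultimately show ?case by fastforce
qed

text \<open>Injectivity of \<open>ev\<close> modulo relations: a chain is determined by its
  polynomial. Thus identities of chains can be verified as identities of polynomials.\<close>

lemma can_ev:
  assumes c: "keys c \<subseteq> hw ones V0 n"
  shows "c - can n (fsum ev c) \<in> zspan (hrel ones V0 n)"
proof (rule free_Abelian_group_induct[OF c])
  fix w assume "w \<in> hw ones V0 n"
  then show "frag_of w - can n (fsum ev (frag_of w)) \<in> zspan (hrel ones V0 n)"
    using normal_word[of n n "fst w []" "snd w"]
    by (cases w) (auto simp: hoch_words_iff vcar_Nil inv normal_def)
next
  fix a b assume 2: "keys a \<subseteq> hw ones V0 n" "keys b \<subseteq> hw ones V0 n"
    "a - can n (fsum ev a) \<in> zspan (hrel ones V0 n)" "b - can n (fsum ev b) \<in> zspan (hrel ones V0 n)"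
  have v: "fsum ev c \<in> vars_in (block_vars N n)" if "keys c \<subseteq> hw ones V0 n" for c
    unfolding fsum_def
    by (intro vars_in_sum vars_in_mult ev_block_vars)
       (use that vars_in_const[of "of_int _" "block_vars N n"] in \<open>auto simp: pconst_def\<close>)
  obtain A B where A_B_def: "A = fsum ev a" "B = fsum ev b" by blast
  have AB: "A \<in> vars_in (block_vars N n)" "B \<in> vars_in (block_vars N n)" using 2 v by (simp_all add: A_B_def)
  have "(a - can n A) - (b - can n B) + (can n ((A - B) + B) - can n (A - B) - can n B) \<in> zspan (hrel ones V0 n)"
    by (rule zspan_add[OF zspan_diff can_add[OF vars_in_diff]]) (use 2 AB in \<open>simp_all add: A_B_def\<close>)
  then show "a - b - can n (fsum ev (a - b)) \<in> zspan (hrel ones V0 n)"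
    by (simp add: A_B_def fsum_diff algebra_simps)
qed simp

lemma fsum_ev_block_vars: "keys c \<subseteq> hw ones V0 n \<Longrightarrow> fsum ev c \<in> vars_in (block_vars N n)"
  unfolding fsum_def
  by (intro vars_in_sum vars_in_mult ev_block_vars)
     (use vars_in_const[of "of_int _" "block_vars N n"] in \<open>auto simp: pconst_def\<close>)

end

section \<open>Contraction for permutation twists of the polynomial ring\<close>

lemma fsum_sum_fun: "fsum (\<lambda>w. \<Sum>i\<in>A. g i w) c = (\<Sum>i\<in>A. fsum (g i) c)"
  unfolding fsum_def sum_distrib_left by (rule sum.swap)

lemma fsum_mult_left: "fsum (\<lambda>w. a * g w) c = a * fsum g c"
  by (simp add: fsum_def sum_distrib_left algebra_simps)

text \<open>The quantum twist as an algebra map: on polynomials of degree 2e it is multiplication by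
  l^e, so l = q^(-2) in the application.\<close>

definition scale_vars :: "'k::comm_ring_1 \<Rightarrow> 'k mpoly \<Rightarrow> 'k mpoly" where
  "scale_vars l = subst (\<lambda>i. pconst l * pvar i)"

lemma alg_hom_scale_vars [simp]: "alg_hom (scale_vars l)"
  by (simp add: scale_vars_def)

lemma scale_vars_pvar [simp]: "scale_vars l (pvar i) = pconst l * pvar i"
  by (simp add: scale_vars_def)

text \<open>On polynomial functions, the face \<open>i\<close> is the pullback along the map that repeats the \<open>i\<close>-th
  argument, the first and the last one being twisted by \<open>p\<close> and by \<open>l\<close>.\<close>

definition face_hom :: "'k::comm_ring_1 \<Rightarrow> (nat \<Rightarrow> nat) \<Rightarrow> nat \<Rightarrow> nat \<Rightarrow> 'k mpoly \<Rightarrow> 'k mpoly" where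
  "face_hom l p n i = psub (\<lambda>j t.
     if i = 0 then (if j = 0 then XX 0 t else if j = 1 then XX 0 (p t) else XX (j - 1) t)
     else if i < n then XX (if j \<le> i then j else j - 1) t
     else if j = n then pconst l * XX 0 t else XX j t)"

lemma alg_hom_face_hom [simp]: "alg_hom (face_hom l p n i)" by (simp add: face_hom_def)

lemma face_hom_XX:
  "face_hom l p n i (XX j t) =
     (if i = 0 then (if j = 0 then XX 0 t else if j = 1 then XX 0 (p t) else XX (j - 1) t)
     else if i < n then XX (if j \<le> i then j else j - 1) t
     else if j = n then pconst l * XX 0 t else XX j t)"
  by (simp add: face_hom_def)

lemmas face_hom_simps = alg_homD[OF alg_hom_face_hom]

lemma face_hom_\<iota>:
  assumes "alg_hom h" "\<And>t. face_hom l p n i (XX j t) = \<iota> j' (h (pvar t))"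
  shows "face_hom l p n i (\<iota> j f) = \<iota> j' (h f)"
  by (rule alg_hom_eq[where g="\<lambda>f. face_hom l p n i (\<iota> j f)" and h="\<lambda>f. \<iota> j' (h f)"])
    (simp_all add: alg_hom_comp[OF alg_hom_face_hom alg_hom_\<iota>] alg_hom_comp[OF alg_hom_\<iota> assms(1)] assms(2))

lemmas face_hom_\<iota>_id = face_hom_\<iota>[OF alg_hom_id]

lemma ev_dface:
  assumes p: "bij p" and n: "length as = Suc n" and i: "i \<le> Suc n"
  shows "ev (dface (scale_vars l) (vmod N (permute_vars p) []) i (v, as)) = face_hom l p (Suc n) i (ev (v, as))"
proof -
  let ?d = "face_hom l p (Suc n) i"
  consider "i = 0" | "0 < i" "i < Suc n" | "i = Suc n" using i by linarith
  then show ?thesis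
  proof cases
    case 1
    obtain a s where as: "as = a # s" using n by (cases as) auto
    have 0: "?d (\<iota> 0 f) = \<iota> 0 f" for f by (rule face_hom_\<iota>_id) (simp add: face_hom_XX 1)
    have d1: "?d (\<iota> (Suc 0) f) = \<iota> 0 (permute_vars p f)" for f
      by (rule face_hom_\<iota>[OF alg_hom_permute_vars[OF p]]) (simp add: face_hom_XX 1 permute_vars_pvar p)
    have 2: "?d (evl (Suc (Suc 0)) s) = evl (Suc 0) s"
      by (rule alg_hom_evl) (simp_all add: face_hom_\<iota>_id face_hom_XX 1)
    show ?thesis
      by (simp add: 1 as dface_def ev_def 0[unfolded 1] d1[unfolded 1] 2[unfolded 1] face_hom_simps mult.assoc)
  next
    case 2
    obtain u a b s where uabs: "u = take (i - 1) as" "a = as ! (i - 1)" "b = as ! i" "s = drop (Suc i) as"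
      by blast
    have as: "as = u @ a # b # s"
      using 2 n id_take_nth_drop[of "i - 1" as] id_take_nth_drop[of i as]
      by (simp add: uabs Cons_nth_drop_Suc)
    have lu: "Suc (length u) = i" using 2 n by (simp add: uabs)
    have mg: "merge i as = u @ (a * b) # s" by (simp add: merge_def uabs)
    have 0: "?d (evl 0 (v [] # u)) = evl 0 (v [] # u)"
      by (rule alg_hom_evl) (use lu 2 in \<open>simp_all add: face_hom_\<iota>_id face_hom_XX\<close>)
    have ab: "?d (\<iota> i f) = \<iota> i f" "?d (\<iota> (Suc i) f) = \<iota> i f" for f
      using 2 by (simp_all add: face_hom_\<iota>_id face_hom_XX)
    have s: "?d (evl (Suc (Suc i)) s) = evl (Suc i) s"
      by (rule alg_hom_evl) (use 2 in \<open>simp_all add: face_hom_\<iota>_id face_hom_XX\<close>)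
    have e: "ev (v, as) = evl 0 (v [] # u) * (\<iota> i a * (\<iota> (Suc i) b * evl (Suc (Suc i)) s))"
      "ev (v, merge i as) = evl 0 (v [] # u) * (\<iota> i a * \<iota> i b * evl (Suc i) s)"
      unfolding mg unfolding as ev_def fst_conv snd_conv append_Cons[symmetric] evl_append
      using lu by simp_all
    have "dface (scale_vars l) (vmod N (permute_vars p) []) i (v, as) = (v, merge i as)"
      using 2 n by (simp add: dface_def)
    then show ?thesis by (simp only: e face_hom_simps 0 ab s mult.assoc)
  next
    case 3
    obtain u a where as: "as = u @ [a]" using n by (cases as rule: rev_cases) auto
    have lu: "length u = n" using n as by simp
    have 0: "?d (evl 0 (v [] # u)) = evl 0 (v [] # u)"
      by (rule alg_hom_evl) (use lu 3 in \<open>simp_all add: face_hom_\<iota>_id face_hom_XX\<close>)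
    have 1: "?d (\<iota> (Suc n) f) = \<iota> 0 (scale_vars l f)" for f
      by (rule face_hom_\<iota>) (use 3 in \<open>simp_all add: face_hom_XX\<close>)
    have e: "ev (v, as) = evl 0 (v [] # u) * \<iota> (Suc n) a"
      unfolding as ev_def fst_conv snd_conv append_Cons[symmetric] evl_append using lu by simp
    have "dface (scale_vars l) (vmod N (permute_vars p) []) i (v, as) = (\<lambda>b. scale_vars l a * v b, u)"
      using 3 n as by (simp add: dface_def)
    then show ?thesis by (simp only: e face_hom_simps 0 1) (simp add: ev_def)
  qed
qed

text \<open>With P the operator (P z) t = z (p t), this is the solution z of l z - P z = A - P B.
  Since P^r = 1, the inverse of l - P is the geometric sum of l^(r-1-k) P^k over k < r, divided by
  l^r - 1; the factor \<open>\<kappa>\<close> is the inverse of l^r - 1.\<close>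

definition zeta ::
    "'k::comm_ring_1 \<Rightarrow> 'k \<Rightarrow> nat \<Rightarrow> (nat \<Rightarrow> nat) \<Rightarrow> (nat \<Rightarrow> 'k mpoly) \<Rightarrow> (nat \<Rightarrow> 'k mpoly) \<Rightarrow> nat \<Rightarrow> 'k mpoly" where
  "zeta l \<kappa> r p A B t = pconst \<kappa> * (\<Sum>k<r. pconst l ^ (r - 1 - k) * (A ((p ^^ k) t) - B ((p ^^ Suc k) t)))"

lemma pconst_cancel: "\<kappa> * (l ^ r - 1) = 1 \<Longrightarrow> pconst \<kappa> * (pconst l ^ r - 1) = 1"
proof -
  assume "\<kappa> * (l ^ r - 1) = 1"
  then have "pconst (\<kappa> * (l ^ r - 1)) = pconst 1" by simp
  then show ?thesis by (simp only: const_simps const_power)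
qed

text \<open>The two sums on the left differ by a shift of the index and telescope to the factor l^r
  - 1, which \<open>\<kappa>\<close> cancels.\<close>

lemma zeta_eq:
  assumes r: "p ^^ r = id" and \<kappa>: "\<kappa> * (l ^ r - 1) = 1"
  shows "pconst l * zeta l \<kappa> r p A B t - zeta l \<kappa> r p A B (p t) = A t - B (p t)"
proof -
  define c where "c k = pconst l ^ (r - k) * (A ((p ^^ k) t) - B ((p ^^ Suc k) t))" for k
  have pw: "pconst l * (pconst l ^ (r - 1 - k) * y) = pconst l ^ (r - k) * y" if "k < r" for k y
  proof -
    obtain d where "r = k + Suc d" using \<open>k < r\<close> by (auto dest: less_imp_Suc_add)
    then show ?thesis by (simp add: mult.assoc)
  qed
  have "pconst l * zeta l \<kappa> r p A B t
      = pconst \<kappa> * (\<Sum>k<r. pconst l * (pconst l ^ (r - 1 - k) * (A ((p ^^ k) t) - B ((p ^^ Suc k) t))))"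
    by (simp only: zeta_def sum_distrib_left mult.left_commute)
  also have "\<dots> = pconst \<kappa> * (\<Sum>k<r. c k)"
    unfolding c_def by (rule arg_cong[of _ _ "(*) (pconst \<kappa>)"], rule sum.cong[OF refl]) (simp only: pw lessThan_iff)
  finally have 1: "pconst l * zeta l \<kappa> r p A B t = pconst \<kappa> * (\<Sum>k<r. c k)" .
  have 2: "zeta l \<kappa> r p A B (p t) = pconst \<kappa> * (\<Sum>k<r. c (Suc k))"
    unfolding zeta_def c_def by (simp add: funpow_swap1)
  have "(\<Sum>k<r. c k) - (\<Sum>k<r. c (Suc k)) = c 0 - c r"
    by (simp add: sum_subtractf[symmetric] sum_lessThan_telescope')
  also have "\<dots> = (pconst l ^ r - 1) * (A t - B (p t))"
    using r by (simp add: c_def algebra_simps)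
  finally have "pconst l * zeta l \<kappa> r p A B t - zeta l \<kappa> r p A B (p t)
    = (pconst \<kappa> * (pconst l ^ r - 1)) * (A t - B (p t))"
    by (simp add: 1 2 right_diff_distrib[symmetric] mult.assoc)
  then show ?thesis by (simp add: pconst_cancel[OF \<kappa>])
qed

text \<open>For A = l B the right-hand side of the linear system is l B - P B, so B is the solution;
  the sum telescopes directly.\<close>

lemma zeta_fixed:
  assumes r: "p ^^ r = id" and \<kappa>: "\<kappa> * (l ^ r - 1) = 1"
  shows "zeta l \<kappa> r p (\<lambda>s. pconst l * B s) B t = B t"
proof -
  define c where "c k = pconst l ^ (r - k) * B ((p ^^ k) t)" for k
  have "pconst l ^ (r - 1 - k) * (pconst l * B ((p ^^ k) t) - B ((p ^^ Suc k) t)) = c k - c (Suc k)" if "k < r" for k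
  proof -
    obtain d where d: "r = k + Suc d" using \<open>k < r\<close> by (auto dest: less_imp_Suc_add)
    show ?thesis unfolding d by (simp add: c_def d right_diff_distrib mult.left_commute mult.assoc del: funpow.simps)
  qed
  then have "zeta l \<kappa> r p (\<lambda>s. pconst l * B s) B t = pconst \<kappa> * (\<Sum>k<r. c k - c (Suc k))"
    unfolding zeta_def by (intro arg_cong[of _ _ "(*) (pconst \<kappa>)"] sum.cong refl) simp_all
  also have "\<dots> = pconst \<kappa> * (c 0 - c r)" by (simp add: sum_lessThan_telescope')
  also have "\<dots> = pconst \<kappa> * (pconst l ^ r - 1) * B t" using r by (simp add: c_def algebra_simps)
  finally show ?thesis by (simp add: pconst_cancel[OF \<kappa>])
qed

lemma alg_hom_zeta: "alg_hom h \<Longrightarrow> h (zeta l \<kappa> r p A B t) = zeta l \<kappa> r p (\<lambda>s. h (A s)) (\<lambda>s. h (B s)) t"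
  by (simp add: zeta_def alg_homD alg_hom_sum alg_hom_power)

text \<open>The substitution \<open>S\<close> is an extra degeneracy. It puts the solution Z of the
  linear system with data X_(m+1), X_0 in place of X_0 and translates all other blocks by P (Z -
  X_0). The new last face undoes \<open>S\<close>, and the remaining faces commute with it, so the
  boundary of S F is S applied to the boundary of F, plus or minus F.\<close>

lemma acyclic_base:
  fixes l :: "'k::comm_ring_1"
  assumes p: "p permutes {..<N}" and r: "p ^^ r = id" and \<kappa>: "\<kappa> * (l ^ r - 1) = 1"
    and inv: "(invariants ones :: 'k mpoly set) = vars_in {..<N}"
    and hb: "hoch_bimod (scale_vars l) ones (vmod N (permute_vars p) [])"
  shows "acyclic_in_pos_deg (scale_vars l) ones (vmod N (permute_vars p) [])"
  unfolding acyclic_in_pos_deg_def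
proof (intro allI impI)
  let ?M = "vmod N (permute_vars p) [] :: ('k mpoly, 'k mpoly, bool list \<Rightarrow> 'k mpoly) graded_bimod"
  let ?\<tau> = "scale_vars l"
  fix n z assume z: "keys z \<subseteq> hw ones ?M (Suc n)" and dz: "frag_extend (bd ?\<tau> ?M) z \<in> zspan (hrel ones ?M n)"
  have bij: "bij p" using p by (rule permutes_bij)
  have pk: "(p ^^ k) t < N" if "t < N" for k t
  proof (induction k)
    case (Suc k)
    then show ?case using permutes_in_image[OF p, of "(p ^^ k) t"] by simp
  qed (use that in simp)
  define D where "D m F = (\<Sum>i\<le>m. (-1) ^ i * face_hom l p m i F)" for m and F :: "'k mpoly"
  have evD: "fsum ev (frag_extend (bd ?\<tau> ?M) c) = D (Suc m) (fsum ev c)" if c: "keys c \<subseteq> hw ones ?M (Suc m)" for c m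
  proof -
    have "fsum ev (bd ?\<tau> ?M w) = (\<Sum>i\<le>Suc m. (-1) ^ i * face_hom l p (Suc m) i (ev w))" if "w \<in> keys c" for w
    proof -
      have len: "length (snd w) = Suc m" using that c by (cases w) (auto simp: hoch_words_iff)
      have "fsum ev (bd ?\<tau> ?M w) = (\<Sum>i\<le>Suc m. (-1) ^ i * ev (dface ?\<tau> ?M i w))"
        using len by (auto simp: bd_def fsum_sum fsum_cmul simp del: sum.atMost_Suc)
      also have "\<dots> = (\<Sum>i\<le>Suc m. (-1) ^ i * face_hom l p (Suc m) i (ev w))"
        by (rule sum.cong[OF refl]) (use ev_dface[OF bij len, of _ l N "fst w"] in auto)
      finally show ?thesis .
    qed
    then have "fsum ev (frag_extend (bd ?\<tau> ?M) c) = fsum (\<lambda>w. \<Sum>i\<le>Suc m. (-1) ^ i * face_hom l p (Suc m) i (ev w)) c"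
      unfolding fsum_frag_extend by (rule fsum_cong)
    also have "\<dots> = D (Suc m) (fsum ev c)"
      unfolding D_def fsum_sum_fun fsum_mult_left alg_hom_fsum[OF alg_hom_face_hom] ..
    finally show ?thesis .
  qed
  \<comment> \<open>The solution of l Z - P Z = X_(m+1) - P X_0, where X_(m+1) is the block added by
    \<open>S\<close>.\<close>
  define Z where "Z m = zeta l \<kappa> r p (XX (Suc m)) (XX 0)" for m
  define S where "S m = psub (\<lambda>j t. if j = 0 then Z m t else XX j t + Z m (p t) - XX 0 (p t))" for m
  have S_XX: "S m (XX j t) = (if j = 0 then Z m t else XX j t + Z m (p t) - XX 0 (p t))" for m j t
    by (simp add: S_def)
  have S_hom: "alg_hom (S m)" for m by (simp add: S_def)
  have Zv: "Z m t \<in> vars_in (block_vars N (Suc m))" if "t < N" for m t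
    unfolding Z_def zeta_def
    by (intro vars_in_intros XX_block_vars pk that) simp_all
  have p1: "p t < N" if "t < N" for t using pk[OF that, of 1] by simp
  have S_block: "S m F \<in> vars_in (block_vars N (Suc m))" if "F \<in> vars_in (block_vars N m)" for m F
  proof (rule alg_hom_vars_in[OF S_hom that])
    fix x assume "x \<in> block_vars N m"
    then obtain j t where x: "x = prod_encode (j, t)" "j \<le> m" "t < N" by (auto simp: block_vars_def)
    have "S m (XX j t) \<in> vars_in (block_vars N (Suc m))"
      unfolding S_XX using x by (auto intro!: vars_in_add vars_in_diff XX_block_vars Zv p1)
    then show "S m (pvar x) \<in> vars_in (block_vars N (Suc m))" by (simp add: XX_def x)
  qed
  \<comment> \<open>The last face puts l X_0 for the added block; then Z = X_0 by
    \<open>zeta_fixed\<close> and the translation vanishes.\<close>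
  have last: "face_hom l p (Suc (Suc n)) (Suc (Suc n)) (S (Suc n) F) = F" if "F \<in> vars_in (block_vars N (Suc n))" for F
  proof (rule block_vars_eqI[where g="\<lambda>F. face_hom l p (Suc (Suc n)) (Suc (Suc n)) (S (Suc n) F)" and h="\<lambda>F. F", OF _ _ that])
    let ?d = "face_hom l p (Suc (Suc n)) (Suc (Suc n))"
    fix j t assume "j \<le> Suc n" "t < N"
    have "?d (Z (Suc n) t) = XX 0 t" for t
      unfolding Z_def alg_hom_zeta[OF alg_hom_face_hom]
      by (simp add: face_hom_XX zeta_fixed[OF r \<kappa>])
    then show "?d (S (Suc n) (XX j t)) = XX j t"
      using \<open>j \<le> Suc n\<close> by (simp add: S_XX face_hom_simps face_hom_XX)
  qed (auto intro: alg_hom_comp[OF alg_hom_face_hom S_hom])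
  have other: "face_hom l p (Suc (Suc n)) i (S (Suc n) F) = S n (face_hom l p (Suc n) i F)"
    if "F \<in> vars_in (block_vars N (Suc n))" and i: "i \<le> Suc n" for F i
  proof (rule block_vars_eqI[where g="\<lambda>F. face_hom l p (Suc (Suc n)) i (S (Suc n) F)"
        and h="\<lambda>F. S n (face_hom l p (Suc n) i F)", OF _ _ that(1)])
    let ?d = "face_hom l p (Suc (Suc n)) i"
    fix j t assume j: "j \<le> Suc n" and "t < N"
    have dX: "?d (XX (Suc (Suc n)) s) = XX (Suc n) s" "?d (XX 0 s) = XX 0 s" for s
      using i by (auto simp: face_hom_XX)
    have dZ: "?d (Z (Suc n) t) = Z n t" for t
      unfolding Z_def alg_hom_zeta[OF alg_hom_face_hom] dX ..
    \<comment> \<open>Needed for i = n + 1: on one side this face is last and replaces X_(n+1) by l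
      X_0, which \<open>S\<close> sends to l Z; on the other side it merges the two top blocks. The
      linear system is exactly this coincidence.\<close>
    have Z1: "pconst l * Z n t = XX (Suc n) t + Z n (p t) - XX 0 (p t)"
      using zeta_eq[OF r \<kappa>, of "XX (Suc n)" "XX 0" t] by (simp add: Z_def algebra_simps)
    define d where "d = ?d"
    note d_hom = alg_homD[OF alg_hom_face_hom[of l p "Suc (Suc n)" i], folded d_def]
    note d_XX = face_hom_XX[of l p "Suc (Suc n)" i, folded d_def]
    note d_Z = dZ[folded d_def]
    have "d (S (Suc n) (XX j t)) = S n (face_hom l p (Suc n) i (XX j t))"
      using i j by (auto simp: S_XX face_hom_XX d_hom d_XX d_Z alg_homD[OF S_hom] Z1)
    then show "?d (S (Suc n) (XX j t)) = S n (face_hom l p (Suc n) i (XX j t))" by (simp add: d_def)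
  qed (auto intro: alg_hom_comp[OF alg_hom_face_hom S_hom] alg_hom_comp[OF S_hom alg_hom_face_hom])
  define F where "F = fsum ev z"
  have F: "F \<in> vars_in (block_vars N (Suc n))" unfolding F_def by (rule fsum_ev_block_vars[OF inv z])
  have DF: "D (Suc n) F = 0"
    unfolding F_def evD[OF z, symmetric] by (rule fsum_zspan[OF dz ev_hrel])
  have "D (Suc (Suc n)) (S (Suc n) F) = (\<Sum>i\<le>Suc n. (-1) ^ i * S n (face_hom l p (Suc n) i F)) + (-1) ^ n * F"
    unfolding D_def by (subst sum.atMost_Suc) (simp add: last[OF F] other[OF F] del: sum.atMost_Suc)
  also have "(\<Sum>i\<le>Suc n. (-1) ^ i * S n (face_hom l p (Suc n) i F)) = S n (D (Suc n) F)"
    by (simp add: D_def alg_hom_sum S_hom alg_homD[OF S_hom] alg_hom_power[OF S_hom] del: sum.atMost_Suc)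
  finally have DS: "D (Suc (Suc n)) (S (Suc n) F) = (-1) ^ n * F"
    by (simp add: DF alg_homD[OF S_hom])
  \<comment> \<open>The last face in degree n + 2 carries the sign of (-1)^n, removed here by
    multiplying with the same sign.\<close>
  define e where "e = frag_cmul ((-1) ^ n) (can (Suc (Suc n)) (S (Suc n) F))"
  have ke: "keys e \<subseteq> hw ones ?M (Suc (Suc n))"
    unfolding e_def by (rule order_trans[OF keys_cmul]) (rule keys_can[OF inv S_block[OF F]])
  have ce: "fsum ev (frag_extend (bd ?\<tau> ?M) e) = F"
  proof -
    have "fsum ev (frag_extend (bd ?\<tau> ?M) (can (Suc (Suc n)) (S (Suc n) F))) = (-1) ^ n * F"
      using evD[OF keys_can[OF inv S_block[OF F]]] ev_can[OF inv S_block[OF F]] DS by simp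
    then have "fsum ev (frag_extend (bd ?\<tau> ?M) e) = (-1) ^ n * ((-1) ^ n * F)"
      by (simp add: e_def frag_extend_cmul fsum_cmul)
    then show ?thesis by (simp flip: mult.assoc power_add add: mult_2[symmetric])
  qed
  have kb: "keys (z - frag_extend (bd ?\<tau> ?M) e) \<subseteq> hw ones ?M (Suc n)"
    by (rule order_trans[OF keys_diff Un_least[OF z keys_frag_extend_subset[OF ke hoch_bimod.bd_closed[OF hb]]]])
  have "z - frag_extend (bd ?\<tau> ?M) e \<in> zspan (hrel ones ?M (Suc n))"
    using can_ev[OF inv kb] ce by (simp add: fsum_diff F_def can_def)
  with ke show "\<exists>e. keys e \<subseteq> hw ones ?M (Suc (Suc n)) \<and> z - frag_extend (bd ?\<tau> ?M) e \<in> zspan (hrel ones ?M (Suc n))"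
    by blast
qed

section \<open>Acyclicity for all words over the polynomial ring\<close>

lemma permutes_power_id:
  assumes p: "p permutes {..<N::nat}" shows "\<exists>r>0. p ^^ r = id"
proof -
  have pk: "(p ^^ k) permutes {..<N}" for k
  proof (induction k)
    case (Suc k) show ?case unfolding funpow.simps(2) by (rule permutes_compose[OF Suc p])
  qed (simp add: permutes_id[unfolded id_def] id_def)
  have "finite (range (\<lambda>k. p ^^ k))"
    by (rule finite_subset[of _ "{f. f permutes {..<N}}"]) (use pk in \<open>auto intro: finite_permutations\<close>)
  then have "\<not> inj (\<lambda>k::nat. p ^^ k)" using finite_imageD by fastforce
  then obtain i j where ij: "i < j" "p ^^ i = p ^^ j" unfolding inj_def by (metis linorder_neqE_nat)
  have inj: "inj (p ^^ i)" using permutes_inj[OF pk] .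
  have "(p ^^ (j - i)) y = y" for y
  proof (rule injD[OF inj])
    have "(p ^^ i) ((p ^^ (j - i)) y) = (p ^^ (i + (j - i))) y" by (simp only: funpow_add comp_apply)
    then show "(p ^^ i) ((p ^^ (j - i)) y) = (p ^^ i) y" using ij by simp
  qed
  then have "p ^^ (j - i) = id" by auto
  then show ?thesis using ij by (intro exI[of _ "j - i"]) simp
qed

text \<open>Stronger than not being a root of unity, as l^r - 1 must be a unit. All r occur, since
  the permutations met in the filtration may have any order.\<close>

definition nonroot :: "'k::comm_ring_1 \<Rightarrow> bool" where
  "nonroot l \<longleftrightarrow> (\<forall>r>0. \<exists>\<kappa>. \<kappa> * (l ^ r - 1) = 1)"

lemma scale_vars_vars_in: "f \<in> vars_in I \<Longrightarrow> scale_vars l f \<in> vars_in I"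
  by (rule alg_hom_vars_in[OF alg_hom_scale_vars]) (auto intro: vars_in_intros)

lemma permute_vars_vars_in: "p permutes {..<N} \<Longrightarrow> f \<in> vars_in {..<N} \<Longrightarrow> permute_vars p f \<in> vars_in {..<N}"
proof (rule alg_hom_vars_in[OF alg_hom_permute_vars])
  assume p: "p permutes {..<N}"
  then show "bij p" by (rule permutes_bij)
  show "permute_vars p (pvar i) \<in> vars_in {..<N}" if "i \<in> {..<N}" for i
    using permutes_in_image[OF p, of i] that by (simp add: permute_vars_pvar[OF permutes_bij[OF p]])
qed

text \<open>Induction on the word, for all permutations at once: the subbimodule split off by a
  letter s is twisted by s composed with p.\<close>

lemma acyclic_vmod:
  assumes l: "nonroot (l :: 'k::comm_ring_1)" and p: "p permutes {..<N}"
    and ws: "\<And>s. s \<in> set ws \<Longrightarrow> Suc s < N"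
  shows "acyclic_in_pos_deg (scale_vars l) (replicate N 1) (vmod N (permute_vars p) ws)"
  using p ws
proof (induction ws arbitrary: p)
  case Nil
  obtain r where r: "r > 0" "p ^^ r = id" using permutes_power_id[OF Nil(1)] by blast
  then obtain \<kappa> where \<kappa>: "\<kappa> * (l ^ r - 1) = 1" using l by (auto simp: nonroot_def)
  show ?case
    by (rule acyclic_base[OF Nil(1) r(2) \<kappa> invariants_ones hoch_bimod_vmod])
      (simp_all add: alg_hom_permute_vars[OF permutes_bij[OF Nil(1)]] permute_vars_vars_in[OF Nil(1)] scale_vars_vars_in)
next
  case (Cons s ws)
  let ?t = "Transposition.transpose s (Suc s)"
  have t: "?t permutes {..<N}" using Cons.prems(2)[of s] by (intro permutes_swap_id) auto
  have tp: "(?t \<circ> p) permutes {..<N}" using permutes_compose[OF Cons.prems(1) t] .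
  have "(\<lambda>g. sw s (permute_vars p g)) = (permute_vars (?t \<circ> p) :: 'k mpoly \<Rightarrow> _)"
    unfolding sw_def by (rule ext, rule permute_vars_comp) (use Cons.prems(1) in \<open>auto intro: permutes_bij\<close>)
  then have 1: "acyclic_in_pos_deg (scale_vars l) (replicate N 1) (vmod N (\<lambda>g. sw s (permute_vars p g)) ws)"
    by (simp only:) (rule Cons.IH[OF tp], rule Cons.prems(2), simp)
  have 2: "acyclic_in_pos_deg (scale_vars l) (replicate N 1) (vmod N (permute_vars p) ws)"
    by (rule Cons.IH[OF Cons.prems(1)], rule Cons.prems(2)) simp
  show ?case
  proof (rule acyclic_vmod_Cons[OF _ _ _ _ _ 1 2])
    show "Suc s' < N" if "s' \<in> set (s # ws)" for s' using that by (rule Cons.prems(2))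
  qed (simp_all add: alg_hom_permute_vars[OF permutes_bij[OF Cons.prems(1)]] permute_vars_vars_in[OF Cons.prems(1)] scale_vars_vars_in)
qed

section \<open>Adjoining tensor factors and pairing them away\<close>

text \<open>The map m |-> m \<otimes> 1 \<otimes> ... \<otimes> 1. In the coordinates of
  \<open>vr\<close> all entries involving one of the new divided differences vanish, since the
  divided difference of 1 is 0.\<close>

fun pad :: "nat \<Rightarrow> (bool list \<Rightarrow> 'k::comm_ring_1 mpoly) \<Rightarrow> bool list \<Rightarrow> 'k mpoly" where
  "pad 0 v b = v b"
| "pad (Suc k) v [] = 0"
| "pad (Suc k) v (False # b) = pad k v b"
| "pad (Suc k) v (True # b) = 0"

text \<open>\<open>contr W ws\<close> models the pairing \<open>(m \<otimes> f\<^sub>1 \<otimes> \<dots> \<otimes> f\<^sub>l, g) \<mapsto> m \<partial>\<^sub>1(f\<^sub>1 \<partial>\<^sub>2(\<dots> \<partial>\<^sub>l(f\<^sub>l g)))\<close>.\<close>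

fun contr :: "nat list \<Rightarrow> nat list \<Rightarrow> (bool list \<Rightarrow> 'k::comm_ring_1 mpoly) \<Rightarrow> 'k mpoly \<Rightarrow> bool list \<Rightarrow> 'k mpoly" where
  "contr [] ws v g b = vr ws v g b"
| "contr (s # W) ws v g b = contr W ws (\<lambda>b. v (False # b)) (dd s g) b + contr W ws (\<lambda>b. v (True # b)) (sw s g) b"

lemma pad_add: "pad k (\<lambda>b. u b + v b) b = pad k u b + pad k v b"
  by (induction k u b rule: pad.induct) simp_all

lemma pad_mult: "pad k (\<lambda>b. a * v b) b = a * pad k v b"
  by (induction k v b rule: pad.induct) simp_all

lemma pad_closed: "v \<in> vcar N ws \<Longrightarrow> pad (length W) v \<in> vcar N (W @ ws)"
proof (induction W)
  case (Cons s W)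
  have "pad (length (s # W)) v b \<in> vars_in {..<N} \<and> (length b \<noteq> length ((s # W) @ ws) \<longrightarrow> pad (length (s # W)) v b = 0)" for b
    using Cons.IH[OF Cons.prems] by (cases "(length (s # W), v, b)" rule: pad.cases) (auto simp: vcar_def)
  then show ?case by (simp add: vcar_def)
qed (simp add: vcar_def)

lemma vr_pad:
  assumes "\<And>s. s \<in> set W \<Longrightarrow> sw s t = t"
  shows "vr (W @ ws) (pad (length W) v) t b = pad (length W) (vr ws v t) b"
  using assms
proof (induction W arbitrary: b)
  case (Cons s W)
  have d: "dd s t = 0" using Cons.prems by (simp add: dd_fixed)
  show ?case
  proof (cases b)
    case (Cons y c)
    then show ?thesis using Cons.IH Cons.prems by (cases y) (simp_all add: d)
  qed simp
next
  case Nil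
  have "pad 0 u = u" for u :: "bool list \<Rightarrow> 'a mpoly" by (simp add: fun_eq_iff)
  then show ?case by simp
qed

lemma contr_add_left: "contr W ws (\<lambda>b. u b + v b) g b = contr W ws u g b + contr W ws v g b"
  by (induction W ws u g b arbitrary: v rule: contr.induct) (simp_all add: vr_add_left)

lemma contr_0_left [simp]: "contr W ws (\<lambda>b. 0) g b = 0"
  using contr_add_left[of W ws "\<lambda>b. 0" "\<lambda>b. 0" g b] by simp

lemma contr_mult_left: "contr W ws (\<lambda>b. a * v b) g b = a * contr W ws v g b"
  by (induction W ws v g b rule: contr.induct) (simp_all add: vr_mult_left distrib_left)

lemma contr_add_right: "contr W ws v (g + h) b = contr W ws v g b + contr W ws v h b"
  by (induction W ws v g b arbitrary: h rule: contr.induct) (simp_all add: vr_add_right dd_add)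

lemma contr_0_right [simp]: "contr W ws v 0 b = 0"
  using contr_add_right[of W ws v 0 0 b] by simp

lemma contr_sum_right: "contr W ws v (sum f A) b = (\<Sum>a\<in>A. contr W ws v (f a) b)"
  by (induction A rule: infinite_finite_induct) (simp_all add: contr_add_right)

text \<open>The pairing is balanced over the polynomial ring: a factor acting on the last tensor
  factor may be moved to the argument, by the Leibniz rule at each letter.\<close>

lemma contr_vr: "contr W ws (vr (W @ ws) v a) g b = contr W ws v (a * g) b"
proof (induction W arbitrary: v a g b)
  case (Cons s W)
  have eta: "(\<lambda>b. vr ((s # W) @ ws) v a (False # b)) = vr (W @ ws) (\<lambda>b. v (False # b)) a"
    "(\<lambda>b. vr ((s # W) @ ws) v a (True # b))
      = (\<lambda>b. vr (W @ ws) (\<lambda>b. v (False # b)) (dd s a) b + vr (W @ ws) (\<lambda>b. v (True # b)) (sw s a) b)"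
    by (simp_all add: fun_eq_iff)
  show ?case
    by (simp only: contr.simps eta contr_add_left Cons.IH dd_mult contr_add_right sw_simps) simp
qed (simp add: vr_mult_right)

text \<open>A factor fixed by all letters of \<open>W\<close> passes through every divided
  difference and comes out as a right action on the remaining bimodule.\<close>

lemma contr_fixed:
  assumes "\<And>s. s \<in> set W \<Longrightarrow> sw s t = t"
  shows "contr W ws v (g * t) b = vr ws (contr W ws v g) t b"
  using assms
proof (induction W arbitrary: v g b)
  case (Cons s W)
  have "contr (s # W) ws v g = (\<lambda>b. contr W ws (\<lambda>b. v (False # b)) (dd s g) b + contr W ws (\<lambda>b. v (True # b)) (sw s g) b)"
    by (simp add: fun_eq_iff)
  then show ?case using Cons by (simp add: dd_mult_fixed vr_add_left)
next
  case Nil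
  have "contr [] ws v g = vr ws v g" by (simp add: fun_eq_iff)
  then show ?case by (simp add: vr_mult_right)
qed

lemma contr_pad: "contr W ws (pad (length W) v) g b = vr ws v (eps W g) b"
proof (induction W arbitrary: g)
  case Nil
  have "pad 0 v = v" by (simp add: fun_eq_iff)
  then show ?case by simp
next
  case (Cons s W)
  have "(\<lambda>b. pad (length (s # W)) v (False # b)) = pad (length W) v" "(\<lambda>b. pad (length (s # W)) v (True # b)) = (\<lambda>b. 0)"
    by (simp_all add: fun_eq_iff)
  then show ?case using Cons by simp
qed

lemma contr_closed:
  assumes "\<And>s. s \<in> set (W @ ws) \<Longrightarrow> Suc s < N" "v \<in> vcar N (W @ ws)" "g \<in> vars_in {..<N}"
  shows "contr W ws v g \<in> vcar N ws"
  using assms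
proof (induction W arbitrary: v g)
  case Nil
  have "contr [] ws v g = vr ws v g" by (simp add: fun_eq_iff)
  then show ?case using Nil by (simp add: vr_closed)
next
  case (Cons s W)
  have s: "Suc s < N" by (rule Cons.prems) simp
  have v: "(\<lambda>b. v (y # b)) \<in> vcar N (W @ ws)" for y using Cons.prems by (simp add: vcar_def)
  have 1: "contr W ws (\<lambda>b. v (y # b)) h \<in> vcar N ws" if "h \<in> vars_in {..<N}" for y h
    by (rule Cons.IH) (use Cons.prems v that in auto)
  have "dd s g \<in> vars_in {..<N}" "sw s g \<in> vars_in {..<N}"
    using s Cons.prems(3) by (auto intro!: dd_vars_in sw_vars_in)
  from 1[OF this(1), of False] 1[OF this(2), of True] show ?case
    by (auto simp: vcar_def intro!: vars_in_add)
qed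

text \<open>Expand a g in the elements \<open>p i\<close> with invariant coefficients and pull these
  out by \<open>contr_fixed\<close>. This is how right multiplication by \<open>a\<close> turns into
  the matrix of \<open>a\<close>.\<close>

lemma contr_dual:
  fixes a :: "'k::comm_ring_1 mpoly"
  assumes t: "trace_data N ks W d x p" and a: "a \<in> vars_in {..<N}" and j: "g \<in> vars_in {..<N}"
  shows "contr W ws v (a * g) b = (\<Sum>i<d. vr ws (contr W ws v (p i)) (eps W (a * x i * g)) b)"
proof -
  have inv: "eps W r \<in> invariants ks" if "r \<in> vars_in {..<N}" for r :: "'k mpoly"
    using t that by (simp add: trace_data_def)
  have xv: "x i \<in> vars_in {..<N}" if "i < d" for i using t that by (simp add: trace_data_def)
  have fx: "sw s f = f" if "s \<in> set W" "f \<in> invariants ks" for s and f :: "'k mpoly"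
    using t that by (auto simp: trace_data_def invariants_eq fixed_by_def subset_iff)
  have "(\<Sum>i<d. eps W (a * g * x i) * p i) = a * g"
    using t vars_in_mult[OF a j] by (simp add: trace_data_def)
  moreover have "eps W (a * g * x i) * p i = p i * eps W (a * x i * g)" for i
    by (simp add: ac_simps)
  ultimately have "(\<Sum>i<d. p i * eps W (a * x i * g)) = a * g" by simp
  then have "contr W ws v (a * g) b = contr W ws v (\<Sum>i<d. p i * eps W (a * x i * g)) b" by (simp only:)
  also have "\<dots> = (\<Sum>i<d. contr W ws v (p i * eps W (a * x i * g)) b)" by (rule contr_sum_right)
  also have "\<dots> = (\<Sum>i<d. vr ws (contr W ws v (p i)) (eps W (a * x i * g)) b)"
    by (intro sum.cong refl contr_fixed fx) (auto intro!: inv vars_in_mult a j xv)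
  finally show ?thesis .
qed


section \<open>From the polynomial ring to invariants by a generalised trace\<close>

lemma frag_extend_bd_faces:
  assumes "keys c \<subseteq> hw ks M (Suc n)"
  shows "frag_extend (bd \<tau> M) c
    = (\<Sum>i\<le>Suc n. frag_cmul ((-1) ^ i) (frag_extend (\<lambda>w. frag_of (dface \<tau> M i w)) c))"
  using assms
proof (induction c rule: frag_induction)
  case (one w)
  then have "length (snd w) = Suc n" by (cases w) (simp add: hoch_words_iff)
  then show ?case by (auto simp: bd_def)
next
  case (diff a b)
  then show ?case by (simp add: frag_extend_diff frag_cmul_diff2 sum_subtractf)
qed simp

text \<open>Two complexes are compared: that of the invariants R^k with coefficients in
  \<open>M\<close>, and that of the polynomial ring with coefficients in \<open>M'\<close>, which is
  \<open>M\<close> with one more tensor factor for each letter of the trace word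
  \<open>W\<close>.\<close>

locale multitrace =
  fixes N :: nat and ks W ws :: "nat list" and d :: nat and x p :: "nat \<Rightarrow> 'k::comm_ring_1 mpoly"
    and \<tau> :: "'k mpoly \<Rightarrow> 'k mpoly"
  assumes N: "sum_list ks = N" and td: "trace_data N ks W d x p"
    and \<tau>: "alg_hom \<tau>" "\<And>f. f \<in> vars_in {..<N} \<Longrightarrow> \<tau> f \<in> vars_in {..<N}"
    and ws: "\<And>s. s \<in> set ws \<Longrightarrow> Suc s < N"
begin

abbreviation (input) "R \<equiv> vars_in {..<N} :: 'k mpoly set"
abbreviation "M \<equiv> vmod N (\<lambda>f. f) ws :: ('k mpoly, 'k mpoly, bool list \<Rightarrow> 'k mpoly) graded_bimod"
abbreviation "M' \<equiv> vmod N (\<lambda>f. f) (W @ ws) :: ('k mpoly, 'k mpoly, bool list \<Rightarrow> 'k mpoly) graded_bimod"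
abbreviation "Rs \<equiv> replicate N (1::nat)"

lemma R_eq: "(invariants (replicate N (Suc 0)) :: 'k mpoly set) = R"
  using invariants_ones[of N] by simp

lemma inv_R: "invariants ks \<subseteq> R"
  by (auto simp: invariants_eq N)

lemma W: "s \<in> set (W @ ws) \<Longrightarrow> Suc s < N"
  using td ws by (auto simp: trace_data_def adj_def N)

lemma eps_inv: "r \<in> R \<Longrightarrow> eps W r \<in> invariants ks"
  and x_R: "j < d \<Longrightarrow> x j \<in> R" and p_R: "j < d \<Longrightarrow> p j \<in> R"
  and dual: "r \<in> R \<Longrightarrow> (\<Sum>j<d. eps W (r * p j) * x j) = r"
  and d0: "0 < d" and x0: "x 0 = 1" and eps_p: "j < d \<Longrightarrow> eps W (p j) = (if j = 0 then 1 else 0)"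
  using td by (auto simp: trace_data_def)

lemma sw_inv: "s \<in> set W \<Longrightarrow> t \<in> invariants ks \<Longrightarrow> sw s t = (t :: 'k mpoly)"
  using td by (auto simp: trace_data_def invariants_eq fixed_by_def subset_iff)

lemma eps_mult_inv: "t \<in> invariants ks \<Longrightarrow> eps W (f * t) = eps W f * (t :: 'k mpoly)"
  by (rule eps_mult_right) (rule sw_inv)

text \<open>The matrix of multiplication by \<open>a\<close> in the coordinates of
  \<open>trace_data\<close>: a x_i is the sum over j of \<open>ent i j a\<close> times x_j.\<close>

definition ent :: "nat \<Rightarrow> nat \<Rightarrow> 'k mpoly \<Rightarrow> 'k mpoly" where
  "ent i j a = eps W (a * x i * p j)"

lemma ent_inv: "i < d \<Longrightarrow> j < d \<Longrightarrow> a \<in> R \<Longrightarrow> ent i j a \<in> invariants ks"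
  unfolding ent_def by (intro eps_inv vars_in_mult x_R p_R)

lemma ent_add: "ent i j (a + b) = ent i j a + ent i j b"
  by (simp add: ent_def distrib_right eps_add)

lemma ent_scale: "ent i j (pconst c * a) = pconst c * ent i j a"
proof -
  have "ent i j (pconst c * a) = eps W (a * x i * p j * pconst c)" by (simp add: ent_def ac_simps)
  also have "\<dots> = eps W (a * x i * p j) * pconst c" by (rule eps_mult_right) simp
  finally show ?thesis by (simp add: ent_def mult.commute)
qed

text \<open>Invariant factors pass through the trace, which reduces the matrix product to the
  expansion of a x_i.\<close>

lemma ent_mult:
  assumes "i < d" "j < d" "a \<in> R" "b \<in> R"
  shows "(\<Sum>k<d. ent i k a * ent k j b) = ent i j (a * b)"
proof -
  have "ent i k a * ent k j b = eps W (b * p j * (eps W (a * x i * p k) * x k))" if "k < d" for k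
    using eps_mult_inv[OF ent_inv[OF assms(1) that assms(3)], of "b * x k * p j"]
    by (simp add: ent_def ac_simps)
  then have "(\<Sum>k<d. ent i k a * ent k j b) = eps W (b * p j * (\<Sum>k<d. eps W (a * x i * p k) * x k))"
    by (simp add: sum_distrib_left eps_sum)
  also have "(\<Sum>k<d. eps W (a * x i * p k) * x k) = a * x i"
    by (intro dual vars_in_mult assms x_R)
  also have "eps W (b * p j * (a * x i)) = ent i j (a * b)"
    by (simp add: ent_def ac_simps)
  finally show ?thesis .
qed

text \<open>Sum over all index paths starting at \<open>i\<close> of tensors of matrix entries, the
  entries already chosen being collected in \<open>pre\<close>. The final index is fed back into the
  module entry through \<open>\<tau> (x i)\<close>, which is where the cyclic rotation, and so the
  twist, takes place.\<close>

fun mt :: "nat \<Rightarrow> (bool list \<Rightarrow> 'k mpoly) \<Rightarrow> 'k mpoly list \<Rightarrow> 'k mpoly list \<Rightarrow>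
    ((bool list \<Rightarrow> 'k mpoly) \<times> 'k mpoly list) \<Rightarrow>\<^sub>0 int" where
  "mt i m pre [] = frag_of (\<lambda>b. \<tau> (x i) * m b, pre)"
| "mt i m pre (a # as) = (\<Sum>j<d. mt j m (pre @ [ent i j a]) as)"

abbreviation "Z n \<equiv> zspan (hrel ks M n)"

lemma vcar_ops:
  "u \<in> vcar N us \<Longrightarrow> v \<in> vcar N us \<Longrightarrow> (\<lambda>b. u b + v b) \<in> vcar N us"
  "a \<in> R \<Longrightarrow> v \<in> vcar N us \<Longrightarrow> (\<lambda>b. a * v b) \<in> vcar N us"
  "(\<lambda>b. 0) \<in> vcar N us"
  by (auto simp: vcar_def intro: vars_in_intros)

text \<open>Matrix entries are invariants by \<open>ent_inv\<close>, so every path gives a word over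
  the smaller ring.\<close>

lemma keys_mt:
  assumes "i < d" "m \<in> vcar N ws" "set pre \<subseteq> invariants ks" "set as \<subseteq> R"
  shows "keys (mt i m pre as) \<subseteq> hw ks M (length pre + length as)"
  using assms
proof (induction as arbitrary: i pre)
  case Nil
  then show ?case by (simp add: hoch_words_iff vcar_ops \<tau> x_R)
next
  case (Cons a as)
  have "keys (mt j m (pre @ [ent i j a]) as) \<subseteq> hw ks M (length (pre @ [ent i j a]) + length as)" if "j < d" for j
    by (rule Cons.IH) (use Cons.prems that ent_inv in auto)
  then show ?case by (simp) (rule keys_sum_subset, simp)
qed

lemma mt_add:
  assumes "i < d" "m \<in> vcar N ws" "m' \<in> vcar N ws" "set pre \<subseteq> invariants ks" "set as \<subseteq> R"
  shows "mt i (\<lambda>b. m b + m' b) pre as - mt i m pre as - mt i m' pre as \<in> Z (length pre + length as)"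
  using assms
proof (induction as arbitrary: i pre)
  case Nil
  have "frag_of ((\<lambda>b. \<tau> (x i) * m b) \<otimes>\<^bsub>M\<^esub> (\<lambda>b. \<tau> (x i) * m' b), pre)
     - frag_of (\<lambda>b. \<tau> (x i) * m b, pre) - frag_of (\<lambda>b. \<tau> (x i) * m' b, pre) \<in> hrel ks M (length pre)"
    by (rule hrel_intros) (use Nil in \<open>auto intro!: vcar_ops \<tau> x_R\<close>)
  then show ?case by (simp add: distrib_left zspan_base)
next
  case (Cons a as)
  have "mt j (\<lambda>b. m b + m' b) (pre @ [ent i j a]) as - mt j m (pre @ [ent i j a]) as - mt j m' (pre @ [ent i j a]) as
      \<in> Z (length (pre @ [ent i j a]) + length as)" if "j < d" for j
    by (rule Cons.IH) (use Cons.prems that ent_inv in auto)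
  then show ?case by (simp flip: sum_subtractf) (rule zspan_sum, simp)
qed

lemma mt_slot_add:
  assumes "i < d" "m \<in> vcar N ws" "set u \<subseteq> invariants ks" "set v \<subseteq> invariants ks"
    "y \<in> invariants ks" "y' \<in> invariants ks" "set as \<subseteq> R"
  shows "mt i m (u @ (y + y') # v) as - mt i m (u @ y # v) as - mt i m (u @ y' # v) as
    \<in> Z (Suc (length u + length v + length as))"
  using assms
proof (induction as arbitrary: i v)
  case Nil
  let ?w = "(u @ 0 # v)"
  have "frag_of (\<lambda>b. \<tau> (x i) * m b, ?w[length u := y + y']) - frag_of (\<lambda>b. \<tau> (x i) * m b, ?w[length u := y])
     - frag_of (\<lambda>b. \<tau> (x i) * m b, ?w[length u := y']) \<in> hrel ks M (Suc (length u + length v))"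
    by (rule hrel_intros) (use Nil in \<open>auto intro!: vcar_ops \<tau> x_R invariants_intros\<close>)
  then show ?case by (simp add: zspan_base)
next
  case (Cons a as)
  have "mt j m (u @ (y + y') # v @ [ent i j a]) as - mt j m (u @ y # v @ [ent i j a]) as - mt j m (u @ y' # v @ [ent i j a]) as
      \<in> Z (Suc (length u + length (v @ [ent i j a]) + length as))" if "j < d" for j
    by (rule Cons.IH) (use Cons.prems that ent_inv in auto)
  then show ?case by (simp flip: sum_subtractf) (rule zspan_sum, simp)
qed

lemma mt_slot_scale:
  assumes "i < d" "m \<in> vcar N ws" "set u \<subseteq> invariants ks" "set v \<subseteq> invariants ks"
    "y \<in> invariants ks" "set as \<subseteq> R"
  shows "mt i (\<lambda>b. pconst c * m b) (u @ y # v) as - mt i m (u @ (pconst c * y) # v) as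
    \<in> Z (Suc (length u + length v + length as))"
  using assms
proof (induction as arbitrary: i v)
  case Nil
  let ?w = "(u @ y # v)"
  have "frag_of (lact M (pconst c) (\<lambda>b. \<tau> (x i) * m b), ?w)
     - frag_of (\<lambda>b. \<tau> (x i) * m b, ?w[length u := pconst c * ?w ! length u]) \<in> hrel ks M (Suc (length u + length v))"
    by (rule hrel_intros) (use Nil in \<open>auto intro!: vcar_ops \<tau> x_R invariants_intros\<close>)
  then show ?case by (simp add: zspan_base mult.left_commute)
next
  case (Cons a as)
  have "mt j (\<lambda>b. pconst c * m b) (u @ y # v @ [ent i j a]) as - mt j m (u @ (pconst c * y) # v @ [ent i j a]) as
      \<in> Z (Suc (length u + length (v @ [ent i j a]) + length as))" if "j < d" for j
    by (rule Cons.IH) (use Cons.prems that ent_inv in auto)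
  then show ?case by (simp flip: sum_subtractf) (rule zspan_sum, simp)
qed

lemma mt_zero:
  assumes "i < d" "set pre \<subseteq> invariants ks" "set as \<subseteq> R"
  shows "mt i (\<lambda>b. 0) pre as \<in> Z (length pre + length as)"
  using zspan_uminus[OF mt_add[OF assms(1) vcar_ops(3) vcar_ops(3) assms(2,3)]] by simp

lemma mt_slot_zero:
  assumes "i < d" "m \<in> vcar N ws" "set u \<subseteq> invariants ks" "set v \<subseteq> invariants ks" "set as \<subseteq> R"
  shows "mt i m (u @ 0 # v) as \<in> Z (Suc (length u + length v + length as))"
  using zspan_uminus[OF mt_slot_add[OF assms(1-4) _ _ assms(5), of 0 0]] by (simp add: invariants_intros)

lemma mt_sum:
  assumes "finite A" "i < d" "\<And>a. a \<in> A \<Longrightarrow> m a \<in> vcar N ws" "set pre \<subseteq> invariants ks" "set as \<subseteq> R"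
  shows "mt i (\<lambda>b. \<Sum>a\<in>A. m a b) pre as - (\<Sum>a\<in>A. mt i (m a) pre as) \<in> Z (length pre + length as)"
  using assms(1,3)
proof (induction A rule: finite_induct)
  case empty then show ?case using mt_zero assms by simp
next
  case (insert a A)
  have s: "(\<lambda>b. \<Sum>a\<in>A. m a b) \<in> vcar N ws"
    using insert.prems by (auto simp: vcar_def intro!: vars_in_sum)
  have "(mt i (\<lambda>b. m a b + (\<Sum>a\<in>A. m a b)) pre as - mt i (m a) pre as - mt i (\<lambda>b. \<Sum>a\<in>A. m a b) pre as)
      + (mt i (\<lambda>b. \<Sum>a\<in>A. m a b) pre as - (\<Sum>a\<in>A. mt i (m a) pre as)) \<in> Z (length pre + length as)"
    by (rule zspan_add[OF mt_add]) (use insert s assms in auto)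
  then show ?case using insert by (simp add: algebra_simps)
qed

lemma mt_slot_sum:
  assumes "finite A" "i < d" "m \<in> vcar N ws" "set u \<subseteq> invariants ks" "set v \<subseteq> invariants ks"
    "\<And>a. a \<in> A \<Longrightarrow> y a \<in> invariants ks" "set as \<subseteq> R"
  shows "mt i m (u @ (\<Sum>a\<in>A. y a) # v) as - (\<Sum>a\<in>A. mt i m (u @ y a # v) as) \<in> Z (Suc (length u + length v + length as))"
  using assms(1,6)
proof (induction A rule: finite_induct)
  case empty then show ?case using mt_slot_zero assms by simp
next
  case (insert a A)
  have s: "(\<Sum>a\<in>A. y a) \<in> invariants ks"
    using insert.hyps(1) insert.prems by (induction A rule: finite_induct) (auto intro: invariants_intros)
  have "(mt i m (u @ (y a + (\<Sum>a\<in>A. y a)) # v) as - mt i m (u @ y a # v) as - mt i m (u @ (\<Sum>a\<in>A. y a) # v) as)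
      + (mt i m (u @ (\<Sum>a\<in>A. y a) # v) as - (\<Sum>a\<in>A. mt i m (u @ y a # v) as)) \<in> Z (Suc (length u + length v + length as))"
    by (rule zspan_add[OF mt_slot_add]) (use insert s assms in auto)
  then show ?case using insert by (simp add: algebra_simps)
qed

end

context multitrace begin

text \<open>The Dennis trace with coefficients. The module entry is contracted with the dual element
  \<open>p i\<close> at the start of a path and multiplied by the twisted generator at its
  end.\<close>

definition tr :: "(bool list \<Rightarrow> 'k mpoly) \<times> 'k mpoly list \<Rightarrow> ((bool list \<Rightarrow> 'k mpoly) \<times> 'k mpoly list) \<Rightarrow>\<^sub>0 int" where
  "tr w = (\<Sum>i<d. mt i (contr W ws (fst w) (p i)) [] (snd w))"

lemma contr_vcar: "v \<in> vcar N (W @ ws) \<Longrightarrow> g \<in> R \<Longrightarrow> contr W ws v g \<in> vcar N ws"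
  by (rule contr_closed) (auto intro: W)

lemma hw_R: "(v, as) \<in> hw Rs M' n \<longleftrightarrow> v \<in> vcar N (W @ ws) \<and> length as = n \<and> set as \<subseteq> R"
  by (simp add: hoch_words_iff R_eq)

lemma tr_closed: "w \<in> hw Rs M' n \<Longrightarrow> keys (tr w) \<subseteq> hw ks M n"
proof -
  assume w: "w \<in> hw Rs M' n"
  obtain v as where v: "w = (v, as)" by (cases w)
  have "keys (mt i (contr W ws v (p i)) [] as) \<subseteq> hw ks M (length ([] :: 'k mpoly list) + length as)" if "i < d" for i
    by (rule keys_mt) (use w v that in \<open>auto simp: hw_R[unfolded One_nat_def] contr_vcar p_R\<close>)
  then show ?thesis
    using w unfolding v tr_def hw_R by (intro keys_sum_subset) auto
qed

lemma mt_as_add: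
  assumes "i < d" "m \<in> vcar N ws" "set pre \<subseteq> invariants ks" "set u \<subseteq> R" "set v \<subseteq> R" "y \<in> R" "y' \<in> R"
  shows "mt i m pre (u @ (y + y') # v) - mt i m pre (u @ y # v) - mt i m pre (u @ y' # v)
    \<in> Z (length pre + Suc (length u + length v))"
  using assms
proof (induction u arbitrary: i pre)
  case Nil
  have "mt j m (pre @ (ent i j y + ent i j y') # []) v - mt j m (pre @ ent i j y # []) v - mt j m (pre @ ent i j y' # []) v
      \<in> Z (Suc (length pre + length ([] :: 'k mpoly list) + length v))" if "j < d" for j
    by (rule mt_slot_add) (use Nil that ent_inv in auto)
  then show ?case by (simp add: ent_add flip: sum_subtractf) (rule zspan_sum, simp)
next
  case (Cons a u)
  have "mt j m (pre @ [ent i j a]) (u @ (y + y') # v) - mt j m (pre @ [ent i j a]) (u @ y # v)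
      - mt j m (pre @ [ent i j a]) (u @ y' # v) \<in> Z (length (pre @ [ent i j a]) + Suc (length u + length v))" if "j < d" for j
    by (rule Cons.IH) (use Cons.prems that ent_inv in auto)
  then show ?case by (simp flip: sum_subtractf) (rule zspan_sum, simp)
qed

lemma mt_as_scale:
  assumes "i < d" "m \<in> vcar N ws" "set pre \<subseteq> invariants ks" "set u \<subseteq> R" "set v \<subseteq> R" "y \<in> R"
  shows "mt i (\<lambda>b. pconst c * m b) pre (u @ y # v) - mt i m pre (u @ (pconst c * y) # v)
    \<in> Z (length pre + Suc (length u + length v))"
  using assms
proof (induction u arbitrary: i pre)
  case Nil
  have "mt j (\<lambda>b. pconst c * m b) (pre @ ent i j y # []) v - mt j m (pre @ (pconst c * ent i j y) # []) v
      \<in> Z (Suc (length pre + length ([] :: 'k mpoly list) + length v))" if "j < d" for j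
    by (rule mt_slot_scale) (use Nil that ent_inv in auto)
  then show ?case by (simp add: ent_scale flip: sum_subtractf) (rule zspan_sum, simp)
next
  case (Cons a u)
  have "mt j (\<lambda>b. pconst c * m b) (pre @ [ent i j a]) (u @ y # v) - mt j m (pre @ [ent i j a]) (u @ (pconst c * y) # v)
      \<in> Z (length (pre @ [ent i j a]) + Suc (length u + length v))" if "j < d" for j
    by (rule Cons.IH) (use Cons.prems that ent_inv in auto)
  then show ?case by (simp flip: sum_subtractf) (rule zspan_sum, simp)
qed

lemma tr_hrel:
  assumes "r \<in> hrel Rs M' n" shows "frag_extend tr r \<in> Z n"
  using assms
proof (cases rule: hrel_cases)
  case (add_mod m m' as)
  then have m: "m \<in> vcar N (W @ ws)" "m' \<in> vcar N (W @ ws)" "length as = n" "set as \<subseteq> R"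
    by (auto simp: hw_R[unfolded One_nat_def])
  have "(\<lambda>b. contr W ws (\<lambda>b. m b + m' b) g b) = (\<lambda>b. contr W ws m g b + contr W ws m' g b)" for g
    by (simp add: contr_add_left)
  then have e: "contr W ws (\<lambda>b. m b + m' b) g = (\<lambda>b. contr W ws m g b + contr W ws m' g b)" for g
    by (simp add: fun_eq_iff)
  have "mt i (\<lambda>b. contr W ws m (p i) b + contr W ws m' (p i) b) [] as - mt i (contr W ws m (p i)) [] as
      - mt i (contr W ws m' (p i)) [] as \<in> Z (length ([] :: 'k mpoly list) + length as)" if "i < d" for i
    by (rule mt_add) (use m that in \<open>auto intro!: contr_vcar p_R\<close>)
  then show ?thesis
    unfolding add_mod(3) using m(3)
    by (simp add: frag_extend_diff tr_def e flip: sum_subtractf) (rule zspan_sum, simp)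
next
  case (add_alg m as i y y')
  then have m: "m \<in> vcar N (W @ ws)" "length as = n" "set as \<subseteq> R" "i < length as" "y \<in> R" "y' \<in> R"
    by (auto simp: hw_R[unfolded One_nat_def] R_eq)
  have "mt k (contr W ws m (p k)) [] (take i as @ (y + y') # drop (Suc i) as) - mt k (contr W ws m (p k)) [] (take i as @ y # drop (Suc i) as)
      - mt k (contr W ws m (p k)) [] (take i as @ y' # drop (Suc i) as)
      \<in> Z (length ([] :: 'k mpoly list) + Suc (length (take i as) + length (drop (Suc i) as)))" if "k < d" for k
    by (rule mt_as_add) (use m that in \<open>auto intro!: contr_vcar p_R dest: in_set_takeD in_set_dropD\<close>)
  moreover have "length ([] :: 'k mpoly list) + Suc (length (take i as) + length (drop (Suc i) as)) = n" using m by simp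
  ultimately show ?thesis
    unfolding add_alg(5)
    by (simp add: frag_extend_diff tr_def list_update_split[OF m(4)] flip: sum_subtractf) (rule zspan_sum, simp)
next
  case (scale m as i c)
  then have m: "m \<in> vcar N (W @ ws)" "length as = n" "set as \<subseteq> R" "i < length as"
    by (auto simp: hw_R[unfolded One_nat_def] R_eq)
  have e: "contr W ws (\<lambda>b. pconst c * m b) g = (\<lambda>b. pconst c * contr W ws m g b)" for g
    by (simp add: fun_eq_iff contr_mult_left)
  have as: "take i as @ as ! i # drop (Suc i) as = as" using m(4) by (simp add: id_take_nth_drop[symmetric])
  have "mt k (\<lambda>b. pconst c * contr W ws m (p k) b) [] (take i as @ as ! i # drop (Suc i) as)
      - mt k (contr W ws m (p k)) [] (take i as @ (pconst c * as ! i) # drop (Suc i) as)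
      \<in> Z (length ([] :: 'k mpoly list) + Suc (length (take i as) + length (drop (Suc i) as)))" if "k < d" for k
    by (rule mt_as_scale) (use m that in \<open>auto intro!: contr_vcar p_R dest: in_set_takeD in_set_dropD\<close>)
  moreover have "length ([] :: 'k mpoly list) + Suc (length (take i as) + length (drop (Suc i) as)) = n" using m by simp
  ultimately show ?thesis
    unfolding scale(3) as
    by (simp add: frag_extend_diff tr_def e list_update_split[OF m(4)] flip: sum_subtractf) (rule zspan_sum, simp)
qed

abbreviation "fc i \<equiv> frag_extend (\<lambda>w. frag_of (dface \<tau> M i w))"

lemma fc_sum: "fc k (\<Sum>j<d. g j) = (\<Sum>j<d. fc k (g j))"
  by (simp add: frag_extend_sum o_def)

lemma fc_first: "fc 0 (mt i m (y # pre) as) = mt i (vr ws m y) pre as"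
proof (induction as arbitrary: i pre)
  case Nil
  have "vr ws (\<lambda>b. \<tau> (x i) * m b) y = (\<lambda>b. \<tau> (x i) * vr ws m y b)" by (simp add: fun_eq_iff vr_mult_left)
  then show ?case by (simp add: dface_def)
next
  case (Cons a as)
  have "fc 0 (mt j m (y # (pre @ [ent i j a])) as) = mt j (vr ws m y) (pre @ [ent i j a]) as" for j
    by (rule Cons.IH)
  then show ?case by (simp add: fc_sum)
qed

lemma fc_merge: "fc (Suc (length u)) (mt i m (u @ y # y' # v) as) = mt i m (u @ (y * y') # v) as"
proof (induction as arbitrary: i v)
  case Nil
  then show ?case by (simp add: dface_def merge_def nth_append)
next
  case (Cons a as)
  have "fc (Suc (length u)) (mt j m (u @ y # y' # (v @ [ent i j a])) as) = mt j m (u @ (y * y') # (v @ [ent i j a])) as" for j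
    by (rule Cons.IH)
  then show ?case by (simp add: fc_sum)
qed

text \<open>Merging two neighbouring matrix entries and summing over the index between them is the
  matrix product, so \<open>ent_mult\<close> applies slot by slot.\<close>

lemma fc_mid:
  assumes "i < d" "m \<in> vcar N ws" "set pre \<subseteq> invariants ks" "set u \<subseteq> R" "set v \<subseteq> R" "a \<in> R" "b \<in> R"
  shows "mt i m pre (u @ (a * b) # v) - fc (Suc (length pre + length u)) (mt i m pre (u @ a # b # v))
    \<in> Z (length pre + Suc (length u + length v))"
  using assms
proof (induction u arbitrary: i pre)
  case Nil
  have "mt l m (pre @ (\<Sum>j<d. ent i j a * ent j l b) # []) v - (\<Sum>j<d. mt l m (pre @ (ent i j a * ent j l b) # []) v)
      \<in> Z (Suc (length pre + length ([] :: 'k mpoly list) + length v))" if "l < d" for l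
    by (rule mt_slot_sum) (use Nil that ent_inv in \<open>auto intro: invariants_intros\<close>)
  moreover have "(\<Sum>j<d. ent i j a * ent j l b) = ent i l (a * b)" if "l < d" for l
    by (rule ent_mult) (use Nil that in auto)
  ultimately have 1: "mt l m (pre @ [ent i l (a * b)]) v - (\<Sum>j<d. mt l m (pre @ [ent i j a * ent j l b]) v)
      \<in> Z (length pre + Suc (length v))" if "l < d" for l
    using that by simp
  have 2: "fc (Suc (length pre)) (mt l m (pre @ [ent i j a, ent j l b]) v) = mt l m (pre @ [ent i j a * ent j l b]) v" for j l
    using fc_merge[of pre l m "ent i j a" "ent j l b" "[]" v] by simp
  have "mt i m pre ((a * b) # v) - fc (Suc (length pre)) (mt i m pre (a # b # v))
      = (\<Sum>l<d. mt l m (pre @ [ent i l (a * b)]) v) - (\<Sum>j<d. \<Sum>l<d. mt l m (pre @ [ent i j a * ent j l b]) v)"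
    by (simp add: fc_sum 2)
  also have "\<dots> = (\<Sum>l<d. mt l m (pre @ [ent i l (a * b)]) v - (\<Sum>j<d. mt l m (pre @ [ent i j a * ent j l b]) v))"
    by (subst sum.swap) (simp only: sum_subtractf)
  also have "\<dots> \<in> Z (length pre + Suc (length v))" by (rule zspan_sum) (use 1 in simp)
  finally show ?case by simp
next
  case (Cons e u)
  have "mt j m (pre @ [ent i j e]) (u @ (a * b) # v)
      - fc (Suc (length (pre @ [ent i j e]) + length u)) (mt j m (pre @ [ent i j e]) (u @ a # b # v))
      \<in> Z (length (pre @ [ent i j e]) + Suc (length u + length v))" if "j < d" for j
    by (rule Cons.IH) (use Cons.prems that ent_inv in auto)
  then show ?case by (simp add: fc_sum flip: sum_subtractf) (rule zspan_sum, simp)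
qed

text \<open>Summing \<open>\<tau>\<close> of the last matrix entry times \<open>\<tau> (x j)\<close>
  over the final index j gives \<open>\<tau> (a * x i)\<close>, because \<open>\<tau>\<close> is an
  algebra map and the x j expand a x_i.\<close>

lemma fc_last:
  assumes "i < d" "m \<in> vcar N ws" "set pre \<subseteq> invariants ks" "set as \<subseteq> R" "a \<in> R"
  shows "mt i (\<lambda>b. \<tau> a * m b) pre as - fc (Suc (length pre + length as)) (mt i m pre (as @ [a]))
    \<in> Z (length pre + length as)"
  using assms
proof (induction as arbitrary: i pre)
  case Nil
  define mm where "mm j b = \<tau> (ent i j a) * (\<tau> (x j) * m b)" for j b
  have mm: "mm j \<in> vcar N ws" if "j < d" for j
    unfolding mm_def using Nil that ent_inv[of i j a] inv_R by (intro vcar_ops \<tau> x_R) auto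
  have z: "mt 0 (\<lambda>b. \<Sum>j<d. mm j b) pre [] - (\<Sum>j<d. mt 0 (mm j) pre []) \<in> Z (length pre + length ([] :: 'k mpoly list))"
    by (rule mt_sum) (use mm d0 Nil in auto)
  \<comment> \<open>The path of length 0 at index 0 leaves the module entry unchanged, as x_0 = 1;
    this lets \<open>mt_sum\<close> be used for plain words.\<close>
  have m0: "mt 0 v pre [] = frag_of (v, pre)" for v by (simp add: x0 alg_homD[OF \<tau>(1)])
  have "(\<Sum>j<d. mm j b) = \<tau> (x i) * (\<tau> a * m b)" for b
  proof -
    have "(\<Sum>j<d. mm j b) = \<tau> (\<Sum>j<d. eps W (a * x i * p j) * x j) * m b"
      by (simp add: mm_def ent_def alg_hom_sum \<tau> alg_homD[OF \<tau>(1)] sum_distrib_right mult.assoc)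
    also have "(\<Sum>j<d. eps W (a * x i * p j) * x j) = a * x i"
      using Nil by (intro dual vars_in_mult x_R) auto
    finally show ?thesis by (simp add: alg_homD[OF \<tau>(1)] ac_simps)
  qed
  then have "frag_of (\<lambda>b. \<tau> (x i) * (\<tau> a * m b), pre) - (\<Sum>j<d. frag_of (mm j, pre)) \<in> Z (length pre)"
    using z unfolding m0 by simp
  moreover have "fc (Suc (length pre)) (mt j m (pre @ [ent i j a]) []) = frag_of (mm j, pre)" for j
    by (simp add: dface_def mm_def[abs_def])
  ultimately show ?case by (simp add: fc_sum)
next
  case (Cons e as)
  have "mt j (\<lambda>b. \<tau> a * m b) (pre @ [ent i j e]) as
      - fc (Suc (length (pre @ [ent i j e]) + length as)) (mt j m (pre @ [ent i j e]) (as @ [a]))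
      \<in> Z (length (pre @ [ent i j e]) + length as)" if "j < d" for j
    by (rule Cons.IH) (use Cons.prems that ent_inv in auto)
  then show ?case by (simp add: fc_sum flip: sum_subtractf) (rule zspan_sum, simp)
qed

text \<open>Face by face: \<open>contr_dual\<close> for the first, multiplicativity of matrices for
  the inner ones, closing of the path for the last.\<close>

lemma tr_face:
  assumes w: "w \<in> hw Rs M' (Suc n)" and k: "k \<le> Suc n"
  shows "tr (dface \<tau> M' k w) - fc k (tr w) \<in> Z n"
proof -
  obtain v as where v: "w = (v, as)" by (cases w)
  have vc: "v \<in> vcar N (W @ ws)" and len: "length as = Suc n" and as: "set as \<subseteq> R"
    using w unfolding v hw_R by auto
  have cv: "contr W ws v (p i) \<in> vcar N ws" if "i < d" for i using contr_vcar[OF vc p_R[OF that]] .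
  consider "k = 0" | "0 < k" "k < Suc n" | "k = Suc n" using k by linarith
  then show ?thesis
  proof cases
    case 1
    obtain a s where s: "as = a # s" using len by (cases as) auto
    have a: "a \<in> R" "set s \<subseteq> R" "length s = n" using as s len by auto
    have c: "contr W ws (vr (W @ ws) v a) (p j) = (\<lambda>b. \<Sum>i<d. vr ws (contr W ws v (p i)) (ent i j a) b)" if "j < d" for j
      by (rule ext) (simp only: contr_vr contr_dual[OF td a(1) p_R[OF that]] ent_def)
    have vrc: "vr ws (contr W ws v (p i)) (ent i j a) \<in> vcar N ws" if "i < d" "j < d" for i j
      by (rule vr_closed) (use ws cv that ent_inv[OF that a(1)] inv_R in auto)
    have q1: "mt j (\<lambda>b. \<Sum>i<d. vr ws (contr W ws v (p i)) (ent i j a) b) [] s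
        - (\<Sum>i<d. mt j (vr ws (contr W ws v (p i)) (ent i j a)) [] s) \<in> Z (length ([] :: 'k mpoly list) + length s)" if "j < d" for j
      by (rule mt_sum) (use that vrc a in auto)
    have "tr (dface \<tau> M' k w) = (\<Sum>j<d. mt j (\<lambda>b. \<Sum>i<d. vr ws (contr W ws v (p i)) (ent i j a) b) [] s)"
      by (simp add: 1 v s dface_def tr_def c)
    moreover have "fc k (tr w) = (\<Sum>i<d. \<Sum>j<d. mt j (vr ws (contr W ws v (p i)) (ent i j a)) [] s)"
      by (simp add: 1 v s tr_def fc_sum fc_first)
    moreover have "(\<Sum>i<d. \<Sum>j<d. mt j (vr ws (contr W ws v (p i)) (ent i j a)) [] s)
        = (\<Sum>j<d. \<Sum>i<d. mt j (vr ws (contr W ws v (p i)) (ent i j a)) [] s)" by (rule sum.swap)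
    ultimately have "tr (dface \<tau> M' k w) - fc k (tr w)
        = (\<Sum>j<d. mt j (\<lambda>b. \<Sum>i<d. vr ws (contr W ws v (p i)) (ent i j a) b) [] s
        - (\<Sum>i<d. mt j (vr ws (contr W ws v (p i)) (ent i j a)) [] s))"
      by (simp only: sum_subtractf)
    also have "\<dots> \<in> Z n" by (rule zspan_sum) (use q1 a in simp)
    finally show ?thesis .
  next
    case 2
    obtain u a b s where uabs: "u = take (k - 1) as" "a = as ! (k - 1)" "b = as ! k" "s = drop (Suc k) as" by blast
    have s: "as = u @ a # b # s"
      using 2 len id_take_nth_drop[of "k - 1" as] id_take_nth_drop[of k as] by (simp add: uabs Cons_nth_drop_Suc)
    have lu: "Suc (length u) = k" using 2 len by (simp add: uabs)
    have mg: "merge k as = u @ (a * b) # s" by (simp add: merge_def uabs)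
    have "mt i (contr W ws v (p i)) [] (u @ (a * b) # s) - fc (Suc (length ([] :: 'k mpoly list) + length u)) (mt i (contr W ws v (p i)) [] (u @ a # b # s))
        \<in> Z (length ([] :: 'k mpoly list) + Suc (length u + length s))" if "i < d" for i
      by (rule fc_mid) (use that cv as s in auto)
    moreover have "Suc (length u + length s) = n" using len s by simp
    moreover have "dface \<tau> M' k w = (v, u @ (a * b) # s)" using 2 len mg by (simp add: v dface_def)
    ultimately show ?thesis
      using lu by (simp add: v tr_def fc_sum s flip: sum_subtractf) (rule zspan_sum, simp)
  next
    case 3
    obtain u a where s: "as = u @ [a]" using len by (cases as rule: rev_cases) auto
    have lu: "length u = n" using len s by simp
    have e: "contr W ws (\<lambda>b. \<tau> a * v b) g = (\<lambda>b. \<tau> a * contr W ws v g b)" for g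
      by (simp add: fun_eq_iff contr_mult_left)
    have "mt i (\<lambda>b. \<tau> a * contr W ws v (p i) b) [] u - fc (Suc (length ([] :: 'k mpoly list) + length u)) (mt i (contr W ws v (p i)) [] (u @ [a]))
        \<in> Z (length ([] :: 'k mpoly list) + length u)" if "i < d" for i
      by (rule fc_last) (use that cv as s in auto)
    moreover have "dface \<tau> M' k w = (\<lambda>b. \<tau> a * v b, u)" using 3 len s by (simp add: v dface_def)
    ultimately show ?thesis
      using lu 3 by (simp add: v tr_def fc_sum s e flip: sum_subtractf) (rule zspan_sum, simp)
  qed
qed

lemma tr_bd:
  assumes w: "w \<in> hw Rs M' (Suc n)"
  shows "frag_extend tr (bd \<tau> M' w) - frag_extend (bd \<tau> M) (tr w) \<in> Z n"
proof -
  have "length (snd w) = Suc n" using w by (cases w) (simp add: hoch_words_iff)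
  then have b: "bd \<tau> M' w = (\<Sum>k\<le>Suc n. frag_cmul ((-1) ^ k) (frag_of (dface \<tau> M' k w)))"
    by (auto simp: bd_def simp del: sum.atMost_Suc)
  have "frag_extend tr (bd \<tau> M' w) = (\<Sum>k\<le>Suc n. frag_cmul ((-1) ^ k) (tr (dface \<tau> M' k w)))"
    unfolding b by (simp add: frag_extend_sum frag_extend_cmul o_def del: sum.atMost_Suc)
  moreover have "frag_extend (bd \<tau> M) (tr w) = (\<Sum>k\<le>Suc n. frag_cmul ((-1) ^ k) (fc k (tr w)))"
    by (rule frag_extend_bd_faces[OF tr_closed[OF w]])
  ultimately have "frag_extend tr (bd \<tau> M' w) - frag_extend (bd \<tau> M) (tr w)
      = (\<Sum>k\<le>Suc n. frag_cmul ((-1) ^ k) (tr (dface \<tau> M' k w) - fc k (tr w)))"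
    by (simp only: frag_cmul_diff2 sum_subtractf)
  also have "\<dots> \<in> Z n" by (intro zspan_sum zspan_cmul tr_face[OF w]) simp
  finally show ?thesis .
qed

text \<open>For an invariant \<open>a\<close> the row 0 of its matrix is (a, 0, ..., 0), because eps
  of \<open>p j\<close> is 1 for j = 0 and 0 otherwise. Only the path that stays at 0 survives
  modulo relations.\<close>

lemma mt_const:
  assumes "m \<in> vcar N ws" "set pre \<subseteq> invariants ks" "set as \<subseteq> invariants ks"
  shows "mt 0 m pre as - frag_of (m, pre @ as) \<in> Z (length pre + length as)"
  using assms
proof (induction as arbitrary: pre)
  case Nil then show ?case by (simp add: x0 alg_homD[OF \<tau>(1)])
next
  case (Cons a as)
  have e: "ent 0 j a = (if j = 0 then a else 0)" if "j < d" for j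
  proof -
    have "ent 0 j a = eps W (p j * a)" by (simp add: ent_def x0 mult.commute)
    also have "\<dots> = eps W (p j) * a" using Cons.prems by (intro eps_mult_inv) simp
    finally show ?thesis using eps_p[OF that] by simp
  qed
  have "mt 0 m pre (a # as) = (\<Sum>j<d. mt j m (pre @ [if j = 0 then a else 0]) as)"
    by (simp add: e)
  also have "\<dots> = mt 0 m (pre @ [a]) as + (\<Sum>j\<in>{..<d} - {0}. mt j m (pre @ [0]) as)"
    using d0 by (subst sum.remove[of _ 0]) auto
  finally have 1: "mt 0 m pre (a # as) - frag_of (m, pre @ a # as)
      = (mt 0 m (pre @ [a]) as - frag_of (m, (pre @ [a]) @ as)) + (\<Sum>j\<in>{..<d} - {0}. mt j m (pre @ [0]) as)" by simp
  have 2: "mt 0 m (pre @ [a]) as - frag_of (m, (pre @ [a]) @ as) \<in> Z (length (pre @ [a]) + length as)"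
    by (rule Cons.IH) (use Cons.prems in auto)
  have 3: "mt j m (pre @ 0 # []) as \<in> Z (Suc (length pre + length ([] :: 'k mpoly list) + length as))" if "j < d" for j
    by (rule mt_slot_zero) (use Cons.prems that inv_R in auto)
  show ?case unfolding 1 by (rule zspan_add, use 2 in simp, rule zspan_sum, use 3 in simp)
qed

text \<open>The inclusion of rings together with \<open>pad\<close> is a chain map from the complex
  over the invariants to that over the polynomial ring, as invariants pass through all new tensor
  signs. The normalisation of the dual families makes \<open>tr\<close> a left inverse of
  it.\<close>

lemma acyclic_multitrace:
  assumes "acyclic_in_pos_deg \<tau> Rs M'"
  shows "acyclic_in_pos_deg \<tau> ks M"
proof (rule acyclic_transfer[where \<alpha>="push (pad (length W))" and \<beta>=tr, OF assms])
  let ?\<alpha> = "push (pad (length W)) :: (bool list \<Rightarrow> 'k mpoly) \<times> 'k mpoly list \<Rightarrow> _"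
  have inc: "set as \<subseteq> R" if "set as \<subseteq> invariants ks" for as using that inv_R by blast
  have pa: "pad (length W) (\<lambda>b. u b + v b) = (\<lambda>b. pad (length W) u b + pad (length W) v b)" for u v :: "bool list \<Rightarrow> 'k mpoly"
    by (simp add: fun_eq_iff pad_add)
  have pm: "pad (length W) (\<lambda>b. a * v b) = (\<lambda>b. a * pad (length W) v b)" for a and v :: "bool list \<Rightarrow> 'k mpoly"
    by (simp add: fun_eq_iff pad_mult)
  have pv: "vr (W @ ws) (pad (length W) v) a = pad (length W) (vr ws v a)" if "a \<in> invariants ks" for a :: "'k mpoly" and v
    by (rule ext, rule vr_pad) (rule sw_inv[OF _ that])
  show "keys (?\<alpha> w) \<subseteq> hw Rs M' n" if "w \<in> hw ks M n" for n w
    using that inc by (cases w) (auto simp: push_def hoch_words_iff R_eq pad_closed)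
  show "frag_extend ?\<alpha> r \<in> zspan (hrel Rs M' n)" if "r \<in> hrel ks M n" for n r
    using that
  proof (cases rule: hrel_cases)
    case (add_mod m m' as)
    have "frag_of (pad (length W) m \<otimes>\<^bsub>M'\<^esub> pad (length W) m', as) - frag_of (pad (length W) m, as) - frag_of (pad (length W) m', as)
        \<in> hrel Rs M' n"
      by (rule hrel_intros) (use add_mod inc in \<open>auto simp: hoch_words_iff R_eq pad_closed\<close>)
    then show ?thesis by (simp add: add_mod(3) frag_extend_diff push_def pa zspan_base)
  next
    case (add_alg m as i y y')
    have "frag_of (pad (length W) m, as[i := y + y']) - frag_of (pad (length W) m, as[i := y]) - frag_of (pad (length W) m, as[i := y'])
        \<in> hrel Rs M' n"
      by (rule hrel_intros) (use add_alg inc inv_R in \<open>auto simp: hoch_words_iff R_eq pad_closed\<close>)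
    then show ?thesis by (simp add: add_alg(5) frag_extend_diff push_def zspan_base)
  next
    case (scale m as i c)
    have "frag_of (lact M' (pconst c) (pad (length W) m), as) - frag_of (pad (length W) m, as[i := pconst c * as ! i])
        \<in> hrel Rs M' n"
      by (rule hrel_intros) (use scale inc inv_R in \<open>auto simp: hoch_words_iff R_eq pad_closed\<close>)
    then show ?thesis by (simp add: scale(3) frag_extend_diff push_def pm zspan_base)
  qed
  show "frag_extend ?\<alpha> (bd \<tau> M w) - frag_extend (bd \<tau> M') (?\<alpha> w) \<in> zspan (hrel Rs M' n)"
    if w: "w \<in> hw ks M (Suc n)" for n w
  proof -
    obtain m as where m: "w = (m, as)" by (cases w)
    have as: "length as = Suc n" "set as \<subseteq> invariants ks" using w by (auto simp: m hoch_words_iff)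
    then have "as \<noteq> []" by auto
    then have "hd as \<in> invariants ks" using hd_in_set[of as] as by blast
    then have "?\<alpha> (dface \<tau> M i w) = frag_of (dface \<tau> M' i (pad (length W) m, as))" for i
      by (auto simp: dface_def m push_def pv pm)
    then have "frag_extend ?\<alpha> (bd \<tau> M w) = frag_extend (bd \<tau> M') (?\<alpha> w)"
      using \<open>as \<noteq> []\<close> by (simp add: bd_def m push_def frag_extend_sum frag_extend_cmul o_def)
    then show ?thesis by simp
  qed
  show "frag_extend tr (?\<alpha> w) - frag_of w \<in> Z n" if w: "w \<in> hw ks M n" for n w
  proof -
    obtain m as where m: "w = (m, as)" by (cases w)
    have mas: "m \<in> vcar N ws" "length as = n" "set as \<subseteq> invariants ks" using w by (auto simp: m hoch_words_iff)
    have c: "contr W ws (pad (length W) m) (p i) = (if i = 0 then m else (\<lambda>b. 0))" if "i < d" for i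
    proof
      fix b
      have "vr ws m (pconst 1) b = pconst 1 * m b"
        by (rule vr_const_right) (use mas in \<open>simp add: vcar_def\<close>)
      then show "contr W ws (pad (length W) m) (p i) b = (if i = 0 then m else (\<lambda>b. 0)) b"
        by (simp add: contr_pad eps_p[OF that])
    qed
    have "tr (pad (length W) m, as) = (\<Sum>i<d. mt i (if i = 0 then m else (\<lambda>b. 0)) [] as)"
      by (simp add: tr_def c)
    also have "\<dots> = mt 0 m [] as + (\<Sum>i\<in>{..<d} - {0}. mt i (\<lambda>b. 0) [] as)"
      using d0 by (subst sum.remove[of _ 0]) auto
    finally have 1: "frag_extend tr (?\<alpha> w) - frag_of w = (mt 0 m [] as - frag_of (m, [] @ as)) + (\<Sum>i\<in>{..<d} - {0}. mt i (\<lambda>b. 0) [] as)"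
      by (simp add: m push_def)
    have 2: "mt 0 m [] as - frag_of (m, [] @ as) \<in> Z (length ([] :: 'k mpoly list) + length as)"
      by (rule mt_const) (use mas in auto)
    have 3: "mt i (\<lambda>b. 0) [] as \<in> Z (length ([] :: 'k mpoly list) + length as)" if "i < d" for i
      by (rule mt_zero) (use mas inc that in auto)
    show ?thesis unfolding 1 by (rule zspan_add, use 2 mas in simp, rule zspan_sum, use 3 mas in simp)
  qed
qed (rule tr_closed tr_hrel tr_bd; assumption)+

end

lemma acyclic_vmod_inv:
  assumes l: "nonroot (l :: 'k::comm_ring_1)" and N: "sum_list ks = N"
    and ws: "\<And>s. s \<in> set ws \<Longrightarrow> Suc s < N"
  shows "acyclic_in_pos_deg (scale_vars l) ks (vmod N (\<lambda>f. f) ws)"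
proof -
  obtain W d and x p :: "nat \<Rightarrow> 'k mpoly" where td: "trace_data N ks W d x p"
    using trace_data_exists[OF N] by blast
  interpret multitrace N ks W ws d x p "scale_vars l"
    by unfold_locales (use N td ws in \<open>auto simp: scale_vars_vars_in\<close>)
  have "(permute_vars (\<lambda>x. x) :: 'k mpoly \<Rightarrow> _) = (\<lambda>f. f)" by (simp add: fun_eq_iff)
  then have "acyclic_in_pos_deg (scale_vars l) (replicate N 1) (vmod N (\<lambda>f. f) (W @ ws))"
    using acyclic_vmod[OF l permutes_id[unfolded id_def], of "W @ ws" N] W by auto
  then show ?thesis by (rule acyclic_multitrace)
qed

section \<open>Singular Bott-Samelson bimodules as retracts\<close>

text \<open>Without gradings, induction and restriction factors look alike: each is a ring R^(L i)
  acted on by multiplication from the two neighbouring rings of the list \<open>cs\<close>. A choice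
  of \<open>trace_data\<close> is fixed for every composition.\<close>

locale bott_samelson =
  fixes N :: nat and ks :: "nat list" and cs :: "nat list list"
    and Ms :: "('k::comm_ring_1 mpoly, 'k mpoly, 'k mpoly) graded_bimod list"
    and L :: "nat \<Rightarrow> nat list" and Wf :: "nat list \<Rightarrow> nat list" and df :: "nat list \<Rightarrow> nat"
    and xf pf :: "nat list \<Rightarrow> nat \<Rightarrow> 'k mpoly"
  assumes ne: "Ms \<noteq> []" and len: "length cs = Suc (length Ms)" and c0: "cs ! 0 = ks" and cn: "cs ! length Ms = ks"
    and csN: "\<And>c. c \<in> set cs \<Longrightarrow> sum_list c = N"
    and td: "\<And>c. sum_list c = N \<Longrightarrow> trace_data N c (Wf c) (df c) (xf c) (pf c)"
    and LN: "\<And>i. i < length Ms \<Longrightarrow> sum_list (L i) = N"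
    and car: "\<And>i. i < length Ms \<Longrightarrow> carrier (Ms ! i) = invariants (L i)"
    and mul: "\<And>i x y. i < length Ms \<Longrightarrow> x \<otimes>\<^bsub>Ms ! i\<^esub> y = x + y"
    and lac: "\<And>i a m. i < length Ms \<Longrightarrow> lact (Ms ! i) a m = a * m"
    and rac: "\<And>i a m. i < length Ms \<Longrightarrow> ract (Ms ! i) m a = m * a"
    and sub: "\<And>i. i < length Ms \<Longrightarrow> (invariants (cs ! i) :: 'k mpoly set) \<subseteq> invariants (L i)"
      "\<And>i. i < length Ms \<Longrightarrow> (invariants (cs ! Suc i) :: 'k mpoly set) \<subseteq> invariants (L i)"
begin

abbreviation (input) "R \<equiv> vars_in {..<N} :: 'k mpoly set"
abbreviation "n \<equiv> length Ms"
abbreviation "c k \<equiv> cs ! Suc k"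

lemma cN: "k < n \<Longrightarrow> sum_list (c k) = N"
  by (rule csN) (simp add: len)

fun Wd :: "nat \<Rightarrow> nat list" where
  "Wd 0 = []"
| "Wd (Suc k) = Wf (c k) @ Wd k"

text \<open>The image of w_0 \<otimes> ... \<otimes> w_k in the model for the word
  \<open>Wd k\<close>: a tensor sign over the invariants of \<open>c k\<close> is replaced by tensor
  factors 1 for the letters of its trace, after which w_(k+1) acts from the right.\<close>

fun av :: "nat \<Rightarrow> 'k mpoly list \<Rightarrow> bool list \<Rightarrow> 'k mpoly" where
  "av 0 w = emb (w ! 0)"
| "av (Suc k) w = vr (Wd (Suc k)) (pad (length (Wf (c k))) (av k w)) (w ! Suc k)"

text \<open>The reverse map, which splits off one factor at a time by v |-> sum over a of contr(v,
  p_a) \<otimes> x_a. The list \<open>suf\<close> collects the factors already split off.\<close>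

fun be :: "nat \<Rightarrow> (bool list \<Rightarrow> 'k mpoly) \<Rightarrow> 'k mpoly list \<Rightarrow> 'k mpoly list \<Rightarrow>\<^sub>0 int" where
  "be 0 v suf = frag_of (v [] # suf)"
| "be (Suc k) v suf = (\<Sum>a<df (c k). be k (contr (Wf (c k)) (Wd k) v (pf (c k) a)) (xf (c k) a # suf))"

lemma trace_simps:
  assumes "sum_list e = N"
  shows "r \<in> R \<Longrightarrow> eps (Wf e) r \<in> invariants e" "j < df e \<Longrightarrow> xf e j \<in> R" "j < df e \<Longrightarrow> pf e j \<in> R"
    "r \<in> R \<Longrightarrow> (\<Sum>j<df e. eps (Wf e) (r * pf e j) * xf e j) = r" "eps (Wf e) (pf e 0) = 1" "0 < df e"
    "s \<in> set (Wf e) \<Longrightarrow> Suc s < N" "s \<in> set (Wf e) \<Longrightarrow> t \<in> invariants e \<Longrightarrow> sw s t = (t :: 'k mpoly)"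
    "(invariants e :: 'k mpoly set) \<subseteq> R"
  using td[OF assms] by (auto simp: trace_data_def adj_def assms invariants_eq fixed_by_def subset_iff)

lemma Wd_bound: "k < n \<Longrightarrow> s \<in> set (Wd k) \<Longrightarrow> Suc s < N"
proof (induction k)
  case (Suc k)
  have "sum_list (c k) = N" using cN Suc.prems(1) by simp
  from trace_simps(7)[OF this] show ?case using Suc by auto
qed simp

lemma av_closed: "k < n \<Longrightarrow> (\<And>i. i \<le> k \<Longrightarrow> w ! i \<in> R) \<Longrightarrow> av k w \<in> vcar N (Wd k)"
proof (induction k)
  case 0 then show ?case by (auto simp: vcar_Nil)
next
  case (Suc k)
  have "pad (length (Wf (c k))) (av k w) \<in> vcar N (Wf (c k) @ Wd k)"
    by (rule pad_closed) (use Suc in auto)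
  then show ?case
    unfolding av.simps by (intro vr_closed) (use Wd_bound[OF Suc.prems(1)] Suc.prems in auto)
qed

lemma av_irrelevant: "k < i \<Longrightarrow> av k (w[i := y]) = av k w"
  by (induction k) auto

lemma av_add:
  "i \<le> k \<Longrightarrow> i < length w \<Longrightarrow> av k (w[i := y + y']) b = av k (w[i := y]) b + av k (w[i := y']) b"
proof (induction k arbitrary: b)
  case 0 then show ?case by (simp add: emb_add)
next
  case (Suc k)
  show ?case
  proof (cases "i = Suc k")
    case True
    then show ?thesis using Suc.prems by (simp add: av_irrelevant vr_add_right del: Wd.simps)
  next
    case False
    then have "av k (w[i := y + y']) = (\<lambda>b. av k (w[i := y]) b + av k (w[i := y']) b)"
      using Suc by (auto simp: fun_eq_iff)
    moreover have "pad l (\<lambda>b. u b + v b) = (\<lambda>b. pad l u b + pad l v b)" for l and u v :: "bool list \<Rightarrow> 'k mpoly"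
      by (simp add: fun_eq_iff pad_add)
    ultimately show ?thesis using False by (simp add: vr_add_left del: Wd.simps)
  qed
qed

lemma av_left: "0 < length w \<Longrightarrow> av k (w[0 := a * w ! 0]) b = a * av k w b"
proof (induction k arbitrary: b)
  case 0 then show ?case by (simp add: emb_mult)
next
  case (Suc k)
  then have "av k (w[0 := a * w ! 0]) = (\<lambda>b. a * av k w b)" by (simp add: fun_eq_iff)
  moreover have "pad l (\<lambda>b. a * v b) = (\<lambda>b. a * pad l v b)" for l and v :: "bool list \<Rightarrow> 'k mpoly"
    by (simp add: fun_eq_iff pad_mult)
  ultimately show ?case by (simp add: vr_mult_left del: Wd.simps)
qed

lemma av_right: "k < length w \<Longrightarrow> av k (w[k := w ! k * t]) b = vr (Wd k) (av k w) t b"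
  by (cases k) (simp_all add: emb_def av_irrelevant vr_mult_right del: Wd.simps(2))

text \<open>Invariants of \<open>c i\<close> pass through the tensor factors adjoined for that
  tensor sign, by \<open>vr_pad\<close>.\<close>

lemma av_balanced:
  assumes "Suc i \<le> k" "k < n" "k < length w" "t \<in> invariants (c i)"
  shows "av k (w[i := w ! i * t]) b = av k (w[Suc i := t * w ! Suc i]) b"
  using assms(1-3)
proof (induction k arbitrary: b)
  case (Suc k)
  have ck: "sum_list (c k) = N" using cN Suc.prems by simp
  show ?case
  proof (cases "i = k")
    case True
    have 1: "av k (w[k := w ! k * t]) = vr (Wd k) (av k w) t"
      by (rule ext, rule av_right) (use Suc.prems in simp)
    have 2: "pad (length (Wf (c k))) (vr (Wd k) (av k w) t) = vr (Wf (c k) @ Wd k) (pad (length (Wf (c k))) (av k w)) t"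
      by (rule ext, rule vr_pad[symmetric], rule trace_simps(8)[OF ck], assumption)
        (use assms(4) True in simp)
    show ?thesis using True Suc.prems by (simp add: 1 2 av_irrelevant vr_mult_right)
  next
    case False
    then have "av k (w[i := w ! i * t]) = av k (w[Suc i := t * w ! Suc i])"
      using Suc by (auto simp: fun_eq_iff)
    then show ?thesis using False Suc.prems by simp
  qed
qed simp

text \<open>Relations of the tensor product over the same rings, but with all factors equal to the
  full polynomial ring. The map \<open>be\<close> takes values there, because the dual families do
  not lie in the smaller rings R^(L i); the projection \<open>pr\<close> leads back.\<close>

definition xrel :: "('k mpoly list \<Rightarrow>\<^sub>0 int) set" where
  "xrel = {frag_of (w[i := y + y']) - frag_of (w[i := y]) - frag_of (w[i := y']) | w i y y'.
      length w = n \<and> set w \<subseteq> R \<and> i < n \<and> y \<in> R \<and> y' \<in> R} \<union>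
    {frag_of (w[i := w ! i * t]) - frag_of (w[Suc i := t * w ! Suc i]) | w i t.
      length w = n \<and> set w \<subseteq> R \<and> Suc i < n \<and> t \<in> invariants (c i)}"

abbreviation "TX \<equiv> zspan xrel"

lemma xrel_intros:
  "length w = n \<Longrightarrow> set w \<subseteq> R \<Longrightarrow> i < n \<Longrightarrow> y \<in> R \<Longrightarrow> y' \<in> R \<Longrightarrow>
    frag_of (w[i := y + y']) - frag_of (w[i := y]) - frag_of (w[i := y']) \<in> TX"
  "length w = n \<Longrightarrow> set w \<subseteq> R \<Longrightarrow> Suc i < n \<Longrightarrow> t \<in> invariants (c i) \<Longrightarrow>
    frag_of (w[i := w ! i * t]) - frag_of (w[Suc i := t * w ! Suc i]) \<in> TX"
  by (rule zspan_base; auto simp: xrel_def)+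

lemma vcar_R: "v \<in> vcar N us \<Longrightarrow> v b \<in> R"
  by (simp add: vcar_def)

lemma contr_vc:
  "Suc k < n \<Longrightarrow> v \<in> vcar N (Wd (Suc k)) \<Longrightarrow> g \<in> R \<Longrightarrow> contr (Wf (c k)) (Wd k) v g \<in> vcar N (Wd k)"
  by (rule contr_closed) (use Wd_bound[of "Suc k"] in auto)

lemma be_suffix_add:
  assumes "k < n" "Suc k + length suf = n" "i < length suf" "v \<in> vcar N (Wd k)" "set suf \<subseteq> R" "y \<in> R" "y' \<in> R"
  shows "be k v (suf[i := y + y']) - be k v (suf[i := y]) - be k v (suf[i := y']) \<in> TX"
  using assms
proof (induction k arbitrary: v suf i)
  case 0
  have "frag_of ((v [] # suf)[Suc i := y + y']) - frag_of ((v [] # suf)[Suc i := y]) - frag_of ((v [] # suf)[Suc i := y']) \<in> TX"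
    by (rule xrel_intros) (use 0 in \<open>auto simp: vcar_R\<close>)
  then show ?case by simp
next
  case (Suc k)
  let ?v = "\<lambda>a. contr (Wf (c k)) (Wd k) v (pf (c k) a)"
  have "be k (?v a) ((xf (c k) a # suf)[Suc i := y + y']) - be k (?v a) ((xf (c k) a # suf)[Suc i := y])
      - be k (?v a) ((xf (c k) a # suf)[Suc i := y']) \<in> TX" if "a < df (c k)" for a
    by (rule Suc.IH) (use Suc.prems that trace_simps(2,3)[OF cN] in \<open>auto intro!: contr_vc\<close>)
  then show ?case by (simp flip: sum_subtractf) (rule zspan_sum, simp)
qed

lemma be_suffix_balanced:
  assumes "k < n" "Suc k + length suf = n" "Suc i < length suf" "v \<in> vcar N (Wd k)" "set suf \<subseteq> R"
    "t \<in> invariants (c (Suc k + i))"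
  shows "be k v (suf[i := suf ! i * t]) - be k v (suf[Suc i := t * suf ! Suc i]) \<in> TX"
  using assms
proof (induction k arbitrary: v suf i)
  case 0
  let ?w = "v [] # suf"
  have "frag_of (?w[Suc i := ?w ! Suc i * t]) - frag_of (?w[Suc (Suc i) := t * ?w ! Suc (Suc i)]) \<in> TX"
    by (rule xrel_intros) (use 0 in \<open>auto simp: vcar_R\<close>)
  then show ?case by simp
next
  case (Suc k)
  let ?v = "\<lambda>a. contr (Wf (c k)) (Wd k) v (pf (c k) a)"
  let ?s = "\<lambda>a. xf (c k) a # suf"
  have "be k (?v a) ((?s a)[Suc i := ?s a ! Suc i * t]) - be k (?v a) ((?s a)[Suc (Suc i) := t * ?s a ! Suc (Suc i)]) \<in> TX"
    if "a < df (c k)" for a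
    by (rule Suc.IH) (use Suc.prems that trace_simps(2,3)[OF cN] in \<open>auto intro!: contr_vc\<close>)
  then show ?case by (simp flip: sum_subtractf) (rule zspan_sum, simp)
qed

lemma be_add:
  assumes "k < n" "Suc k + length suf = n" "v \<in> vcar N (Wd k)" "v' \<in> vcar N (Wd k)" "set suf \<subseteq> R"
  shows "be k (\<lambda>b. v b + v' b) suf - be k v suf - be k v' suf \<in> TX"
  using assms
proof (induction k arbitrary: v v' suf)
  case 0
  have "frag_of ((0 # suf)[0 := v [] + v' []]) - frag_of ((0 # suf)[0 := v []]) - frag_of ((0 # suf)[0 := v' []]) \<in> TX"
    by (rule xrel_intros) (use 0 in \<open>auto simp: vcar_R\<close>)
  then show ?case by simp
next
  case (Suc k)
  have e: "contr (Wf (c k)) (Wd k) (\<lambda>b. v b + v' b) g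
      = (\<lambda>b. contr (Wf (c k)) (Wd k) v g b + contr (Wf (c k)) (Wd k) v' g b)" for g
    by (simp add: fun_eq_iff contr_add_left)
  let ?v = "\<lambda>v a. contr (Wf (c k)) (Wd k) v (pf (c k) a)"
  have "be k (\<lambda>b. ?v v a b + ?v v' a b) (xf (c k) a # suf) - be k (?v v a) (xf (c k) a # suf) - be k (?v v' a) (xf (c k) a # suf) \<in> TX"
    if "a < df (c k)" for a
    by (rule Suc.IH) (use Suc.prems that trace_simps(2,3)[OF cN] in \<open>auto intro!: contr_vc\<close>)
  then show ?case by (simp add: e flip: sum_subtractf) (rule zspan_sum, simp)
qed

lemma be_sum:
  assumes "finite A" "k < n" "Suc k + length suf = n" "\<And>a. a \<in> A \<Longrightarrow> v a \<in> vcar N (Wd k)" "set suf \<subseteq> R"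
  shows "be k (\<lambda>b. \<Sum>a\<in>A. v a b) suf - (\<Sum>a\<in>A. be k (v a) suf) \<in> TX"
  using assms(1,4)
proof (induction A rule: finite_induct)
  case empty
  have "be k (\<lambda>b. 0 + 0) suf - be k (\<lambda>b. 0) suf - be k (\<lambda>b. 0) suf \<in> TX"
    by (rule be_add) (use assms in \<open>auto simp: vcar_def\<close>)
  then show ?case using zspan_uminus[of "- be k (\<lambda>b. 0) suf" xrel] by simp
next
  case (insert a A)
  have s: "(\<lambda>b. \<Sum>a\<in>A. v a b) \<in> vcar N (Wd k)"
    using insert.prems by (auto simp: vcar_def intro!: vars_in_sum)
  have "(be k (\<lambda>b. v a b + (\<Sum>a\<in>A. v a b)) suf - be k (v a) suf - be k (\<lambda>b. \<Sum>a\<in>A. v a b) suf)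
      + (be k (\<lambda>b. \<Sum>a\<in>A. v a b) suf - (\<Sum>a\<in>A. be k (v a) suf)) \<in> TX"
    by (rule zspan_add[OF be_add]) (use insert s assms in auto)
  then show ?case using insert by (simp add: algebra_simps)
qed

lemma be_suffix_sum:
  assumes "finite A" "k < n" "Suc (Suc k) + length suf = n" "v \<in> vcar N (Wd k)" "set suf \<subseteq> R" "\<And>a. a \<in> A \<Longrightarrow> y a \<in> R"
  shows "be k v ((\<Sum>a\<in>A. y a) # suf) - (\<Sum>a\<in>A. be k v (y a # suf)) \<in> TX"
  using assms(1,6)
proof (induction A rule: finite_induct)
  case empty
  have "be k v ((0 # suf)[0 := 0 + 0]) - be k v ((0 # suf)[0 := 0]) - be k v ((0 # suf)[0 := 0]) \<in> TX"
    by (rule be_suffix_add) (use assms in auto)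
  then show ?case using zspan_uminus[of "- be k v (0 # suf)" xrel] by simp
next
  case (insert a A)
  have s: "(\<Sum>a\<in>A. y a) \<in> R" using insert.prems by (auto intro!: vars_in_sum)
  have "be k v ((0 # suf)[0 := y a + (\<Sum>a\<in>A. y a)]) - be k v ((0 # suf)[0 := y a]) - be k v ((0 # suf)[0 := \<Sum>a\<in>A. y a]) \<in> TX"
    by (rule be_suffix_add) (use insert s assms in auto)
  then have q: "be k v ((y a + (\<Sum>a\<in>A. y a)) # suf) - be k v (y a # suf) - be k v ((\<Sum>a\<in>A. y a) # suf) \<in> TX"
    by simp
  have "be k v ((\<Sum>a\<in>A. y a) # suf) - (\<Sum>a\<in>A. be k v (y a # suf)) \<in> TX"
    using insert.IH insert.prems by blast
  from zspan_add[OF q this] show ?case using insert.hyps by (simp add: algebra_simps)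
qed

text \<open>By \<open>contr_dual\<close> the contraction of v t with p_a is the sum over b of
  contr(v, p_b) e_ba, where (e_ba) is the matrix of t. Moving e_ba across the tensor sign by the
  premise on \<open>k\<close> and summing over a gives t x_b in the next factor.\<close>

lemma be_right_step:
  assumes k: "Suc k < n" and l: "Suc (Suc k) + length suf = n" and v: "v \<in> vcar N (Wd (Suc k))" and suf: "set suf \<subseteq> R"
    and t: "t \<in> R"
    and IH: "\<And>v e y. v \<in> vcar N (Wd k) \<Longrightarrow> e \<in> invariants (c k) \<Longrightarrow> y \<in> R \<Longrightarrow>
          be k (vr (Wd k) v e) (y # suf) - be k v (e * y # suf) \<in> TX"
  shows "be (Suc k) (vr (Wd (Suc k)) v t) suf
    - (\<Sum>a<df (c k). be k (contr (Wf (c k)) (Wd k) v (pf (c k) a)) (t * xf (c k) a # suf)) \<in> TX"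
proof -
  have ck: "sum_list (c k) = N" using cN k by simp
  note ts = trace_simps[OF ck]
  define u where "u a = contr (Wf (c k)) (Wd k) v (pf (c k) a)" for a
  define e where "e b a = eps (Wf (c k)) (t * xf (c k) b * pf (c k) a)" for b a
  have u: "u a \<in> vcar N (Wd k)" if "a < df (c k)" for a
    unfolding u_def by (rule contr_vc[OF k v ts(3)[OF that]])
  have e: "e b a \<in> invariants (c k)" if "a < df (c k)" "b < df (c k)" for a b
    unfolding e_def using that t by (intro ts vars_in_mult)
  have ve: "vr (Wd k) (u b) (e b a) \<in> vcar N (Wd k)" if "a < df (c k)" "b < df (c k)" for a b
    by (rule vr_closed) (use Wd_bound[of k] k u that e[OF that] ts(9) in auto)
  have c: "contr (Wf (c k)) (Wd k) (vr (Wd (Suc k)) v t) (pf (c k) a) = (\<lambda>x. \<Sum>b<df (c k). vr (Wd k) (u b) (e b a) x)"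
    if "a < df (c k)" for a
    by (rule ext) (simp only: Wd.simps contr_vr contr_dual[OF td[OF ck] t ts(3)[OF that]] u_def e_def)
  have 1: "be k (\<lambda>x. \<Sum>b<df (c k). vr (Wd k) (u b) (e b a) x) (xf (c k) a # suf)
      - (\<Sum>b<df (c k). be k (vr (Wd k) (u b) (e b a)) (xf (c k) a # suf)) \<in> TX" if "a < df (c k)" for a
    by (rule be_sum) (use that ve k l suf ts in auto)
  have 2: "be k (vr (Wd k) (u b) (e b a)) (xf (c k) a # suf) - be k (u b) (e b a * xf (c k) a # suf) \<in> TX"
    if "a < df (c k)" "b < df (c k)" for a b
    by (rule IH) (use that u e ts in auto)
  have 3: "be k (u b) ((\<Sum>a<df (c k). e b a * xf (c k) a) # suf) - (\<Sum>a<df (c k). be k (u b) (e b a * xf (c k) a # suf)) \<in> TX"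
    if "b < df (c k)" for b
    by (rule be_suffix_sum) (use that u e k l suf ts in \<open>auto intro!: vars_in_mult\<close>)
  have 4: "(\<Sum>a<df (c k). e b a * xf (c k) a) = t * xf (c k) b" if "b < df (c k)" for b
    unfolding e_def by (rule ts(4)) (use that t ts in \<open>auto intro!: vars_in_mult\<close>)
  have A: "be (Suc k) (vr (Wd (Suc k)) v t) suf - (\<Sum>a<df (c k). \<Sum>b<df (c k). be k (vr (Wd k) (u b) (e b a)) (xf (c k) a # suf)) \<in> TX"
    by (simp add: c del: Wd.simps flip: sum_subtractf) (rule zspan_sum, use 1 in simp)
  have B: "(\<Sum>a<df (c k). \<Sum>b<df (c k). be k (vr (Wd k) (u b) (e b a)) (xf (c k) a # suf))
      - (\<Sum>a<df (c k). \<Sum>b<df (c k). be k (u b) (e b a * xf (c k) a # suf)) \<in> TX"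
    unfolding sum_subtractf[symmetric] by (intro zspan_sum) (use 2 in simp)
  have C: "(\<Sum>b<df (c k). be k (u b) (t * xf (c k) b # suf)) - (\<Sum>b<df (c k). \<Sum>a<df (c k). be k (u b) (e b a * xf (c k) a # suf)) \<in> TX"
    unfolding sum_subtractf[symmetric] by (intro zspan_sum) (use 3 4 in simp)
  have D: "(\<Sum>a<df (c k). \<Sum>b<df (c k). be k (u b) (e b a * xf (c k) a # suf))
      = (\<Sum>b<df (c k). \<Sum>a<df (c k). be k (u b) (e b a * xf (c k) a # suf))" by (rule sum.swap)
  show ?thesis
    using zspan_trans[OF zspan_trans[OF A B] zspan_commute[OF C[folded D]]] by (simp only: u_def)
qed

text \<open>\<open>be_right_step\<close> moves t onto the last factor split off, from where it
  crosses the next tensor sign by a relation. The induction hypothesis is the balance needed one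
  sign to the left.\<close>

lemma be_balanced:
  assumes "k < n" "Suc (Suc k) + length suf = n" "v \<in> vcar N (Wd k)" "set suf \<subseteq> R" "y \<in> R" "t \<in> invariants (c k)"
  shows "be k (vr (Wd k) v t) (y # suf) - be k v (t * y # suf) \<in> TX"
  using assms
proof (induction k arbitrary: v suf y t)
  case 0
  let ?w = "v [] # y # suf"
  have "frag_of (?w[0 := ?w ! 0 * t]) - frag_of (?w[Suc 0 := t * ?w ! Suc 0]) \<in> TX"
    by (rule xrel_intros) (use 0 in \<open>auto simp: vcar_R\<close>)
  then show ?case by simp
next
  case (Suc k)
  have ck: "sum_list (c k) = N" "sum_list (c (Suc k)) = N" using cN Suc.prems by simp_all
  note ts = trace_simps[OF ck(1)]
  have tR: "t \<in> R" using Suc.prems trace_simps(9)[OF ck(2)] by blast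
  define u where "u a = contr (Wf (c k)) (Wd k) v (pf (c k) a)" for a
  have u: "u a \<in> vcar N (Wd k)" if "a < df (c k)" for a
    unfolding u_def by (rule contr_vc) (use Suc.prems ts that in auto)
  have A: "be (Suc k) (vr (Wd (Suc k)) v t) (y # suf) - (\<Sum>a<df (c k). be k (u a) (t * xf (c k) a # y # suf)) \<in> TX"
    unfolding u_def
  proof (rule be_right_step)
    show "be k (vr (Wd k) v' e) (y' # y # suf) - be k v' (e * y' # y # suf) \<in> TX"
      if "v' \<in> vcar N (Wd k)" "e \<in> invariants (c k)" "y' \<in> R" for v' e y'
      by (rule Suc.IH) (use Suc.prems that in auto)
  qed (use Suc.prems tR in auto)
  have "be k (u a) ((xf (c k) a # y # suf)[0 := (xf (c k) a # y # suf) ! 0 * t])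
      - be k (u a) ((xf (c k) a # y # suf)[Suc 0 := t * (xf (c k) a # y # suf) ! Suc 0]) \<in> TX" if "a < df (c k)" for a
    by (rule be_suffix_balanced) (use Suc.prems that u ts in auto)
  then have "(\<Sum>a<df (c k). be k (u a) (t * xf (c k) a # y # suf) - be k (u a) (xf (c k) a # t * y # suf)) \<in> TX"
    by (intro zspan_sum) (simp add: mult.commute)
  then have "(\<Sum>a<df (c k). be k (u a) (t * xf (c k) a # y # suf)) - be (Suc k) v (t * y # suf) \<in> TX"
    by (simp add: sum_subtractf u_def)
  from zspan_trans[OF A this] show ?case .
qed

text \<open>Contracting the adjoined factors of \<open>av\<close> with p_j leaves av k w acted on by
  eps(s p_j), where s is the next factor. These coefficients are invariant, cross the tensor sign
  and reassemble s from its expansion.\<close>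

lemma be_av:
  assumes "k < n" "length w = n" "set w \<subseteq> R"
  shows "be k (av k w) (drop (Suc k) w) - frag_of w \<in> TX"
  using assms
proof (induction k)
  case 0
  then have "w ! 0 # drop (Suc 0) w = w" by (simp add: Cons_nth_drop_Suc)
  then show ?case by simp
next
  case (Suc k)
  have ck: "sum_list (c k) = N" using cN Suc.prems by simp
  note ts = trace_simps[OF ck]
  have w: "w ! i \<in> R" if "i < n" for i using Suc.prems that by (auto simp: subset_iff)
  have sf: "set (drop (Suc (Suc k)) w) \<subseteq> R" using Suc.prems by (auto dest: in_set_dropD)
  have a: "av k w \<in> vcar N (Wd k)" by (rule av_closed) (use Suc.prems w in auto)
  let ?s = "w ! Suc k" and ?suf = "drop (Suc (Suc k)) w"
  define e where "e j = eps (Wf (c k)) (?s * pf (c k) j)" for j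
  have e: "e j \<in> invariants (c k)" if "j < df (c k)" for j
    unfolding e_def using that w Suc.prems by (intro ts vars_in_mult) auto
  have c: "contr (Wf (c k)) (Wd k) (av (Suc k) w) (pf (c k) j) = vr (Wd k) (av k w) (e j)" for j
    by (rule ext) (simp add: contr_vr contr_pad e_def)
  have 1: "be (Suc k) (av (Suc k) w) ?suf = (\<Sum>j<df (c k). be k (vr (Wd k) (av k w) (e j)) (xf (c k) j # ?suf))"
    by (simp only: be.simps c)
  have 2: "\<dots> - (\<Sum>j<df (c k). be k (av k w) (e j * xf (c k) j # ?suf)) \<in> TX"
    unfolding sum_subtractf[symmetric]
    by (rule zspan_sum, rule be_balanced) (use Suc.prems a sf ts e in auto)
  have 3: "be k (av k w) ((\<Sum>j<df (c k). e j * xf (c k) j) # ?suf) - (\<Sum>j<df (c k). be k (av k w) (e j * xf (c k) j # ?suf)) \<in> TX"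
    by (rule be_suffix_sum) (use Suc.prems a sf ts e in \<open>auto intro!: vars_in_mult\<close>)
  have 4: "(\<Sum>j<df (c k). e j * xf (c k) j) = ?s" unfolding e_def using w Suc.prems by (intro ts(4)) auto
  have 5: "?s # ?suf = drop (Suc k) w" using Suc.prems by (simp add: Cons_nth_drop_Suc)
  have "be (Suc k) (av (Suc k) w) ?suf - be k (av k w) (drop (Suc k) w) \<in> TX"
    unfolding 1 using zspan_trans[OF 2 zspan_commute[OF 3]] by (simp only: 4 5)
  moreover have "be k (av k w) (drop (Suc k) w) - frag_of w \<in> TX" using Suc by simp
  ultimately show ?case by (rule zspan_trans)
qed

lemma be_left:
  "be k (\<lambda>b. a * v b) suf = frag_extend (\<lambda>w. frag_of (w[0 := a * w ! 0])) (be k v suf)"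
proof (induction k arbitrary: v suf)
  case (Suc k)
  have "contr (Wf (c k)) (Wd k) (\<lambda>b. a * v b) g = (\<lambda>b. a * contr (Wf (c k)) (Wd k) v g b)" for g
    by (simp add: fun_eq_iff contr_mult_left)
  then show ?case by (simp add: Suc frag_extend_sum o_def)
qed simp

lemma be_last_slot:
  "length suf = Suc m \<Longrightarrow> be k v (suf[m := suf ! m * t])
    = frag_extend (\<lambda>w. frag_of (w[k + Suc m := w ! (k + Suc m) * t])) (be k v suf)"
proof (induction k arbitrary: v suf m)
  case (Suc k)
  have "be k u ((y # suf)[Suc m := (y # suf) ! Suc m * t])
      = frag_extend (\<lambda>w. frag_of (w[k + Suc (Suc m) := w ! (k + Suc (Suc m)) * t])) (be k u (y # suf))" for u y
    by (rule Suc.IH) (use Suc.prems in simp)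
  then show ?case by (simp add: frag_extend_sum o_def)
qed simp

lemma be_right:
  assumes v: "v \<in> vcar N (Wd (n - 1))" and t: "t \<in> R"
  shows "be (n - 1) (vr (Wd (n - 1)) v t) []
    - frag_extend (\<lambda>w. frag_of (w[n - 1 := w ! (n - 1) * t])) (be (n - 1) v []) \<in> TX"
proof (cases "n - 1")
  case 0 then show ?thesis by simp
next
  case (Suc k)
  have A: "be (Suc k) (vr (Wd (Suc k)) v t) [] - (\<Sum>a<df (c k). be k (contr (Wf (c k)) (Wd k) v (pf (c k) a)) [t * xf (c k) a]) \<in> TX"
    by (rule be_right_step) (use Suc v t be_balanced[of k "[]"] in auto)
  have "be k u [t * y] = frag_extend (\<lambda>w. frag_of (w[Suc k := w ! Suc k * t])) (be k u [y])" for u y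
    using be_last_slot[of "[y]" 0 k u t] by (simp add: mult.commute)
  then show ?thesis using A unfolding Suc by (simp add: frag_extend_sum o_def del: Wd.simps)
qed

lemma keys_be:
  assumes "k < n" "Suc k + length suf = n" "v \<in> vcar N (Wd k)" "set suf \<subseteq> R"
  shows "keys (be k v suf) \<subseteq> {w. length w = n \<and> set w \<subseteq> R}"
  using assms
proof (induction k arbitrary: v suf)
  case 0 then show ?case by (auto simp: vcar_R)
next
  case (Suc k)
  have "keys (be k (contr (Wf (c k)) (Wd k) v (pf (c k) a)) (xf (c k) a # suf)) \<subseteq> {w. length w = n \<and> set w \<subseteq> R}"
    if "a < df (c k)" for a
    by (rule Suc.IH) (use Suc.prems that trace_simps(2,3)[OF cN] in \<open>auto intro!: contr_vc\<close>)
  then show ?case unfolding be.simps by (intro keys_sum_subset) auto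
qed

end

lemma vr_fsum:
  fixes f :: "'w \<Rightarrow> bool list \<Rightarrow> 'k::comm_ring_1 mpoly"
  shows "vr ws (\<lambda>b. fsum (\<lambda>w. f w b) c) g b = fsum (\<lambda>w. vr ws (f w) g b) c"
proof (rule frag_induction[of c UNIV])
  fix a b' :: "'w \<Rightarrow>\<^sub>0 int"
  assume h: "vr ws (\<lambda>b. fsum (\<lambda>w. f w b) a) g b = fsum (\<lambda>w. vr ws (f w) g b) a"
    "vr ws (\<lambda>b. fsum (\<lambda>w. f w b) b') g b = fsum (\<lambda>w. vr ws (f w) g b) b'"
  have "vr ws (\<lambda>b. fsum (\<lambda>w. f w b) (a - b') + fsum (\<lambda>w. f w b) b') g b = vr ws (\<lambda>b. fsum (\<lambda>w. f w b) a) g b"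
    by (simp add: fsum_diff)
  then show "vr ws (\<lambda>b. fsum (\<lambda>w. f w b) (a - b')) g b = fsum (\<lambda>w. vr ws (f w) g b) (a - b')"
    unfolding vr_add_left by (simp add: h fsum_diff algebra_simps)
qed simp_all

lemma vcar_add: "u \<in> vcar N ws \<Longrightarrow> v \<in> vcar N ws \<Longrightarrow> (\<lambda>b. u b + v b) \<in> vcar N ws"
  and vcar_diff: "u \<in> vcar N ws \<Longrightarrow> v \<in> vcar N ws \<Longrightarrow> (\<lambda>b. u b - v b) \<in> vcar N ws"
  and vcar_0: "(\<lambda>b. 0) \<in> vcar N ws"
  by (auto simp: vcar_def intro: vars_in_intros)

lemma keys_diff_subset: "keys a \<subseteq> S \<Longrightarrow> keys b \<subseteq> S \<Longrightarrow> keys (a - b :: 'a \<Rightarrow>\<^sub>0 int) \<subseteq> S"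
  using keys_diff[of a b] by blast

context bott_samelson
begin

abbreviation (input) "SY \<equiv> tensor_words Ms"
abbreviation (input) "RY \<equiv> tensor_rels (map inv_ring cs :: ('k, 'k mpoly) graded_alg list) Ms"
abbreviation (input) "Y \<equiv> tensor (map inv_ring cs :: ('k, 'k mpoly) graded_alg list) Ms"

lemma n0: "0 < n" using ne by simp

lemma SY_iff: "w \<in> SY \<longleftrightarrow> length w = n \<and> (\<forall>i<n. w ! i \<in> invariants (L i))"
  by (auto simp: tensor_words_def car)

lemma LR: "i < n \<Longrightarrow> (invariants (L i) :: 'k mpoly set) \<subseteq> R"
  using trace_simps(9)[OF LN] .

lemma SY_R: "w \<in> SY \<Longrightarrow> length w = n \<and> set w \<subseteq> R"
  using LR[THEN subsetD] unfolding SY_iff in_set_conv_nth subset_iff by metis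

lemma SY_update: "w \<in> SY \<Longrightarrow> i < n \<Longrightarrow> x \<in> invariants (L i) \<Longrightarrow> w[i := x] \<in> SY"
  by (auto simp: SY_iff nth_list_update)

lemma cL: "i < n \<Longrightarrow> t \<in> invariants (c i) \<Longrightarrow> (t :: 'k mpoly) \<in> invariants (L i)"
  "Suc i < n \<Longrightarrow> t \<in> invariants (c i) \<Longrightarrow> (t :: 'k mpoly) \<in> invariants (L (Suc i))"
  using sub by blast+

lemma ksL: "t \<in> invariants ks \<Longrightarrow> (t :: 'k mpoly) \<in> invariants (L 0)"
  "t \<in> invariants ks \<Longrightarrow> (t :: 'k mpoly) \<in> invariants (L (n - 1))"
proof -
  assume t: "t \<in> invariants ks"
  show "t \<in> invariants (L 0)" using sub(1)[OF n0, unfolded c0] t by (rule subsetD)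
  have s: "Suc (n - 1) = n" and l: "n - 1 < n" using n0 by linarith+
  show "t \<in> invariants (L (n - 1))" using sub(2)[OF l, unfolded s cn] t by (rule subsetD)
qed

lemma RY_intros:
  "w \<in> SY \<Longrightarrow> i < n \<Longrightarrow> x \<in> invariants (L i) \<Longrightarrow> y \<in> invariants (L i) \<Longrightarrow>
    frag_of (w[i := x + y]) - frag_of (w[i := x]) - frag_of (w[i := y]) \<in> zspan RY"
  "w \<in> SY \<Longrightarrow> Suc i < n \<Longrightarrow> t \<in> invariants (c i) \<Longrightarrow>
    frag_of (w[i := w ! i * t]) - frag_of (w[Suc i := t * w ! Suc i]) \<in> zspan RY"
proof (goal_cases)
  case 1
  have "w[i := x + y] = w[i := x \<otimes>\<^bsub>Ms ! i\<^esub> y]" using 1 by (simp add: mul)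
  then have "frag_of (w[i := x + y]) - frag_of (w[i := x]) - frag_of (w[i := y]) \<in> RY"
    unfolding tensor_rels_def using 1 car[of i]
    by (intro UnI1 CollectI exI[of _ w] exI[of _ i] exI[of _ x] exI[of _ y]) simp
  then show ?case by (rule zspan_base)
next
  case 2
  have e: "w[i := w ! i * t] = w[i := ract (Ms ! i) (w ! i) t]" "w[Suc i := t * w ! Suc i] = w[Suc i := lact (Ms ! Suc i) t (w ! Suc i)]"
    using 2 by (simp_all add: lac rac)
  have "t \<in> carrier ((map inv_ring cs :: ('k, 'k mpoly) graded_alg list) ! Suc i)" using 2 len by simp
  then have "frag_of (w[i := w ! i * t]) - frag_of (w[Suc i := t * w ! Suc i]) \<in> RY"
    unfolding tensor_rels_def e using 2 by (intro UnI2 CollectI exI[of _ w] exI[of _ i] exI[of _ t]) simp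
  then show ?case by (rule zspan_base)
qed

lemma RY_cases [consumes 1, case_names add bal]:
  assumes "r \<in> RY"
  obtains w i x y where "w \<in> SY" "i < n" "x \<in> invariants (L i)" "y \<in> invariants (L i)"
      "r = frag_of (w[i := x + y]) - frag_of (w[i := x]) - frag_of (w[i := y])"
  | w i t where "w \<in> SY" "Suc i < n" "t \<in> invariants (c i)"
      "r = frag_of (w[i := w ! i * t]) - frag_of (w[Suc i := t * w ! Suc i])"
  using assms unfolding tensor_rels_def
proof (elim UnE CollectE exE conjE, goal_cases)
  case (1 w i x y)
  show ?case by (rule 1(1)[of w i x y]) (use 1(3-) in \<open>auto simp: car mul\<close>)
next
  case (2 w i a)
  show ?case by (rule 2(2)[of w i a]) (use 2(3-) len in \<open>auto simp: rac lac\<close>)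
qed

lemma RY_keys: "r \<in> RY \<Longrightarrow> keys r \<subseteq> SY"
proof (induction rule: RY_cases)
  case (add w i x y)
  then have "w[i := z] \<in> SY" if "z \<in> {x, y, x + y}" for z
    using that by (intro SY_update) (auto intro: invariants_intros)
  then show ?case unfolding add(5) by (intro keys_diff_subset) simp_all
next
  case (bal w i t)
  then have "w ! i * t \<in> invariants (L i)" "t * w ! Suc i \<in> invariants (L (Suc i))"
    using cL[of i t] by (auto simp: SY_iff intro!: invariants_intros(3))
  then have "w[i := w ! i * t] \<in> SY" "w[Suc i := t * w ! Suc i] \<in> SY"
    using bal by (simp_all add: SY_update)
  then show ?case unfolding bal(4) by (intro keys_diff_subset) simp_all
qed

text \<open>Since all rings are commutative, multiplying one slot by an element of its ring respects
  the relations. It is applied to the outer slots, where it gives the two actions on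
  classes.\<close>

lemma slot_RY:
  assumes p: "p < n" and a: "a \<in> invariants (L p)" and "r \<in> RY"
  shows "frag_extend (\<lambda>w. frag_of (w[p := a * w ! p])) r \<in> zspan RY"
  using assms(3)
proof (cases rule: RY_cases)
  case (add w i x y)
  let ?w = "w[p := a * w ! p]"
  have l: "length w = n" using add by (simp add: SY_iff)
  have w: "?w \<in> SY" using add(1) p a by (intro SY_update) (auto simp: SY_iff intro!: invariants_intros)
  show ?thesis
  proof (cases "i = p")
    case True
    have "frag_of (w[p := a * x + a * y]) - frag_of (w[p := a * x]) - frag_of (w[p := a * y]) \<in> zspan RY"
      by (rule RY_intros) (use add a p True in \<open>auto intro!: invariants_intros\<close>)
    then show ?thesis using add True l p by (simp add: frag_extend_diff distrib_left)
  next
    case False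
    have "frag_of (?w[i := x + y]) - frag_of (?w[i := x]) - frag_of (?w[i := y]) \<in> zspan RY"
      by (rule RY_intros) (use add w in auto)
    then show ?thesis using add False by (simp add: frag_extend_diff list_update_swap)
  qed
next
  case (bal w i t)
  let ?w = "w[p := a * w ! p]"
  have l: "length w = n" using bal by (simp add: SY_iff)
  have w: "?w \<in> SY" using bal(1) p a by (intro SY_update) (auto simp: SY_iff intro!: invariants_intros)
  have 1: "(w[i := w ! i * t])[p := a * w[i := w ! i * t] ! p] = ?w[i := ?w ! i * t]"
    by (rule nth_equalityI) (use l p bal(2) in \<open>auto simp: nth_list_update algebra_simps\<close>)
  have 2: "(w[Suc i := t * w ! Suc i])[p := a * w[Suc i := t * w ! Suc i] ! p] = ?w[Suc i := t * ?w ! Suc i]"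
    by (rule nth_equalityI) (use l p bal(2) in \<open>auto simp: nth_list_update algebra_simps\<close>)
  show ?thesis using RY_intros(2)[OF w bal(2,3)] unfolding bal(4) by (simp only: frag_extend_diff frag_extend_of 1 2)
qed

lemma fsum_av_RY: "r \<in> RY \<Longrightarrow> fsum (\<lambda>w. av (n - 1) w b) r = 0"
proof (induction rule: RY_cases)
  case (add w i x y)
  then show ?case by (simp add: fsum_diff SY_iff av_add)
next
  case (bal w i t)
  have "av (n - 1) (w[i := w ! i * t]) b = av (n - 1) (w[Suc i := t * w ! Suc i]) b"
    by (rule av_balanced) (use bal in \<open>auto simp: SY_iff\<close>)
  then show ?case using bal by (simp add: fsum_diff)
qed

lemma Y_simps:
  "carrier Y = {cls RY c |c. keys c \<subseteq> SY}"
  "keys u \<subseteq> SY \<Longrightarrow> keys v \<subseteq> SY \<Longrightarrow> cls RY u \<otimes>\<^bsub>Y\<^esub> cls RY v = cls RY (u + v)"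
  "\<one>\<^bsub>Y\<^esub> = cls RY 0"
  "a \<in> invariants ks \<Longrightarrow> lact Y a (cls RY u) = cls RY (frag_extend (\<lambda>w. frag_of (w[0 := a * w ! 0])) u)"
  "a \<in> invariants ks \<Longrightarrow> ract Y (cls RY u) a = cls RY (frag_extend (\<lambda>w. frag_of (w[n - 1 := a * w ! (n - 1)])) u)"
proof (goal_cases)
  case 1 show ?case by (simp add: tensor_def Let_def carrier_pres_group[OF RY_keys])
next
  case 2 then show ?case by (simp add: tensor_def Let_def cls_mult[OF RY_keys])
next
  case 3 show ?case by (simp add: tensor_def Let_def one_pres_group[OF RY_keys])
next
  case 4
  show ?case using pres_map_cls[OF RY_keys RY_keys slot_RY[OF n0 ksL(1)[OF 4]]]
    by (simp add: tensor_def Let_def lac[OF n0])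
next
  case 5
  have l: "n - 1 < n" using n0 by simp
  show ?case using pres_map_cls[OF RY_keys RY_keys slot_RY[OF l ksL(2)[OF 5]]] rac[OF l]
    by (simp add: tensor_def Let_def mult.commute)
qed

lemma comm_group_Y: "comm_group Y"
proof -
  have "comm_group (pres_group SY RY)" by (rule comm_group_pres_group[OF RY_keys])
  moreover have "comm_group (pres_group SY RY) = comm_group Y"
    unfolding comm_group_def comm_monoid_def comm_monoid_axioms_def group_def group_axioms_def
      monoid_def Units_def by (simp add: tensor_def Let_def)
  ultimately show ?thesis by simp
qed

lemma Y_one_act: "a \<in> invariants ks \<Longrightarrow> lact Y a \<one>\<^bsub>Y\<^esub> = \<one>\<^bsub>Y\<^esub>" "a \<in> invariants ks \<Longrightarrow> ract Y \<one>\<^bsub>Y\<^esub> a = \<one>\<^bsub>Y\<^esub>"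
  by (simp_all add: Y_simps)

text \<open>A projection of the polynomial ring onto R^(L i), linear over R^(L i); it fixes that
  ring because \<open>p 0\<close> has trace 1.\<close>

definition pj :: "nat \<Rightarrow> 'k mpoly \<Rightarrow> 'k mpoly" where "pj i f = eps (Wf (L i)) (f * pf (L i) 0)"
definition pw :: "'k mpoly list \<Rightarrow> 'k mpoly list" where "pw w = map (\<lambda>i. pj i (w ! i)) [0..<n]"

lemma pj_add: "pj i (f + g) = pj i f + pj i g"
  by (simp add: pj_def distrib_right eps_add)

lemma pj_mult:
  assumes "i < n" "t \<in> invariants (L i)" shows "pj i (t * f) = t * pj i f"
proof -
  have "eps (Wf (L i)) (f * pf (L i) 0 * t) = eps (Wf (L i)) (f * pf (L i) 0) * t"
    by (rule eps_mult_right) (use trace_simps(8)[OF LN] assms in auto)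
  then show ?thesis by (simp add: pj_def algebra_simps)
qed

lemma pj_fix: "i < n \<Longrightarrow> t \<in> invariants (L i) \<Longrightarrow> pj i t = t"
  using pj_mult[of i t 1] trace_simps(5)[OF LN] by (simp add: pj_def)

lemma pj_inv: "i < n \<Longrightarrow> f \<in> R \<Longrightarrow> pj i f \<in> invariants (L i)"
  unfolding pj_def using LN trace_simps by (intro trace_simps(1)) (auto intro!: vars_in_mult)

lemma length_pw: "length (pw w) = n" and nth_pw: "i < n \<Longrightarrow> pw w ! i = pj i (w ! i)"
  by (simp_all add: pw_def)

lemma pw_SY: "length w = n \<Longrightarrow> set w \<subseteq> R \<Longrightarrow> pw w \<in> SY"
  by (auto simp: SY_iff length_pw nth_pw subset_iff intro!: pj_inv)

lemma pw_fix: "w \<in> SY \<Longrightarrow> pw w = w"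
  by (rule nth_equalityI) (auto simp: length_pw nth_pw SY_iff pj_fix)

lemma pw_update: "length w = n \<Longrightarrow> pw (w[i := x]) = (pw w)[i := pj i x]"
  by (rule nth_equalityI) (cases "i < n"; auto simp: length_pw nth_pw nth_list_update)+

lemma pw_slot: "length w = n \<Longrightarrow> i < n \<Longrightarrow> t \<in> invariants (L i) \<Longrightarrow> pw (w[i := t * w ! i]) = (pw w)[i := t * pw w ! i]"
  by (simp add: pw_update pj_mult nth_pw)

abbreviation "pr \<equiv> frag_extend (\<lambda>w. frag_of (pw w))"

text \<open>An invariant of \<open>c i\<close> lies in the rings of both neighbouring factors, so
  the projections on either side are linear over it and respect balancing.\<close>

lemma pr_xrel:
  assumes "r \<in> xrel" shows "pr r \<in> zspan RY"
proof -
  consider w i y y' where "length w = n" "set w \<subseteq> R" "i < n" "y \<in> R" "y' \<in> R"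
      "r = frag_of (w[i := y + y']) - frag_of (w[i := y]) - frag_of (w[i := y'])"
    | w i t where "length w = n" "set w \<subseteq> R" "Suc i < n" "t \<in> invariants (c i)"
      "r = frag_of (w[i := w ! i * t]) - frag_of (w[Suc i := t * w ! Suc i])"
    using assms unfolding xrel_def by blast
  then show ?thesis
  proof cases
    case 1
    show ?thesis using RY_intros(1)[OF pw_SY[OF 1(1,2)] 1(3) pj_inv[OF 1(3,4)] pj_inv[OF 1(3,5)]]
      unfolding 1(6) by (simp only: frag_extend_diff frag_extend_of pw_update[OF 1(1)] pj_add)
  next
    case 2
    have i: "i < n" using 2 by simp
    have "pw (w[i := w ! i * t]) = (pw w)[i := pw w ! i * t]"
      using pw_slot[OF 2(1) i cL(1)[OF i 2(4)]] by (simp add: mult.commute)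
    then show ?thesis using RY_intros(2)[OF pw_SY[OF 2(1,2)] 2(3,4)]
      unfolding 2(5) by (simp only: frag_extend_diff frag_extend_of pw_slot[OF 2(1,3) cL(2)[OF 2(3,4)]])
  qed
qed

lemma pr_TX: "u \<in> TX \<Longrightarrow> pr u \<in> zspan RY"
  by (erule zspan_map) (rule pr_xrel)

text \<open>An arbitrary representative may be chosen, since the value vanishes on relations
  (\<open>fsum_av_RY\<close>).\<close>

definition F :: "('k mpoly list \<Rightarrow>\<^sub>0 int) set \<Rightarrow> bool list \<Rightarrow> 'k mpoly" where
  "F K = (\<lambda>b. fsum (\<lambda>w. av (n - 1) w b) (SOME c. c \<in> K))"

definition G :: "(bool list \<Rightarrow> 'k mpoly) \<Rightarrow> ('k mpoly list \<Rightarrow>\<^sub>0 int) set" where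
  "G v = cls RY (pr (be (n - 1) v []))"

declare One_nat_def [simp del]

lemma F_cls: "F (cls RY u) = (\<lambda>b. fsum (\<lambda>w. av (n - 1) w b) u)"
proof
  fix b
  have "(SOME c. c \<in> cls RY u) \<in> cls RY u" using someI[of "\<lambda>c. c \<in> cls RY u"] cls_self by blast
  then have "fsum (\<lambda>w. av (n - 1) w b) ((SOME c. c \<in> cls RY u) - u) = 0"
    unfolding mem_cls by (rule fsum_zspan) (rule fsum_av_RY)
  then show "F (cls RY u) b = fsum (\<lambda>w. av (n - 1) w b) u" by (simp add: F_def fsum_diff)
qed

lemma av_SY: "w \<in> SY \<Longrightarrow> av (n - 1) w \<in> vcar N (Wd (n - 1))"
proof (rule av_closed)
  assume w: "w \<in> SY"
  show "w ! i \<in> R" if "i \<le> n - 1" for i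
  proof -
    have "i < n" using that n0 by linarith
    then show ?thesis using SY_R[OF w] nth_mem[of i w] by auto
  qed
qed (use n0 in linarith)

lemma fsum_av_closed:
  assumes "keys u \<subseteq> SY" shows "(\<lambda>b. fsum (\<lambda>w. av (n - 1) w b) u) \<in> vcar N (Wd (n - 1))"
  using assms
proof (induction u rule: frag_induction)
  case (diff a b) then show ?case by (simp add: fsum_diff vcar_diff)
qed (use vcar_0 av_SY in simp_all)

lemma F_bimod_map: "bimod_map ks Y (vmod N (\<lambda>f. f) (Wd (n - 1))) F"
  unfolding bimod_map_def
proof (intro conjI ballI)
  fix m assume "m \<in> carrier Y"
  then obtain u where m: "m = cls RY u" and u: "keys u \<subseteq> SY" by (auto simp: Y_simps)
  show "F m \<in> carrier (vmod N (\<lambda>f. f) (Wd (n - 1)))" by (simp add: m F_cls fsum_av_closed u)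
  show "F (m \<otimes>\<^bsub>Y\<^esub> m') = F m \<otimes>\<^bsub>vmod N (\<lambda>f. f) (Wd (n - 1))\<^esub> F m'" if "m' \<in> carrier Y" for m'
    using that u by (auto simp: Y_simps m F_cls fsum_add)
  fix a :: "'k mpoly" assume a: "a \<in> invariants ks"
  have "fsum (\<lambda>w. av (n - 1) (w[0 := a * w ! 0]) b) u = fsum (\<lambda>w. a * av (n - 1) w b) u" for b
    by (rule fsum_cong, rule av_left) (use u n0 SY_iff in auto)
  then show "F (lact Y a m) = lact (vmod N (\<lambda>f. f) (Wd (n - 1))) a (F m)"
    using a by (simp add: m Y_simps F_cls fsum_frag_extend fsum_mult_left)
  have "fsum (\<lambda>w. av (n - 1) (w[n - 1 := w ! (n - 1) * a]) b) u = fsum (\<lambda>w. vr (Wd (n - 1)) (av (n - 1) w) a b) u" for b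
    by (rule fsum_cong, rule av_right) (use u n0 SY_iff in auto)
  then show "F (ract Y m a) = ract (vmod N (\<lambda>f. f) (Wd (n - 1))) (F m) a"
    using a by (simp add: m Y_simps F_cls fsum_frag_extend vr_fsum fun_eq_iff mult.commute)
qed

lemma keys_pr: "keys u \<subseteq> {w. length w = n \<and> set w \<subseteq> R} \<Longrightarrow> keys (pr u) \<subseteq> SY"
  by (rule keys_frag_extend_subset) (use pw_SY in auto)

lemma pr_slot:
  assumes "keys u \<subseteq> {w. length w = n \<and> set w \<subseteq> R}" "p < n" "a \<in> invariants (L p)"
  shows "pr (frag_extend (\<lambda>w. frag_of (w[p := a * w ! p])) u) = frag_extend (\<lambda>w. frag_of (w[p := a * w ! p])) (pr u)"
  unfolding frag_extend_comp by (rule frag_extend_eq) (use assms pw_slot in auto)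

lemma keys_be_last: "v \<in> vcar N (Wd (n - 1)) \<Longrightarrow> keys (be (n - 1) v []) \<subseteq> {w. length w = n \<and> set w \<subseteq> R}"
  by (rule keys_be) (use n0 in auto)

lemma G_bimod_map: "bimod_map ks (vmod N (\<lambda>f. f) (Wd (n - 1))) Y G"
  unfolding bimod_map_def vmod_simps
proof (intro conjI ballI)
  fix v :: "bool list \<Rightarrow> 'k mpoly" assume v: "v \<in> vcar N (Wd (n - 1))"
  note kv = keys_be_last[OF v]
  show "G v \<in> carrier Y" using keys_pr[OF kv] by (auto simp: G_def Y_simps)
  show "G (\<lambda>b. v b + v' b) = G v \<otimes>\<^bsub>Y\<^esub> G v'" if v': "v' \<in> vcar N (Wd (n - 1))" for v' :: "bool list \<Rightarrow> 'k mpoly"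
  proof -
    have "be (n - 1) (\<lambda>b. v b + v' b) [] - be (n - 1) v [] - be (n - 1) v' [] \<in> TX"
      by (rule be_add) (use n0 v v' in auto)
    from pr_TX[OF this] show ?thesis
      by (simp add: G_def Y_simps keys_pr kv keys_be_last v' cls_eq_iff frag_extend_diff frag_extend_add flip: diff_diff_eq)
  qed
  fix a :: "'k mpoly" assume a: "a \<in> invariants ks"
  show "G (\<lambda>b. a * v b) = lact Y a (G v)"
    using a by (simp add: G_def Y_simps be_left pr_slot[OF kv n0 ksL(1)[OF a]])
  have aR: "a \<in> R" using LR[OF n0] ksL(1)[OF a] by blast
  have l: "n - 1 < n" using n0 by linarith
  show "G (vr (Wd (n - 1)) v a) = ract Y (G v) a"
    using pr_TX[OF be_right[OF v aR]] a pr_slot[OF kv l ksL(2)[OF a]]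
    by (simp add: G_def Y_simps cls_eq_iff frag_extend_diff mult.commute)
qed

lemma be_fsum_av:
  assumes "keys u \<subseteq> SY"
  shows "be (n - 1) (\<lambda>b. fsum (\<lambda>w. av (n - 1) w b) u) [] - u \<in> TX"
proof -
  have "keys u \<subseteq> SY \<and> be (n - 1) (\<lambda>b. fsum (\<lambda>w. av (n - 1) w b) u) [] - u \<in> TX"
    using assms
  proof (induction u rule: frag_induction)
    case zero
    have "be (n - 1) (\<lambda>b. 0 + 0) [] - be (n - 1) (\<lambda>b. 0) [] - be (n - 1) (\<lambda>b. 0) [] \<in> TX"
      by (rule be_add) (use n0 in \<open>auto simp: vcar_0\<close>)
    then show ?case using zspan_uminus[of "- be (n - 1) (\<lambda>b. 0) []" xrel] by simp
  next
    case (one w)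
    then show ?case using be_av[of "n - 1" w] n0 SY_R[of w] by simp
  next
    case (diff a b)
    let ?f = "\<lambda>u b. fsum (\<lambda>w. av (n - 1) w b) u"
    have k: "keys (a - b) \<subseteq> SY" using diff by (intro keys_diff_subset) simp_all
    have "be (n - 1) (\<lambda>x. ?f (a - b) x + ?f b x) [] - be (n - 1) (?f (a - b)) [] - be (n - 1) (?f b) [] \<in> TX"
      by (rule be_add) (use n0 diff k in \<open>auto intro!: fsum_av_closed\<close>)
    then have q: "be (n - 1) (?f a) [] - be (n - 1) (?f (a - b)) [] - be (n - 1) (?f b) [] \<in> TX"
      by (simp add: fsum_diff)
    have "be (n - 1) (?f (a - b)) [] - (a - b)
      = (be (n - 1) (?f a) [] - a) - (be (n - 1) (?f b) [] - b)
        - (be (n - 1) (?f a) [] - be (n - 1) (?f (a - b)) [] - be (n - 1) (?f b) [])" by simp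
    also have "\<dots> \<in> TX" using diff q by (blast intro: zspan_diff)
    finally show ?case using k by blast
  qed
  then show ?thesis by blast
qed

text \<open>\<open>be\<close> undoes \<open>av\<close> in the tensor product of full polynomial
  rings, and \<open>pr\<close> is the identity on words with entries in the rings R^(L i).\<close>

lemma G_F: "m \<in> carrier Y \<Longrightarrow> G (F m) = m"
proof -
  assume "m \<in> carrier Y"
  then obtain u where m: "m = cls RY u" and u: "keys u \<subseteq> SY" by (auto simp: Y_simps)
  have "pr u = frag_extend frag_of u" by (rule frag_extend_eq) (use u pw_fix in auto)
  then show ?thesis using pr_TX[OF be_fsum_av[OF u]] by (simp add: m F_cls G_def cls_eq_iff frag_extend_diff)
qed

lemma acyclic_Y:
  assumes "nonroot l" "\<And>a. a \<in> invariants ks \<Longrightarrow> scale_vars l a \<in> invariants ks"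
  shows "acyclic_in_pos_deg (scale_vars l) ks Y"
proof (rule acyclic_retract[OF _ F_bimod_map G_bimod_map])
  show "acyclic_in_pos_deg (scale_vars l) ks (vmod N (\<lambda>f. f) (Wd (n - 1)))"
  proof (rule acyclic_vmod_inv[OF assms(1)])
    show "sum_list ks = N" using csN[OF nth_mem[of 0 cs]] c0 len by simp
  qed (rule Wd_bound[OF diff_less[OF zero_less_one n0]])
qed (use G_F assms in auto)

end

section \<open>Shifts, summands and the quantum twist\<close>

lemma sum_list_refines: "refines ls ks \<Longrightarrow> sum_list ls = sum_list ks"
proof -
  assume "refines ls ks"
  then obtain lss where l: "length lss = length ks" "\<And>i. i < length ks \<Longrightarrow> sum_list (lss ! i) = ks ! i" "ls = concat lss"
    by (auto simp: refines_def composition_def)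
  have "map sum_list lss = ks" by (rule nth_equalityI) (simp_all add: l)
  moreover have "sum_list (concat lss) = sum_list (map sum_list lss)" by (induction lss) simp_all
  ultimately show ?thesis by (simp add: l)
qed

lemma bs_factor_cases:
  fixes M :: "('k::comm_ring_1 mpoly, 'k mpoly, 'k mpoly) graded_bimod"
  assumes "bs_factor c c' M"
  shows "\<exists>l. sum_list l = sum_list c \<and> carrier M = invariants l \<and> (\<forall>x y. x \<otimes>\<^bsub>M\<^esub> y = x + y) \<and>
    (\<forall>a m. lact M a m = a * m) \<and> (\<forall>a m. ract M m a = m * a) \<and>
    (invariants c :: 'k mpoly set) \<subseteq> invariants l \<and> (invariants c' :: 'k mpoly set) \<subseteq> invariants l"
  using assms
proof cases
  case induction_bimod
  then show ?thesis
    using sum_list_refines[of c c'] invariants_mono[of c c'] by (intro exI[of _ c]) (simp add: inv_bimod_def)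
next
  case (restriction_bimod d)
  then show ?thesis
    using sum_list_refines[of c' c] invariants_mono[of c' c]
    by (intro exI[of _ c']) (simp add: inv_bimod_def shift_def)
qed

lemma acyclic_bott_samelson:
  fixes Y :: "('k::comm_ring_1 mpoly, 'k mpoly, ('k mpoly list \<Rightarrow>\<^sub>0 int) set) graded_bimod"
  assumes Y: "singular_bott_samelson ks ks Y" and l: "nonroot l"
    and s: "\<And>a. a \<in> invariants ks \<Longrightarrow> scale_vars l a \<in> invariants ks"
  shows "acyclic_in_pos_deg (scale_vars l) ks Y \<and> comm_group Y \<and>
    (\<forall>a\<in>invariants ks. lact Y a \<one>\<^bsub>Y\<^esub> = \<one>\<^bsub>Y\<^esub> \<and> ract Y \<one>\<^bsub>Y\<^esub> a = \<one>\<^bsub>Y\<^esub>)"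
proof -
  define N where "N = sum_list ks"
  obtain cs and Ms :: "('k mpoly, 'k mpoly, 'k mpoly) graded_bimod list"
    where ne: "Ms \<noteq> []" and len: "length cs = Suc (length Ms)" and h: "hd cs = ks" "last cs = ks"
      and comp: "\<And>c. c \<in> set cs \<Longrightarrow> composition N c"
      and f: "\<And>i. i < length Ms \<Longrightarrow> bs_factor (cs ! i) (cs ! Suc i) (Ms ! i)"
      and Yd: "Y = tensor (map inv_ring cs) Ms"
    using Y unfolding singular_bott_samelson_def N_def by blast
  have csN: "sum_list c = N" if "c \<in> set cs" for c using comp[OF that] by (simp add: composition_def)
  have cne: "cs \<noteq> []" using len by auto
  obtain L where L: "\<And>i. i < length Ms \<Longrightarrow> sum_list (L i) = sum_list (cs ! i) \<and> carrier (Ms ! i) = invariants (L i)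
    \<and> (\<forall>x y. x \<otimes>\<^bsub>Ms ! i\<^esub> y = x + y) \<and> (\<forall>a m. lact (Ms ! i) a m = a * m) \<and> (\<forall>a m. ract (Ms ! i) m a = m * a) \<and>
    (invariants (cs ! i) :: 'k mpoly set) \<subseteq> invariants (L i) \<and> (invariants (cs ! Suc i) :: 'k mpoly set) \<subseteq> invariants (L i)"
    using bs_factor_cases[OF f] by metis
  have "\<exists>t. case t of (W, d, x, p) \<Rightarrow> trace_data N e W d (x :: nat \<Rightarrow> 'k mpoly) p" if "sum_list e = N" for e
    using trace_data_exists[OF that] by auto
  then obtain t where t: "\<And>e. sum_list e = N \<Longrightarrow> case t e of (W, d, x, p) \<Rightarrow> trace_data N e W d (x :: nat \<Rightarrow> 'k mpoly) p"
    by metis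
  interpret bott_samelson N ks cs Ms L "\<lambda>e. fst (t e)" "\<lambda>e. fst (snd (t e))" "\<lambda>e. fst (snd (snd (t e)))" "\<lambda>e. snd (snd (snd (t e)))"
  proof
    show "cs ! 0 = ks" using h cne by (simp add: hd_conv_nth)
    show "cs ! length Ms = ks" using h cne len by (simp add: last_conv_nth)
    show "trace_data N c (fst (t c)) (fst (snd (t c))) (fst (snd (snd (t c)))) (snd (snd (snd (t c))))"
      if "sum_list c = N" for c using t[OF that] by (simp add: case_prod_unfold)
    show "sum_list (L i) = N" if "i < length Ms" for i
      using L[OF that] csN[of "cs ! i"] that len by simp
  qed (use ne len csN L in auto)
  show ?thesis unfolding Yd using acyclic_Y[OF l s] comm_group_Y Y_one_act by blast
qed

lemma shift_simps [simp]:
  "carrier (shift s M) = carrier M" "x \<otimes>\<^bsub>shift s M\<^esub> y = x \<otimes>\<^bsub>M\<^esub> y" "\<one>\<^bsub>shift s M\<^esub> = \<one>\<^bsub>M\<^esub>"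
  "lact (shift s M) = lact M" "ract (shift s M) = ract M"
  by (simp_all add: shift_def)

lemma comm_group_shift [simp]: "comm_group (shift s M) = comm_group M"
  unfolding comm_group_def comm_monoid_def comm_monoid_axioms_def group_def group_axioms_def
    monoid_def Units_def by simp

lemma acyclic_shift:
  assumes "acyclic_in_pos_deg \<tau> ks M" "\<And>a. a \<in> invariants ks \<Longrightarrow> \<tau> a \<in> invariants ks"
  shows "acyclic_in_pos_deg \<tau> ks (shift s M)"
  by (rule acyclic_retract[OF assms(1), where f="\<lambda>m. m" and g="\<lambda>m. m"])
    (simp_all add: bimod_map_def assms)

text \<open>B is a retract of the sum, by inclusion with second component zero and by the first
  projection, both transported along the isomorphism.\<close>

lemma acyclic_summand:
  fixes B :: "('k::comm_ring_1 mpoly, 'k mpoly, 'b) graded_bimod"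
    and C :: "('k mpoly, 'k mpoly, 'c) graded_bimod" and S :: "('k mpoly, 'k mpoly, 's) graded_bimod"
  assumes B: "graded_bimodule (inv_ring ks :: ('k, 'k mpoly) graded_alg) (inv_ring ks) B"
    and C: "graded_bimodule (inv_ring ks :: ('k, 'k mpoly) graded_alg) (inv_ring ks) C"
    and iso: "graded_bimod_iso (inv_ring ks :: ('k, 'k mpoly) graded_alg) (inv_ring ks) (bimod_sum B C) S"
    and ac: "acyclic_in_pos_deg \<tau> ks S" and \<tau>: "\<And>a. a \<in> invariants ks \<Longrightarrow> \<tau> a \<in> invariants ks"
  shows "acyclic_in_pos_deg \<tau> ks B"
proof -
  interpret B: graded_bimodule "inv_ring ks :: ('k, 'k mpoly) graded_alg" "inv_ring ks" B by (rule B)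
  interpret C: graded_bimodule "inv_ring ks :: ('k, 'k mpoly) graded_alg" "inv_ring ks" C by (rule C)
  let ?D = "bimod_sum B C"
  have D: "carrier ?D = carrier B \<times> carrier C" "\<And>x y x' y'. (x, y) \<otimes>\<^bsub>?D\<^esub> (x', y') = (x \<otimes>\<^bsub>B\<^esub> x', y \<otimes>\<^bsub>C\<^esub> y')"
    "\<And>a x y. lact ?D a (x, y) = (lact B a x, lact C a y)" "\<And>a x y. ract ?D (x, y) a = (ract B x a, ract C y a)"
    by (simp_all add: bimod_sum_def)
  obtain h where h: "h \<in> Group.iso ?D S"
    and hl: "\<And>a m. a \<in> invariants ks \<Longrightarrow> m \<in> carrier ?D \<Longrightarrow> h (lact ?D a m) = lact S a (h m)"
    and hr: "\<And>a m. a \<in> invariants ks \<Longrightarrow> m \<in> carrier ?D \<Longrightarrow> h (ract ?D m a) = ract S (h m) a"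
    using iso unfolding graded_bimod_iso_def by auto
  have hb: "bij_betw h (carrier ?D) (carrier S)"
    and hm: "\<And>x y. x \<in> carrier ?D \<Longrightarrow> y \<in> carrier ?D \<Longrightarrow> h (x \<otimes>\<^bsub>?D\<^esub> y) = h x \<otimes>\<^bsub>S\<^esub> h y"
    using h by (auto simp: Group.iso_def hom_def)
  have hc: "h x \<in> carrier S" if "x \<in> carrier ?D" for x using hb that by (auto simp: bij_betw_def)
  define g where "g y = fst (inv_into (carrier ?D) h y)" for y
  have g: "g (h x) = fst x" if "x \<in> carrier ?D" for x
    using hb that by (simp add: g_def bij_betw_def inv_into_f_f)
  have surj: "\<exists>x\<in>carrier ?D. y = h x" if "y \<in> carrier S" for y using hb that by (auto simp: bij_betw_def)
  have C1: "lact C a \<one>\<^bsub>C\<^esub> = \<one>\<^bsub>C\<^esub>" "ract C \<one>\<^bsub>C\<^esub> a = \<one>\<^bsub>C\<^esub>" if a: "a \<in> invariants ks" for a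
  proof -
    have c: "lact C a \<one>\<^bsub>C\<^esub> \<in> carrier C" "ract C \<one>\<^bsub>C\<^esub> a \<in> carrier C"
      using a by (simp_all add: C.lact_closed C.ract_closed)
    have "lact C a \<one>\<^bsub>C\<^esub> = lact C a \<one>\<^bsub>C\<^esub> \<otimes>\<^bsub>C\<^esub> lact C a \<one>\<^bsub>C\<^esub>" "ract C \<one>\<^bsub>C\<^esub> a = ract C \<one>\<^bsub>C\<^esub> a \<otimes>\<^bsub>C\<^esub> ract C \<one>\<^bsub>C\<^esub> a"
      using C.lact_add[of a "\<one>\<^bsub>C\<^esub>" "\<one>\<^bsub>C\<^esub>"] C.add_ract[of a "\<one>\<^bsub>C\<^esub>" "\<one>\<^bsub>C\<^esub>"] a by simp_all
    then show "lact C a \<one>\<^bsub>C\<^esub> = \<one>\<^bsub>C\<^esub>" "ract C \<one>\<^bsub>C\<^esub> a = \<one>\<^bsub>C\<^esub>"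
      using c C.l_cancel_one' by metis+
  qed
  have la: "lact ?D a m \<in> carrier ?D" and ra: "ract ?D m a \<in> carrier ?D" if "a \<in> invariants ks" "m \<in> carrier ?D" for a m
    using that by (auto simp: D B.lact_closed B.ract_closed C.lact_closed C.ract_closed)
  have mu: "x \<otimes>\<^bsub>?D\<^esub> y \<in> carrier ?D" if "x \<in> carrier ?D" "y \<in> carrier ?D" for x y using that by (auto simp: D)
  show ?thesis
  proof (rule acyclic_retract[OF ac, where f="\<lambda>m. h (m, \<one>\<^bsub>C\<^esub>)" and g=g])
    show "bimod_map ks B S (\<lambda>m. h (m, \<one>\<^bsub>C\<^esub>))"
      unfolding bimod_map_def using hc hm hl hr C1 by (simp add: D flip: hm hl hr)
    show "bimod_map ks S B g"
      unfolding bimod_map_def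
    proof (intro conjI ballI)
      fix y assume "y \<in> carrier S"
      then obtain x where x: "x \<in> carrier ?D" "y = h x" using surj by blast
      show "g y \<in> carrier B" using x by (auto simp: g D)
      show "g (y \<otimes>\<^bsub>S\<^esub> y') = g y \<otimes>\<^bsub>B\<^esub> g y'" if y': "y' \<in> carrier S" for y'
      proof -
        obtain x' where x': "x' \<in> carrier ?D" "y' = h x'" using surj y' by blast
        have "fst (x \<otimes>\<^bsub>?D\<^esub> x') = fst x \<otimes>\<^bsub>B\<^esub> fst x'" by (cases x; cases x') (simp add: D)
        then show ?thesis using x x' mu by (simp add: g flip: hm)
      qed
      fix a :: "'k mpoly" assume a: "a \<in> invariants ks"
      have "fst (lact ?D a x) = lact B a (fst x)" "fst (ract ?D x a) = ract B (fst x) a"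
        by (cases x; simp add: D)+
      then show "g (lact S a y) = lact B a (g y)" "g (ract S y a) = ract B (g y) a"
        using x a la ra by (simp_all add: g flip: hl hr)
    qed
    show "g (h (m, \<one>\<^bsub>C\<^esub>)) = m" if "m \<in> carrier B" for m using that by (simp add: g D)
  qed (rule \<tau>)
qed

lemma scale_vars_invariants: "a \<in> invariants ks \<Longrightarrow> scale_vars l a \<in> invariants ks"
proof -
  assume a: "a \<in> invariants ks"
  have "sw i (scale_vars l a) = scale_vars l (sw i a)" for i
    by (rule alg_hom_eqI[OF alg_hom_comp[OF alg_hom_sw alg_hom_scale_vars] alg_hom_comp[OF alg_hom_scale_vars alg_hom_sw], of a UNIV])
      (simp_all add: vars_in_def sw_pvar alg_homD)
  then show ?thesis using a by (auto simp: invariants_eq fixed_by_def scale_vars_vars_in)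
qed

text \<open>Each of the e variables of a monomial of degree 2e contributes one factor l. When d is
  not of the form 2e, the polynomial has no monomials and both sides are zero, so \<open>c\<close>
  is constrained only in the even case.\<close>

lemma scale_vars_poly_hom:
  assumes f: "f \<in> poly_hom d" and c: "\<And>e. d = 2 * int e \<Longrightarrow> c = l ^ e"
  shows "scale_vars l f = pconst c * f"
proof -
  have "scale_vars l (single m (lookup f m)) = pconst c * single m (lookup f m)" if "m \<in> keys f" for m
  proof -
    have p: "pconst l ^ e = pconst (l ^ e)" for e by (induction e) simp_all
    have c: "c = l ^ (\<Sum>i\<in>keys m. lookup m i)"
      by (rule c) (use f that in \<open>auto simp: poly_hom_def\<close>)
    have "(\<Prod>i\<in>keys m. (pconst l * pvar i) ^ lookup m i) = (\<Prod>i\<in>keys m. pconst l ^ lookup m i) * pmon m"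
      by (simp only: power_mult_distrib prod.distrib mon_expand[symmetric])
    also have "(\<Prod>i\<in>keys m. pconst l ^ lookup m i) = pconst c"
      by (simp only: power_sum[symmetric]) (simp only: p c)
    finally show ?thesis
      unfolding scale_vars_def subst_single by (simp add: single_eq_const_mon mult_ac)
  qed
  then have "scale_vars l (\<Sum>m\<in>keys f. single m (lookup f m)) = pconst c * (\<Sum>m\<in>keys f. single m (lookup f m))"
    by (simp add: alg_hom_sum sum_distrib_left)
  then show ?thesis by (simp add: pm_sum_single)
qed

lemma finsum_inv_ring:
  assumes "ring (inv_ring ks :: ('k::comm_ring_1, 'k mpoly) graded_alg)" "finite A" "\<And>d. d \<in> A \<Longrightarrow> c d \<in> invariants ks"
  shows "finsum (inv_ring ks :: ('k, 'k mpoly) graded_alg) c A = (\<Sum>d\<in>A. c d)"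
proof -
  interpret ring "inv_ring ks :: ('k, 'k mpoly) graded_alg" by (rule assms(1))
  show ?thesis using assms(2,3)
  proof (induction A rule: finite_induct)
    case (insert x A) then show ?case by (subst finsum_insert) auto
  qed (use finsum_empty in simp)
qed

text \<open>Both maps are additive and agree on homogeneous components, where
  \<open>scale_vars_poly_hom\<close> applies.\<close>

lemma qtwist_inv_ring:
  fixes q :: "'k::comm_ring_1"
  assumes A: "graded_algebra (inv_ring ks :: ('k, 'k mpoly) graded_alg)" and a: "a \<in> invariants ks"
    and l: "\<And>e. unit_powi q (- (2 * int e)) = l ^ e"
  shows "qtwist q (inv_ring ks) a = scale_vars l a"
proof -
  let ?A = "inv_ring ks :: ('k, 'k mpoly) graded_alg"
  interpret graded_algebra ?A by (rule A)
  define c where "c = hom_component (add_monoid ?A) (alg_deg ?A) a"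
  have "\<exists>!c. graded_decomp (add_monoid ?A) (alg_deg ?A) a c"
    using alg_grading a by (simp add: grading_def)
  then have "graded_decomp (add_monoid ?A) (alg_deg ?A) a c"
    unfolding c_def hom_component_def by (rule theI')
  then have cd: "\<And>d. c d \<in> invariants ks \<inter> poly_hom d" and fin: "finite {d. c d \<noteq> 0}"
    and ac: "a = finsum ?A c {d. c d \<noteq> 0}"
    by (simp_all add: graded_decomp_def finsum_def)
  have sc: "scale_vars l (c d) = pconst (unit_powi q (- d)) * c d" for d
    by (rule scale_vars_poly_hom[of _ d]) (use cd l in auto)
  have k: "pconst (unit_powi q (- d)) * c d \<in> invariants ks" for d
    using cd by (auto intro: invariants_intros)
  have ks: "kscale ?A r f = pconst r * f" for r f by (simp add: inv_ring_def pconst_def)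
  have z: "\<zero>\<^bsub>?A\<^esub> = 0" by simp
  have "qtwist q ?A a = finsum ?A (\<lambda>d. pconst (unit_powi q (- d)) * c d) {d. c d \<noteq> 0}"
    unfolding qtwist_def Let_def c_def[symmetric] unfolding ks z ..
  also have "\<dots> = (\<Sum>d\<in>{d. c d \<noteq> 0}. scale_vars l (c d))"
    unfolding sc by (rule finsum_inv_ring[OF ring_axioms fin k])
  also have "\<dots> = scale_vars l (\<Sum>d\<in>{d. c d \<noteq> 0}. c d)" by (simp add: alg_hom_sum)
  also have "(\<Sum>d\<in>{d. c d \<noteq> 0}. c d) = finsum ?A c {d. c d \<noteq> 0}"
    using cd by (intro finsum_inv_ring[OF ring_axioms fin, symmetric]) auto
  finally show ?thesis unfolding ac[symmetric] .
qed

lemma hoch_bimod_graded_bimodule: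
  fixes B :: "('k::comm_ring_1 mpoly, 'k mpoly, 'b) graded_bimod"
  assumes "graded_bimodule (inv_ring ks :: ('k, 'k mpoly) graded_alg) (inv_ring ks) B"
  shows "hoch_bimod (scale_vars l) ks B"
proof -
  interpret B: graded_bimodule "inv_ring ks :: ('k, 'k mpoly) graded_alg" "inv_ring ks" B by (rule assms)
  have ks: "kscale (inv_ring ks :: ('k, 'k mpoly) graded_alg) c 1 = pconst c" for c by (simp add: inv_ring_def pconst_def)
  show ?thesis
    by unfold_locales
      (use B.lact_closed B.ract_closed B.lact_add B.add_ract B.add_lact B.ract_add B.mult_lact B.ract_mult
        B.lact_ract B.central B.comm_group_axioms scale_vars_invariants
       in \<open>auto simp: ks simp del: const_simps\<close>)
qed

theorem theorem2p36:
  fixes q :: "'k::comm_ring_1"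
    and N :: nat
    and ks :: "nat list"
    and B :: "('k mpoly, 'k mpoly, 'b) graded_bimod"
  assumes "q dvd 1"
    and "\<forall>d::int. d \<noteq> 0 \<longrightarrow> (1 - unit_powi q d) dvd 1"
    and "composition N ks"
    and "singular_soergel ks ks B"
  shows "\<forall>i>0. trivial_group (qHH q (inv_ring ks) B i)"
proof (intro allI impI)
  fix i :: nat assume i: "0 < i"
  \<comment> \<open>The inverse of q, in the form used by \<open>unit_powi\<close>, squared because
    the variables have degree 2.\<close>
  define l where "l = (THE r. q * r = 1)\<^sup>2"
  have lp: "unit_powi q (- (2 * int e)) = l ^ e" for e
    by (cases "e = 0") (simp_all add: unit_powi_def l_def power_mult nat_mult_distrib)
  have nl: "nonroot l"
    unfolding nonroot_def
  proof (intro allI impI)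
    fix r :: nat assume r: "0 < r"
    have "(1 - unit_powi q (- (2 * int r))) dvd 1" using assms(2) r by simp
    then obtain k where "1 = (1 - l ^ r) * k" unfolding lp by (rule dvdE)
    \<comment> \<open>The hypothesis, used for the exponent -2r, inverts 1 - l^r, whence the change
      of sign.\<close>
    then show "\<exists>\<kappa>. \<kappa> * (l ^ r - 1) = 1" by (intro exI[of _ "- k"]) (simp add: algebra_simps)
  qed
  have B: "graded_bimodule (inv_ring ks :: ('k, 'k mpoly) graded_alg) (inv_ring ks) B"
    using assms(4) by (simp add: singular_soergel_def)
  then interpret B: graded_bimodule "inv_ring ks :: ('k, 'k mpoly) graded_alg" "inv_ring ks" B .
  obtain n Y s and C :: "('k mpoly, 'k mpoly, nat \<Rightarrow> ('k mpoly list \<Rightarrow>\<^sub>0 int) set) graded_bimod"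
    where Y: "\<And>i. i < n \<Longrightarrow> singular_bott_samelson ks ks (Y i)"
      and C: "graded_bimodule (inv_ring ks :: ('k, 'k mpoly) graded_alg) (inv_ring ks) C"
      and iso: "graded_bimod_iso (inv_ring ks :: ('k, 'k mpoly) graded_alg) (inv_ring ks)
          (bimod_sum B C) (bimod_finite_sum n (\<lambda>i. shift (s i) (Y i)))"
    using assms(4) unfolding singular_soergel_def by blast
  note Y' = acyclic_bott_samelson[OF Y nl scale_vars_invariants]
  have "acyclic_in_pos_deg (scale_vars l) ks (bimod_finite_sum n (\<lambda>i. shift (s i) (Y i)))"
    by (rule acyclic_finite_sum) (use Y' in \<open>auto intro!: acyclic_shift scale_vars_invariants\<close>)
  then have "acyclic_in_pos_deg (scale_vars l) ks B"
    by (rule acyclic_summand[OF B C iso]) (rule scale_vars_invariants)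
  then show "trivial_group (qHH q (inv_ring ks) B i)"
    using qtwist_inv_ring[OF B.A.graded_algebra_axioms _ lp] i
    by (intro hoch_bimod.trivial_qHH[OF hoch_bimod_graded_bimodule[OF B]])
qed

end
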